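(* Let $H$ be a finite dimensional Hopf algebra over a field $k$, and let $G=\mathrm{Aut}_{Hopf}(H)\times \mathrm{Aut}_{Hopf}(H)$ with multiplication $(\alpha,\beta)*(\gamma,\delta)=(\delta\alpha\delta^{-1}\gamma,\delta\beta)$. Let $CT(H)$ be the coquasitriangular crossed Turaev $G$-algebra and $\widehat{\mathcal{YD}(H)}$ the braided $T$-category of generalized Yetter-Drinfel'd modules, both described in the context. Then the category $Corep(CT(H))$ of corepresentations of $CT(H)$ and $\widehat{\mathcal{YD}(H)}$ are isomorphic as braided $T$-categories over $G$.
   Context: $\mathrm{Aut}_{Hopf}(H)$ is the group of Hopf algebra automorphisms of $H$ under composition. In $G$ the unit is $(id,id)$ and $(\alpha,\beta)^{-1}=(\beta^{-1}\alpha^{-1}\beta,\beta^{-1})$. The antipode $S$ of $H$ is bijective since $H$ is finite dimensional. Tensor products of vector spaces are treated as strictly associative and unital. **Braided $T$-categories.** A crossed category over a group $G$ is a strict monoidal category $\mathcal C$ which is the disjoint union of subcategories $\{\mathcal C_a\}_{a\in G}$ with $U\otimes V\in\mathcal C_{ab}$ for $U\in\mathcal C_a$, $V\in\mathcal C_b$, with a group homomorphism $\varphi$ from $G$ to the group of invertible strict tensor functors $\mathcal C\to\mathcal C$ such that $\varphi_b(\mathcal C_a)=\mathcal C_{bab^{-1}}$; for $V\in\mathcal C_b$ write ${}^V(\cdot)={}^b(\cdot)=\varphi_b$. A braided $T$-category over $G$ is a crossed category with isomorphisms $c_{U,V}:U\otimes V\to{}^UV\otimes U$ such that $({}^ag\otimes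 f)c_{U,V}=c_{U',V'}(f\otimes g)$ for $f:U\to U'$ in $\mathcal C_a$, $g:V\to V'$ in $\mathcal C_b$; $c_{U\otimes V,W}=(c_{U,{}^VW}\otimes id_V)(id_U\otimes c_{V,W})$; $c_{U,V\otimes W}=(id_{{}^UV}\otimes c_{U,W})(c_{U,V}\otimes id_W)$; and $\varphi_a(c_{U,V})=c_{{}^aU,{}^aV}$. An isomorphism of braided $T$-categories over $G$ is an isomorphism of categories that is strict monoidal, maps the $a$-component onto the $a$-component for each $a\in G$, commutes with the conjugation functors and preserves the braidings. **The category $\widehat{\mathcal{YD}(H)}$.** For $(\alpha,\beta)\in G$, ${}_H\mathcal{YD}^H(\alpha,\beta)$ is the category of vector spaces $M$ that are left $H$-modules and right $H$-comodules with $$h_1\cdot m_{(0)}\otimes\beta(h_2)m_{(1)}=(h_2\cdot m)_{(0)}\otimes(h_2\cdot m)_{(1)}\alpha(h_1)\quad(h\in H,\ m\in M),$$ and morphisms the $H$-linear $H$-colinear maps. $\widehat{\mathcal{YD}(H)}$ is the disjoint union of these over $(\alpha,\beta)\in G$. For $M\in {}_H\mathcal{YD}^H(\alpha,\beta)$ and $N\in {}_H\mathcal{YD}^H(\gamma,\delta)$: $M\otimes N\in{}_H\mathcal{YD}^H((\alpha,\beta)*(\gamma,\delta))$ has action $h\cdot(m\otimes n)=h_2\cdot m\otimes h_1\cdot n$ and coaction $m\otimes n\mapsto m_{(0)}\otimes n_{(0)}\otimes\delta(m_{(1)})\,\delta\alpha\delta^{-1}(n_{(1)})$; the unit is $k\in{}_H\mathcal{YD}^H(id,id)$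 with trivial structures; conjugation sends $N$ to ${}^{(\alpha,\beta)}N=N$ with action $h\rightharpoonup n=\alpha^{-1}\beta(h)\cdot n$ and coaction $n\mapsto n_{(0)}\otimes\beta^{-1}\delta\alpha\delta^{-1}(n_{(1)})$, and is the identity on morphisms; the braiding is $c_{M,N}(m\otimes n)=\alpha^{-1}(m_{(1)})\cdot n\otimes m_{(0)}$. **The crossed Turaev $G$-algebra $CT(H)$.** On $H^*$ juxtaposition denotes the convolution product $(pq)(h)=p(h_1)q(h_2)$, and $p\mapsto p_1\otimes p_2$ is determined by $p(hh')=p_1(h)p_2(h')$; $\{h_i\},\{h^i\}$ are dual bases of $H$ and $H^*$; $S^{-1*}(p)=p\circ S^{-1}$. $CT(H)_{(\alpha,\beta)}=H^{*op}\bowtie H(\alpha,\beta)$ is the vector space $H^*\otimes H$ (elements $p\bowtie h$) with coalgebra structure $$\bar\Delta(p\bowtie h)=\sum_{i,j}\bigl(p_1\bowtie\beta(h_j)h_1S^{-1}\alpha(h_i)\bigr)\otimes\bigl(h^ip_2h^j\bowtie h_2\bigr),\qquad\bar\varepsilon(p\bowtie h)=p(1)\varepsilon(h).$$ For $p\bowtie h\in CT(H)_{(\alpha,\beta)}$ and $q\bowtie h'\in CT(H)_{(\gamma,\delta)}$: multiplication $(p\bowtie h)(q\bowtie h')=qp\bowtie\delta(h)\,\delta\alpha\delta^{-1}(h')\in CT(H)_{(\alpha,\beta)*(\gamma,\delta)}$, with unit $\varepsilon\bowtie1$; antipode $S_{(\alpha,\beta)}(p\bowtie h)=\sum_{i,j}h^iS^{-1*}(p)S^{-1*}(h^j)\bowtie\beta^{-1}(h_j)\beta^{-1}\alpha^{-1}S(h)\beta^{-1}\alpha^{-1}\beta(h_i)$;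 crossing $\psi_{(\alpha,\beta)}(q\bowtie h')=q\circ\alpha^{-1}\beta\bowtie\beta^{-1}\delta\alpha\delta^{-1}(h')\in CT(H)_{(\alpha,\beta)*(\gamma,\delta)*(\alpha,\beta)^{-1}}$; coquasitriangular structure $\sigma_{(\alpha,\beta),(\gamma,\delta)}(p\bowtie h,q\bowtie h')=p(\delta^{-1}(h'))q(1)\varepsilon(h)$. **The category $Corep(CT(H))$.** It is the disjoint union over $a\in G$ of the categories of right $CT(H)_a$-comodules (coaction written $m\mapsto m_{[0]}\otimes m_{[1]}$). For $M$ in the $a$-component and $N$ in the $b$-component, $M\otimes N$ is in the $ab$-component with coaction $m\otimes n\mapsto m_{[0]}\otimes n_{[0]}\otimes m_{[1]}n_{[1]}$; the unit is $k$ with coaction $1\mapsto1\otimes(\varepsilon\bowtie1)$; conjugation sends $N$ to ${}^aN=N$ with coaction $n\mapsto n_{[0]}\otimes\psi_a(n_{[1]})$ and is the identity on morphisms; the braiding $M\otimes N\to{}^aN\otimes M$ is $m\otimes n\mapsto\sigma_{aba^{-1},a}(\psi_a(n_{[1]}),m_{[1]})\;n_{[0]}\otimes m_{[0]}$. *)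

theory Defs
  imports
    Complex_Main
    "HOL-Algebra.Group"
    "HOL-Library.Function_Algebras"
    "HOL-Library.FuncSet"
    "HOL-Library.Poly_Mapping"
begin

section \<open>Braided T-categories\<close>

record ('o, 'm) cat_data =
  Obj :: "'o set"
  Arr :: "'m set"
  Dom :: "'m \<Rightarrow> 'o"
  Cod :: "'m \<Rightarrow> 'o"
  Id :: "'o \<Rightarrow> 'm"
  Comp :: "'m \<Rightarrow> 'm \<Rightarrow> 'm"

record ('o, 'm) moncat_data = "('o, 'm) cat_data" +
  TenO :: "'o \<Rightarrow> 'o \<Rightarrow> 'o"
  TenA :: "'m \<Rightarrow> 'm \<Rightarrow> 'm"
  UnitO :: "'o"

record ('o, 'm, 'g) tcat_data = "('o, 'm) moncat_data" +
  Deg :: "'o \<Rightarrow> 'g"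
  ConjO :: "'g \<Rightarrow> 'o \<Rightarrow> 'o"
  ConjA :: "'g \<Rightarrow> 'm \<Rightarrow> 'm"
  Braid :: "'o \<Rightarrow> 'o \<Rightarrow> 'm"

text \<open>\<open>Comp C g f\<close> is \<open>g\<close> after \<open>f\<close>.\<close>

locale category =
  fixes C :: "('o, 'm, 'z) cat_data_scheme"
  assumes dom_obj: "f \<in> Arr C \<Longrightarrow> Dom C f \<in> Obj C"
    and cod_obj: "f \<in> Arr C \<Longrightarrow> Cod C f \<in> Obj C"
    and id_arr: "X \<in> Obj C \<Longrightarrow> Id C X \<in> Arr C \<and> Dom C (Id C X) = X \<and> Cod C (Id C X) = X"
    and comp_arr: "\<lbrakk>f \<in> Arr C; g \<in> Arr C; Cod C f = Dom C g\<rbrakk> \<Longrightarrow>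
      Comp C g f \<in> Arr C \<and> Dom C (Comp C g f) = Dom C f \<and> Cod C (Comp C g f) = Cod C g"
    and comp_id_left: "f \<in> Arr C \<Longrightarrow> Comp C (Id C (Cod C f)) f = f"
    and comp_id_right: "f \<in> Arr C \<Longrightarrow> Comp C f (Id C (Dom C f)) = f"
    and comp_assoc: "\<lbrakk>f \<in> Arr C; g \<in> Arr C; h \<in> Arr C; Cod C f = Dom C g; Cod C g = Dom C h\<rbrakk> \<Longrightarrow>
      Comp C h (Comp C g f) = Comp C (Comp C h g) f"

definition iso_arr :: "('o, 'm, 'z) cat_data_scheme \<Rightarrow> 'm \<Rightarrow> bool" where
  "iso_arr C f \<longleftrightarrow> f \<in> Arr C \<and> (\<exists>g\<in>Arr C. Dom C g = Cod C f \<and> Cod C g = Dom C f \<and>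
     Comp C g f = Id C (Dom C f) \<and> Comp C f g = Id C (Cod C f))"

locale strict_monoidal_category = category C
  for C :: "('o, 'm, 'z) moncat_data_scheme" +
  assumes tenO_obj: "\<lbrakk>X \<in> Obj C; Y \<in> Obj C\<rbrakk> \<Longrightarrow> TenO C X Y \<in> Obj C"
    and tenA_arr: "\<lbrakk>f \<in> Arr C; g \<in> Arr C\<rbrakk> \<Longrightarrow> TenA C f g \<in> Arr C \<and>
      Dom C (TenA C f g) = TenO C (Dom C f) (Dom C g) \<and>
      Cod C (TenA C f g) = TenO C (Cod C f) (Cod C g)"
    and tenA_id: "\<lbrakk>X \<in> Obj C; Y \<in> Obj C\<rbrakk> \<Longrightarrow> TenA C (Id C X) (Id C Y) = Id C (TenO C X Y)"
    and tenA_comp: "\<lbrakk>f \<in> Arr C; g \<in> Arr C; f' \<in> Arr C; g' \<in> Arr C;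
        Cod C f = Dom C f'; Cod C g = Dom C g'\<rbrakk> \<Longrightarrow>
      TenA C (Comp C f' f) (Comp C g' g) = Comp C (TenA C f' g') (TenA C f g)"
    and tenO_assoc: "\<lbrakk>X \<in> Obj C; Y \<in> Obj C; Z \<in> Obj C\<rbrakk> \<Longrightarrow>
      TenO C (TenO C X Y) Z = TenO C X (TenO C Y Z)"
    and tenA_assoc: "\<lbrakk>f \<in> Arr C; g \<in> Arr C; h \<in> Arr C\<rbrakk> \<Longrightarrow>
      TenA C (TenA C f g) h = TenA C f (TenA C g h)"
    and unit_obj: "UnitO C \<in> Obj C"
    and unitO: "X \<in> Obj C \<Longrightarrow> TenO C (UnitO C) X = X \<and> TenO C X (UnitO C) = X"
    and unitA: "f \<in> Arr C \<Longrightarrow> TenA C (Id C (UnitO C)) f = f \<and> TenA C f (Id C (UnitO C)) = f"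

definition is_functor ::
  "('o, 'm, 'z) cat_data_scheme \<Rightarrow> ('p, 'n, 'y) cat_data_scheme \<Rightarrow> ('o \<Rightarrow> 'p) \<Rightarrow> ('m \<Rightarrow> 'n) \<Rightarrow> bool"
where
  "is_functor C D FO FA \<longleftrightarrow>
     (\<forall>X\<in>Obj C. FO X \<in> Obj D \<and> FA (Id C X) = Id D (FO X)) \<and>
     (\<forall>f\<in>Arr C. FA f \<in> Arr D \<and> Dom D (FA f) = FO (Dom C f) \<and> Cod D (FA f) = FO (Cod C f)) \<and>
     (\<forall>f\<in>Arr C. \<forall>g\<in>Arr C. Cod C f = Dom C g \<longrightarrow> FA (Comp C g f) = Comp D (FA g) (FA f))"

definition cat_isomorphism ::
  "('o, 'm, 'z) cat_data_scheme \<Rightarrow> ('p, 'n, 'y) cat_data_scheme \<Rightarrow> ('o \<Rightarrow> 'p) \<Rightarrow> ('m \<Rightarrow> 'n) \<Rightarrow> bool"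
where
  "cat_isomorphism C D FO FA \<longleftrightarrow>
     is_functor C D FO FA \<and> bij_betw FO (Obj C) (Obj D) \<and> bij_betw FA (Arr C) (Arr D)"

definition strict_tensor_functor ::
  "('o, 'm, 'z) moncat_data_scheme \<Rightarrow> ('p, 'n, 'y) moncat_data_scheme \<Rightarrow>
   ('o \<Rightarrow> 'p) \<Rightarrow> ('m \<Rightarrow> 'n) \<Rightarrow> bool"
where
  "strict_tensor_functor C D FO FA \<longleftrightarrow> is_functor C D FO FA \<and>
     (\<forall>X\<in>Obj C. \<forall>Y\<in>Obj C. FO (TenO C X Y) = TenO D (FO X) (FO Y)) \<and>
     (\<forall>f\<in>Arr C. \<forall>g\<in>Arr C. FA (TenA C f g) = TenA D (FA f) (FA g)) \<and>
     FO (UnitO C) = UnitO D"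

definition comp_objs :: "('o, 'm, 'g, 'z) tcat_data_scheme \<Rightarrow> 'g \<Rightarrow> 'o set" where
  "comp_objs C a = {X \<in> Obj C. Deg C X = a}"

definition comp_arrs :: "('o, 'm, 'g, 'z) tcat_data_scheme \<Rightarrow> 'g \<Rightarrow> 'm set" where
  "comp_arrs C a = {f \<in> Arr C. Dom C f \<in> comp_objs C a \<and> Cod C f \<in> comp_objs C a}"

locale crossed_category = group G + strict_monoidal_category C
  for G :: "('g, 'y) monoid_scheme" and C :: "('o, 'm, 'g, 'z) tcat_data_scheme" +
  assumes deg_carrier: "X \<in> Obj C \<Longrightarrow> Deg C X \<in> carrier G"
    and deg_arr: "f \<in> Arr C \<Longrightarrow> Deg C (Dom C f) = Deg C (Cod C f)"
    and deg_tenO: "\<lbrakk>X \<in> Obj C; Y \<in> Obj C\<rbrakk> \<Longrightarrow>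
      Deg C (TenO C X Y) = Deg C X \<otimes>\<^bsub>G\<^esub> Deg C Y"
    and conj_functor: "a \<in> carrier G \<Longrightarrow>
      strict_tensor_functor C C (ConjO C a) (ConjA C a) \<and>
      cat_isomorphism C C (ConjO C a) (ConjA C a)"
    and conjO_mult: "\<lbrakk>a \<in> carrier G; b \<in> carrier G; X \<in> Obj C\<rbrakk> \<Longrightarrow>
      ConjO C (a \<otimes>\<^bsub>G\<^esub> b) X = ConjO C a (ConjO C b X)"
    and conjA_mult: "\<lbrakk>a \<in> carrier G; b \<in> carrier G; f \<in> Arr C\<rbrakk> \<Longrightarrow>
      ConjA C (a \<otimes>\<^bsub>G\<^esub> b) f = ConjA C a (ConjA C b f)"
    and conjO_comp: "\<lbrakk>a \<in> carrier G; b \<in> carrier G\<rbrakk> \<Longrightarrow>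
      ConjO C b ` comp_objs C a = comp_objs C (b \<otimes>\<^bsub>G\<^esub> a \<otimes>\<^bsub>G\<^esub> inv\<^bsub>G\<^esub> b)"
    and conjA_comp: "\<lbrakk>a \<in> carrier G; b \<in> carrier G\<rbrakk> \<Longrightarrow>
      ConjA C b ` comp_arrs C a = comp_arrs C (b \<otimes>\<^bsub>G\<^esub> a \<otimes>\<^bsub>G\<^esub> inv\<^bsub>G\<^esub> b)"

locale braided_T_category = crossed_category G C
  for G :: "('g, 'y) monoid_scheme" and C :: "('o, 'm, 'g, 'z) tcat_data_scheme" +
  assumes braid_iso: "\<lbrakk>U \<in> Obj C; V \<in> Obj C\<rbrakk> \<Longrightarrow> iso_arr C (Braid C U V) \<and>
      Dom C (Braid C U V) = TenO C U V \<and>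
      Cod C (Braid C U V) = TenO C (ConjO C (Deg C U) V) U"
    and braid_natural: "\<lbrakk>a \<in> carrier G; b \<in> carrier G; f \<in> comp_arrs C a; g \<in> comp_arrs C b\<rbrakk> \<Longrightarrow>
      Comp C (TenA C (ConjA C a g) f) (Braid C (Dom C f) (Dom C g)) =
      Comp C (Braid C (Cod C f) (Cod C g)) (TenA C f g)"
    and braid_tensor_left: "\<lbrakk>U \<in> Obj C; V \<in> Obj C; W \<in> Obj C\<rbrakk> \<Longrightarrow>
      Braid C (TenO C U V) W =
      Comp C (TenA C (Braid C U (ConjO C (Deg C V) W)) (Id C V))
             (TenA C (Id C U) (Braid C V W))"
    and braid_tensor_right: "\<lbrakk>U \<in> Obj C; V \<in> Obj C; W \<in> Obj C\<rbrakk> \<Longrightarrow>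
      Braid C U (TenO C V W) =
      Comp C (TenA C (Id C (ConjO C (Deg C U) V)) (Braid C U W))
             (TenA C (Braid C U V) (Id C W))"
    and braid_conj: "\<lbrakk>a \<in> carrier G; U \<in> Obj C; V \<in> Obj C\<rbrakk> \<Longrightarrow>
      ConjA C a (Braid C U V) = Braid C (ConjO C a U) (ConjO C a V)"

definition braided_T_isomorphism ::
  "('g, 'y) monoid_scheme \<Rightarrow> ('o, 'm, 'g, 'z) tcat_data_scheme \<Rightarrow> ('p, 'n, 'g, 'x) tcat_data_scheme \<Rightarrow>
   ('o \<Rightarrow> 'p) \<Rightarrow> ('m \<Rightarrow> 'n) \<Rightarrow> bool"
where
  "braided_T_isomorphism G C D FO FA \<longleftrightarrow>
     cat_isomorphism C D FO FA \<and> strict_tensor_functor C D FO FA \<and>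
     (\<forall>a\<in>carrier G. FO ` comp_objs C a = comp_objs D a \<and> FA ` comp_arrs C a = comp_arrs D a) \<and>
     (\<forall>a\<in>carrier G. \<forall>X\<in>Obj C. FO (ConjO C a X) = ConjO D a (FO X)) \<and>
     (\<forall>a\<in>carrier G. \<forall>f\<in>Arr C. FA (ConjA C a f) = ConjA D a (FA f)) \<and>
     (\<forall>X\<in>Obj C. \<forall>Y\<in>Obj C. FA (Braid C X Y) = Braid D (FO X) (FO Y))"

definition isomorphic_braided_T_categories ::
  "('g, 'y) monoid_scheme \<Rightarrow> ('o, 'm, 'g, 'z) tcat_data_scheme \<Rightarrow> ('p, 'n, 'g, 'x) tcat_data_scheme \<Rightarrow> bool"
where
  "isomorphic_braided_T_categories G C D \<longleftrightarrow>
     braided_T_category G C \<and> braided_T_category G D \<and> (\<exists>FO FA. braided_T_isomorphism G C D FO FA)"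


section \<open>Tensor products\<close>

definition linear_on ::
  "'a set \<Rightarrow> ('k \<Rightarrow> 'a \<Rightarrow> 'a) \<Rightarrow> ('k \<Rightarrow> 'b \<Rightarrow> 'b) \<Rightarrow> ('a::plus \<Rightarrow> 'b::plus) \<Rightarrow> bool"
where
  "linear_on V s1 s2 f \<longleftrightarrow>
     (\<forall>x\<in>V. \<forall>y\<in>V. f (x + y) = f x + f y) \<and> (\<forall>c. \<forall>x\<in>V. f (s1 c x) = s2 c (f x))"

definition bilinear_form ::
  "('k \<Rightarrow> 'a \<Rightarrow> 'a) \<Rightarrow> ('k \<Rightarrow> 'b \<Rightarrow> 'b) \<Rightarrow> ('a::ab_group_add \<Rightarrow> 'b::ab_group_add \<Rightarrow> 'k::field) \<Rightarrow> bool"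
where
  "bilinear_form s1 s2 B \<longleftrightarrow>
     (\<forall>a. Vector_Spaces.linear s2 (*) (B a)) \<and> (\<forall>b. Vector_Spaces.linear s1 (*) (\<lambda>a. B a b))"

definition fscale :: "'k \<Rightarrow> ('x \<Rightarrow> 'k::times) \<Rightarrow> 'x \<Rightarrow> 'k" where
  "fscale c f = (\<lambda>x. c * f x)"

text \<open>
  Over a field, a tensor \<open>\<Sum> a \<otimes> b\<close> is determined by the values \<open>\<Sum> B a b\<close> of the
  bilinear forms \<open>B\<close>; the tensor product is realised inside the functions on bilinear forms.
  The universal property is lemma \<open>sweedler_pure_tensor\<close> below.
\<close>

type_synonym ('a, 'b, 'k) tensor = "('a \<Rightarrow> 'b \<Rightarrow> 'k) \<Rightarrow> 'k"

definition pure_tensor ::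
  "('k \<Rightarrow> 'a \<Rightarrow> 'a) \<Rightarrow> ('k \<Rightarrow> 'b \<Rightarrow> 'b) \<Rightarrow> 'a \<Rightarrow> 'b \<Rightarrow>
   ('a::ab_group_add, 'b::ab_group_add, 'k::field) tensor"
where
  "pure_tensor s1 s2 a b = (\<lambda>B. if bilinear_form s1 s2 B then B a b else 0)"

text \<open>
  In the next two definitions \<open>\<tau>\<close> is the map sending a pair to its elementary tensor.
  If \<open>t = \<Sum> \<tau> a b\<close> with \<open>a \<in> V\<close> and \<open>b \<in> W\<close>, then \<open>sweedler \<tau> V W t F = \<Sum> F a b\<close>;
  for \<open>F\<close> bilinear on \<open>V \<times> W\<close> this does not depend on the decomposition of \<open>t\<close>
  (lemmas \<open>sweedler_pure_tensor\<close> and \<open>sweedler_universe\<close>).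
\<close>

definition tensor_space ::
  "('a \<Rightarrow> 'b \<Rightarrow> 't::comm_monoid_add) \<Rightarrow> 'a set \<Rightarrow> 'b set \<Rightarrow> 't set"
where
  "tensor_space \<tau> V W = {(\<Sum>(a, b)\<leftarrow>xs. \<tau> a b) | xs. set xs \<subseteq> V \<times> W}"

definition sweedler ::
  "('a \<Rightarrow> 'b \<Rightarrow> 't::comm_monoid_add) \<Rightarrow> 'a set \<Rightarrow> 'b set \<Rightarrow> 't \<Rightarrow>
   ('a \<Rightarrow> 'b \<Rightarrow> 'c::comm_monoid_add) \<Rightarrow> 'c"
where
  "sweedler \<tau> V W t F =
     (THE c. \<exists>xs. set xs \<subseteq> V \<times> W \<and> t = (\<Sum>(a, b)\<leftarrow>xs. \<tau> a b) \<and> c = (\<Sum>(a, b)\<leftarrow>xs. F a b))"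

text \<open>
  A class \<open>\<U>\<close> of vector spaces over \<open>'k\<close> with a strictly associative and strictly unital
  tensor product. The spaces are subspaces of an associative unital algebra (think of the direct
  sum of all spaces in \<open>\<U>\<close>, graded by \<open>\<U>\<close>) whose multiplication restricts to the
  tensor map \<open>V \<times> W \<rightarrow> V \<otimes> W\<close> for \<open>V\<close>, \<open>W\<close> in \<open>\<U>\<close>: it factorises all bilinear forms.
  Strictness is associativity and unitality of the algebra; the ground field is the line
  through \<open>1\<close>. The homogeneous subspaces of a free algebra are an example, see
  \<open>strict_tensor_universe_free_algebra\<close>; there every subspace of the free vector
  space on the generators is in \<open>\<U>\<close>, so that up to isomorphism every vector space occurs.
\<close>

locale strict_tensor_universe = vector_space s
  for s :: "'k::field \<Rightarrow> 'v::ring_1 \<Rightarrow> 'v" +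
  fixes \<U> :: "'v set set"
  assumes scale_mult_left: "s c x * y = s c (x * y)"
    and scale_mult_right: "x * s c y = s c (x * y)"
    and universe_subspace: "V \<in> \<U> \<Longrightarrow> subspace V"
    and universe_unit: "span {1} \<in> \<U>"
    and universe_tensor: "\<lbrakk>V \<in> \<U>; W \<in> \<U>\<rbrakk> \<Longrightarrow> tensor_space (*) V W \<in> \<U>"
    and universe_factor: "\<lbrakk>V \<in> \<U>; W \<in> \<U>; bilinear_form s s B\<rbrakk> \<Longrightarrow>
      \<exists>f. Vector_Spaces.linear s (*) f \<and> (\<forall>v\<in>V. \<forall>w\<in>W. f (v * w) = B v w)"

definition tensor_map ::
  "'v set \<Rightarrow> 'v set \<Rightarrow> ('v \<Rightarrow> 'v) \<Rightarrow> ('v \<Rightarrow> 'v) \<Rightarrow> 'v \<Rightarrow> 'v::ring_1"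
where
  "tensor_map V W f g =
     (\<lambda>x\<in>tensor_space (*) V W. sweedler (*) V W x (\<lambda>v w. f v * g w))"


subsection \<open>Well-definedness\<close>

definition bilinear_on ::
  "'a set \<Rightarrow> 'b set \<Rightarrow> ('k \<Rightarrow> 'a \<Rightarrow> 'a) \<Rightarrow> ('k \<Rightarrow> 'b \<Rightarrow> 'b) \<Rightarrow> ('k \<Rightarrow> 'c \<Rightarrow> 'c) \<Rightarrow>
   ('a::plus \<Rightarrow> 'b::plus \<Rightarrow> 'c::plus) \<Rightarrow> bool"
where
  "bilinear_on V W s1 s2 s3 F \<longleftrightarrow>
     (\<forall>v\<in>V. linear_on W s2 s3 (F v)) \<and> (\<forall>w\<in>W. linear_on V s1 s3 (\<lambda>v. F v w))"

lemma linear_projection: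
  assumes "vector_space s" "module.subspace s V"
  shows "\<exists>p. Vector_Spaces.linear s s p \<and> (\<forall>x. p x \<in> V) \<and> (\<forall>x\<in>V. p x = x)"
proof -
  interpret vector_space s by fact
  interpret P: vector_space_pair s s by unfold_locales
  obtain A where A: "A \<subseteq> V" "independent A" "V \<subseteq> span A" by (rule basis_exists) 
  have sp: "span A \<subseteq> V" using A(1) assms(2) by (metis span_minimal)
  let ?p = "P.construct A id"
  have lin: "Vector_Spaces.linear s s ?p" by (rule P.linear_construct[OF A(2)])
  have b: "?p x = x" if "x \<in> A" for x using P.construct_basis[OF A(2) that, of id] by simp
  have "?p x \<in> V" for x
    using P.construct_in_span[OF A(2), of id x] sp by auto
  moreover have "?p x = x" if "x \<in> V" for x
  proof -
    have "x \<in> span A" using that A(3) by blast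
    then show ?thesis
      using P.linear_eq_on[OF lin linear_id, of x A] b by auto
  qed
  ultimately show ?thesis using lin by blast
qed

lemma linear_functional_separates:
  assumes "vector_space (s :: 'k::field \<Rightarrow> 'a::ab_group_add \<Rightarrow> 'a)" "x \<noteq> 0"
  shows "\<exists>p. Vector_Spaces.linear s (*) p \<and> p x \<noteq> 0"
proof -
  interpret vector_space s by fact
  interpret P: vector_space_pair s "(*)::'k\<Rightarrow>'k\<Rightarrow>'k" by unfold_locales (auto simp: algebra_simps)
  have ind: "independent {x}" using assms(2) by simp
  show ?thesis
    by (rule exI[of _ "P.construct {x} (\<lambda>_. 1)"])
       (use P.linear_construct[OF ind] P.construct_basis[OF ind] in auto)
qed

lemma linear_sum_list_on:
  assumes "Vector_Spaces.linear s1 s2 f"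
  shows "f (\<Sum>(a, b)\<leftarrow>xs. F a b) = (\<Sum>(a, b)\<leftarrow>xs. f (F a b))"
proof -
  interpret Vector_Spaces.linear s1 s2 f by fact
  show ?thesis by (induction xs) (auto simp: add zero)
qed

lemma sum_list_pure_tensor:
  "bilinear_form s1 s2 B \<Longrightarrow> (\<Sum>(a, b)\<leftarrow>xs. pure_tensor s1 s2 a b) B = (\<Sum>(a, b)\<leftarrow>xs. B a b)"
  by (induction xs) (auto simp: pure_tensor_def)

lemma linear_from_maps:
  assumes "vector_space s" "\<And>x y. p (x + y) = p x + p y" "\<And>c x. p (s c x) = c * p x"
  shows "Vector_Spaces.linear s (*) (p :: _ \<Rightarrow> 'k::field)"
proof -
  interpret vector_space s by fact
  interpret vector_space_pair s "(*) :: 'k \<Rightarrow> _"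
    by unfold_locales (simp_all add: distrib_left distrib_right mult.assoc)
  show ?thesis by unfold_locales (simp_all add: assms)
qed

lemma pure_tensor_universal:
  assumes s: "vector_space s1" "vector_space s2" "vector_space s3"
    and sub: "module.subspace s1 V" "module.subspace s2 W"
    and F: "bilinear_on V W s1 s2 s3 F"
    and xs: "set xs \<subseteq> V \<times> W" and ys: "set ys \<subseteq> V \<times> W"
    and eq: "(\<Sum>(a, b)\<leftarrow>xs. pure_tensor s1 s2 a b) = (\<Sum>(a, b)\<leftarrow>ys. pure_tensor s1 s2 a b)"
  shows "(\<Sum>(a, b)\<leftarrow>xs. F a b) = (\<Sum>(a, b)\<leftarrow>ys. F a b)"
proof (rule ccontr)
  assume "\<not> ?thesis"
  then have "(\<Sum>(a, b)\<leftarrow>xs. F a b) - (\<Sum>(a, b)\<leftarrow>ys. F a b) \<noteq> 0" by simp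
  from linear_functional_separates[OF s(3) this] obtain p
    where p: "Vector_Spaces.linear s3 (*) p"
      and ne: "p ((\<Sum>(a, b)\<leftarrow>xs. F a b) - (\<Sum>(a, b)\<leftarrow>ys. F a b)) \<noteq> 0" by blast
  obtain f where f: "Vector_Spaces.linear s1 s1 f" "\<And>x. f x \<in> V" "\<And>x. x \<in> V \<Longrightarrow> f x = x"
    using linear_projection[OF s(1) sub(1)] by blast
  obtain g where g: "Vector_Spaces.linear s2 s2 g" "\<And>x. g x \<in> W" "\<And>x. x \<in> W \<Longrightarrow> g x = x"
    using linear_projection[OF s(2) sub(2)] by blast
  interpret p: Vector_Spaces.linear s3 "(*)" p by fact
  interpret f: Vector_Spaces.linear s1 s1 f by fact
  interpret g: Vector_Spaces.linear s2 s2 g by fact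
  define Q where "Q = (\<lambda>a b. p (F (f a) (g b)))"
  have Q: "bilinear_form s1 s2 Q"
    unfolding bilinear_form_def
  proof (intro conjI allI)
    fix a
    have "linear_on W s2 s3 (F (f a))" using F f(2)[of a] by (simp add: bilinear_on_def)
    then show "Vector_Spaces.linear s2 (*) (Q a)"
      by (intro linear_from_maps[OF s(2)])
        (simp_all add: linear_on_def Q_def g.add g.scale g(2) p.add p.scale)
  next
    fix b
    have "linear_on V s1 s3 (\<lambda>v. F v (g b))" using F g(2)[of b] by (simp add: bilinear_on_def)
    then show "Vector_Spaces.linear s1 (*) (\<lambda>a. Q a b)"
      by (intro linear_from_maps[OF s(1)])
        (simp_all add: linear_on_def Q_def f.add f.scale f(2) p.add p.scale)
  qed
  have *: "p (\<Sum>(a, b)\<leftarrow>zs. F a b) = (\<Sum>(a, b)\<leftarrow>zs. Q a b)" if "set zs \<subseteq> V \<times> W" for zs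
    using that by (induction zs) (auto simp: Q_def p.add p.zero f(3) g(3))
  have "(\<Sum>(a, b)\<leftarrow>xs. Q a b) = (\<Sum>(a, b)\<leftarrow>ys. Q a b)"
    using fun_cong[OF eq, of Q] by (simp add: sum_list_pure_tensor[OF Q])
  then show False using ne *[OF xs] *[OF ys] by (simp add: p.diff)
qed

lemma sweedler_pure_tensor:
  assumes "vector_space s1" "vector_space s2" "vector_space s3"
    and "module.subspace s1 V" "module.subspace s2 W"
    and "bilinear_on V W s1 s2 s3 F" and "set xs \<subseteq> V \<times> W"
  shows "sweedler (pure_tensor s1 s2) V W (\<Sum>(a, b)\<leftarrow>xs. pure_tensor s1 s2 a b) F = (\<Sum>(a, b)\<leftarrow>xs. F a b)"
  unfolding sweedler_def
proof (rule the_equality)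
  show "\<exists>ys. set ys \<subseteq> V \<times> W \<and> (\<Sum>(a, b)\<leftarrow>xs. pure_tensor s1 s2 a b) = (\<Sum>(a, b)\<leftarrow>ys. pure_tensor s1 s2 a b) \<and>
      (\<Sum>(a, b)\<leftarrow>xs. F a b) = (\<Sum>(a, b)\<leftarrow>ys. F a b)"
    by (intro exI[of _ xs] conjI refl assms(7))
qed (elim exE conjE, simp only: pure_tensor_universal[OF assms(1-7)])

context strict_tensor_universe
begin

lemma sweedler_universe:
  assumes s3: "vector_space s3" and V: "V \<in> \<U>" and W: "W \<in> \<U>"
    and F: "bilinear_on V W s s s3 F" and xs: "set xs \<subseteq> V \<times> W"
  shows "sweedler (*) V W (\<Sum>(a, b)\<leftarrow>xs. a * b) F = (\<Sum>(a, b)\<leftarrow>xs. F a b)"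
proof -
  have eq: "(\<Sum>(a, b)\<leftarrow>xs. F a b) = (\<Sum>(a, b)\<leftarrow>ys. F a b)"
    if ys: "set ys \<subseteq> V \<times> W" and eq: "(\<Sum>(a, b)\<leftarrow>xs. a * b) = (\<Sum>(a, b)\<leftarrow>ys. a * b)" for ys
  proof -
    have "(\<Sum>(a, b)\<leftarrow>xs. pure_tensor s s a b) Q = (\<Sum>(a, b)\<leftarrow>ys. pure_tensor s s a b) Q" for Q
    proof (cases "bilinear_form s s Q")
      case True
      obtain f where f: "Vector_Spaces.linear s (*) f" "\<forall>v\<in>V. \<forall>w\<in>W. f (v * w) = Q v w"
        using universe_factor[OF V W True] by blast
      have *: "f (\<Sum>(a, b)\<leftarrow>zs. a * b) = (\<Sum>(a, b)\<leftarrow>zs. Q a b)" if "set zs \<subseteq> V \<times> W" for zs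
      proof -
        interpret f: Vector_Spaces.linear s "(*)" f by fact
        show ?thesis using that f(2) by (induction zs) (auto simp: f.add f.zero)
      qed
      show ?thesis
        using *[OF xs] *[OF ys] eq by (simp add: sum_list_pure_tensor[OF True])
    next
      case False
      have "(\<Sum>(a, b)\<leftarrow>zs. pure_tensor s s a b) Q = 0" for zs
        using False by (induction zs) (auto simp: pure_tensor_def)
      then show ?thesis by simp
    qed
    then have "(\<Sum>(a, b)\<leftarrow>xs. pure_tensor s s a b) = (\<Sum>(a, b)\<leftarrow>ys. pure_tensor s s a b)" by (rule ext)
    from pure_tensor_universal[OF vector_space_axioms vector_space_axioms s3 universe_subspace[OF V]
        universe_subspace[OF W] F xs ys this]
    show ?thesis .
  qed
  show ?thesis
    unfolding sweedler_def
  proof (rule the_equality)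
    show "\<exists>ys. set ys \<subseteq> V \<times> W \<and> (\<Sum>(a, b)\<leftarrow>xs. a * b) = (\<Sum>(a, b)\<leftarrow>ys. a * b) \<and>
        (\<Sum>(a, b)\<leftarrow>xs. F a b) = (\<Sum>(a, b)\<leftarrow>ys. F a b)"
      by (intro exI[of _ xs] conjI refl xs)
  qed (elim exE conjE, simp only: eq)
qed

end

subsection \<open>Free algebras\<close>

text \<open>Existence of strict tensor universes: words are the free monoid, written additively.\<close>

datatype 'x mword = MWord (letters: "'x list")

instantiation mword :: (type) monoid_add
begin
definition zero_mword :: "'a mword" where "0 = MWord []"
definition plus_mword :: "'a mword \<Rightarrow> 'a mword \<Rightarrow> 'a mword" where "u + v = MWord (letters u @ letters v)"
instance by standard (auto simp: zero_mword_def plus_mword_def)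
end

definition free_scale :: "'k::field \<Rightarrow> ('x mword \<Rightarrow>\<^sub>0 'k) \<Rightarrow> ('x mword \<Rightarrow>\<^sub>0 'k)" where
  "free_scale c p = Poly_Mapping.single 0 c * p"

definition free_homogeneous :: "('x mword \<Rightarrow>\<^sub>0 'k::field) set set" where
  "free_homogeneous = {V. module.subspace free_scale V \<and>
     (\<exists>n. \<forall>p\<in>V. \<forall>w\<in>Poly_Mapping.keys p. length (letters w) = n)}"

lemma vector_space_free_scale: "vector_space free_scale"
  by unfold_locales
    (simp_all add: free_scale_def distrib_left distrib_right mult_single single_add flip: mult.assoc)

lemma poly_mapping_sum_single:
  "(p :: 'a \<Rightarrow>\<^sub>0 'b::comm_monoid_add) = (\<Sum>x\<in>Poly_Mapping.keys p. Poly_Mapping.single x (Poly_Mapping.lookup p x))"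
  by (rule poly_mapping_eqI)
    (auto simp: lookup_sum lookup_single when_def in_keys_iff sum.delta)

lemma free_scale_single: "free_scale c (Poly_Mapping.single w a) = Poly_Mapping.single w (c * a)"
  by (simp add: free_scale_def mult_single)

lemma free_scale_commute: "Poly_Mapping.single 0 c * p = p * Poly_Mapping.single 0 c"
  for p :: "'x mword \<Rightarrow>\<^sub>0 'k::field"
  by (subst (1 2) poly_mapping_sum_single[of p])
    (simp add: sum_distrib_left sum_distrib_right mult_single mult.commute)

lemma lookup_free_scale: "Poly_Mapping.lookup (free_scale c p) w = c * Poly_Mapping.lookup p w"
proof -
  have "free_scale c p = (\<Sum>x\<in>Poly_Mapping.keys p. Poly_Mapping.single x (c * Poly_Mapping.lookup p x))"
    by (subst poly_mapping_sum_single[of p]) (simp add: free_scale_def sum_distrib_left mult_single)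
  then show ?thesis by (auto simp: lookup_sum lookup_single when_def in_keys_iff sum.delta)
qed

lemma tensor_space_subspace:
  assumes "vector_space (s :: 'k::field \<Rightarrow> 'v::ring_1 \<Rightarrow> 'v)"
    and "\<And>c x y. s c x * y = s c (x * y)" and "module.subspace s V"
  shows "module.subspace s (tensor_space (*) V W)"
proof -
  interpret vector_space s by fact
  show ?thesis
    unfolding subspace_def
  proof (intro conjI ballI allI)
    show "0 \<in> tensor_space (*) V W" unfolding tensor_space_def by (auto intro!: exI[of _ "[]"])
  next
    fix x y assume "x \<in> tensor_space (*) V W" "y \<in> tensor_space (*) V W"
    then obtain xs ys where "x = (\<Sum>(a, b)\<leftarrow>xs. a * b)" "y = (\<Sum>(a, b)\<leftarrow>ys. a * b)"
      "set xs \<subseteq> V \<times> W" "set ys \<subseteq> V \<times> W" unfolding tensor_space_def by auto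
    then show "x + y \<in> tensor_space (*) V W" unfolding tensor_space_def
      by (auto intro!: exI[of _ "xs @ ys"])
  next
    fix c x assume "x \<in> tensor_space (*) V W"
    then obtain xs where x: "x = (\<Sum>(a, b)\<leftarrow>xs. a * b)" "set xs \<subseteq> V \<times> W"
      unfolding tensor_space_def by auto
    have "s c (\<Sum>(a, b)\<leftarrow>xs. a * b) = (\<Sum>(a, b)\<leftarrow>map (\<lambda>(a, b). (s c a, b)) xs. a * b)"
      by (induction xs) (auto simp: scale_right_distrib assms(2))
    then show "s c x \<in> tensor_space (*) V W" unfolding tensor_space_def
      using x assms(3) by (intro CollectI exI[of _ "map (\<lambda>(a, b). (s c a, b)) xs"])
        (auto simp: subspace_def)
  qed
qed

lemma linear_free_extend:
  "Vector_Spaces.linear free_scale (*) (\<lambda>p::'x mword \<Rightarrow>\<^sub>0 'k::field. \<Sum>w\<in>Poly_Mapping.keys p. Poly_Mapping.lookup p w * g w)"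
proof -
  interpret vector_space "free_scale :: 'k \<Rightarrow> ('x mword \<Rightarrow>\<^sub>0 'k) \<Rightarrow> _" by (rule vector_space_free_scale)
  have eq: "(\<Sum>w\<in>Poly_Mapping.keys p. Poly_Mapping.lookup p w * g w) = (\<Sum>w\<in>A. Poly_Mapping.lookup p w * g w)"
    if "finite A" "Poly_Mapping.keys p \<subseteq> A" for p :: "'x mword \<Rightarrow>\<^sub>0 'k" and A
    using that by (intro sum.mono_neutral_left) (auto simp: in_keys_iff)
  show ?thesis
  proof (unfold_locales, goal_cases)
    case (5 x y)
    let ?A = "Poly_Mapping.keys x \<union> Poly_Mapping.keys y"
    have "Poly_Mapping.keys (x + y) \<subseteq> ?A" by (rule Poly_Mapping.keys_add)
    note 1 = eq[of ?A "x + y", OF _ this] eq[of ?A x] eq[of ?A y]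
    show ?case
      by (simp add: 1) (simp add: lookup_add distrib_right sum.distrib)
  next
    case (6 c x)
    show ?case
      by (subst eq[of "Poly_Mapping.keys x"])
        (auto simp: in_keys_iff lookup_free_scale sum_distrib_left mult.assoc)
  qed (auto simp: algebra_simps)
qed

theorem strict_tensor_universe_free_algebra:
  "strict_tensor_universe free_scale (free_homogeneous :: ('x mword \<Rightarrow>\<^sub>0 'k::field) set set)"
proof -
  interpret vector_space "free_scale :: 'k \<Rightarrow> ('x mword \<Rightarrow>\<^sub>0 'k) \<Rightarrow> _" by (rule vector_space_free_scale)
  have l: "free_scale c x * y = free_scale c (x * y)" for c and x y :: "'x mword \<Rightarrow>\<^sub>0 'k"
    by (simp add: free_scale_def mult.assoc)
  have r: "x * free_scale c y = free_scale c (x * y)" for c and x y :: "'x mword \<Rightarrow>\<^sub>0 'k"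
    unfolding free_scale_def by (metis free_scale_commute mult.assoc)
  show ?thesis
  proof (unfold_locales, goal_cases)
    case (4 )
    have "span {1 :: 'x mword \<Rightarrow>\<^sub>0 'k} = range (\<lambda>c. free_scale c 1)" by (simp add: span_singleton)
    then have "\<forall>p\<in>span {1 :: 'x mword \<Rightarrow>\<^sub>0 'k}. \<forall>w\<in>Poly_Mapping.keys p. length (letters w) = 0"
      by (auto simp: free_scale_def zero_mword_def split: if_splits)
    then show ?case by (auto simp: free_homogeneous_def)
  next
    case (5 V W)
    then obtain n m where nm: "\<forall>p\<in>V. \<forall>w\<in>Poly_Mapping.keys p. length (letters w) = n"
      "\<forall>p\<in>W. \<forall>w\<in>Poly_Mapping.keys p. length (letters w) = m" 
      and V: "subspace V" by (auto simp: free_homogeneous_def)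
    have "\<forall>w\<in>Poly_Mapping.keys (\<Sum>(a, b)\<leftarrow>xs. a * b). length (letters w) = n + m" if "set xs \<subseteq> V \<times> W" for xs
      using that
    proof (induction xs)
      case (Cons x xs)
      obtain a b where x: "x = (a, b)" by force
      have "length (letters w) = n + m" if "w \<in> Poly_Mapping.keys (a * b)" for w
      proof -
        from that keys_mult[of a b] obtain u v where "w = u + v" "u \<in> Poly_Mapping.keys a" "v \<in> Poly_Mapping.keys b"
          by blast
        then show ?thesis using nm Cons.prems x by (auto simp: plus_mword_def)
      qed
      then show ?case using Cons Poly_Mapping.keys_add[of "a * b" "\<Sum>(a, b)\<leftarrow>xs. a * b"] x by auto
    qed auto
    then have "\<forall>p\<in>tensor_space (*) V W. \<forall>w\<in>Poly_Mapping.keys p. length (letters w) = n + m"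
      unfolding tensor_space_def by blast
    moreover have "subspace (tensor_space (*) V W)"
      by (rule tensor_space_subspace[OF vector_space_axioms l V])
    ultimately show ?case by (auto simp: free_homogeneous_def)
  next
    case (6 V W B)
    then obtain n where n: "\<forall>p\<in>V. \<forall>w\<in>Poly_Mapping.keys p. length (letters w) = n"
      by (auto simp: free_homogeneous_def)
    define g where "g = (\<lambda>w. B (Poly_Mapping.single (MWord (take n (letters w))) 1)
                              (Poly_Mapping.single (MWord (drop n (letters w))) 1))"
    define f where "f = (\<lambda>p::'x mword \<Rightarrow>\<^sub>0 'k. \<Sum>w\<in>Poly_Mapping.keys p. Poly_Mapping.lookup p w * g w)"
    have f: "Vector_Spaces.linear free_scale (*) f"
      unfolding f_def by (rule linear_free_extend)
    interpret f: Vector_Spaces.linear free_scale "(*)" f by (rule f)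
    have BL: "Vector_Spaces.linear free_scale (*) (B a)" "Vector_Spaces.linear free_scale (*) (\<lambda>a. B a b)" for a b
      using 6 by (auto simp: bilinear_form_def)
    have fs: "f (Poly_Mapping.single w c) = c * g w" for w c by (simp add: f_def)
    have Bs: "B (Poly_Mapping.single x a) (Poly_Mapping.single y b) =
        a * b * B (Poly_Mapping.single x 1) (Poly_Mapping.single y 1)" for x y a b
    proof -
      interpret L: Vector_Spaces.linear free_scale "(*)" "B (Poly_Mapping.single x a)" by (rule BL)
      interpret R: Vector_Spaces.linear free_scale "(*)" "\<lambda>u. B u (Poly_Mapping.single y 1)" by (rule BL)
      have "B (Poly_Mapping.single x a) (Poly_Mapping.single y b) =
          b * B (Poly_Mapping.single x a) (Poly_Mapping.single y 1)"
        using L.scale[of b "Poly_Mapping.single y 1"] unfolding free_scale_single mult_1_right .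
      moreover have "B (Poly_Mapping.single x a) (Poly_Mapping.single y 1) =
          a * B (Poly_Mapping.single x 1) (Poly_Mapping.single y 1)"
        using R.scale[of a "Poly_Mapping.single x 1"] unfolding free_scale_single mult_1_right .
      ultimately show ?thesis by (simp only: mult_ac)
    qed
    have "f (v * w) = B v w" if "v \<in> V" for v w
    proof -
      let ?v = "Poly_Mapping.lookup v" and ?w = "Poly_Mapping.lookup w"
      have "v * w = (\<Sum>x\<in>Poly_Mapping.keys v. \<Sum>y\<in>Poly_Mapping.keys w. Poly_Mapping.single (x + y) (?v x * ?w y))"
        by (subst poly_mapping_sum_single[of v], subst poly_mapping_sum_single[of w])
          (simp add: sum_product mult_single)
      then have "f (v * w) = (\<Sum>x\<in>Poly_Mapping.keys v. \<Sum>y\<in>Poly_Mapping.keys w. ?v x * ?w y * g (x + y))"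
        by (simp only: f.sum fs)
      also have "\<dots> = (\<Sum>x\<in>Poly_Mapping.keys v. \<Sum>y\<in>Poly_Mapping.keys w.
          B (Poly_Mapping.single x (?v x)) (Poly_Mapping.single y (?w y)))"
      proof (intro sum.cong refl)
        fix x y assume "x \<in> Poly_Mapping.keys v" 
        then have "length (letters x) = n" using n that by blast
        then show "?v x * ?w y * g (x + y) = B (Poly_Mapping.single x (?v x)) (Poly_Mapping.single y (?w y))"
          by (simp add: Bs[of x "?v x"] g_def plus_mword_def)
      qed
      also have "\<dots> = (\<Sum>x\<in>Poly_Mapping.keys v. B (Poly_Mapping.single x (?v x)) w)"
      proof (intro sum.cong refl)
        fix x
        interpret L: Vector_Spaces.linear free_scale "(*)" "B (Poly_Mapping.single x (?v x))" by (rule BL)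
        show "(\<Sum>y\<in>Poly_Mapping.keys w. B (Poly_Mapping.single x (?v x)) (Poly_Mapping.single y (?w y))) =
          B (Poly_Mapping.single x (?v x)) w"
          by (subst (3) poly_mapping_sum_single[of w]) (simp add: L.sum)
      qed
      also have "\<dots> = B v w"
      proof -
        interpret R: Vector_Spaces.linear free_scale "(*)" "\<lambda>u. B u w" by (rule BL)
        show ?thesis by (subst (3) poly_mapping_sum_single[of v]) (simp add: R.sum)
      qed
      finally show ?thesis .
    qed
    then show ?case using f by blast
  qed (use l r in \<open>auto simp: free_homogeneous_def\<close>)
qed


section \<open>Hopf algebras\<close>

text \<open>The algebra structure is the ring structure on the type \<open>'h\<close>.\<close>

record ('k, 'h) hopf_data =
  hscale :: "'k \<Rightarrow> 'h \<Rightarrow> 'h"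
  hcomult :: "'h \<Rightarrow> ('h, 'h, 'k) tensor"
  hcounit :: "'h \<Rightarrow> 'k"
  hantipode :: "'h \<Rightarrow> 'h"

abbreviation tenH :: "('k::field, 'h::ring_1) hopf_data \<Rightarrow> 'h \<Rightarrow> 'h \<Rightarrow> ('h, 'h, 'k) tensor" where
  "tenH H \<equiv> pure_tensor (hscale H) (hscale H)"

abbreviation swH :: "('k::field, 'h::ring_1) hopf_data \<Rightarrow> 'h \<Rightarrow> ('h \<Rightarrow> 'h \<Rightarrow> 'c::comm_monoid_add) \<Rightarrow> 'c"
where
  "swH H h F \<equiv> sweedler (tenH H) UNIV UNIV (hcomult H h) F"

definition coalgebra ::
  "('k::field \<Rightarrow> 'c::ab_group_add \<Rightarrow> 'c) \<Rightarrow> 'c set \<Rightarrow> ('c \<Rightarrow> ('c, 'c, 'k) tensor) \<Rightarrow> ('c \<Rightarrow> 'k) \<Rightarrow> bool"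
where
  "coalgebra s C \<Delta> \<epsilon> \<longleftrightarrow>
     linear_on C s fscale \<Delta> \<and> linear_on C s (*) \<epsilon> \<and>
     (\<forall>x\<in>C. \<Delta> x \<in> tensor_space (pure_tensor s s) C C \<and>
       sweedler (pure_tensor s s) C C (\<Delta> x) (\<lambda>x1 x2.
         sweedler (pure_tensor s s) C C (\<Delta> x1) (\<lambda>y z. pure_tensor s fscale y (pure_tensor s s z x2))) =
       sweedler (pure_tensor s s) C C (\<Delta> x) (\<lambda>x1 x2.
         sweedler (pure_tensor s s) C C (\<Delta> x2) (\<lambda>y z. pure_tensor s fscale x1 (pure_tensor s s y z))) \<and>
       sweedler (pure_tensor s s) C C (\<Delta> x) (\<lambda>x1 x2. s (\<epsilon> x1) x2) = x \<and>
       sweedler (pure_tensor s s) C C (\<Delta> x) (\<lambda>x1 x2. s (\<epsilon> x2) x1) = x)"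

locale hopf_algebra = vector_space "hscale H"
  for H :: "('k::field, 'h::ring_1) hopf_data" +
  assumes scale_mult_left: "hscale H c x * y = hscale H c (x * y)"
    and scale_mult_right: "x * hscale H c y = hscale H c (x * y)"
    and coalg: "coalgebra (hscale H) UNIV (hcomult H) (hcounit H)"
    and comult_mult: "hcomult H (x * y) =
      swH H x (\<lambda>x1 x2. swH H y (\<lambda>y1 y2. tenH H (x1 * y1) (x2 * y2)))"
    and comult_one: "hcomult H 1 = tenH H 1 1"
    and counit_mult: "hcounit H (x * y) = hcounit H x * hcounit H y"
    and counit_one: "hcounit H 1 = 1"
    and antipode_linear: "Vector_Spaces.linear (hscale H) (hscale H) (hantipode H)"
    and antipode_left: "swH H x (\<lambda>x1 x2. hantipode H x1 * x2) = hscale H (hcounit H x) 1"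
    and antipode_right: "swH H x (\<lambda>x1 x2. x1 * hantipode H x2) = hscale H (hcounit H x) 1"

text \<open>The syntax of \<open>m_inv\<close> shadows that of inverse functions.\<close>

abbreviation finv :: "('a \<Rightarrow> 'b) \<Rightarrow> 'b \<Rightarrow> 'a" where
  "finv \<equiv> inv_into UNIV"

definition hopf_automorphisms :: "('k::field, 'h::ring_1) hopf_data \<Rightarrow> ('h \<Rightarrow> 'h) set" where
  "hopf_automorphisms H = {\<alpha>. bij \<alpha> \<and> Vector_Spaces.linear (hscale H) (hscale H) \<alpha> \<and>
     (\<forall>x y. \<alpha> (x * y) = \<alpha> x * \<alpha> y) \<and> \<alpha> 1 = 1 \<and>
     (\<forall>x. hcomult H (\<alpha> x) = swH H x (\<lambda>x1 x2. tenH H (\<alpha> x1) (\<alpha> x2))) \<and>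
     (\<forall>x. hcounit H (\<alpha> x) = hcounit H x) \<and>
     (\<forall>x. \<alpha> (hantipode H x) = hantipode H (\<alpha> x))}"

definition GAut :: "('k::field, 'h::ring_1) hopf_data \<Rightarrow> (('h \<Rightarrow> 'h) \<times> ('h \<Rightarrow> 'h)) monoid" where
  "GAut H = \<lparr>carrier = hopf_automorphisms H \<times> hopf_automorphisms H,
     mult = (\<lambda>(\<alpha>, \<beta>) (\<gamma>, \<delta>). (\<delta> \<circ> \<alpha> \<circ> finv \<delta> \<circ> \<gamma>, \<delta> \<circ> \<beta>)),
     one = (id, id)\<rparr>"


section \<open>Comodules and categories of structured vector spaces\<close>

text \<open>
  All structure maps are extensional (undefined outside the carrier), so that equality
  of objects and of morphisms is equality of mathematical structures.
\<close>

definition comodule ::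
  "('k::field \<Rightarrow> 'v::ab_group_add \<Rightarrow> 'v) \<Rightarrow> ('k \<Rightarrow> 'c::ab_group_add \<Rightarrow> 'c) \<Rightarrow> 'c set \<Rightarrow>
   ('c \<Rightarrow> ('c, 'c, 'k) tensor) \<Rightarrow> ('c \<Rightarrow> 'k) \<Rightarrow> 'v set \<Rightarrow> ('v \<Rightarrow> ('v, 'c, 'k) tensor) \<Rightarrow> bool"
where
  "comodule s sc C \<Delta> \<epsilon> M \<rho> \<longleftrightarrow>
     \<rho> \<in> M \<rightarrow>\<^sub>E tensor_space (pure_tensor s sc) M C \<and> linear_on M s fscale \<rho> \<and>
     (\<forall>m\<in>M.
       sweedler (pure_tensor s sc) M C (\<rho> m) (\<lambda>m0 m1.
         sweedler (pure_tensor s sc) M C (\<rho> m0) (\<lambda>n0 n1. pure_tensor s fscale n0 (pure_tensor sc sc n1 m1))) =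
       sweedler (pure_tensor s sc) M C (\<rho> m) (\<lambda>m0 m1.
         sweedler (pure_tensor sc sc) C C (\<Delta> m1) (\<lambda>c1 c2. pure_tensor s fscale m0 (pure_tensor sc sc c1 c2))) \<and>
       sweedler (pure_tensor s sc) M C (\<rho> m) (\<lambda>m0 m1. s (\<epsilon> m1) m0) = m)"

definition colinear ::
  "('k::field \<Rightarrow> 'v::ab_group_add \<Rightarrow> 'v) \<Rightarrow> ('k \<Rightarrow> 'c::ab_group_add \<Rightarrow> 'c) \<Rightarrow> 'c set \<Rightarrow>
   'v set \<Rightarrow> ('v \<Rightarrow> ('v, 'c, 'k) tensor) \<Rightarrow> ('v \<Rightarrow> ('v, 'c, 'k) tensor) \<Rightarrow> ('v \<Rightarrow> 'v) \<Rightarrow> bool"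
where
  "colinear s sc C M \<rho> \<rho>' f \<longleftrightarrow>
     (\<forall>m\<in>M. \<rho>' (f m) =
        sweedler (pure_tensor s sc) M C (\<rho> m) (\<lambda>m0 m1. pure_tensor s sc (f m0) m1))"

text \<open>
  The data of a braided T-category of vector spaces with additional structure. A morphism is a
  triple of source, target and underlying map; \<open>car\<close> gives the underlying space, \<open>mor\<close>
  the admissible maps and \<open>br\<close> the map underlying the braiding. Conjugation does not
  change underlying maps.
\<close>

definition concrete_tcat ::
  "('o \<Rightarrow> 'v::ring_1 set) \<Rightarrow> 'o set \<Rightarrow> ('o \<Rightarrow> 'o \<Rightarrow> ('v \<Rightarrow> 'v) \<Rightarrow> bool) \<Rightarrow> ('o \<Rightarrow> 'o \<Rightarrow> 'o) \<Rightarrow> 'o \<Rightarrow>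
   ('o \<Rightarrow> 'g) \<Rightarrow> ('g \<Rightarrow> 'o \<Rightarrow> 'o) \<Rightarrow> ('o \<Rightarrow> 'o \<Rightarrow> 'v \<Rightarrow> 'v) \<Rightarrow>
   ('o, 'o \<times> 'o \<times> ('v \<Rightarrow> 'v), 'g) tcat_data"
where
  "concrete_tcat car objs mor ten unit deg cng br = \<lparr>
     Obj = objs,
     Arr = {(M, N, f). M \<in> objs \<and> N \<in> objs \<and> mor M N f},
     Dom = (\<lambda>(M, N, f). M),
     Cod = (\<lambda>(M, N, f). N),
     Id = (\<lambda>M. (M, M, \<lambda>m\<in>car M. m)),
     Comp = (\<lambda>(N, P, g) (M, N', f). (M, P, \<lambda>m\<in>car M. g (f m))),
     TenO = ten,
     TenA = (\<lambda>(M, N, f) (M', N', f'). (ten M M', ten N N', tensor_map (car M) (car M') f f')),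
     UnitO = unit,
     Deg = deg,
     ConjO = cng,
     ConjA = (\<lambda>a (M, N, f). (cng a M, cng a N, f)),
     Braid = (\<lambda>M N. (ten M N, ten (cng (deg M) N) M, br M N))\<rparr>"


section \<open>Generalized Yetter-Drinfel'd modules\<close>

record ('k, 'h, 'v) yd_module =
  ydeg :: "('h \<Rightarrow> 'h) \<times> ('h \<Rightarrow> 'h)"
  ycar :: "'v set"
  yact :: "'h \<Rightarrow> 'v \<Rightarrow> 'v"
  ycoact :: "'v \<Rightarrow> ('v, 'h, 'k) tensor"

abbreviation swY ::
  "('k::field \<Rightarrow> 'v::ring_1 \<Rightarrow> 'v) \<Rightarrow> ('k, 'h::ring_1) hopf_data \<Rightarrow> ('k, 'h, 'v) yd_module \<Rightarrow>
   'v \<Rightarrow> ('v \<Rightarrow> 'h \<Rightarrow> 'c::comm_monoid_add) \<Rightarrow> 'c"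
where
  "swY s H M m F \<equiv> sweedler (pure_tensor s (hscale H)) (ycar M) UNIV (ycoact M m) F"

definition yd_modules ::
  "('k::field \<Rightarrow> 'v::ring_1 \<Rightarrow> 'v) \<Rightarrow> 'v set set \<Rightarrow> ('k, 'h::ring_1) hopf_data \<Rightarrow> ('k, 'h, 'v) yd_module set"
where
  "yd_modules s \<U> H = {M. ycar M \<in> \<U> \<and> ydeg M \<in> carrier (GAut H) \<and>
     (\<forall>h. yact M h \<in> ycar M \<rightarrow>\<^sub>E ycar M \<and> linear_on (ycar M) s s (yact M h)) \<and>
     (\<forall>m\<in>ycar M. linear_on UNIV (hscale H) s (\<lambda>h. yact M h m) \<and>
        yact M 1 m = m \<and> (\<forall>g h. yact M (g * h) m = yact M g (yact M h m))) \<and>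
     comodule s (hscale H) UNIV (hcomult H) (hcounit H) (ycar M) (ycoact M) \<and>
     (case ydeg M of (\<alpha>, \<beta>) \<Rightarrow> \<forall>h. \<forall>m\<in>ycar M.
        swH H h (\<lambda>h1 h2. swY s H M m (\<lambda>m0 m1.
          pure_tensor s (hscale H) (yact M h1 m0) (\<beta> h2 * m1))) =
        swH H h (\<lambda>h1 h2. swY s H M (yact M h2 m) (\<lambda>m0 m1.
          pure_tensor s (hscale H) m0 (m1 * \<alpha> h1))))}"

definition yd_morphism ::
  "('k::field \<Rightarrow> 'v::ring_1 \<Rightarrow> 'v) \<Rightarrow> ('k, 'h::ring_1) hopf_data \<Rightarrow>
   ('k, 'h, 'v) yd_module \<Rightarrow> ('k, 'h, 'v) yd_module \<Rightarrow> ('v \<Rightarrow> 'v) \<Rightarrow> bool"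
where
  "yd_morphism s H M N f \<longleftrightarrow> ydeg M = ydeg N \<and>
     f \<in> ycar M \<rightarrow>\<^sub>E ycar N \<and> linear_on (ycar M) s s f \<and>
     (\<forall>h. \<forall>m\<in>ycar M. f (yact M h m) = yact N h (f m)) \<and>
     colinear s (hscale H) UNIV (ycar M) (ycoact M) (ycoact N) f"

definition yd_tensor ::
  "('k::field \<Rightarrow> 'v::ring_1 \<Rightarrow> 'v) \<Rightarrow> ('k, 'h::ring_1) hopf_data \<Rightarrow>
   ('k, 'h, 'v) yd_module \<Rightarrow> ('k, 'h, 'v) yd_module \<Rightarrow> ('k, 'h, 'v) yd_module"
where
  "yd_tensor s H M N = (case (ydeg M, ydeg N) of ((\<alpha>, \<beta>), (\<gamma>, \<delta>)) \<Rightarrow> \<lparr>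
     ydeg = ydeg M \<otimes>\<^bsub>GAut H\<^esub> ydeg N,
     ycar = tensor_space (*) (ycar M) (ycar N),
     yact = (\<lambda>h. \<lambda>x\<in>tensor_space (*) (ycar M) (ycar N).
       sweedler (*) (ycar M) (ycar N) x (\<lambda>m n. swH H h (\<lambda>h1 h2. yact M h2 m * yact N h1 n))),
     ycoact = (\<lambda>x\<in>tensor_space (*) (ycar M) (ycar N).
       sweedler (*) (ycar M) (ycar N) x (\<lambda>m n.
         swY s H M m (\<lambda>m0 m1. swY s H N n (\<lambda>n0 n1.
           pure_tensor s (hscale H) (m0 * n0) (\<delta> m1 * (\<delta> \<circ> \<alpha> \<circ> finv \<delta>) n1)))))\<rparr>)"

definition yd_unit ::
  "('k::field \<Rightarrow> 'v::ring_1 \<Rightarrow> 'v) \<Rightarrow> ('k, 'h::ring_1) hopf_data \<Rightarrow> ('k, 'h, 'v) yd_module"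
where
  "yd_unit s H = \<lparr>
     ydeg = (id, id),
     ycar = module.span s {1},
     yact = (\<lambda>h. \<lambda>x\<in>module.span s {1}. s (hcounit H h) x),
     ycoact = (\<lambda>x\<in>module.span s {1}. pure_tensor s (hscale H) x 1)\<rparr>"

definition yd_conj ::
  "('k::field \<Rightarrow> 'v::ring_1 \<Rightarrow> 'v) \<Rightarrow> ('k, 'h::ring_1) hopf_data \<Rightarrow>
   ('h \<Rightarrow> 'h) \<times> ('h \<Rightarrow> 'h) \<Rightarrow> ('k, 'h, 'v) yd_module \<Rightarrow> ('k, 'h, 'v) yd_module"
where
  "yd_conj s H a N = (case (a, ydeg N) of ((\<alpha>, \<beta>), (\<gamma>, \<delta>)) \<Rightarrow> \<lparr>
     ydeg = a \<otimes>\<^bsub>GAut H\<^esub> ydeg N \<otimes>\<^bsub>GAut H\<^esub> inv\<^bsub>GAut H\<^esub> a,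
     ycar = ycar N,
     yact = (\<lambda>h. yact N ((finv \<alpha> \<circ> \<beta>) h)),
     ycoact = (\<lambda>n\<in>ycar N. swY s H N n (\<lambda>n0 n1.
       pure_tensor s (hscale H) n0 ((finv \<beta> \<circ> \<delta> \<circ> \<alpha> \<circ> finv \<delta>) n1)))\<rparr>)"

definition yd_braiding ::
  "('k::field \<Rightarrow> 'v::ring_1 \<Rightarrow> 'v) \<Rightarrow> ('k, 'h::ring_1) hopf_data \<Rightarrow>
   ('k, 'h, 'v) yd_module \<Rightarrow> ('k, 'h, 'v) yd_module \<Rightarrow> 'v \<Rightarrow> 'v"
where
  "yd_braiding s H M N = (case ydeg M of (\<alpha>, \<beta>) \<Rightarrow>
     \<lambda>x\<in>tensor_space (*) (ycar M) (ycar N). sweedler (*) (ycar M) (ycar N) x (\<lambda>m n.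
       swY s H M m (\<lambda>m0 m1. yact N (finv \<alpha> m1) n * m0)))"

definition YDhat ::
  "('k::field \<Rightarrow> 'v::ring_1 \<Rightarrow> 'v) \<Rightarrow> 'v set set \<Rightarrow> ('k, 'h::ring_1) hopf_data \<Rightarrow>
   (('k, 'h, 'v) yd_module, ('k, 'h, 'v) yd_module \<times> ('k, 'h, 'v) yd_module \<times> ('v \<Rightarrow> 'v),
    ('h \<Rightarrow> 'h) \<times> ('h \<Rightarrow> 'h)) tcat_data"
where
  "YDhat s \<U> H = concrete_tcat ycar (yd_modules s \<U> H) (yd_morphism s H) (yd_tensor s H) (yd_unit s H)
     ydeg (yd_conj s H) (yd_braiding s H)"


section \<open>Corepresentations of a coquasitriangular crossed Turaev algebra\<close>

text \<open>
  The operations of the components are indexed by the degrees of their arguments: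
  \<open>tmult A a b\<close> multiplies elements of degrees \<open>a\<close> and \<open>b\<close>, \<open>tcross A a b\<close> is
  the restriction of \<open>\<psi>\<^sub>a\<close> to the component of degree \<open>b\<close>, and so on.
\<close>

record ('k, 'g, 'c) turaev_data =
  tcar :: "'g \<Rightarrow> 'c set"
  tscale :: "'k \<Rightarrow> 'c \<Rightarrow> 'c"
  tcomult :: "'g \<Rightarrow> 'c \<Rightarrow> ('c, 'c, 'k) tensor"
  tcounit :: "'g \<Rightarrow> 'c \<Rightarrow> 'k"
  tmult :: "'g \<Rightarrow> 'g \<Rightarrow> 'c \<Rightarrow> 'c \<Rightarrow> 'c"
  tone :: "'c"
  tantipode :: "'g \<Rightarrow> 'c \<Rightarrow> 'c"
  tcross :: "'g \<Rightarrow> 'g \<Rightarrow> 'c \<Rightarrow> 'c"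
  tcqt :: "'g \<Rightarrow> 'g \<Rightarrow> 'c \<Rightarrow> 'c \<Rightarrow> 'k"

record ('k, 'g, 'c, 'v) corep =
  cdeg :: "'g"
  ccar :: "'v set"
  ccoact :: "'v \<Rightarrow> ('v, 'c, 'k) tensor"

abbreviation swC ::
  "('k::field \<Rightarrow> 'v::ring_1 \<Rightarrow> 'v) \<Rightarrow> ('k, 'g, 'c::ab_group_add) turaev_data \<Rightarrow> ('k, 'g, 'c, 'v) corep \<Rightarrow>
   'v \<Rightarrow> ('v \<Rightarrow> 'c \<Rightarrow> 'd::comm_monoid_add) \<Rightarrow> 'd"
where
  "swC s A M m F \<equiv> sweedler (pure_tensor s (tscale A)) (ccar M) (tcar A (cdeg M)) (ccoact M m) F"

definition coreps ::
  "('k::field \<Rightarrow> 'v::ring_1 \<Rightarrow> 'v) \<Rightarrow> 'v set set \<Rightarrow> ('g, 'y) monoid_scheme \<Rightarrow>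
   ('k, 'g, 'c::ab_group_add) turaev_data \<Rightarrow> ('k, 'g, 'c, 'v) corep set"
where
  "coreps s \<U> G A = {M. ccar M \<in> \<U> \<and> cdeg M \<in> carrier G \<and>
     comodule s (tscale A) (tcar A (cdeg M)) (tcomult A (cdeg M)) (tcounit A (cdeg M)) (ccar M) (ccoact M)}"

definition corep_morphism ::
  "('k::field \<Rightarrow> 'v::ring_1 \<Rightarrow> 'v) \<Rightarrow> ('k, 'g, 'c::ab_group_add) turaev_data \<Rightarrow>
   ('k, 'g, 'c, 'v) corep \<Rightarrow> ('k, 'g, 'c, 'v) corep \<Rightarrow> ('v \<Rightarrow> 'v) \<Rightarrow> bool"
where
  "corep_morphism s A M N f \<longleftrightarrow> cdeg M = cdeg N \<and>
     f \<in> ccar M \<rightarrow>\<^sub>E ccar N \<and> linear_on (ccar M) s s f \<and>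
     colinear s (tscale A) (tcar A (cdeg M)) (ccar M) (ccoact M) (ccoact N) f"

definition corep_tensor ::
  "('k::field \<Rightarrow> 'v::ring_1 \<Rightarrow> 'v) \<Rightarrow> ('g, 'y) monoid_scheme \<Rightarrow> ('k, 'g, 'c::ab_group_add) turaev_data \<Rightarrow>
   ('k, 'g, 'c, 'v) corep \<Rightarrow> ('k, 'g, 'c, 'v) corep \<Rightarrow> ('k, 'g, 'c, 'v) corep"
where
  "corep_tensor s G A M N = \<lparr>
     cdeg = cdeg M \<otimes>\<^bsub>G\<^esub> cdeg N,
     ccar = tensor_space (*) (ccar M) (ccar N),
     ccoact = (\<lambda>x\<in>tensor_space (*) (ccar M) (ccar N).
       sweedler (*) (ccar M) (ccar N) x (\<lambda>m n.
         swC s A M m (\<lambda>m0 m1. swC s A N n (\<lambda>n0 n1.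
           pure_tensor s (tscale A) (m0 * n0) (tmult A (cdeg M) (cdeg N) m1 n1)))))\<rparr>"

definition corep_unit ::
  "('k::field \<Rightarrow> 'v::ring_1 \<Rightarrow> 'v) \<Rightarrow> ('g, 'y) monoid_scheme \<Rightarrow> ('k, 'g, 'c::ab_group_add) turaev_data \<Rightarrow>
   ('k, 'g, 'c, 'v) corep"
where
  "corep_unit s G A = \<lparr>
     cdeg = \<one>\<^bsub>G\<^esub>,
     ccar = module.span s {1},
     ccoact = (\<lambda>x\<in>module.span s {1}. pure_tensor s (tscale A) x (tone A))\<rparr>"

definition corep_conj ::
  "('k::field \<Rightarrow> 'v::ring_1 \<Rightarrow> 'v) \<Rightarrow> ('g, 'y) monoid_scheme \<Rightarrow> ('k, 'g, 'c::ab_group_add) turaev_data \<Rightarrow>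
   'g \<Rightarrow> ('k, 'g, 'c, 'v) corep \<Rightarrow> ('k, 'g, 'c, 'v) corep"
where
  "corep_conj s G A a N = \<lparr>
     cdeg = a \<otimes>\<^bsub>G\<^esub> cdeg N \<otimes>\<^bsub>G\<^esub> inv\<^bsub>G\<^esub> a,
     ccar = ccar N,
     ccoact = (\<lambda>n\<in>ccar N. swC s A N n (\<lambda>n0 n1.
       pure_tensor s (tscale A) n0 (tcross A a (cdeg N) n1)))\<rparr>"

definition corep_braiding ::
  "('k::field \<Rightarrow> 'v::ring_1 \<Rightarrow> 'v) \<Rightarrow> ('g, 'y) monoid_scheme \<Rightarrow> ('k, 'g, 'c::ab_group_add) turaev_data \<Rightarrow>
   ('k, 'g, 'c, 'v) corep \<Rightarrow> ('k, 'g, 'c, 'v) corep \<Rightarrow> 'v \<Rightarrow> 'v"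
where
  "corep_braiding s G A M N = (let a = cdeg M; b = cdeg N in
     (\<lambda>x\<in>tensor_space (*) (ccar M) (ccar N). sweedler (*) (ccar M) (ccar N) x (\<lambda>m n.
       swC s A M m (\<lambda>m0 m1. swC s A N n (\<lambda>n0 n1.
         s (tcqt A (a \<otimes>\<^bsub>G\<^esub> b \<otimes>\<^bsub>G\<^esub> inv\<^bsub>G\<^esub> a) a (tcross A a b n1) m1) (n0 * m0))))))"

definition Corep ::
  "('k::field \<Rightarrow> 'v::ring_1 \<Rightarrow> 'v) \<Rightarrow> 'v set set \<Rightarrow> ('g, 'y) monoid_scheme \<Rightarrow>
   ('k, 'g, 'c::ab_group_add) turaev_data \<Rightarrow>
   (('k, 'g, 'c, 'v) corep, ('k, 'g, 'c, 'v) corep \<times> ('k, 'g, 'c, 'v) corep \<times> ('v \<Rightarrow> 'v), 'g) tcat_data"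
where
  "Corep s \<U> G A = concrete_tcat ccar (coreps s \<U> G A) (corep_morphism s A) (corep_tensor s G A)
     (corep_unit s G A) cdeg (corep_conj s G A) (corep_braiding s G A)"


section \<open>The crossed Turaev algebra CT(H)\<close>

text \<open>Elements of the dual are functions \<open>'h \<Rightarrow> 'k\<close> with pointwise addition; the pointwise
  product of functions is not used, the multiplication is \<open>conv\<close>.\<close>

definition dual :: "('k::field, 'h::ring_1) hopf_data \<Rightarrow> ('h \<Rightarrow> 'k) set" where
  "dual H = {p. Vector_Spaces.linear (hscale H) (*) p}"

definition conv :: "('k::field, 'h::ring_1) hopf_data \<Rightarrow> ('h \<Rightarrow> 'k) \<Rightarrow> ('h \<Rightarrow> 'k) \<Rightarrow> 'h \<Rightarrow> 'k" where
  "conv H p q = (\<lambda>h. swH H h (\<lambda>h1 h2. p h1 * q h2))"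

definition dual_comult :: "('k::field, 'h::ring_1) hopf_data \<Rightarrow> ('h \<Rightarrow> 'k) \<Rightarrow> ('h \<Rightarrow> 'k, 'h \<Rightarrow> 'k, 'k) tensor"
where
  "dual_comult H p = (THE t. t \<in> tensor_space (pure_tensor fscale fscale) (dual H) (dual H) \<and>
     (\<forall>g h. p (g * h) =
        sweedler (pure_tensor fscale fscale) (dual H) (dual H) t (\<lambda>p1 p2. p1 g * p2 h)))"

definition dual_vector :: "('k::field, 'h::ring_1) hopf_data \<Rightarrow> 'h set \<Rightarrow> 'h \<Rightarrow> 'h \<Rightarrow> 'k" where
  "dual_vector H B b = (\<lambda>h. module.representation (hscale H) B h b)"

type_synonym ('k, 'h) ct = "('h \<Rightarrow> 'k, 'h, 'k) tensor"

definition bowtie :: "('k::field, 'h::ring_1) hopf_data \<Rightarrow> ('h \<Rightarrow> 'k) \<Rightarrow> 'h \<Rightarrow> ('k, 'h) ct" where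
  "bowtie H = pure_tensor fscale (hscale H)"

abbreviation swD :: "('k::field, 'h::ring_1) hopf_data \<Rightarrow> ('h \<Rightarrow> 'k) \<Rightarrow>
    (('h \<Rightarrow> 'k) \<Rightarrow> ('h \<Rightarrow> 'k) \<Rightarrow> 'c::comm_monoid_add) \<Rightarrow> 'c"
where
  "swD H p F \<equiv> sweedler (pure_tensor fscale fscale) (dual H) (dual H) (dual_comult H p) F"

abbreviation swB :: "('k::field, 'h::ring_1) hopf_data \<Rightarrow> ('k, 'h) ct \<Rightarrow>
    (('h \<Rightarrow> 'k) \<Rightarrow> 'h \<Rightarrow> 'c::comm_monoid_add) \<Rightarrow> 'c"
where
  "swB H t F \<equiv> sweedler (bowtie H) (dual H) UNIV t F"

text \<open>\<open>B\<close> is a basis of \<open>H\<close>, used to form the sums over dual bases.\<close>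

definition CT ::
  "('k::field, 'h::ring_1) hopf_data \<Rightarrow> 'h set \<Rightarrow> ('k, ('h \<Rightarrow> 'h) \<times> ('h \<Rightarrow> 'h), ('k, 'h) ct) turaev_data"
where
  "CT H B = \<lparr>
     tcar = (\<lambda>a. tensor_space (bowtie H) (dual H) UNIV),
     tscale = fscale,
     tcomult = (\<lambda>(\<alpha>, \<beta>) t. swB H t (\<lambda>p h. swD H p (\<lambda>p1 p2. swH H h (\<lambda>h1 h2.
       \<Sum>i\<in>B. \<Sum>j\<in>B. pure_tensor fscale fscale
         (bowtie H p1 (\<beta> j * h1 * finv (hantipode H) (\<alpha> i)))
         (bowtie H (conv H (conv H (dual_vector H B i) p2) (dual_vector H B j)) h2))))),
     tcounit = (\<lambda>a t. swB H t (\<lambda>p h. p 1 * hcounit H h)),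
     tmult = (\<lambda>(\<alpha>, \<beta>) (\<gamma>, \<delta>) t u. swB H t (\<lambda>p h. swB H u (\<lambda>q h'.
       bowtie H (conv H q p) (\<delta> h * (\<delta> \<circ> \<alpha> \<circ> finv \<delta>) h')))),
     tone = bowtie H (hcounit H) 1,
     tantipode = (\<lambda>(\<alpha>, \<beta>) t. swB H t (\<lambda>p h. \<Sum>i\<in>B. \<Sum>j\<in>B.
       bowtie H
         (conv H (conv H (dual_vector H B i) (p \<circ> finv (hantipode H)))
            (dual_vector H B j \<circ> finv (hantipode H)))
         (finv \<beta> j * (finv \<beta> \<circ> finv \<alpha>) (hantipode H h) * (finv \<beta> \<circ> finv \<alpha> \<circ> \<beta>) i))),
     tcross = (\<lambda>(\<alpha>, \<beta>) (\<gamma>, \<delta>) t. swB H t (\<lambda>q h'.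
       bowtie H (q \<circ> finv \<alpha> \<circ> \<beta>) ((finv \<beta> \<circ> \<delta> \<circ> \<alpha> \<circ> finv \<delta>) h'))),
     tcqt = (\<lambda>(\<alpha>, \<beta>) (\<gamma>, \<delta>) t u. swB H t (\<lambda>p h. swB H u (\<lambda>q h'.
       p (finv \<delta> h') * q 1 * hcounit H h)))\<rparr>"

end

theory Submission
  imports Defs
begin

text \<open>
  A generalized Yetter-Drinfel'd module \<open>M\<close> of degree \<open>a\<close> becomes a right \<open>CT(H)\<^sub>a\<close>-comodule via
  \<open>m\<^sub>[\<^sub>0\<^sub>] \<otimes> m\<^sub>[\<^sub>1\<^sub>] = \<Sum>\<^sub>i h\<^sub>i \<cdot> m\<^sub>(\<^sub>0\<^sub>) \<otimes> (h\<^sup>i \<bowtie> m\<^sub>(\<^sub>1\<^sub>))\<close>. Conversely, pairing the comodule with \<open>p \<bowtie> h \<mapsto> p(g) \<epsilon>(h)\<close>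
  gives back the action of \<open>g\<close>, and the coalgebra map \<open>p \<bowtie> h \<mapsto> p(1) h\<close> gives back the coaction.
  Coassociativity over \<open>CT(H)\<^sub>a\<close>, tested with two such functionals or projections, is
  associativity of the action, coassociativity of the coaction and the compatibility condition.
  The bijection on objects does not change the underlying spaces or linear maps and respects all the
  structure, so the axioms of a braided T-category need only be checked for Yetter-Drinfel'd
  modules. Bijectivity of the antipode, needed for the comultiplication of \<open>CT(H)\<^sub>a\<close>, follows from the
  existence of integrals.
\<close>

section \<open>Linear maps and tensors\<close>

text \<open>The comultiplication of CT(H) is the compatibility condition read dually. Solved for the
  coaction of g \<cdot> m, the condition makes it the sum of g2 \<cdot> m0 \<otimes> \<beta>(g3) m1
  S^-1(\<alpha>(g1)) (\<open>SWY_act\<close>). When g runs through a basis and its three legs are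
  separated by the duality of comultiplication and convolution (\<open>dual_basis_comult3\<close>),
  the factors \<beta>(h_j), S^-1(\<alpha>(h_i)) and h^i p2 h^j appear. Testing with
  \<open>ev\<close> and \<open>pr\<close> loses no information, since for p \<bowtie> h the two
  together yield p(g) and h (\<open>Delta_ev_pr\<close>). The form of the proof is dictated by
  \<open>sweedler\<close>, a definite description that can be evaluated only once the summand is
  known to be bilinear, and by modules of arbitrary dimension. A finite basis B of H suffices to
  write sums over comultiplications and coactions of H as finite sums (\<open>SWH\<close>,
  \<open>SWY\<close>), which can be exchanged freely; sums over elements and coactions of CT(H) and
  over products of underlying spaces keep the original form.\<close>

named_theorems lin

lemma vector_space_mult [simp]: "vector_space ((*) :: 'k::field \<Rightarrow> 'k \<Rightarrow> 'k)"
  by unfold_locales (simp_all add: algebra_simps)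

lemma vector_space_fscale [simp]: "vector_space (fscale :: 'k::field \<Rightarrow> ('x \<Rightarrow> 'k) \<Rightarrow> 'x \<Rightarrow> 'k)"
  by unfold_locales (simp_all add: fscale_def fun_eq_iff algebra_simps)

lemma linear_onI:
  "\<lbrakk>\<And>x y. \<lbrakk>x \<in> V; y \<in> V\<rbrakk> \<Longrightarrow> f (x + y) = f x + f y; \<And>c x. x \<in> V \<Longrightarrow> f (s1 c x) = s2 c (f x)\<rbrakk> \<Longrightarrow>
   linear_on V s1 s2 f"
  by (simp add: linear_on_def)

lemma linear_on_add: "\<lbrakk>linear_on V s1 s2 f; x \<in> V; y \<in> V\<rbrakk> \<Longrightarrow> f (x + y) = f x + f y"
  and linear_on_scale: "\<lbrakk>linear_on V s1 s2 f; x \<in> V\<rbrakk> \<Longrightarrow> f (s1 c x) = s2 c (f x)"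
  by (simp_all add: linear_on_def)

lemma linear_on_zero:
  assumes "linear_on V s1 s2 f" "vector_space s1" "vector_space s2" "module.subspace s1 V"
  shows "f 0 = 0"
proof -
  interpret V: vector_space s1 by fact
  interpret W: vector_space s2 by fact
  have "0 \<in> V" using assms(4) by (rule V.subspace_0)
  then show ?thesis using linear_on_scale[OF assms(1), of 0 0] by simp
qed

lemma linear_on_sum:
  assumes f: "linear_on V s1 s2 f" and vs: "vector_space s1" "vector_space s2" and V: "module.subspace s1 V"
    and x: "\<And>i. i \<in> A \<Longrightarrow> x i \<in> V"
  shows "f (\<Sum>i\<in>A. x i) = (\<Sum>i\<in>A. f (x i))"
proof (cases "finite A")
  case True
  interpret V: vector_space s1 by fact
  show ?thesis using True x
  proof (induction A)
    case (insert a A)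
    then have "(\<Sum>i\<in>A. x i) \<in> V" by (intro V.subspace_sum[OF V]) auto
    then show ?case using insert by (simp add: linear_on_add[OF f])
  qed (simp add: linear_on_zero[OF f vs V])
qed (simp add: linear_on_zero[OF f vs V])

lemma subspace_UNIV_of [simp]: "vector_space s \<Longrightarrow> module.subspace s UNIV"
  by (simp add: module.subspace_UNIV module_iff_vector_space)

text \<open>The rules collected in \<open>lin\<close> follow a term down to its variable, where this
  one ends the descent. Repeated introduction with \<open>lin\<close> thus settles most of the
  bilinearity conditions on summands.\<close>

lemma lin_id [lin]: "linear_on V s s (\<lambda>x. x)"
  by (simp add: linear_on_def)

lemma lin_zero: "vector_space s2 \<Longrightarrow> linear_on V s1 s2 (\<lambda>x. 0)"
  by (simp add: linear_on_def module.scale_zero_right module_iff_vector_space)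

lemma lin_add [lin]:
  assumes "vector_space s2" "linear_on V s1 s2 f" "linear_on V s1 s2 g"
  shows "linear_on V s1 s2 (\<lambda>x. f x + g x)"
proof -
  interpret vector_space s2 by fact
  show ?thesis using assms(2,3) by (simp add: linear_on_def scale_right_distrib algebra_simps)
qed

lemma lin_sum [lin]:
  assumes "vector_space s2" "\<And>i. i \<in> A \<Longrightarrow> linear_on V s1 s2 (\<lambda>x. f x i)"
  shows "linear_on V s1 s2 (\<lambda>x. \<Sum>i\<in>A. f x i)"
proof -
  interpret vector_space s2 by fact
  show ?thesis using assms(2) by (simp add: linear_on_def scale_sum_right sum.distrib cong: sum.cong)
qed

lemma lin_scale [lin]:
  assumes "vector_space s2" "linear_on V s1 s2 f"
  shows "linear_on V s1 s2 (\<lambda>x. s2 c (f x))"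
proof -
  interpret vector_space s2 by fact
  show ?thesis using assms(2) by (simp add: linear_on_def scale_right_distrib mult.commute)
qed

lemma lin_scale_left [lin]:
  assumes "vector_space s2" "linear_on V s1 (*) f"
  shows "linear_on V s1 s2 (\<lambda>x. s2 (f x) v)"
proof -
  interpret vector_space s2 by fact
  show ?thesis using assms(2) by (simp add: linear_on_def scale_left_distrib)
qed

lemma lin_comp:
  assumes "linear_on W s2 s3 g" "linear_on V s1 s2 f" "\<And>x. x \<in> V \<Longrightarrow> f x \<in> W"
  shows "linear_on V s1 s3 (\<lambda>x. g (f x))"
  using assms by (simp add: linear_on_def)

lemma linear_on_UNIV_iff:
  assumes "vector_space s1" "vector_space s2"
  shows "linear_on UNIV s1 s2 f \<longleftrightarrow> Vector_Spaces.linear s1 s2 f"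
proof -
  interpret V: vector_space s1 by fact
  interpret W: vector_space s2 by fact
  interpret P: vector_space_pair s1 s2 ..
  have "Vector_Spaces.linear s1 s2 f" if "linear_on UNIV s1 s2 f"
    using that by unfold_locales (simp_all add: linear_on_def)
  then show ?thesis by (auto simp: linear_on_def Vector_Spaces.linear_iff)
qed

lemma bilinear_onI:
  "\<lbrakk>\<And>v. v \<in> V \<Longrightarrow> linear_on W s2 s3 (\<lambda>w. F v w); \<And>w. w \<in> W \<Longrightarrow> linear_on V s1 s3 (\<lambda>v. F v w)\<rbrakk> \<Longrightarrow>
   bilinear_on V W s1 s2 s3 F"
  by (simp add: bilinear_on_def)

lemma bilinear_form_add:
  assumes "bilinear_form s1 s2 Q"
  shows "Q (x + y) z = Q x z + Q y z" "Q x' (y' + z') = Q x' y' + Q x' z'"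
    "Q (s1 c x) z = c * Q x z" "Q x (s2 c z) = c * Q x z"
proof -
  have *: "Vector_Spaces.linear s1 (*) (\<lambda>a. Q a b)" "Vector_Spaces.linear s2 (*) (Q a)" for a b
    using assms by (simp_all add: bilinear_form_def)
  show "Q (x + y) z = Q x z + Q y z" "Q (s1 c x) z = c * Q x z"
    using *(1)[of z] by (simp_all add: Vector_Spaces.linear_iff)
  show "Q x' (y' + z') = Q x' y' + Q x' z'" "Q x (s2 c z) = c * Q x z"
    using *(2) by (simp_all add: Vector_Spaces.linear_iff)
qed

lemma pure_tensor_add_left: "pure_tensor s1 s2 (x + y) z = pure_tensor s1 s2 x z + pure_tensor s1 s2 y z"
  and pure_tensor_add_right: "pure_tensor s1 s2 x (z + w) = pure_tensor s1 s2 x z + pure_tensor s1 s2 x w"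
  and pure_tensor_scale_left: "pure_tensor s1 s2 (s1 c x) z = fscale c (pure_tensor s1 s2 x z)"
  and pure_tensor_scale_right: "pure_tensor s1 s2 x (s2 c z) = fscale c (pure_tensor s1 s2 x z)"
  by (auto simp: pure_tensor_def fun_eq_iff fscale_def bilinear_form_add)

lemma lin_pure_tensor_left [lin]:
  "linear_on V s s1 f \<Longrightarrow> linear_on V s fscale (\<lambda>x. pure_tensor s1 s2 (f x) b)"
  by (simp add: linear_on_def pure_tensor_add_left pure_tensor_scale_left)

lemma lin_pure_tensor_right [lin]:
  "linear_on V s s2 f \<Longrightarrow> linear_on V s fscale (\<lambda>x. pure_tensor s1 s2 a (f x))"
  by (simp add: linear_on_def pure_tensor_add_right pure_tensor_scale_right)

section \<open>Sweedler sums over an abstract tensor product\<close>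

lemma sweedler_cong:
  assumes "\<And>a b. \<lbrakk>a \<in> V; b \<in> W\<rbrakk> \<Longrightarrow> F a b = G a b"
  shows "sweedler \<tau> V W t F = sweedler \<tau> V W t G"
proof -
  have "(\<Sum>(a, b)\<leftarrow>xs. F a b) = (\<Sum>(a, b)\<leftarrow>xs. G a b)" if "set xs \<subseteq> V \<times> W" for xs
    using that assms by (induction xs) auto
  then show ?thesis unfolding sweedler_def by (intro arg_cong[where f = The] ext) metis
qed

text \<open>Covers both tensor products in use: \<open>pure_tensor\<close> and the multiplication of
  a strict tensor universe. The last assumption speaks of scalar-valued forms only;
  \<open>eval\<close> extends it to values in any vector space.\<close>

locale tensor_product =
  fixes \<tau> :: "'a::ab_group_add \<Rightarrow> 'b::ab_group_add \<Rightarrow> 't::ab_group_add"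
    and s1 :: "'k::field \<Rightarrow> 'a \<Rightarrow> 'a" and s2 :: "'k \<Rightarrow> 'b \<Rightarrow> 'b" and st :: "'k \<Rightarrow> 't \<Rightarrow> 't"
    and V :: "'a set" and W :: "'b set"
  assumes vs1: "vector_space s1" and vs2: "vector_space s2" and vst: "vector_space st"
    and subV: "module.subspace s1 V" and subW: "module.subspace s2 W"
    and bil: "bilinear_on V W s1 s2 st \<tau>"
    and functional: "\<lbrakk>bilinear_on V W s1 s2 (*) Q; set xs \<subseteq> V \<times> W; set ys \<subseteq> V \<times> W;
      (\<Sum>(a, b)\<leftarrow>xs. \<tau> a b) = (\<Sum>(a, b)\<leftarrow>ys. \<tau> a b)\<rbrakk> \<Longrightarrow> (\<Sum>(a, b)\<leftarrow>xs. Q a b) = (\<Sum>(a, b)\<leftarrow>ys. Q a b)"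
begin

abbreviation TS where "TS \<equiv> tensor_space \<tau> V W"
abbreviation sw where "sw \<equiv> sweedler \<tau> V W"

text \<open>If two decompositions of one tensor gave different values, a linear functional p would
  separate them, and p composed with F would be a scalar form violating
  \<open>functional\<close>.\<close>

lemma eval:
  assumes s3: "vector_space s3" and F: "bilinear_on V W s1 s2 s3 F" and xs: "set xs \<subseteq> V \<times> W"
  shows "sw (\<Sum>(a, b)\<leftarrow>xs. \<tau> a b) F = (\<Sum>(a, b)\<leftarrow>xs. F a b)"
  unfolding sweedler_def
proof (rule the_equality)
  show "\<exists>ys. set ys \<subseteq> V \<times> W \<and> (\<Sum>(a, b)\<leftarrow>xs. \<tau> a b) = (\<Sum>(a, b)\<leftarrow>ys. \<tau> a b) \<and>
      (\<Sum>(a, b)\<leftarrow>xs. F a b) = (\<Sum>(a, b)\<leftarrow>ys. F a b)"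
    by (intro exI[of _ xs] conjI refl xs)
next
  fix c assume "\<exists>ys. set ys \<subseteq> V \<times> W \<and> (\<Sum>(a, b)\<leftarrow>xs. \<tau> a b) = (\<Sum>(a, b)\<leftarrow>ys. \<tau> a b) \<and>
      c = (\<Sum>(a, b)\<leftarrow>ys. F a b)"
  then obtain ys where ys: "set ys \<subseteq> V \<times> W" "(\<Sum>(a, b)\<leftarrow>xs. \<tau> a b) = (\<Sum>(a, b)\<leftarrow>ys. \<tau> a b)"
    and c: "c = (\<Sum>(a, b)\<leftarrow>ys. F a b)" by blast
  show "c = (\<Sum>(a, b)\<leftarrow>xs. F a b)"
  proof (rule ccontr)
    assume "c \<noteq> (\<Sum>(a, b)\<leftarrow>xs. F a b)"
    then obtain p where p: "Vector_Spaces.linear s3 (*) p" "p (c - (\<Sum>(a, b)\<leftarrow>xs. F a b)) \<noteq> 0"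
      using linear_functional_separates[OF s3, of "c - (\<Sum>(a, b)\<leftarrow>xs. F a b)"] by auto
    interpret p: Vector_Spaces.linear s3 "(*)" p by fact
    have "linear_on UNIV s3 (*) p" by (simp add: linear_on_def p.add p.scale)
    then have "bilinear_on V W s1 s2 (*) (\<lambda>a b. p (F a b))"
      using F by (simp add: bilinear_on_def linear_on_def p.add p.scale)
    from functional[OF this xs ys] have "(\<Sum>(a, b)\<leftarrow>xs. p (F a b)) = (\<Sum>(a, b)\<leftarrow>ys. p (F a b))" .
    then have "p (\<Sum>(a, b)\<leftarrow>xs. F a b) = p c"
      unfolding c linear_sum_list_on[OF p(1)] .
    then show False using p(2) by (simp add: p.diff)
  qed
qed

lemma tensor_in: "\<lbrakk>a \<in> V; b \<in> W\<rbrakk> \<Longrightarrow> \<tau> a b \<in> TS"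
  unfolding tensor_space_def by (rule CollectI, rule exI[of _ "[(a, b)]"]) simp

lemma tau_linear: "b \<in> W \<Longrightarrow> linear_on V s1 st (\<lambda>a. \<tau> a b)" "a \<in> V \<Longrightarrow> linear_on W s2 st (\<lambda>b. \<tau> a b)"
  using bil by (simp_all add: bilinear_on_def)

lemma TS_subspace: "module.subspace st TS"
proof -
  interpret T: vector_space st by (rule vst)
  interpret V: vector_space s1 by (rule vs1)
  show ?thesis unfolding T.subspace_def
  proof (intro conjI ballI allI)
    show "0 \<in> TS" unfolding tensor_space_def by (auto intro!: exI[of _ "[]"])
  next
    fix x y assume "x \<in> TS" "y \<in> TS"
    then obtain xs ys where "x = (\<Sum>(a, b)\<leftarrow>xs. \<tau> a b)" "y = (\<Sum>(a, b)\<leftarrow>ys. \<tau> a b)"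
      "set xs \<subseteq> V \<times> W" "set ys \<subseteq> V \<times> W" unfolding tensor_space_def by auto
    then show "x + y \<in> TS" unfolding tensor_space_def by (auto intro!: exI[of _ "xs @ ys"])
  next
    fix c x assume "x \<in> TS"
    then obtain xs where x: "x = (\<Sum>(a, b)\<leftarrow>xs. \<tau> a b)" "set xs \<subseteq> V \<times> W"
      unfolding tensor_space_def by auto
    have "st c (\<Sum>(a, b)\<leftarrow>xs. \<tau> a b) = (\<Sum>(a, b)\<leftarrow>map (\<lambda>(a, b). (s1 c a, b)) xs. \<tau> a b)"
      using x(2) by (induction xs) (auto simp: T.scale_right_distrib linear_on_scale[OF tau_linear(1)])
    then show "st c x \<in> TS" unfolding tensor_space_def
      using x V.subspace_scale[OF subV] by (intro CollectI exI[of _ "map (\<lambda>(a, b). (s1 c a, b)) xs"]) auto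
  qed
qed

text \<open>The step provides u \<in> TS along with the induction hypothesis, because additivity of
  \<open>sw\<close> is available only inside TS.\<close>

lemma tensor_induct [consumes 1, case_names zero add]:
  assumes "t \<in> TS" "P 0" "\<And>a b u. \<lbrakk>a \<in> V; b \<in> W; u \<in> TS; P u\<rbrakk> \<Longrightarrow> P (\<tau> a b + u)"
  shows "P t"
proof -
  have "set xs \<subseteq> V \<times> W \<Longrightarrow> P (\<Sum>(a, b)\<leftarrow>xs. \<tau> a b) \<and> (\<Sum>(a, b)\<leftarrow>xs. \<tau> a b) \<in> TS" for xs
  proof (induction xs)
    case Nil
    then show ?case using assms(2) by (auto simp: tensor_space_def intro!: exI[of _ "[]"])
  next
    case (Cons x xs)
    obtain a b where x: "x = (a, b)" by force
    have "(\<Sum>(a, b)\<leftarrow>x # xs. \<tau> a b) \<in> TS" unfolding tensor_space_def using Cons.prems by blast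
    then show ?case using Cons assms(3) by (auto simp: x)
  qed
  then show ?thesis using assms(1) by (auto simp: tensor_space_def)
qed

lemma sw_zero: "\<lbrakk>vector_space s3; bilinear_on V W s1 s2 s3 F\<rbrakk> \<Longrightarrow> sw 0 F = 0"
  using eval[of s3 F "[]"] by simp

lemma sw_tau: "\<lbrakk>vector_space s3; bilinear_on V W s1 s2 s3 F; a \<in> V; b \<in> W\<rbrakk> \<Longrightarrow> sw (\<tau> a b) F = F a b"
  using eval[of s3 F "[(a, b)]"] by simp

lemma sw_add:
  assumes "vector_space s3" "bilinear_on V W s1 s2 s3 F" "x \<in> TS" "y \<in> TS"
  shows "sw (x + y) F = sw x F + sw y F"
proof -
  obtain xs ys where "x = (\<Sum>(a, b)\<leftarrow>xs. \<tau> a b)" "y = (\<Sum>(a, b)\<leftarrow>ys. \<tau> a b)"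
      "set xs \<subseteq> V \<times> W" "set ys \<subseteq> V \<times> W" using assms(3,4) unfolding tensor_space_def by auto
  then show ?thesis using eval[OF assms(1,2), of "xs @ ys"] eval[OF assms(1,2), of xs] eval[OF assms(1,2), of ys]
    by simp
qed

text \<open>The standard way to prove identities of tensors below: on elementary tensors
  \<open>sw_tau\<close> evaluates both sides.\<close>

lemma linear_ext:
  assumes "vector_space s3" "linear_on TS st s3 f" "linear_on TS st s3 g" "t \<in> TS"
    and "\<And>a b. \<lbrakk>a \<in> V; b \<in> W\<rbrakk> \<Longrightarrow> f (\<tau> a b) = g (\<tau> a b)"
  shows "f t = g t"
  using assms(4)
proof (induction rule: tensor_induct)
  case zero
  then show ?case using linear_on_zero[OF assms(2) vst assms(1) TS_subspace] linear_on_zero[OF assms(3) vst assms(1) TS_subspace] by simp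
next
  case (add a b u)
  then show ?case using assms(5) tensor_in by (simp add: linear_on_add[OF assms(2)] linear_on_add[OF assms(3)])
qed

lemma sw_linear:
  assumes s3: "vector_space s3" and F: "bilinear_on V W s1 s2 s3 F"
  shows "linear_on TS st s3 (\<lambda>t. sw t F)"
proof (rule linear_onI)
  interpret T: vector_space st by (rule vst)
  interpret X: vector_space s3 by (rule s3)
  interpret V: vector_space s1 by (rule vs1)
  fix c t assume "t \<in> TS"
  then show "sw (st c t) F = s3 c (sw t F)"
  proof (induction rule: tensor_induct)
    case (add a b u)
    have "st c (\<tau> a b) = \<tau> (s1 c a) b" using add by (simp add: linear_on_scale[OF tau_linear(1)])
    moreover have "F (s1 c a) b = s3 c (F a b)" using F add by (simp add: bilinear_on_def linear_on_def)
    ultimately show ?case using add T.subspace_scale[OF TS_subspace] V.subspace_scale[OF subV]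
      by (simp add: T.scale_right_distrib X.scale_right_distrib sw_add[OF s3 F] tensor_in sw_tau[OF s3 F])
  qed (simp add: sw_zero[OF s3 F])
qed (use sw_add[OF assms] in auto)

lemma sw_in:
  assumes s3: "vector_space s3" and F: "bilinear_on V W s1 s2 s3 F" and X: "module.subspace s3 X"
    and t: "t \<in> TS" and "\<And>a b. \<lbrakk>a \<in> V; b \<in> W\<rbrakk> \<Longrightarrow> F a b \<in> X"
  shows "sw t F \<in> X"
  using t
proof (induction rule: tensor_induct)
  interpret X: vector_space s3 by (rule s3)
  case zero
  then show ?case by (simp add: sw_zero[OF s3 F] X.subspace_0[OF X])
next
  interpret X: vector_space s3 by (rule s3)
  case (add a b u)
  then show ?case using assms(5) X.subspace_add[OF X] by (simp add: sw_add[OF s3 F] tensor_in sw_tau[OF s3 F])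
qed

text \<open>The subspace X allows maps f that are linear only on a carrier, such as the action or
  the coaction of a module.\<close>

lemma sw_comp:
  assumes s3: "vector_space s3" and s4: "vector_space s4" and F: "bilinear_on V W s1 s2 s3 F"
    and X: "module.subspace s3 X" and t: "t \<in> TS" and FX: "\<And>a b. \<lbrakk>a \<in> V; b \<in> W\<rbrakk> \<Longrightarrow> F a b \<in> X"
    and f: "linear_on X s3 s4 f"
  shows "f (sw t F) = sw t (\<lambda>a b. f (F a b))"
proof -
  have fF: "bilinear_on V W s1 s2 s4 (\<lambda>a b. f (F a b))"
    using F by (intro bilinear_onI lin_comp[OF f] FX) (simp_all add: bilinear_on_def)
  show ?thesis
    by (rule linear_ext[OF s4 lin_comp[OF f sw_linear[OF s3 F]] sw_linear[OF s4 fF] t])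
      (simp_all add: sw_tau[OF s3 F] sw_tau[OF s4 fF] sw_in[OF s3 F X _ FX])
qed

lemma sw_sum:
  assumes "vector_space s3" "bilinear_on V W s1 s2 s3 F" "\<And>i. i \<in> A \<Longrightarrow> x i \<in> V" "\<And>i. i \<in> A \<Longrightarrow> y i \<in> W"
  shows "sw (\<Sum>i\<in>A. \<tau> (x i) (y i)) F = (\<Sum>i\<in>A. F (x i) (y i))"
  by (subst linear_on_sum[OF sw_linear[OF assms(1,2)] vst assms(1) TS_subspace])
    (use assms in \<open>auto intro!: sum.cong tensor_in simp: sw_tau[OF assms(1,2)]\<close>)

text \<open>Here the tensor stays fixed and the summand varies. A decomposition of t, chosen once
  for all x, turns the sum into a finite sum of linear functions of x.\<close>

lemma sw_body_linear:
  assumes s3: "vector_space s3" and s': "vector_space s'" and X: "module.subspace s' X" and t: "t \<in> TS"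
    and F: "\<And>x. x \<in> X \<Longrightarrow> bilinear_on V W s1 s2 s3 (F x)"
      "\<And>a b. \<lbrakk>a \<in> V; b \<in> W\<rbrakk> \<Longrightarrow> linear_on X s' s3 (\<lambda>x. F x a b)"
  shows "linear_on X s' s3 (\<lambda>x. sw t (F x))"
proof -
  interpret s': vector_space s' by (rule s')
  interpret s3: vector_space s3 by (rule s3)
  obtain xs where xs: "set xs \<subseteq> V \<times> W" "t = (\<Sum>(a, b)\<leftarrow>xs. \<tau> a b)" using t by (auto simp: tensor_space_def)
  have "linear_on X s' s3 (\<lambda>x. \<Sum>(a, b)\<leftarrow>xs. F x a b)" using xs(1)
  proof (induction xs)
    case Nil
    then show ?case by (simp add: lin_zero s3)
  next
    case (Cons z xs)
    then show ?case using F(2) by (cases z) (auto intro!: lin_add s3)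
  qed
  then show ?thesis
    by (simp add: linear_on_def xs(2) eval[OF s3 F(1) xs(1)] s'.subspace_add[OF X] s'.subspace_scale[OF X])
qed

lemma sw_sum_body:
  assumes s3: "vector_space s3" and t: "t \<in> TS" and F: "\<And>i. i \<in> I \<Longrightarrow> bilinear_on V W s1 s2 s3 (F i)"
  shows "sw t (\<lambda>a b. \<Sum>i\<in>I. F i a b) = (\<Sum>i\<in>I. sw t (F i))"
proof -
  have *: "bilinear_on V W s1 s2 s3 (\<lambda>a b. \<Sum>i\<in>I. F i a b)"
    using F by (intro bilinear_onI lin_sum s3) (simp_all add: bilinear_on_def)
  show ?thesis
    by (rule linear_ext[OF s3 sw_linear[OF s3 *] _ t])
      (use F s3 in \<open>auto intro!: lin_sum sw_linear simp: sw_tau[OF s3 *] sw_tau[OF s3] cong: sum.cong\<close>)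
qed

end

lemma tensor_product_pure_tensor:
  assumes "vector_space s1" "vector_space s2" "module.subspace s1 V" "module.subspace s2 W"
  shows "tensor_product (pure_tensor s1 s2) s1 s2 fscale V W"
proof (rule tensor_product.intro)
  fix Q :: "'b \<Rightarrow> 'c \<Rightarrow> 'a" and xs ys
  assume "bilinear_on V W s1 s2 (*) Q" "set xs \<subseteq> V \<times> W" "set ys \<subseteq> V \<times> W"
    "(\<Sum>(a, b)\<leftarrow>xs. pure_tensor s1 s2 a b) = (\<Sum>(a, b)\<leftarrow>ys. pure_tensor s1 s2 a b)"
  then show "(\<Sum>(a, b)\<leftarrow>xs. Q a b) = (\<Sum>(a, b)\<leftarrow>ys. Q a b)"
    by (rule pure_tensor_universal[OF assms(1,2) vector_space_mult assms(3,4)])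
qed (use assms in \<open>auto intro!: bilinear_onI lin\<close>)

lemma (in strict_tensor_universe) tensor_product_universe:
  assumes V: "V \<in> \<U>" and W: "W \<in> \<U>"
  shows "tensor_product (*) s s s V W"
proof (rule tensor_product.intro)
  fix Q :: "'v \<Rightarrow> 'v \<Rightarrow> 'k" and xs ys
  assume Q: "bilinear_on V W s s (*) Q" and xs: "set xs \<subseteq> V \<times> W" and ys: "set ys \<subseteq> V \<times> W"
    and eq: "(\<Sum>(a, b)\<leftarrow>xs. a * b) = (\<Sum>(a, b)\<leftarrow>ys. a * b)"
  show "(\<Sum>(a, b)\<leftarrow>xs. Q a b) = (\<Sum>(a, b)\<leftarrow>ys. Q a b)"
    using sweedler_universe[OF vector_space_mult V W Q xs] sweedler_universe[OF vector_space_mult V W Q ys]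
    by (simp add: eq)
qed (use V W in \<open>auto intro!: bilinear_onI linear_onI vector_space_axioms universe_subspace
  simp: distrib_left distrib_right scale_mult_left scale_mult_right\<close>)

section \<open>Sweedler calculus in a finite-dimensional Hopf algebra\<close>

locale fd_hopf = hop: hopf_algebra H + fd: finite_dimensional_vector_space "hscale H" B
  for H :: "('k::field, 'h::ring_1) hopf_data" and B :: "'h set"
begin

abbreviation "hs \<equiv> hscale H"
abbreviation "eps \<equiv> hcounit H"
abbreviation "S \<equiv> hantipode H"
abbreviation "ds \<equiv> dual_vector H B"
abbreviation "Aut \<equiv> hopf_automorphisms H"

lemma vs_hs [simp]: "vector_space hs"
  by (rule hop.vector_space_axioms)

lemma finite_B [simp]: "finite B"
  by (rule fd.finite_Basis)

lemma ds_expand: "(\<Sum>b\<in>B. hs (ds b x) b) = x"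
  unfolding dual_vector_def
  by (rule hop.sum_representation_eq[OF fd.independent_Basis]) (simp_all add: fd.span_Basis)

lemma lin_ds [lin]: "linear_on V s hs f \<Longrightarrow> linear_on V s (*) (\<lambda>x. ds b (f x))"
  unfolding linear_on_def dual_vector_def
  by (simp add: hop.representation_add hop.representation_scale fd.independent_Basis fd.span_Basis)

lemma sum_ds_linear:
  assumes "vector_space s" "linear_on UNIV hs s f"
  shows "(\<Sum>b\<in>B. s (ds b x) (f b)) = f x"
proof -
  have "f x = f (\<Sum>b\<in>B. hs (ds b x) b)" by (simp add: ds_expand)
  also have "\<dots> = (\<Sum>b\<in>B. s (ds b x) (f b))"
    by (subst linear_on_sum[OF assms(2)]) (simp_all add: assms linear_on_scale[OF assms(2)])
  finally show ?thesis by simp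
qed

lemma lin_hmult_left [lin]: "linear_on V s hs f \<Longrightarrow> linear_on V s hs (\<lambda>x. f x * c)"
  and lin_hmult_right [lin]: "linear_on V s hs f \<Longrightarrow> linear_on V s hs (\<lambda>x. c * f x)"
  by (simp_all add: linear_on_def distrib_left distrib_right hop.scale_mult_left hop.scale_mult_right)

lemma lin_kmult_left [lin]: "linear_on V s (*) f \<Longrightarrow> linear_on V s (*) (\<lambda>x. f x * (c :: 'k))"
  by (simp_all add: linear_on_def distrib_right)

lemma lin_eps [lin]: "linear_on V s hs f \<Longrightarrow> linear_on V s (*) (\<lambda>x. eps (f x))"
  using hop.coalg by (simp add: linear_on_def coalgebra_def)

lemma lin_S [lin]: "linear_on V s hs f \<Longrightarrow> linear_on V s hs (\<lambda>x. S (f x))"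
  using hop.antipode_linear by (simp add: linear_on_def Vector_Spaces.linear_iff)

lemma lin_comult: "linear_on UNIV hs fscale (hcomult H)"
  using hop.coalg by (simp add: coalgebra_def)

lemma comult_in: "hcomult H h \<in> tensor_space (tenH H) UNIV UNIV"
  using hop.coalg by (simp add: coalgebra_def)

lemma eps_scale: "eps (hs c x) = c * eps x"
  using lin_eps[OF lin_id, of UNIV] by (simp add: linear_on_def)

subsection \<open>Coordinates of tensors whose second factor is the Hopf algebra\<close>

text \<open>The map id \<otimes> \<open>ds b\<close>, which extracts the coefficient of the basis
  element b. Coordinates are taken in the second factor only, so V may have any dimension.\<close>

definition coord :: "('k \<Rightarrow> 'v \<Rightarrow> 'v) \<Rightarrow> 'v set \<Rightarrow> 'h \<Rightarrow> ('v::ab_group_add, 'h, 'k) tensor \<Rightarrow> 'v" where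
  "coord s V b t = sweedler (pure_tensor s hs) V UNIV t (\<lambda>x y. s (ds b y) x)"

context
  fixes s :: "'k \<Rightarrow> 'v::ab_group_add \<Rightarrow> 'v" and V :: "'v set"
  assumes s: "vector_space s" and V: "module.subspace s V"
begin

interpretation s: vector_space s by (rule s)

interpretation tp: tensor_product "pure_tensor s hs" s hs fscale V UNIV
  by (rule tensor_product_pure_tensor) (simp_all add: s V)

lemma coord_bilinear: "bilinear_on V UNIV s hs s (\<lambda>x y. s (ds b y) x)"
  by (intro bilinear_onI lin s)

lemma coord_in: "t \<in> tensor_space (pure_tensor s hs) V UNIV \<Longrightarrow> coord s V b t \<in> V"
  unfolding coord_def using V by (intro tp.sw_in[OF s coord_bilinear V]) (auto intro: s.subspace_scale)

lemma coord_pure: "v \<in> V \<Longrightarrow> coord s V b (pure_tensor s hs v y) = s (ds b y) v"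
  unfolding coord_def by (rule tp.sw_tau[OF s coord_bilinear]) simp_all

lemma coord_linear: "linear_on (tensor_space (pure_tensor s hs) V UNIV) fscale s (coord s V b)"
  unfolding coord_def by (rule tp.sw_linear[OF s coord_bilinear])

lemma coord_expand:
  assumes t: "t \<in> tensor_space (pure_tensor s hs) V UNIV"
  shows "(\<Sum>b\<in>B. pure_tensor s hs (coord s V b t) b) = t"
proof (rule tp.linear_ext[OF vector_space_fscale _ _ t])
  fix v y assume v: "v \<in> V"
  have "(\<Sum>b\<in>B. pure_tensor s hs (coord s V b (pure_tensor s hs v y)) b)
      = (\<Sum>b\<in>B. fscale (ds b y) (pure_tensor s hs v b))"
    by (simp add: coord_pure[OF v] pure_tensor_scale_left)
  also have "\<dots> = pure_tensor s hs v y"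
    by (rule sum_ds_linear) (intro vector_space_fscale lin)+
  finally show "(\<Sum>b\<in>B. pure_tensor s hs (coord s V b (pure_tensor s hs v y)) b) = pure_tensor s hs v y" .
qed (intro lin vector_space_fscale coord_linear)+

text \<open>Replaces the definite description by a finite sum over the basis; all finite-sum forms
  of Sweedler notation below come from this.\<close>

lemma sweedler_coord:
  assumes "vector_space s3" "bilinear_on V UNIV s hs s3 F" "t \<in> tensor_space (pure_tensor s hs) V UNIV"
  shows "sweedler (pure_tensor s hs) V UNIV t F = (\<Sum>b\<in>B. F (coord s V b t) b)"
  by (subst coord_expand[OF assms(3), symmetric], rule tp.sw_sum[OF assms(1,2)]) (simp_all add: assms coord_in)

end

subsection \<open>The comultiplication\<close>

definition D :: "'h \<Rightarrow> 'h \<Rightarrow> 'h" where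
  "D b h = coord hs UNIV b (hcomult H h)"

text \<open>Sweedler notation for the comultiplication with the second leg running through the
  basis. Being a plain finite sum, it distributes over products and can be exchanged with other sums
  for every F; bilinearity enters only through \<open>swH_eq\<close> and the Hopf algebra
  axioms.\<close>

definition SWH :: "'h \<Rightarrow> ('h \<Rightarrow> 'h \<Rightarrow> 'c::comm_monoid_add) \<Rightarrow> 'c" where
  "SWH h F = (\<Sum>b\<in>B. F (D b h) b)"

lemma lin_D: "linear_on V s hs f \<Longrightarrow> linear_on V s hs (\<lambda>x. D b (f x))"
  unfolding D_def
  by (rule lin_comp[OF lin_comp[OF coord_linear lin_comult]]) (simp_all add: comult_in)

lemma swH_eq:
  assumes "vector_space s3" "\<And>b. linear_on UNIV hs s3 (\<lambda>a. F a b)" "\<And>a. linear_on UNIV hs s3 (\<lambda>b. F a b)"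
  shows "swH H h F = SWH h F"
  unfolding SWH_def D_def using assms by (intro sweedler_coord) (auto intro: bilinear_onI comult_in)

lemma lin_SWH [lin]:
  assumes "vector_space s3" "linear_on V s hs f" "\<And>b. linear_on UNIV hs s3 (\<lambda>a. F a b)"
  shows "linear_on V s s3 (\<lambda>x. SWH (f x) F)"
  unfolding SWH_def by (intro lin_sum assms lin_comp[OF assms(3) lin_D]) simp

lemma lin_SWH_body [lin]:
  assumes "vector_space s3" "\<And>a b. linear_on V s s3 (\<lambda>x. F x a b)"
  shows "linear_on V s s3 (\<lambda>x. SWH h (F x))"
  unfolding SWH_def by (intro lin_sum assms)

lemma SWH_lin:
  assumes "linear_on X s3 s4 f" "vector_space s3" "vector_space s4" "module.subspace s3 X" "\<And>a b. F a b \<in> X"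
  shows "f (SWH h F) = SWH h (\<lambda>a b. f (F a b))"
  unfolding SWH_def by (rule linear_on_sum[OF assms(1-4)]) (rule assms)

lemma SWH_mult_left: "c * SWH h F = SWH h (\<lambda>a b. c * F a b)"
  and SWH_mult_right: "SWH h F * c = SWH h (\<lambda>a b. F a b * c)"
  for c :: "'r::ring"
  by (simp_all add: SWH_def sum_distrib_left sum_distrib_right)

lemma SWH_scale: "vector_space s \<Longrightarrow> s c (SWH h F) = SWH h (\<lambda>a b. s c (F a b))"
  by (rule SWH_lin[OF lin_scale[OF _ lin_id], of s UNIV]) simp_all

lemma SWH_in: "\<lbrakk>vector_space s; module.subspace s X; \<And>a b. F a b \<in> X\<rbrakk> \<Longrightarrow> SWH h F \<in> X"
  unfolding SWH_def by (rule module.subspace_sum) (simp_all add: module_iff_vector_space)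

lemma SWH_swap: "SWH h (\<lambda>a b. SWH g (\<lambda>c d. F a b c d)) = SWH g (\<lambda>c d. SWH h (\<lambda>a b. F a b c d))"
  unfolding SWH_def by (rule sum.swap)

lemma SWH_sum_swap: "SWH h (\<lambda>a b. \<Sum>i\<in>A. F i a b) = (\<Sum>i\<in>A. SWH h (F i))"
  unfolding SWH_def by (rule sum.swap)

lemma SWH_add: "SWH h (\<lambda>a b. F a b + G a b) = SWH h F + SWH h G"
  unfolding SWH_def by (simp add: sum.distrib)

lemma comult_eq: "hcomult H h = SWH h (tenH H)"
  unfolding SWH_def D_def by (rule coord_expand[OF _ _ comult_in, symmetric]) simp_all

lemma hcomult_SWH:
  assumes "hcomult H h = SWH g (\<lambda>a b. tenH H (f a) (k b))" "vector_space s3"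
    "\<And>b. linear_on UNIV hs s3 (\<lambda>a. F a b)" "\<And>a. linear_on UNIV hs s3 (\<lambda>b. F a b)"
  shows "SWH h F = SWH g (\<lambda>a b. F (f a) (k b))"
proof -
  interpret tp: tensor_product "tenH H" hs hs fscale UNIV UNIV
    by (rule tensor_product_pure_tensor) simp_all
  show ?thesis
    unfolding swH_eq[OF assms(2-4), symmetric] assms(1) unfolding SWH_def
    by (rule tp.sw_sum[OF assms(2)]) (auto intro: bilinear_onI assms)
qed

text \<open>The axiom is an equation in H \<otimes> (H \<otimes> H). A trilinear F induces a linear
  function on this space in two stages, first on the inner tensor for fixed x (\<open>?G x\<close>),
  then on the outer one, and the claim is that function applied to both sides.\<close>

lemma SWH_coassoc:
  assumes s3: "vector_space s3"
    and F: "\<And>b c. linear_on UNIV hs s3 (\<lambda>a. F a b c)" "\<And>a c. linear_on UNIV hs s3 (\<lambda>b. F a b c)"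
      "\<And>a b. linear_on UNIV hs s3 (\<lambda>c. F a b c)"
  shows "SWH h (\<lambda>x y. SWH x (\<lambda>u v. F u v y)) = SWH h (\<lambda>x y. SWH y (\<lambda>u v. F x u v))"
proof -
  interpret t: tensor_product "tenH H" hs hs fscale UNIV UNIV
    by (rule tensor_product_pure_tensor) simp_all
  interpret T: tensor_product "pure_tensor hs fscale" hs fscale fscale UNIV "tensor_space (tenH H) UNIV UNIV"
    by (rule tensor_product_pure_tensor) (simp_all add: t.TS_subspace)
  let ?G = "\<lambda>x t. sweedler (tenH H) UNIV UNIV t (F x)"
  have bF: "bilinear_on UNIV UNIV hs hs s3 (F x)" for x by (intro bilinear_onI F)
  have G: "bilinear_on UNIV (tensor_space (tenH H) UNIV UNIV) hs fscale s3 ?G"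
  proof (rule bilinear_onI)
    fix w assume w: "w \<in> tensor_space (tenH H) UNIV UNIV"
    show "linear_on UNIV hs s3 (\<lambda>v. sweedler (tenH H) UNIV UNIV w (F v))"
      by (subst sweedler_coord[OF _ _ s3 bF w]) (use F s3 in \<open>auto intro!: lin\<close>)
  qed (rule t.sw_linear[OF s3 bF])
  have Gt: "?G x (tenH H y z) = F x y z" for x y z by (rule t.sw_tau[OF s3 bF]) simp_all
  have "swH H h (\<lambda>x1 x2. swH H x1 (\<lambda>y z. pure_tensor hs fscale y (tenH H z x2))) =
       swH H h (\<lambda>x1 x2. swH H x2 (\<lambda>y z. pure_tensor hs fscale x1 (tenH H y z)))"
    using hop.coalg by (simp add: coalgebra_def)
  also have "swH H h (\<lambda>x1 x2. swH H x1 (\<lambda>y z. pure_tensor hs fscale y (tenH H z x2))) =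
      swH H h (\<lambda>x1 x2. SWH x1 (\<lambda>y z. pure_tensor hs fscale y (tenH H z x2)))"
    by (subst swH_eq[of fscale]) (intro refl lin vector_space_fscale)+
  also have "\<dots> = SWH h (\<lambda>x1 x2. SWH x1 (\<lambda>y z. pure_tensor hs fscale y (tenH H z x2)))"
    by (rule swH_eq[of fscale]) (intro refl lin vector_space_fscale)+
  also have "swH H h (\<lambda>x1 x2. swH H x2 (\<lambda>y z. pure_tensor hs fscale x1 (tenH H y z))) =
      swH H h (\<lambda>x1 x2. SWH x2 (\<lambda>y z. pure_tensor hs fscale x1 (tenH H y z)))"
    by (subst swH_eq[of fscale]) (intro refl lin vector_space_fscale)+
  also have "\<dots> = SWH h (\<lambda>x1 x2. SWH x2 (\<lambda>y z. pure_tensor hs fscale x1 (tenH H y z)))"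
    by (rule swH_eq[of fscale]) (intro refl lin vector_space_fscale vs_hs)+
  finally have eq: "SWH h (\<lambda>x1 x2. SWH x1 (\<lambda>y z. pure_tensor hs fscale y (tenH H z x2))) =
    SWH h (\<lambda>x1 x2. SWH x2 (\<lambda>y z. pure_tensor hs fscale x1 (tenH H y z)))" .
  have in1: "pure_tensor hs fscale x (tenH H y z) \<in> T.TS" for x y z
    by (intro T.tensor_in t.tensor_in) simp_all
  have app: "T.sw (SWH h K) ?G = SWH h (\<lambda>x y. T.sw (K x y) ?G)" if "\<And>x y. K x y \<in> T.TS" for h K
    by (rule SWH_lin[OF T.sw_linear[OF s3 G]]) (use that T.TS_subspace s3 in auto)
  have "T.sw (pure_tensor hs fscale x (tenH H y z)) ?G = F x y z" for x y z
    by (subst T.sw_tau[OF s3 G]) (simp_all add: Gt t.tensor_in)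
  then show ?thesis
    using arg_cong[OF eq, of "\<lambda>t. T.sw t ?G"]
    by (simp add: app in1 SWH_in[OF vector_space_fscale T.TS_subspace])
qed

text \<open>The function f stands for whatever surrounds the remaining leg. In this form the counit
  axiom can be applied inside any linear expression; the antipode rules below have the same
  shape.\<close>

lemma SWH_counit_left:
  assumes s3: "vector_space s3" and f: "linear_on UNIV hs s3 f"
  shows "SWH h (\<lambda>x y. s3 (eps x) (f y)) = f h"
proof -
  have "SWH h (\<lambda>x y. hs (eps x) y) = swH H h (\<lambda>x y. hs (eps x) y)"
    by (rule swH_eq[of hs, symmetric]) (intro lin vs_hs)+
  also have "\<dots> = h" using hop.coalg by (simp add: coalgebra_def)
  finally have "f h = f (SWH h (\<lambda>x y. hs (eps x) y))" by simp
  also have "\<dots> = SWH h (\<lambda>x y. s3 (eps x) (f y))"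
    by (subst SWH_lin[OF f]) (simp_all add: s3 linear_on_scale[OF f])
  finally show ?thesis by simp
qed

lemma SWH_counit_right:
  assumes s3: "vector_space s3" and f: "linear_on UNIV hs s3 f"
  shows "SWH h (\<lambda>x y. s3 (eps y) (f x)) = f h"
proof -
  have "SWH h (\<lambda>x y. hs (eps y) x) = swH H h (\<lambda>x y. hs (eps y) x)"
    by (rule swH_eq[of hs, symmetric]) (intro lin vs_hs)+
  also have "\<dots> = h" using hop.coalg by (simp add: coalgebra_def)
  finally have "f h = f (SWH h (\<lambda>x y. hs (eps y) x))" by simp
  also have "\<dots> = SWH h (\<lambda>x y. s3 (eps y) (f x))"
    by (subst SWH_lin[OF f]) (simp_all add: s3 linear_on_scale[OF f])
  finally show ?thesis by simp
qed

lemma SWH_mult: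
  assumes s3: "vector_space s3"
    and F: "\<And>b. linear_on UNIV hs s3 (\<lambda>a. F a b)" "\<And>a. linear_on UNIV hs s3 (\<lambda>b. F a b)"
  shows "SWH (x * y) F = SWH x (\<lambda>a b. SWH y (\<lambda>c d. F (a * c) (b * d)))"
proof -
  interpret tp: tensor_product "tenH H" hs hs fscale UNIV UNIV
    by (rule tensor_product_pure_tensor) simp_all
  have bF: "bilinear_on UNIV UNIV hs hs s3 F" by (intro bilinear_onI F)
  have "hcomult H (x * y) = swH H x (\<lambda>a b. SWH y (\<lambda>c d. tenH H (a * c) (b * d)))"
    unfolding hop.comult_mult by (subst swH_eq[of fscale]) (intro refl lin vector_space_fscale)+
  also have "\<dots> = SWH x (\<lambda>a b. SWH y (\<lambda>c d. tenH H (a * c) (b * d)))"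
    by (rule swH_eq[of fscale]) (intro lin vector_space_fscale)+
  finally have eq: "hcomult H (x * y) = SWH x (\<lambda>a b. SWH y (\<lambda>c d. tenH H (a * c) (b * d)))" .
  have app: "tp.sw (SWH h K) F = SWH h (\<lambda>x y. tp.sw (K x y) F)" if "\<And>x y. K x y \<in> tp.TS" for h K
    by (rule SWH_lin[OF tp.sw_linear[OF s3 bF]]) (use that tp.TS_subspace s3 in auto)
  show ?thesis
    unfolding swH_eq[OF s3 F, symmetric] eq
    by (simp add: app tp.tensor_in SWH_in[OF vector_space_fscale tp.TS_subspace] tp.sw_tau[OF s3 bF])
qed

lemma SWH_one:
  assumes s3: "vector_space s3"
    and F: "\<And>b. linear_on UNIV hs s3 (\<lambda>a. F a b)" "\<And>a. linear_on UNIV hs s3 (\<lambda>b. F a b)"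
  shows "SWH 1 F = F 1 1"
proof -
  interpret tp: tensor_product "tenH H" hs hs fscale UNIV UNIV
    by (rule tensor_product_pure_tensor) simp_all
  show ?thesis
    unfolding swH_eq[OF s3 F, symmetric] hop.comult_one
    by (rule tp.sw_tau[OF s3]) (intro bilinear_onI F UNIV_I)+
qed

lemma SWH_antipode_left:
  assumes s3: "vector_space s3" and f: "linear_on UNIV hs s3 f"
  shows "SWH h (\<lambda>x y. f (S x * y)) = s3 (eps h) (f 1)"
proof -
  have "SWH h (\<lambda>x y. f (S x * y)) = f (SWH h (\<lambda>x y. S x * y))"
    by (rule SWH_lin[OF f, symmetric]) (simp_all add: s3)
  also have "SWH h (\<lambda>x y. S x * y) = hs (eps h) 1"
    unfolding hop.antipode_left[symmetric] by (rule swH_eq[of hs, symmetric]) (intro lin vs_hs)+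
  finally show ?thesis by (simp add: linear_on_scale[OF f])
qed

lemma SWH_antipode_right:
  assumes s3: "vector_space s3" and f: "linear_on UNIV hs s3 f"
  shows "SWH h (\<lambda>x y. f (x * S y)) = s3 (eps h) (f 1)"
proof -
  have "SWH h (\<lambda>x y. f (x * S y)) = f (SWH h (\<lambda>x y. x * S y))"
    by (rule SWH_lin[OF f, symmetric]) (simp_all add: s3)
  also have "SWH h (\<lambda>x y. x * S y) = hs (eps h) 1"
    unfolding hop.antipode_right[symmetric] by (rule swH_eq[of hs, symmetric]) (intro lin vs_hs)+
  finally show ?thesis by (simp add: linear_on_scale[OF f])
qed

end

context fd_hopf
begin

lemma SWH_cong: "(\<And>a b. F a b = G a b) \<Longrightarrow> SWH h F = SWH h G"
  by (simp add: SWH_def)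

lemma SWH_zero: "SWH h (\<lambda>a b. 0) = 0"
  by (simp add: SWH_def)

subsection \<open>The antipode\<close>

text \<open>Both sides are convolution inverse to the multiplication. The sum of S(x1 y1) x2 y2
  S(y3) S(x3) collapses from the right to S(xy) and, after regrouping the legs, from the left to
  S(y) S(x).\<close>

lemma S_mult: "S (x * y) = S y * S x"
proof -
  define T where "T x1 x2 x3 y1 y2 y3 = S (x1 * y1) * (x2 * (y2 * S y3) * S x3)" for x1 x2 x3 y1 y2 y3
  have "SWH x (\<lambda>x1 x'. SWH x' (\<lambda>x2 x3. SWH y (\<lambda>y1 y'. SWH y' (\<lambda>y2 y3. T x1 x2 x3 y1 y2 y3)))) =
      SWH x (\<lambda>x1 x'. SWH x' (\<lambda>x2 x3. SWH y (\<lambda>y1 y'. hs (eps y') (S (x1 * y1) * (x2 * 1 * S x3)))))"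
    unfolding T_def by (intro SWH_cong SWH_antipode_right lin vs_hs)
  also have "\<dots> = SWH x (\<lambda>x1 x'. SWH x' (\<lambda>x2 x3. S (x1 * y) * (x2 * 1 * S x3)))"
    by (intro SWH_cong SWH_counit_right lin vs_hs)
  also have "\<dots> = SWH x (\<lambda>x1 x'. hs (eps x') (S (x1 * y) * 1))"
    unfolding mult_1_right by (intro SWH_cong SWH_antipode_right[where f = "\<lambda>z. S (_ * y) * z", simplified] lin vs_hs)
  also have "\<dots> = S (x * y) * 1"
    by (intro SWH_counit_right lin vs_hs)
  finally have 1: "SWH x (\<lambda>x1 x'. SWH x' (\<lambda>x2 x3. SWH y (\<lambda>y1 y'. SWH y' (\<lambda>y2 y3. T x1 x2 x3 y1 y2 y3)))) = S (x * y)"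
    by simp
  \<comment> \<open>The legs are regrouped so that x1, x2 and y1, y2 are the two legs of x' and of
    y'. Multiplicativity of the comultiplication then makes S(x1 y1) (x2 y2) an instance of the
    antipode axiom at x' y'.\<close>
  have "SWH x (\<lambda>x1 x'. SWH x' (\<lambda>x2 x3. SWH y (\<lambda>y1 y'. SWH y' (\<lambda>y2 y3. T x1 x2 x3 y1 y2 y3)))) =
      SWH x (\<lambda>x1 x'. SWH x' (\<lambda>x2 x3. SWH y (\<lambda>y' y3. SWH y' (\<lambda>y1 y2. T x1 x2 x3 y1 y2 y3))))"
    unfolding T_def by (rule SWH_cong, rule SWH_cong, rule SWH_coassoc[OF vs_hs, symmetric]) (intro lin vs_hs)+
  also have "\<dots> = SWH x (\<lambda>x' x3. SWH x' (\<lambda>x1 x2. SWH y (\<lambda>y' y3. SWH y' (\<lambda>y1 y2. T x1 x2 x3 y1 y2 y3))))"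
    unfolding T_def by (rule SWH_coassoc[OF vs_hs, symmetric]) (intro lin vs_hs)+
  also have "\<dots> = SWH x (\<lambda>x' x3. SWH y (\<lambda>y' y3. SWH x' (\<lambda>x1 x2. SWH y' (\<lambda>y1 y2. T x1 x2 x3 y1 y2 y3))))"
    by (rule SWH_cong, rule SWH_swap)
  also have "\<dots> = SWH x (\<lambda>x' x3. SWH y (\<lambda>y' y3. SWH (x' * y') (\<lambda>u v. S u * v * (S y3 * S x3))))"
    unfolding T_def by (subst SWH_mult[OF vs_hs]) (intro lin vs_hs | simp add: mult.assoc)+
  also have "\<dots> = SWH x (\<lambda>x' x3. SWH y (\<lambda>y' y3. hs (eps (x' * y')) (1 * (S y3 * S x3))))"
    by (intro SWH_cong SWH_antipode_left lin vs_hs)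
  also have "\<dots> = SWH x (\<lambda>x' x3. hs (eps x') (SWH y (\<lambda>y' y3. hs (eps y') (1 * (S y3 * S x3)))))"
    by (simp add: hop.counit_mult SWH_scale)
  also have "\<dots> = SWH x (\<lambda>x' x3. hs (eps x') (1 * (S y * S x3)))"
    by (subst SWH_counit_left) (intro lin vs_hs refl)+
  also have "\<dots> = 1 * (S y * S x)"
    by (intro SWH_counit_left lin vs_hs)
  finally show ?thesis using 1 by simp
qed

lemma S_one: "S 1 = 1"
proof -
  have "SWH 1 (\<lambda>x y. S x * y) = S 1 * 1" by (rule SWH_one[OF vs_hs]) (intro lin)+
  then show ?thesis using SWH_antipode_left[OF vs_hs lin_id, of 1] by (simp add: hop.counit_one)
qed

lemma eps_S: "eps (S h) = eps h"
proof -
  have "eps (S h) = SWH h (\<lambda>x y. eps y * eps (S x))"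
    by (intro SWH_counit_right[symmetric] lin vector_space_mult)
  also have "\<dots> = SWH h (\<lambda>x y. eps (S x * y))" by (simp add: hop.counit_mult mult.commute)
  also have "\<dots> = eps h * eps 1" by (intro SWH_antipode_left lin vector_space_mult)
  finally show ?thesis by (simp add: hop.counit_one)
qed

text \<open>The comultiplication \<Delta> has the two convolution inverses \<Delta> \<circ> S and
  flip \<circ> (S \<otimes> S) \<circ> \<Delta>, which therefore agree. \<open>E\<close> is F on the
  product of \<Delta>(S(h1)), \<Delta>(h2) and the flipped antipodes of the legs of h3. Contracting
  the last two factors gives the left side, contracting the first two gives the right side.\<close>

lemma SWH_S:
  assumes s3: "vector_space s3"
    and F: "\<And>b. linear_on UNIV hs s3 (\<lambda>a. F a b)" "\<And>a. linear_on UNIV hs s3 (\<lambda>b. F a b)"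
  shows "SWH (S h) F = SWH h (\<lambda>a b. F (S b) (S a))"
proof -
  note FF = lin_comp[OF F(1) _ UNIV_I] lin_comp[OF F(2) _ UNIV_I]
  define E where "E p q a b c d = F (p * (a * S d)) (q * (b * S c))" for p q a b c d
  have *: "SWH r (\<lambda>u v. SWH u (\<lambda>a b. SWH v (\<lambda>c d. E p q a b c d))) = s3 (eps r) (F p q)" for p q r
  proof -
    have "SWH r (\<lambda>u v. SWH u (\<lambda>a b. SWH v (\<lambda>c d. E p q a b c d))) =
        SWH r (\<lambda>a r'. SWH r' (\<lambda>b v. SWH v (\<lambda>c d. E p q a b c d)))"
      unfolding E_def by (rule SWH_coassoc[OF s3]) (intro lin FF s3)+
    also have "\<dots> = SWH r (\<lambda>a r'. SWH r' (\<lambda>w d. SWH w (\<lambda>b c. E p q a b c d)))"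
      unfolding E_def by (rule SWH_cong, rule SWH_coassoc[OF s3, symmetric]) (intro lin FF s3)+
    also have "\<dots> = SWH r (\<lambda>a r'. SWH r' (\<lambda>w d. s3 (eps w) (F (p * (a * S d)) (q * 1))))"
      unfolding E_def by (intro SWH_cong SWH_antipode_right lin FF s3)
    also have "\<dots> = SWH r (\<lambda>a r'. F (p * (a * S r')) (q * 1))"
      by (intro SWH_cong SWH_counit_left lin FF s3)
    also have "\<dots> = s3 (eps r) (F (p * 1) (q * 1))"
      by (intro SWH_antipode_right lin FF s3)
    finally show ?thesis by simp
  qed
  have "SWH h (\<lambda>h1 r. SWH (S h1) (\<lambda>p q. SWH r (\<lambda>u v. SWH u (\<lambda>a b. SWH v (\<lambda>c d. E p q a b c d))))) =
      SWH h (\<lambda>h1 r. SWH (S h1) (\<lambda>p q. s3 (eps r) (F p q)))"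
    by (simp only: *)
  also have "\<dots> = SWH h (\<lambda>h1 r. s3 (eps r) (SWH (S h1) F))" by (simp add: SWH_scale[OF s3])
  also have "\<dots> = SWH (S h) F" by (intro SWH_counit_right lin FF s3)
  finally have 1: "SWH (S h) F =
      SWH h (\<lambda>h1 r. SWH (S h1) (\<lambda>p q. SWH r (\<lambda>u v. SWH u (\<lambda>a b. SWH v (\<lambda>c d. E p q a b c d)))))" ..
  also have "\<dots> = SWH h (\<lambda>h1 r. SWH r (\<lambda>u v. SWH (S h1) (\<lambda>p q. SWH u (\<lambda>a b. SWH v (\<lambda>c d. E p q a b c d)))))"
    by (rule SWH_cong, rule SWH_swap)
  also have "\<dots> = SWH h (\<lambda>w v. SWH w (\<lambda>h1 u. SWH (S h1) (\<lambda>p q. SWH u (\<lambda>a b. SWH v (\<lambda>c d. E p q a b c d)))))"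
    unfolding E_def by (rule SWH_coassoc[OF s3, symmetric]) (intro lin FF s3)+
  also have "\<dots> = SWH h (\<lambda>w v. SWH w (\<lambda>h1 u. SWH (S h1 * u) (\<lambda>x y. SWH v (\<lambda>c d. F (x * S d) (y * S c)))))"
    unfolding E_def by (subst SWH_mult[OF s3]) (intro lin FF s3 | simp add: mult.assoc)+
  also have "\<dots> = SWH h (\<lambda>w v. s3 (eps w) (SWH 1 (\<lambda>x y. SWH v (\<lambda>c d. F (x * S d) (y * S c)))))"
    by (intro SWH_cong SWH_antipode_left lin FF s3)
  also have "\<dots> = SWH 1 (\<lambda>x y. SWH h (\<lambda>c d. F (x * S d) (y * S c)))"
    by (intro SWH_counit_left lin FF s3)
  also have "\<dots> = SWH h (\<lambda>c d. F (1 * S d) (1 * S c))"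
    by (rule SWH_one[OF s3]) (intro lin FF s3)+
  finally show ?thesis by simp
qed

subsection \<open>The convolution algebra\<close>

abbreviation "Hd \<equiv> dual H"

lemma dual_iff: "p \<in> Hd \<longleftrightarrow> linear_on UNIV hs (*) p"
  by (simp add: dual_def linear_on_UNIV_iff)

lemma lin_dual: "\<lbrakk>p \<in> Hd; linear_on V s hs f\<rbrakk> \<Longrightarrow> linear_on V s (*) (\<lambda>x. p (f x))"
  by (auto simp: dual_iff linear_on_def)

lemma ds_dual [simp]: "ds b \<in> Hd"
  unfolding dual_iff by (intro lin)

lemma eps_dual [simp]: "eps \<in> Hd"
  unfolding dual_iff by (intro lin)

lemma dual_subspace [simp]: "module.subspace fscale Hd"
proof -
  interpret vector_space "fscale :: 'k \<Rightarrow> ('h \<Rightarrow> 'k) \<Rightarrow> _" by simp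
  show ?thesis unfolding subspace_def
    by (auto simp: dual_iff linear_on_def fscale_def zero_fun_def algebra_simps)
qed

lemma sum_fun_apply: "(\<Sum>i\<in>A. f i) x = (\<Sum>i\<in>A. f i x)"
  by (induction A rule: infinite_finite_induct) simp_all

lemma dual_expand:
  assumes "p \<in> Hd"
  shows "(\<Sum>b\<in>B. fscale (p b) (ds b)) = p"
proof
  fix x
  have "(\<Sum>b\<in>B. fscale (p b) (ds b)) x = (\<Sum>b\<in>B. ds b x * p b)"
    by (simp add: fscale_def sum_fun_apply mult.commute)
  then show "(\<Sum>b\<in>B. fscale (p b) (ds b)) x = p x"
    using sum_ds_linear[OF vector_space_mult, of p x] assms by (simp add: dual_iff)
qed

lemma lin_eval [lin]: "linear_on V fscale (*) (\<lambda>f. f a)"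
  by (simp add: linear_on_def fscale_def)

text \<open>The convolution product as a finite sum. It agrees with \<open>conv\<close> on the dual
  (\<open>conv_eq\<close>) and is linear in each factor as an operation on arbitrary
  functions.\<close>

definition cnv :: "('h \<Rightarrow> 'k) \<Rightarrow> ('h \<Rightarrow> 'k) \<Rightarrow> 'h \<Rightarrow> 'k" where
  "cnv p q h = SWH h (\<lambda>a b. p a * q b)"

lemma conv_eq: "\<lbrakk>p \<in> Hd; q \<in> Hd\<rbrakk> \<Longrightarrow> conv H p q = cnv p q"
  unfolding conv_def cnv_def
  by (rule ext, rule swH_eq[of "(*)"]) (auto simp: dual_iff linear_on_def algebra_simps)

lemma cnv_dual [simp]: "p \<in> Hd \<Longrightarrow> cnv p q \<in> Hd"
  unfolding dual_iff cnv_def by (intro lin vector_space_mult) (auto simp: dual_iff)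

lemma lin_cnv1 [lin]: "linear_on V s fscale f \<Longrightarrow> linear_on V s fscale (\<lambda>x. cnv (f x) q)"
  and lin_cnv2 [lin]: "linear_on V s fscale f \<Longrightarrow> linear_on V s fscale (\<lambda>x. cnv p (f x))"
  by (simp_all add: linear_on_def cnv_def fun_eq_iff fscale_def distrib_left distrib_right SWH_add SWH_mult_left mult_ac)

lemma cnv_assoc:
  assumes "p \<in> Hd" "q \<in> Hd" "r \<in> Hd"
  shows "cnv (cnv p q) r = cnv p (cnv q r)"
proof
  fix h
  have "SWH h (\<lambda>x y. SWH x (\<lambda>u v. p u * (q v * r y))) = SWH h (\<lambda>x y. SWH y (\<lambda>u v. p x * (q u * r v)))"
    by (rule SWH_coassoc[OF vector_space_mult])
      (use assms in \<open>auto simp: dual_iff linear_on_def algebra_simps\<close>)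
  then show "cnv (cnv p q) r h = cnv p (cnv q r) h"
    by (simp add: cnv_def SWH_mult_left SWH_mult_right mult.assoc)
qed

lemma cnv_eps_left: "p \<in> Hd \<Longrightarrow> cnv eps p = p" and cnv_eps_right: "p \<in> Hd \<Longrightarrow> cnv p eps = p"
  unfolding cnv_def
  using SWH_counit_left[OF vector_space_mult, of p] SWH_counit_right[OF vector_space_mult, of p]
  by (auto simp: dual_iff mult.commute)

lemma sum_dual_linear:
  assumes "vector_space s" "linear_on Hd fscale s f" "p \<in> Hd"
  shows "(\<Sum>b\<in>B. s (p b) (f (ds b))) = f p"
proof -
  have "f p = f (\<Sum>b\<in>B. fscale (p b) (ds b))" by (simp add: dual_expand assms)
  also have "\<dots> = (\<Sum>b\<in>B. s (p b) (f (ds b)))"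
    by (subst linear_on_sum[OF assms(2)])
      (simp_all add: assms linear_on_scale[OF assms(2)] module.subspace_scale[OF _ dual_subspace] module_iff_vector_space)
  finally show ?thesis by simp
qed

text \<open>Convolution is dual to comultiplication: \<Sum> k1 \<otimes> k2 \<otimes> h^k = \<Sum>
  h_i \<otimes> h_j \<otimes> h^i h^j. To see it, expand h^i h^j in the dual basis, with
  coefficients h^i(k1) h^j(k2), and collapse the sums over i and j. Read from right to left, two
  dual-basis sums merge into the legs of one.\<close>

lemma dual_basis_comult:
  assumes s: "vector_space s"
    and F: "\<And>b p. p \<in> Hd \<Longrightarrow> linear_on UNIV hs s (\<lambda>a. F a b p)" "\<And>a p. p \<in> Hd \<Longrightarrow> linear_on UNIV hs s (\<lambda>b. F a b p)"
      "\<And>a b. linear_on Hd fscale s (\<lambda>p. F a b p)"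
  shows "(\<Sum>k\<in>B. SWH k (\<lambda>a b. F a b (ds k))) = (\<Sum>i\<in>B. \<Sum>j\<in>B. F i j (cnv (ds i) (ds j)))"
proof -
  interpret vector_space s by (rule s)
  have "F i j (cnv (ds i) (ds j)) = (\<Sum>k\<in>B. SWH k (\<lambda>a b. s (ds i a) (s (ds j b) (F i j (ds k)))))" for i j
    by (subst sum_dual_linear[OF s F(3), symmetric])
      (simp_all add: cnv_def, simp add: SWH_def scale_sum_left)
  then have "(\<Sum>i\<in>B. \<Sum>j\<in>B. F i j (cnv (ds i) (ds j))) =
      (\<Sum>i\<in>B. \<Sum>k\<in>B. SWH k (\<lambda>a b. s (ds i a) (\<Sum>j\<in>B. s (ds j b) (F i j (ds k)))))"
    by (simp add: scale_sum_right SWH_sum_swap, intro sum.cong refl sum.swap)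
  also have "\<dots> = (\<Sum>i\<in>B. \<Sum>k\<in>B. SWH k (\<lambda>a b. s (ds i a) (F i b (ds k))))"
    by (simp add: sum_ds_linear[OF s F(2)])
  also have "\<dots> = (\<Sum>k\<in>B. SWH k (\<lambda>a b. \<Sum>i\<in>B. s (ds i a) (F i b (ds k))))"
    by (simp add: SWH_sum_swap, rule sum.swap)
  also have "\<dots> = (\<Sum>k\<in>B. SWH k (\<lambda>a b. F a b (ds k)))"
    by (subst sum_ds_linear[OF s F(1)]) simp_all
  finally show ?thesis by simp
qed

subsection \<open>Integrals and bijectivity of the antipode\<close>

text \<open>The dual is a right Hopf module with action \<open>(p \<cdot> h) x = p (x * S h)\<close> and the coaction dual to
  left multiplication; \<open>integral_of\<close> is the projection \<open>p \<mapsto> p\<^sub>0 \<cdot> S p\<^sub>1\<close> onto its coinvariants.\<close>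

definition integral_of :: "('h \<Rightarrow> 'k) \<Rightarrow> 'h \<Rightarrow> 'k" where
  "integral_of p x = (\<Sum>i\<in>B. cnv (ds i) p (x * S (S i)))"

text \<open>The Hopf-module law: the coaction of q \<cdot> h is q0 \<cdot> h1 \<otimes> q1 h2. The
  coaction of q is encoded as the H-valued function x \<mapsto> \<Sum> q(x2) x1. Expanding the
  comultiplication of x S(h1) leaves a factor S(h2) h3, which cancels.\<close>

lemma dual_coaction_action:
  assumes q: "q \<in> Hd"
  shows "SWH x (\<lambda>a b. hs (q (b * S h)) a) = SWH h (\<lambda>c d. SWH (x * S c) (\<lambda>a b. hs (q b) a) * d)"
proof -
  note Q = lin_dual[OF q]
  have "SWH h (\<lambda>c d. SWH (x * S c) (\<lambda>a b. hs (q b) a) * d) =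
      SWH h (\<lambda>c d. SWH x (\<lambda>a b. SWH (S c) (\<lambda>u v. hs (q (b * v)) (a * u * d))))"
    by (rule SWH_cong, subst SWH_mult[OF vs_hs])
      (intro lin Q vs_hs | simp add: SWH_mult_right hop.scale_mult_left)+
  also have "\<dots> = SWH h (\<lambda>c d. SWH x (\<lambda>a b. SWH c (\<lambda>v u. hs (q (b * S v)) (a * S u * d))))"
    by (subst SWH_S[OF vs_hs]) (intro lin Q vs_hs refl)+
  also have "\<dots> = SWH h (\<lambda>c d. SWH c (\<lambda>v u. SWH x (\<lambda>a b. hs (q (b * S v)) (a * S u * d))))"
    by (rule SWH_cong, rule SWH_swap)
  also have "\<dots> = SWH h (\<lambda>v w. SWH w (\<lambda>u d. SWH x (\<lambda>a b. hs (q (b * S v)) (a * S u * d))))"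
    by (rule SWH_coassoc[OF vs_hs]) (intro lin Q vs_hs)+
  also have "\<dots> = SWH h (\<lambda>v w. SWH w (\<lambda>u d. SWH x (\<lambda>a b. hs (q (b * S v)) (a * (S u * d)))))"
    by (simp add: mult.assoc)
  also have "\<dots> = SWH h (\<lambda>v w. hs (eps w) (SWH x (\<lambda>a b. hs (q (b * S v)) (a * 1))))"
    by (intro SWH_cong SWH_antipode_left lin Q vs_hs)
  also have "\<dots> = SWH x (\<lambda>a b. hs (q (b * S h)) (a * 1))"
    by (intro SWH_counit_right lin Q vs_hs)
  finally show ?thesis by simp
qed

text \<open>In dual bases the coaction is q0 \<otimes> q1 = \<Sum> h^j q \<otimes> h_j, the form in
  which it enters \<open>integral_of\<close>.\<close>

lemma coaction_expand:
  assumes q: "q \<in> Hd"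
  shows "SWH y (\<lambda>a b. hs (q b) a) = (\<Sum>j\<in>B. hs (cnv (ds j) q y) j)"
proof -
  have "SWH y (\<lambda>a b. hs (q b) a) = SWH y (\<lambda>a b. hs (q b) (\<Sum>j\<in>B. hs (ds j a) j))"
    by (simp add: ds_expand)
  also have "\<dots> = (\<Sum>j\<in>B. hs (cnv (ds j) q y) j)"
    by (simp add: cnv_def SWH_def hop.scale_sum_left hop.scale_sum_right mult.commute) (rule sum.swap)
  finally show ?thesis .
qed

lemma integral_of_dual [simp]: "integral_of p \<in> Hd"
  unfolding dual_iff integral_of_def by (intro lin vector_space_mult lin_dual[OF cnv_dual] ds_dual)

text \<open>The projection p0 \<cdot> S(p1) is coinvariant, hence a left integral on H: by the
  Hopf-module law its coaction is p0 \<cdot> S(p3) \<otimes> p1 S(p2), where p1 S(p2)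
  cancels.\<close>

lemma integral_of_integral:
  assumes p: "p \<in> Hd"
  shows "SWH x (\<lambda>a b. hs (integral_of p b) a) = hs (integral_of p x) 1"
proof -
  have q: "cnv q p \<in> Hd" if "q \<in> Hd" for q using that by simp
  note C = lin_dual[OF q]
  have "SWH x (\<lambda>a b. hs (integral_of p b) a) =
      (\<Sum>i\<in>B. SWH x (\<lambda>a b. hs (cnv (ds i) p (b * S (S i))) a))"
    by (simp add: integral_of_def hop.scale_sum_left SWH_sum_swap)
  also have "\<dots> = (\<Sum>i\<in>B. SWH (S i) (\<lambda>c d. SWH (x * S c) (\<lambda>a b. hs (cnv (ds i) p b) a) * d))"
    by (intro sum.cong refl dual_coaction_action) simp
  also have "\<dots> = (\<Sum>i\<in>B. SWH i (\<lambda>d c. SWH (x * S (S c)) (\<lambda>a b. hs (cnv (ds i) p b) a) * S d))"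
    by (intro sum.cong refl, subst SWH_S[OF vs_hs]) (intro lin C vs_hs ds_dual | simp)+
  also have "\<dots> = (\<Sum>i\<in>B. \<Sum>j\<in>B. SWH i (\<lambda>d c. hs (cnv (ds j) (cnv (ds i) p) (x * S (S c))) (j * S d)))"
    by (simp add: coaction_expand sum_distrib_right hop.scale_mult_left SWH_sum_swap)
  also have "\<dots> = (\<Sum>j\<in>B. \<Sum>i\<in>B. SWH i (\<lambda>d c. hs (cnv (cnv (ds j) (ds i)) p (x * S (S c))) (j * S d)))"
    by (subst sum.swap) (simp add: cnv_assoc p)
  \<comment> \<open>The two dual-basis sums merge into one over k, whose legs a and b take the
    places of j and i.\<close>
  also have "\<dots> = (\<Sum>k\<in>B. SWH k (\<lambda>a b. SWH b (\<lambda>d c. hs (cnv (ds k) p (x * S (S c))) (a * S d))))"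
    by (rule dual_basis_comult[symmetric, OF vs_hs])
       (auto simp: cnv_def[of _ p] intro!: lin vs_hs C[unfolded cnv_def[abs_def]])
  also have "\<dots> = (\<Sum>k\<in>B. SWH k (\<lambda>w c. SWH w (\<lambda>a d. hs (cnv (ds k) p (x * S (S c))) (a * S d))))"
    by (rule sum.cong[OF refl], rule SWH_coassoc[OF vs_hs, symmetric]) (intro lin C vs_hs ds_dual)+
  also have "\<dots> = (\<Sum>k\<in>B. SWH k (\<lambda>w c. hs (eps w) (hs (cnv (ds k) p (x * S (S c))) 1)))"
    by (intro sum.cong refl SWH_cong SWH_antipode_right lin vs_hs)
  also have "\<dots> = (\<Sum>k\<in>B. hs (cnv (ds k) p (x * S (S k))) 1)"
    by (intro sum.cong refl SWH_counit_left lin C vs_hs ds_dual)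
  finally show ?thesis by (simp add: integral_of_def hop.scale_sum_left)
qed

text \<open>The structure theorem for Hopf modules: with E the projection onto coinvariants, p is
  the sum of E(p0) \<cdot> p1. It is used to show that some integral is nonzero.\<close>

lemma integral_of_reconstruct:
  assumes p: "p \<in> Hd"
  shows "(\<Sum>i\<in>B. integral_of (cnv (ds i) p) (x * S i)) = p x"
proof -
  have q: "cnv q p \<in> Hd" if "q \<in> Hd" for q using that by simp
  note C = lin_dual[OF q]
  have "(\<Sum>i\<in>B. integral_of (cnv (ds i) p) (x * S i)) =
      (\<Sum>j\<in>B. \<Sum>i\<in>B. cnv (cnv (ds j) (ds i)) p (x * S i * S (S j)))"
    unfolding integral_of_def by (subst sum.swap) (simp add: cnv_assoc p)
  also have "\<dots> = (\<Sum>k\<in>B. SWH k (\<lambda>a b. cnv (ds k) p (x * S b * S (S a))))"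
    by (rule dual_basis_comult[symmetric, OF vector_space_mult])
       (auto simp: cnv_def[of _ p] intro!: lin vector_space_mult C[unfolded cnv_def[abs_def]])
  also have "\<dots> = (\<Sum>k\<in>B. SWH k (\<lambda>a b. cnv (ds k) p (x * S (S a * b))))"
    by (simp add: S_mult mult.assoc)
  also have "\<dots> = (\<Sum>k\<in>B. eps k * cnv (ds k) p (x * S 1))"
    by (intro sum.cong refl SWH_antipode_left lin C vector_space_mult ds_dual)
  also have "\<dots> = (\<Sum>k\<in>B. eps k * cnv (ds k) p x)" by (simp add: S_one)
  also have "\<dots> = cnv eps p x"
  proof (rule sum_dual_linear[OF vector_space_mult _ eps_dual, of "\<lambda>q. cnv q p x"])
    show "linear_on Hd fscale (*) (\<lambda>q. cnv q p x)" unfolding cnv_def by (intro lin vector_space_mult)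
  qed
  finally show ?thesis by (simp add: cnv_eps_left p)
qed

text \<open>Suppose S(h) = 0 and let \<mu> be a nonzero integral. Then \<mu> \<cdot> h = 0, while
  its coaction is \<Sum> \<mu> \<cdot> h1 \<otimes> h2 by coinvariance of \<mu>. So \<Sum> \<mu>(x
  S(h1)) h2 = 0 for every x. Letting x depend on a further leg of h, as x0 S(S(h2)), recovers
  \<mu>(x0) h, whence h = 0.\<close>

lemma S_inj: "inj S"
proof -
  have "\<exists>p\<in>Hd. \<exists>x. integral_of p x \<noteq> 0"
  proof (rule ccontr)
    assume "\<not> ?thesis"
    then have "integral_of p x = 0" if "p \<in> Hd" for p x using that by blast
    \<comment> \<open>By \<open>integral_of_reconstruct\<close> the counit is a sum of translates of
      integrals, so it would vanish at 1.\<close>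
    then have "eps 1 = (0 :: 'k)"
      by (subst integral_of_reconstruct[symmetric]) simp_all
    then show False by (simp add: hop.counit_one)
  qed
  then obtain p x0 where p: "p \<in> Hd" and x0: "integral_of p x0 \<noteq> 0" by blast
  define \<mu> where "\<mu> = integral_of p"
  have \<mu>: "\<mu> \<in> Hd" by (simp add: \<mu>_def)
  note M = lin_dual[OF \<mu>]
  have ker: "h = 0" if h: "S h = 0" for h
  proof -
    have zero: "SWH h (\<lambda>c d. hs (\<mu> (x * S c)) d) = 0" for x
    proof -
      have "\<mu> 0 = 0" using linear_on_zero[of UNIV hs "(*)" \<mu>] \<mu> by (simp add: dual_iff)
      then have "SWH x (\<lambda>a b. hs (\<mu> (b * S h)) a) = 0" by (simp add: h SWH_def)
      moreover have "SWH h (\<lambda>c d. SWH (x * S c) (\<lambda>a b. hs (\<mu> b) a) * d) = SWH h (\<lambda>c d. hs (\<mu> (x * S c)) d)"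
        unfolding \<mu>_def by (rule SWH_cong) (simp add: integral_of_integral p hop.scale_mult_left)
      ultimately show ?thesis by (simp add: dual_coaction_action[OF \<mu>])
    qed
    let ?F = "\<lambda>c r. SWH r (\<lambda>a b. hs (\<mu> (x0 * S (S a) * S c)) b)"
    \<comment> \<open>The factor S(h1 S(h2)) is inserted; it contributes \<epsilon> of the inserted
      legs and, since S reverses products, splits into S(S(h2)) S(h1).\<close>
    have "hs (\<mu> x0) h = SWH h (\<lambda>w b. hs (eps w) (hs (\<mu> (x0 * S 1)) b))"
      by (subst SWH_counit_left) (intro lin vs_hs | simp add: S_one)+
    also have "\<dots> = SWH h (\<lambda>w b. SWH w (\<lambda>c a. hs (\<mu> (x0 * S (c * S a))) b))"
      by (rule SWH_cong, rule SWH_antipode_right[symmetric]) (intro lin M vs_hs)+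
    also have "\<dots> = SWH h (\<lambda>w b. SWH w (\<lambda>c a. hs (\<mu> (x0 * S (S a) * S c)) b))"
      by (simp add: S_mult mult.assoc)
    also have "\<dots> = SWH h (\<lambda>c r. ?F c r)"
      by (rule SWH_coassoc[OF vs_hs]) (intro lin M vs_hs)+
    \<comment> \<open>Expanding r in the basis separates its legs a, b from c: a and b become legs
      of a fixed d, and the remaining sum over c and r is the one that vanishes by
      \<open>zero\<close> at x = x0 S(S(a)).\<close>
    also have "\<dots> = SWH h (\<lambda>c r. \<Sum>d\<in>B. hs (ds d r) (?F c d))"
      by (rule SWH_cong, rule sum_ds_linear[OF vs_hs, symmetric]) (intro lin vs_hs M)
    also have "\<dots> = (\<Sum>d\<in>B. SWH d (\<lambda>a b. hs (ds d (SWH h (\<lambda>c r. hs (\<mu> (x0 * S (S a) * S c)) r))) b))"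
      unfolding SWH_sum_swap
    proof (rule sum.cong[OF refl])
      fix d
      have "SWH h (\<lambda>c r. hs (ds d r) (?F c d)) =
          SWH h (\<lambda>c r. SWH d (\<lambda>a b. hs (ds d (hs (\<mu> (x0 * S (S a) * S c)) r)) b))"
        by (simp add: SWH_scale linear_on_scale[OF lin_ds[OF lin_id], of _ UNIV] mult.commute)
      also have "\<dots> = SWH d (\<lambda>a b. SWH h (\<lambda>c r. hs (ds d (hs (\<mu> (x0 * S (S a) * S c)) r)) b))"
        by (rule SWH_swap)
      also have "\<dots> = SWH d (\<lambda>a b. hs (ds d (SWH h (\<lambda>c r. hs (\<mu> (x0 * S (S a) * S c)) r))) b)"
        by (rule SWH_cong, rule SWH_lin[symmetric, OF lin_scale_left[OF vs_hs lin_ds[OF lin_id]], of UNIV]) simp_all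
      finally show "SWH h (\<lambda>c r. hs (ds d r) (?F c d)) =
          SWH d (\<lambda>a b. hs (ds d (SWH h (\<lambda>c r. hs (\<mu> (x0 * S (S a) * S c)) r))) b)" .
    qed
    also have "\<dots> = 0"
      using linear_on_zero[OF lin_ds[OF lin_id, of UNIV]] by (simp add: zero SWH_zero)
    finally show "h = 0" using x0 by (simp add: \<mu>_def)
  qed
  interpret S: Vector_Spaces.linear hs hs S by (rule hop.antipode_linear)
  have "x - y = 0" if "S x = S y" for x y by (rule ker) (simp add: S.diff that)
  then show "inj S" by (auto intro: injI)
qed

lemma bij_S: "bij S"
  using S_inj fd.linear_inj_imp_surj[OF hop.antipode_linear] by (simp add: bij_def)

abbreviation "Si \<equiv> finv S"

lemma S_Si [simp]: "S (Si x) = x" and Si_S [simp]: "Si (S x) = x"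
  using bij_S by (simp_all add: bij_def surj_f_inv_f)

lemma S_eq_iff: "S x = S y \<longleftrightarrow> x = y"
  using S_inj by (simp add: inj_eq)

lemma Si_mult: "Si (x * y) = Si y * Si x"
  by (subst S_eq_iff[symmetric]) (simp add: S_mult)

lemma Si_one [simp]: "Si 1 = 1"
  by (subst S_eq_iff[symmetric]) (simp add: S_one)

lemma eps_Si [simp]: "eps (Si x) = eps x"
  by (metis S_Si eps_S)

lemma lin_Si [lin]: "linear_on V s hs f \<Longrightarrow> linear_on V s hs (\<lambda>x. Si (f x))"
  unfolding linear_on_def
  using linear_on_add[OF lin_S[OF lin_id], of _ UNIV] linear_on_scale[OF lin_S[OF lin_id], of _ UNIV]
  by (metis S_Si S_eq_iff UNIV_I)

text \<open>The inverse antipode is antimultiplicative, so applying it to S(h1) h2 reverses the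
  order of the legs in the antipode axiom.\<close>

lemma SWH_Si_left:
  assumes s3: "vector_space s3" and f: "linear_on UNIV hs s3 f"
  shows "SWH h (\<lambda>x y. f (Si y * x)) = s3 (eps h) (f 1)"
  using SWH_antipode_left[OF s3, of "\<lambda>z. f (Si z)" h] lin_comp[OF f lin_Si[OF lin_id]]
  by (simp add: Si_mult)

lemma SWH_Si_right:
  assumes s3: "vector_space s3" and f: "linear_on UNIV hs s3 f"
  shows "SWH h (\<lambda>x y. f (y * Si x)) = s3 (eps h) (f 1)"
  using SWH_antipode_right[OF s3, of "\<lambda>z. f (Si z)" h] lin_comp[OF f lin_Si[OF lin_id]]
  by (simp add: Si_mult)

subsection \<open>Hopf automorphisms\<close>

lemma aut_mult: "\<alpha> \<in> Aut \<Longrightarrow> \<alpha> (x * y) = \<alpha> x * \<alpha> y"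
  and aut_one: "\<alpha> \<in> Aut \<Longrightarrow> \<alpha> 1 = 1"
  and aut_eps: "\<alpha> \<in> Aut \<Longrightarrow> eps (\<alpha> x) = eps x"
  and aut_S: "\<alpha> \<in> Aut \<Longrightarrow> \<alpha> (S x) = S (\<alpha> x)"
  and aut_bij: "\<alpha> \<in> Aut \<Longrightarrow> bij \<alpha>"
  by (simp_all add: hopf_automorphisms_def)

lemma lin_aut: "\<lbrakk>\<alpha> \<in> Aut; linear_on V s hs f\<rbrakk> \<Longrightarrow> linear_on V s hs (\<lambda>x. \<alpha> (f x))"
  by (simp add: hopf_automorphisms_def linear_on_def Vector_Spaces.linear_iff)

lemma aut_inv [simp]: "\<alpha> \<in> Aut \<Longrightarrow> \<alpha> (finv \<alpha> x) = x" "\<alpha> \<in> Aut \<Longrightarrow> finv \<alpha> (\<alpha> x) = x"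
  using aut_bij by (auto simp: bij_def surj_f_inv_f)

lemma aut_comult: "\<alpha> \<in> Aut \<Longrightarrow> hcomult H (\<alpha> h) = SWH h (\<lambda>a b. tenH H (\<alpha> a) (\<alpha> b))"
proof -
  assume a: "\<alpha> \<in> Aut"
  then have "hcomult H (\<alpha> h) = swH H h (\<lambda>a b. tenH H (\<alpha> a) (\<alpha> b))"
    by (simp add: hopf_automorphisms_def)
  also have "\<dots> = SWH h (\<lambda>a b. tenH H (\<alpha> a) (\<alpha> b))"
    by (rule swH_eq[of fscale]) (intro lin lin_aut[OF a] vector_space_fscale)+
  finally show ?thesis .
qed

lemma SWH_aut:
  assumes "\<alpha> \<in> Aut" "vector_space s3"
    "\<And>b. linear_on UNIV hs s3 (\<lambda>a. F a b)" "\<And>a. linear_on UNIV hs s3 (\<lambda>b. F a b)"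
  shows "SWH (\<alpha> h) F = SWH h (\<lambda>a b. F (\<alpha> a) (\<alpha> b))"
  by (rule hcomult_SWH[OF aut_comult]) (fact assms)+

lemma AutI:
  assumes "bij \<alpha>" "linear_on UNIV hs hs \<alpha>" "\<And>x y. \<alpha> (x * y) = \<alpha> x * \<alpha> y" "\<alpha> 1 = 1"
    "\<And>x. hcomult H (\<alpha> x) = SWH x (\<lambda>a b. tenH H (\<alpha> a) (\<alpha> b))" "\<And>x. eps (\<alpha> x) = eps x" "\<And>x. \<alpha> (S x) = S (\<alpha> x)"
  shows "\<alpha> \<in> Aut"
proof -
  have "swH H x (\<lambda>a b. tenH H (\<alpha> a) (\<alpha> b)) = SWH x (\<lambda>a b. tenH H (\<alpha> a) (\<alpha> b))" for x
    by (rule swH_eq[of fscale]) (intro lin lin_comp[OF assms(2) _ UNIV_I] vector_space_fscale)+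
  then show ?thesis using assms by (simp add: hopf_automorphisms_def linear_on_UNIV_iff)
qed

lemma aut_id [simp]: "id \<in> Aut"
  by (rule AutI) (simp_all add: comult_eq id_def[symmetric], simp add: id_def lin_id)

lemma aut_comp [simp]:
  assumes a: "\<alpha> \<in> Aut" and b: "\<beta> \<in> Aut"
  shows "\<alpha> \<circ> \<beta> \<in> Aut"
proof (rule AutI)
  show "bij (\<alpha> \<circ> \<beta>)" by (rule bij_comp[OF aut_bij[OF b] aut_bij[OF a]])
  show "linear_on UNIV hs hs (\<alpha> \<circ> \<beta>)" unfolding comp_def by (intro lin_aut[OF a] lin_aut[OF b] lin)
  show "hcomult H ((\<alpha> \<circ> \<beta>) x) = SWH x (\<lambda>u v. tenH H ((\<alpha> \<circ> \<beta>) u) ((\<alpha> \<circ> \<beta>) v))" for x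
    unfolding comp_def aut_comult[OF a]
    by (rule SWH_aut[OF b vector_space_fscale]) (intro lin lin_aut[OF a])+
qed (simp_all add: a b aut_mult aut_one aut_eps aut_S)

lemma aut_finv [simp]:
  assumes a: "\<alpha> \<in> Aut"
  shows "finv \<alpha> \<in> Aut"
proof (rule AutI)
  have inj: "\<alpha> x = \<alpha> y \<longleftrightarrow> x = y" for x y using aut_bij[OF a] by (metis bij_def inj_eq)
  show "bij (finv \<alpha>)" by (rule bij_imp_bij_inv[OF aut_bij[OF a]])
  show lf: "linear_on UNIV hs hs (finv \<alpha>)"
  proof (rule linear_onI)
    fix x y c
    show "finv \<alpha> (x + y) = finv \<alpha> x + finv \<alpha> y"
      by (subst inj[symmetric]) (simp add: a linear_on_add[OF lin_aut[OF a lin_id], of _ UNIV])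
    show "finv \<alpha> (hs c x) = hs c (finv \<alpha> x)"
      by (subst inj[symmetric]) (simp add: a linear_on_scale[OF lin_aut[OF a lin_id], of _ UNIV])
  qed
  fix x y
  show "finv \<alpha> (x * y) = finv \<alpha> x * finv \<alpha> y" by (subst inj[symmetric]) (simp add: a aut_mult)
  show "finv \<alpha> 1 = 1" by (subst inj[symmetric]) (simp add: a aut_one)
  show "eps (finv \<alpha> x) = eps x" using aut_eps[OF a, of "finv \<alpha> x"] by (simp add: a)
  show "finv \<alpha> (S x) = S (finv \<alpha> x)" by (subst inj[symmetric]) (simp add: a aut_S)
  note L = lin_comp[OF lf _ UNIV_I]
  have "SWH x (\<lambda>u v. tenH H (finv \<alpha> u) (finv \<alpha> v)) = SWH (\<alpha> (finv \<alpha> x)) (\<lambda>u v. tenH H (finv \<alpha> u) (finv \<alpha> v))"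
    by (simp add: a)
  also have "\<dots> = SWH (finv \<alpha> x) (\<lambda>u v. tenH H (finv \<alpha> (\<alpha> u)) (finv \<alpha> (\<alpha> v)))"
    by (rule SWH_aut[OF a vector_space_fscale]) (intro lin L)+
  finally show "hcomult H (finv \<alpha> x) = SWH x (\<lambda>u v. tenH H (finv \<alpha> u) (finv \<alpha> v))"
    by (simp add: a comult_eq)
qed

lemma finv_comp: "\<lbrakk>\<alpha> \<in> Aut; \<beta> \<in> Aut\<rbrakk> \<Longrightarrow> finv (\<alpha> \<circ> \<beta>) = finv \<beta> \<circ> finv \<alpha>"
  by (simp add: aut_bij o_inv_distrib)

lemma finv_finv: "\<alpha> \<in> Aut \<Longrightarrow> finv (finv \<alpha>) = \<alpha>"
  by (simp add: aut_bij inv_inv_eq)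

lemma aut_Si: "\<alpha> \<in> Aut \<Longrightarrow> \<alpha> (Si x) = Si (\<alpha> x)"
  by (subst S_eq_iff[symmetric]) (simp add: aut_S[symmetric])

section \<open>The group of degrees\<close>

abbreviation "G \<equiv> GAut H"

lemma carrier_G: "carrier G = Aut \<times> Aut"
  by (simp add: GAut_def)

lemma mult_G: "(\<alpha>, \<beta>) \<otimes>\<^bsub>G\<^esub> (\<gamma>, \<delta>) = (\<delta> \<circ> \<alpha> \<circ> finv \<delta> \<circ> \<gamma>, \<delta> \<circ> \<beta>)"
  by (simp add: GAut_def)

lemma one_G: "\<one>\<^bsub>G\<^esub> = (id, id)"
  by (simp add: GAut_def)

lemma group_G: "group G"
proof (rule groupI)
  fix x y z assume "x \<in> carrier G" "y \<in> carrier G" "z \<in> carrier G"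
  then show "x \<otimes>\<^bsub>G\<^esub> y \<otimes>\<^bsub>G\<^esub> z = x \<otimes>\<^bsub>G\<^esub> (y \<otimes>\<^bsub>G\<^esub> z)"
    by (cases x; cases y; cases z) (auto simp: carrier_G mult_G finv_comp fun_eq_iff)
next
  fix x assume "x \<in> carrier G"
  then show "\<exists>y\<in>carrier G. y \<otimes>\<^bsub>G\<^esub> x = \<one>\<^bsub>G\<^esub>"
    by (cases x, intro bexI[of _ "(finv (snd x) \<circ> finv (fst x) \<circ> snd x, finv (snd x))"])
      (auto simp: carrier_G mult_G one_G fun_eq_iff)
qed (auto simp: carrier_G mult_G one_G fun_eq_iff)

lemma inv_G:
  assumes "\<alpha> \<in> Aut" "\<beta> \<in> Aut"
  shows "inv\<^bsub>G\<^esub> (\<alpha>, \<beta>) = (finv \<beta> \<circ> finv \<alpha> \<circ> \<beta>, finv \<beta>)"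
  by (rule group.inv_equality[OF group_G])
    (use assms in \<open>auto simp: carrier_G mult_G one_G fun_eq_iff\<close>)

lemma conj_G:
  assumes "\<alpha> \<in> Aut" "\<beta> \<in> Aut" "\<gamma> \<in> Aut" "\<delta> \<in> Aut"
  shows "(\<alpha>, \<beta>) \<otimes>\<^bsub>G\<^esub> (\<gamma>, \<delta>) \<otimes>\<^bsub>G\<^esub> inv\<^bsub>G\<^esub> (\<alpha>, \<beta>) =
    (finv \<beta> \<circ> \<delta> \<circ> \<alpha> \<circ> finv \<delta> \<circ> \<gamma> \<circ> finv \<alpha> \<circ> \<beta>, finv \<beta> \<circ> \<delta> \<circ> \<beta>)"
  using assms by (simp add: inv_G mult_G finv_finv fun_eq_iff)

end

section \<open>Generalized Yetter-Drinfel'd modules in coordinates\<close>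

locale yd_setting = fd_hopf H B + uni: strict_tensor_universe s \<U>
  for H :: "('k::field, 'h::ring_1) hopf_data" and B :: "'h set"
    and s :: "'k \<Rightarrow> 'v::ring_1 \<Rightarrow> 'v" and \<U> :: "'v set set"
begin

lemma vs_s [simp]: "vector_space s"
  by (rule uni.vector_space_axioms)

lemmas vss = vs_s vs_hs vector_space_mult vector_space_fscale

lemma lin_smult_left [lin]: "linear_on V s' s f \<Longrightarrow> linear_on V s' s (\<lambda>x. f x * c)"
  and lin_smult_right [lin]: "linear_on V s' s f \<Longrightarrow> linear_on V s' s (\<lambda>x. c * f x)"
  by (simp_all add: linear_on_def distrib_left distrib_right uni.scale_mult_left uni.scale_mult_right)

abbreviation "ten \<equiv> tensor_space ((*) :: 'v \<Rightarrow> 'v \<Rightarrow> 'v)"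
abbreviation "swt \<equiv> sweedler ((*) :: 'v \<Rightarrow> 'v \<Rightarrow> 'v)"

lemma ten_U: "\<lbrakk>V \<in> \<U>; W \<in> \<U>\<rbrakk> \<Longrightarrow> ten V W \<in> \<U>"
  by (rule uni.universe_tensor)

lemma subU: "V \<in> \<U> \<Longrightarrow> uni.subspace V"
  by (rule uni.universe_subspace)

lemma scale_in: "\<lbrakk>V \<in> \<U>; v \<in> V\<rbrakk> \<Longrightarrow> s c v \<in> V"
  using subU uni.subspace_scale by blast

lemma ten_in: "\<lbrakk>v \<in> V; w \<in> W\<rbrakk> \<Longrightarrow> v * w \<in> ten V W"
  unfolding tensor_space_def by (rule CollectI, rule exI[of _ "[(v, w)]"]) simp

lemma ten_ext:
  assumes "V \<in> \<U>" "W \<in> \<U>" "vector_space s3" "linear_on (ten V W) s s3 f" "linear_on (ten V W) s s3 g" "t \<in> ten V W"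
    and "\<And>a b. \<lbrakk>a \<in> V; b \<in> W\<rbrakk> \<Longrightarrow> f (a * b) = g (a * b)"
  shows "f t = g t"
  by (rule tensor_product.linear_ext[OF uni.tensor_product_universe[OF assms(1,2)] assms(3-7)])

lemma swt_mult:
  assumes "V \<in> \<U>" "W \<in> \<U>" "vector_space s3" "\<And>w. w \<in> W \<Longrightarrow> linear_on V s s3 (\<lambda>v. F v w)"
    "\<And>v. v \<in> V \<Longrightarrow> linear_on W s s3 (\<lambda>w. F v w)" "v \<in> V" "w \<in> W"
  shows "swt V W (v * w) F = F v w"
  by (rule tensor_product.sw_tau[OF uni.tensor_product_universe[OF assms(1,2)] assms(3)])
    (auto intro: bilinear_onI assms)

lemma swt_linear:
  assumes "V \<in> \<U>" "W \<in> \<U>" "vector_space s3" "\<And>w. w \<in> W \<Longrightarrow> linear_on V s s3 (\<lambda>v. F v w)"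
    "\<And>v. v \<in> V \<Longrightarrow> linear_on W s s3 (\<lambda>w. F v w)"
  shows "linear_on (ten V W) s s3 (\<lambda>x. swt V W x F)"
  by (rule tensor_product.sw_linear[OF uni.tensor_product_universe[OF assms(1,2)] assms(3)])
    (intro bilinear_onI assms)

lemma swt_in:
  assumes "V \<in> \<U>" "W \<in> \<U>" "vector_space s3" "\<And>w. w \<in> W \<Longrightarrow> linear_on V s s3 (\<lambda>v. F v w)"
    "\<And>v. v \<in> V \<Longrightarrow> linear_on W s s3 (\<lambda>w. F v w)" "module.subspace s3 X" "t \<in> ten V W"
    "\<And>v w. \<lbrakk>v \<in> V; w \<in> W\<rbrakk> \<Longrightarrow> F v w \<in> X"
  shows "swt V W t F \<in> X"
  by (rule tensor_product.sw_in[OF uni.tensor_product_universe[OF assms(1,2)] assms(3)])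
    (auto intro: bilinear_onI assms)

abbreviation "tenY \<equiv> pure_tensor s hs"
abbreviation "TY V \<equiv> tensor_space tenY V UNIV"
abbreviation "tenYHH \<equiv> (\<lambda>x c d. pure_tensor s fscale x (tenH H c d))"

lemma TY_product: "V \<in> \<U> \<Longrightarrow> tensor_product tenY s hs fscale V UNIV"
  by (rule tensor_product_pure_tensor) (simp_all add: subU)

lemma TY_subspace: "V \<in> \<U> \<Longrightarrow> module.subspace fscale (TY V)"
  by (rule tensor_product.TS_subspace[OF TY_product])

lemma TY_in: "v \<in> V \<Longrightarrow> tenY v h \<in> TY V"
  unfolding tensor_space_def by (rule CollectI, rule exI[of _ "[(v, h)]"]) simp

subsection \<open>Coactions\<close>

definition yco :: "('k, 'h, 'v) yd_module \<Rightarrow> 'h \<Rightarrow> 'v \<Rightarrow> 'v" where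
  "yco M b m = coord s (ycar M) b (ycoact M m)"

text \<open>Sweedler notation for a coaction of H as a finite sum: the comodule leg is a coordinate
  of the coaction and the leg in H is a basis element.\<close>

definition SWY :: "('k, 'h, 'v) yd_module \<Rightarrow> 'v \<Rightarrow> ('v \<Rightarrow> 'h \<Rightarrow> 'c::comm_monoid_add) \<Rightarrow> 'c" where
  "SWY M m F = (\<Sum>b\<in>B. F (yco M b m) b)"

text \<open>Isolated from the comodule axioms, because Sweedler sums over a coaction can be computed
  as soon as it is linear with values in the tensor product. They are then available when the axioms
  of a newly built module are being verified.\<close>

definition precoaction :: "('k, 'h, 'v) yd_module \<Rightarrow> bool" where
  "precoaction M \<longleftrightarrow> ycar M \<in> \<U> \<and> ycoact M \<in> ycar M \<rightarrow>\<^sub>E TY (ycar M) \<and> linear_on (ycar M) s fscale (ycoact M)"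

context
  fixes M :: "('k, 'h, 'v) yd_module"
  assumes M: "precoaction M"
begin

lemma pre_U: "ycar M \<in> \<U>"
  using M by (simp add: precoaction_def)

lemma coact_in: "m \<in> ycar M \<Longrightarrow> ycoact M m \<in> TY (ycar M)"
  using M by (auto simp: precoaction_def)

lemma lin_coact: "linear_on (ycar M) s fscale (ycoact M)"
  using M by (simp add: precoaction_def)

lemma yco_in: "m \<in> ycar M \<Longrightarrow> yco M b m \<in> ycar M"
  unfolding yco_def by (rule coord_in[OF vs_s subU[OF pre_U] coact_in])

lemma lin_yco: "\<lbrakk>linear_on V s' s f; \<And>x. x \<in> V \<Longrightarrow> f x \<in> ycar M\<rbrakk> \<Longrightarrow> linear_on V s' s (\<lambda>x. yco M b (f x))"
  unfolding yco_def
  by (rule lin_comp[OF lin_comp[OF coord_linear[OF vs_s subU[OF pre_U]] lin_coact]]) (simp_all add: coact_in)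

lemma coact_eq: "m \<in> ycar M \<Longrightarrow> ycoact M m = SWY M m tenY"
  unfolding SWY_def yco_def by (rule coord_expand[OF vs_s subU[OF pre_U] coact_in, symmetric])

lemma swY_eq:
  assumes "vector_space s3" "\<And>c. linear_on (ycar M) s s3 (\<lambda>x. F x c)"
    "\<And>x. x \<in> ycar M \<Longrightarrow> linear_on UNIV hs s3 (\<lambda>c. F x c)" "m \<in> ycar M"
  shows "swY s H M m F = SWY M m F"
  unfolding SWY_def yco_def
  by (rule sweedler_coord[OF vs_s subU[OF pre_U] assms(1)]) (auto intro: bilinear_onI assms coact_in)

lemma lin_SWY:
  assumes "vector_space s3" "linear_on V s' s f" "\<And>x. x \<in> V \<Longrightarrow> f x \<in> ycar M"
    "\<And>c. linear_on (ycar M) s s3 (\<lambda>x. F x c)"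
  shows "linear_on V s' s3 (\<lambda>x. SWY M (f x) F)"
  unfolding SWY_def by (intro lin_sum assms(1) lin_comp[OF assms(4) lin_yco] yco_in assms(2,3))

lemma lin_SWY_body:
  assumes "vector_space s3" "m \<in> ycar M" "\<And>a c. a \<in> ycar M \<Longrightarrow> linear_on V s' s3 (\<lambda>x. F x a c)"
  shows "linear_on V s' s3 (\<lambda>x. SWY M m (F x))"
  unfolding SWY_def by (intro lin_sum assms yco_in)

lemma SWY_cong: "\<lbrakk>m \<in> ycar M; \<And>a c. a \<in> ycar M \<Longrightarrow> F a c = F' a c\<rbrakk> \<Longrightarrow> SWY M m F = SWY M m F'"
  unfolding SWY_def by (intro sum.cong refl) (simp add: yco_in)

lemma SWY_in: "\<lbrakk>m \<in> ycar M; vector_space s'; module.subspace s' X; \<And>a c. a \<in> ycar M \<Longrightarrow> F a c \<in> X\<rbrakk> \<Longrightarrow> SWY M m F \<in> X"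
  unfolding SWY_def by (rule module.subspace_sum) (simp_all add: module_iff_vector_space yco_in)

lemma SWY_lin:
  assumes "m \<in> ycar M" "linear_on X s3 s4 f" "vector_space s3" "vector_space s4" "module.subspace s3 X"
    "\<And>a c. a \<in> ycar M \<Longrightarrow> F a c \<in> X"
  shows "f (SWY M m F) = SWY M m (\<lambda>a c. f (F a c))"
  unfolding SWY_def by (rule linear_on_sum[OF assms(2-5)]) (simp add: assms yco_in)

text \<open>Evaluates sums over a constructed coaction. Such a coaction is given by an explicit sum
  of elementary tensors that need not be its expansion in the basis B.\<close>

lemma SWY_tenY:
  assumes "ycoact M m = (\<Sum>i\<in>A. tenY (x i) (y i))" "\<And>i. i \<in> A \<Longrightarrow> x i \<in> ycar M"
    "\<And>c. linear_on (ycar M) s s3 (\<lambda>x. F x c)" "\<And>x. x \<in> ycar M \<Longrightarrow> linear_on UNIV hs s3 (\<lambda>c. F x c)"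
    "vector_space s3" "m \<in> ycar M"
  shows "SWY M m F = (\<Sum>i\<in>A. F (x i) (y i))"
proof -
  interpret tp: tensor_product tenY s hs fscale "ycar M" UNIV by (rule TY_product[OF pre_U])
  have "SWY M m F = swY s H M m F" by (rule swY_eq[symmetric]) (fact assms)+
  also have "\<dots> = (\<Sum>i\<in>A. F (x i) (y i))"
    unfolding assms(1) by (rule tp.sw_sum[OF assms(5)]) (auto intro: bilinear_onI assms)
  finally show ?thesis .
qed

end

lemma SWY_mult_left: "c * SWY M m F = SWY M m (\<lambda>a b. c * F a b)"
  and SWY_mult_right: "SWY M m F * c = SWY M m (\<lambda>a b. F a b * c)"
  for c :: "'r::ring"
  by (simp_all add: SWY_def sum_distrib_left sum_distrib_right)

lemma SWY_scale: "vector_space s' \<Longrightarrow> s' c (SWY M m F) = SWY M m (\<lambda>a b. s' c (F a b))"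
  unfolding SWY_def by (rule linear_on_sum[OF lin_scale[OF _ lin_id, of s' UNIV]]) simp_all

lemma SWY_swap: "SWY M m (\<lambda>a b. SWY N n (\<lambda>c d. F a b c d)) = SWY N n (\<lambda>c d. SWY M m (\<lambda>a b. F a b c d))"
  and SWY_SWH_swap: "SWY M m (\<lambda>a b. SWH g (\<lambda>c d. F'' a b c d)) = SWH g (\<lambda>c d. SWY M m (\<lambda>a b. F'' a b c d))"
  and SWY_sum_swap: "SWY M m (\<lambda>a b. \<Sum>i\<in>A. F' i a b) = (\<Sum>i\<in>A. SWY M m (F' i))"
  unfolding SWY_def SWH_def by (rule sum.swap)+

lemma comodule_iff:
  assumes M: "precoaction M"
  shows "comodule s hs UNIV (hcomult H) eps (ycar M) (ycoact M) \<longleftrightarrow>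
    (\<forall>m\<in>ycar M. SWY M m (\<lambda>x c. SWY M x (\<lambda>y d. tenYHH y d c)) = SWY M m (\<lambda>x c. SWH c (\<lambda>d e. tenYHH x d e)) \<and>
       SWY M m (\<lambda>x c. s (eps c) x) = m)"
proof -
  note [intro] = lin_SWY[OF M] lin_SWY_body[OF M] lin
  have 1: "swY s H M m (\<lambda>x c. swY s H M x (\<lambda>y d. tenYHH y d c)) = SWY M m (\<lambda>x c. SWY M x (\<lambda>y d. tenYHH y d c))"
    if m: "m \<in> ycar M" for m
  proof -
    have "swY s H M m (\<lambda>x c. swY s H M x (\<lambda>y d. tenYHH y d c)) = swY s H M m (\<lambda>x c. SWY M x (\<lambda>y d. tenYHH y d c))"
      by (rule sweedler_cong, rule swY_eq[OF M vector_space_fscale]) (auto intro!: lin)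
    also have "\<dots> = SWY M m (\<lambda>x c. SWY M x (\<lambda>y d. tenYHH y d c))"
      by (rule swY_eq[OF M vector_space_fscale]) (auto simp: m intro!: lin lin_SWY[OF M] lin_SWY_body[OF M])
    finally show ?thesis .
  qed
  have 2: "swY s H M m (\<lambda>x c. swH H c (\<lambda>d e. tenYHH x d e)) = SWY M m (\<lambda>x c. SWH c (\<lambda>d e. tenYHH x d e))"
    if m: "m \<in> ycar M" for m
  proof -
    have "swY s H M m (\<lambda>x c. swH H c (\<lambda>d e. tenYHH x d e)) = swY s H M m (\<lambda>x c. SWH c (\<lambda>d e. tenYHH x d e))"
      by (rule sweedler_cong, rule swH_eq[OF vector_space_fscale]) (auto intro!: lin)
    also have "\<dots> = SWY M m (\<lambda>x c. SWH c (\<lambda>d e. tenYHH x d e))"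
      by (rule swY_eq[OF M vector_space_fscale]) (auto simp: m intro!: lin)
    finally show ?thesis .
  qed
  have 3: "swY s H M m (\<lambda>x c. s (eps c) x) = SWY M m (\<lambda>x c. s (eps c) x)" if "m \<in> ycar M" for m
    by (rule swY_eq[OF M vs_s]) (auto simp: that intro!: lin)
  show ?thesis
    using M by (simp add: comodule_def precoaction_def 1 2 3 cong: ball_cong)
qed

subsection \<open>Modules\<close>

abbreviation "yd M \<equiv> M \<in> yd_modules s \<U> H"

lemma yd_precoaction: "yd M \<Longrightarrow> precoaction M"
  by (auto simp: yd_modules_def precoaction_def comodule_def)

context
  fixes M :: "('k, 'h, 'v) yd_module"
  assumes M: "yd M"
begin

lemma yd_U: "ycar M \<in> \<U>"
  using M by (simp add: yd_modules_def)

lemma yd_deg: "ydeg M \<in> carrier G"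
  using M by (simp add: yd_modules_def)

lemma act_in: "m \<in> ycar M \<Longrightarrow> yact M h m \<in> ycar M"
  using M by (auto simp: yd_modules_def)

lemma act_ext: "yact M h \<in> extensional (ycar M)"
  using M by (auto simp: yd_modules_def PiE_def)

lemma act_one: "m \<in> ycar M \<Longrightarrow> yact M 1 m = m"
  using M by (auto simp: yd_modules_def)

lemma act_mult: "m \<in> ycar M \<Longrightarrow> yact M (g * h) m = yact M g (yact M h m)"
  using M by (auto simp: yd_modules_def)

lemma lin_act: "\<lbrakk>linear_on V s' s f; \<And>x. x \<in> V \<Longrightarrow> f x \<in> ycar M\<rbrakk> \<Longrightarrow> linear_on V s' s (\<lambda>x. yact M h (f x))"
  using M by (auto simp: yd_modules_def linear_on_def)

lemma lin_act_h: "\<lbrakk>m \<in> ycar M; linear_on V s' hs f\<rbrakk> \<Longrightarrow> linear_on V s' s (\<lambda>x. yact M (f x) m)"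
  using M by (auto simp: yd_modules_def linear_on_def)

lemma SWY_counit:
  assumes "vector_space s3" "linear_on (ycar M) s s3 f" "m \<in> ycar M"
  shows "SWY M m (\<lambda>x c. s3 (eps c) (f x)) = f m"
proof -
  have pre: "precoaction M" by (rule yd_precoaction[OF M])
  have "f m = f (SWY M m (\<lambda>x c. s (eps c) x))"
    using M assms(3) by (simp add: yd_modules_def comodule_iff[OF pre])
  also have "\<dots> = SWY M m (\<lambda>x c. f (s (eps c) x))"
    by (rule SWY_lin[OF pre assms(3,2)]) (simp_all add: assms subU yd_U scale_in)
  also have "\<dots> = SWY M m (\<lambda>x c. s3 (eps c) (f x))"
    by (rule SWY_cong[OF pre assms(3)]) (simp add: linear_on_scale[OF assms(2)])
  finally show ?thesis by simp
qed

text \<open>As for \<open>SWH_coassoc\<close>: F induces a linear function on M \<otimes> (H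
  \<otimes> H), which is applied to both sides of the axiom.\<close>

lemma SWY_coassoc:
  assumes s3: "vector_space s3"
    and F: "\<And>c d. linear_on (ycar M) s s3 (\<lambda>x. F x c d)" "\<And>x d. x \<in> ycar M \<Longrightarrow> linear_on UNIV hs s3 (\<lambda>c. F x c d)"
      "\<And>x c. x \<in> ycar M \<Longrightarrow> linear_on UNIV hs s3 (\<lambda>d. F x c d)"
    and m: "m \<in> ycar M"
  shows "SWY M m (\<lambda>x c. SWY M x (\<lambda>y d. F y d c)) = SWY M m (\<lambda>x c. SWH c (\<lambda>d e. F x d e))"
proof -
  have pre: "precoaction M" by (rule yd_precoaction[OF M])
  interpret t: tensor_product "tenH H" hs hs fscale UNIV UNIV
    by (rule tensor_product_pure_tensor) simp_all
  interpret T: tensor_product "pure_tensor s fscale" s fscale fscale "ycar M" "tensor_space (tenH H) UNIV UNIV"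
    by (rule tensor_product_pure_tensor) (simp_all add: t.TS_subspace subU yd_U)
  let ?G = "\<lambda>x t. sweedler (tenH H) UNIV UNIV t (F x)"
  have bF: "bilinear_on UNIV UNIV hs hs s3 (F x)" if "x \<in> ycar M" for x by (intro bilinear_onI F that)
  have G: "bilinear_on (ycar M) (tensor_space (tenH H) UNIV UNIV) s fscale s3 ?G"
  proof (rule bilinear_onI)
    fix w assume w: "w \<in> tensor_space (tenH H) UNIV UNIV"
    \<comment> \<open>The summand F v is known to be bilinear only for v in the carrier, so
      linearity in v is proved for the coordinate form first and transferred afterwards.\<close>
    have "linear_on (ycar M) s s3 (\<lambda>v. \<Sum>b\<in>B. F v (coord hs UNIV b w) b)"
      by (intro lin_sum s3 F)
    then show "linear_on (ycar M) s s3 (\<lambda>v. sweedler (tenH H) UNIV UNIV w (F v))"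
      by (simp add: linear_on_def sweedler_coord[OF _ _ s3 bF w] uni.subspace_add[OF subU[OF yd_U]]
        uni.subspace_scale[OF subU[OF yd_U]])
  qed (rule t.sw_linear[OF s3 bF])
  have in1: "tenYHH x y z \<in> T.TS" if "x \<in> ycar M" for x y z
    using that by (intro T.tensor_in t.tensor_in) simp_all
  have T_eq: "T.sw (tenYHH x y z) ?G = F x y z" if "x \<in> ycar M" for x y z
    using that by (subst T.sw_tau[OF s3 G]) (simp_all add: t.tensor_in t.sw_tau[OF s3 bF])
  note LG = T.sw_linear[OF s3 G]
  have eq: "SWY M m (\<lambda>x c. SWY M x (\<lambda>y d. tenYHH y d c)) = SWY M m (\<lambda>x c. SWH c (\<lambda>d e. tenYHH x d e))"
    using M m by (simp add: yd_modules_def comodule_iff[OF pre])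
  have "SWY M m (\<lambda>x c. SWY M x (\<lambda>y d. F y d c)) = SWY M m (\<lambda>x c. T.sw (SWY M x (\<lambda>y d. tenYHH y d c)) ?G)"
  proof (rule SWY_cong[OF pre m])
    fix x c assume x: "x \<in> ycar M"
    have "T.sw (SWY M x (\<lambda>y d. tenYHH y d c)) ?G = SWY M x (\<lambda>y d. T.sw (tenYHH y d c) ?G)"
      by (rule SWY_lin[OF pre x LG]) (simp_all add: s3 T.TS_subspace in1)
    also have "\<dots> = SWY M x (\<lambda>y d. F y d c)"
      by (rule SWY_cong[OF pre x]) (rule T_eq)
    finally show "SWY M x (\<lambda>y d. F y d c) = T.sw (SWY M x (\<lambda>y d. tenYHH y d c)) ?G" by simp
  qed
  also have "\<dots> = T.sw (SWY M m (\<lambda>x c. SWY M x (\<lambda>y d. tenYHH y d c))) ?G"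
    by (rule SWY_lin[OF pre m LG, symmetric])
      (simp_all add: s3 T.TS_subspace in1 SWY_in[OF pre _ vector_space_fscale T.TS_subspace])
  also have "\<dots> = SWY M m (\<lambda>x c. T.sw (SWH c (\<lambda>d e. tenYHH x d e)) ?G)"
    unfolding eq by (rule SWY_lin[OF pre m LG])
      (simp_all add: s3 T.TS_subspace in1 SWH_in[OF vector_space_fscale T.TS_subspace])
  also have "\<dots> = SWY M m (\<lambda>x c. SWH c (\<lambda>d e. F x d e))"
  proof (rule SWY_cong[OF pre m])
    fix x c assume x: "x \<in> ycar M"
    have "T.sw (SWH c (\<lambda>d e. tenYHH x d e)) ?G = SWH c (\<lambda>d e. T.sw (tenYHH x d e) ?G)"
      by (rule SWH_lin[OF LG]) (simp_all add: s3 T.TS_subspace in1 x)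
    then show "T.sw (SWH c (\<lambda>d e. tenYHH x d e)) ?G = SWH c (\<lambda>d e. F x d e)"
      by (simp add: T_eq x)
  qed
  finally show ?thesis .
qed

lemma SWY_yd:
  assumes deg: "ydeg M = (\<alpha>, \<beta>)" and s3: "vector_space s3"
    and F: "\<And>c. linear_on (ycar M) s s3 (\<lambda>x. F x c)" "\<And>x. x \<in> ycar M \<Longrightarrow> linear_on UNIV hs s3 (\<lambda>c. F x c)"
    and m: "m \<in> ycar M"
  shows "SWH h (\<lambda>h1 h2. SWY M m (\<lambda>m0 m1. F (yact M h1 m0) (\<beta> h2 * m1))) =
    SWH h (\<lambda>h1 h2. SWY M (yact M h2 m) (\<lambda>m0 m1. F m0 (m1 * \<alpha> h1)))"
proof -
  have pre: "precoaction M" by (rule yd_precoaction[OF M])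
  have ab: "\<alpha> \<in> Aut" "\<beta> \<in> Aut" using yd_deg deg by (auto simp: carrier_G)
  interpret tp: tensor_product tenY s hs fscale "ycar M" UNIV by (rule TY_product[OF yd_U])
  have bF: "bilinear_on (ycar M) UNIV s hs s3 F" by (intro bilinear_onI F)
  note LF = tp.sw_linear[OF s3 bF]
  note L = lin lin_aut[OF ab(1)] lin_aut[OF ab(2)] lin_act lin_act_h lin_SWY[OF pre] lin_SWY_body[OF pre]
  let ?T1 = "\<lambda>h1 h2 m0 m1. tenY (yact M h1 m0) (\<beta> h2 * m1)"
  let ?T2 = "\<lambda>h1 m0 m1. tenY m0 (m1 * \<alpha> h1)"
  have "swH H h (\<lambda>h1 h2. swY s H M m (?T1 h1 h2)) = swH H h (\<lambda>h1 h2. SWY M m (?T1 h1 h2))"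
    by (rule sweedler_cong, rule swY_eq[OF pre vector_space_fscale]) (intro L act_in m | simp)+
  also have "\<dots> = SWH h (\<lambda>h1 h2. SWY M m (?T1 h1 h2))"
    by (rule swH_eq[OF vector_space_fscale]) (intro L act_in m | simp)+
  finally have 1: "swH H h (\<lambda>h1 h2. swY s H M m (?T1 h1 h2)) = SWH h (\<lambda>h1 h2. SWY M m (?T1 h1 h2))" .
  have "swH H h (\<lambda>h1 h2. swY s H M (yact M h2 m) (?T2 h1)) = swH H h (\<lambda>h1 h2. SWY M (yact M h2 m) (?T2 h1))"
    by (rule sweedler_cong, rule swY_eq[OF pre vector_space_fscale]) (intro L act_in m | simp)+
  also have "\<dots> = SWH h (\<lambda>h1 h2. SWY M (yact M h2 m) (?T2 h1))"
    by (rule swH_eq[OF vector_space_fscale]) (intro L act_in m | simp)+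
  finally have 2: "swH H h (\<lambda>h1 h2. swY s H M (yact M h2 m) (?T2 h1)) = SWH h (\<lambda>h1 h2. SWY M (yact M h2 m) (?T2 h1))" .
  have eq: "SWH h (\<lambda>h1 h2. SWY M m (?T1 h1 h2)) = SWH h (\<lambda>h1 h2. SWY M (yact M h2 m) (?T2 h1))"
    unfolding 1[symmetric] 2[symmetric] using M deg m by (simp add: yd_modules_def)
  have push: "tp.sw (SWY M n K) F = SWY M n (\<lambda>a c. tp.sw (K a c) F)"
    if "n \<in> ycar M" "\<And>a c. a \<in> ycar M \<Longrightarrow> K a c \<in> tp.TS" for n K
    by (rule SWY_lin[OF pre that(1) LF]) (simp_all add: s3 tp.TS_subspace that)
  have "SWH h (\<lambda>h1 h2. SWY M m (\<lambda>m0 m1. F (yact M h1 m0) (\<beta> h2 * m1))) =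
      SWH h (\<lambda>h1 h2. tp.sw (SWY M m (?T1 h1 h2)) F)"
    by (rule SWH_cong, subst push[OF m])
      (auto intro!: TY_in act_in SWY_cong[OF pre m] simp: tp.sw_tau[OF s3 bF] act_in)
  also have "\<dots> = tp.sw (SWH h (\<lambda>h1 h2. SWY M m (?T1 h1 h2))) F"
    by (rule SWH_lin[OF LF, symmetric])
      (auto intro!: SWY_in[OF pre] TY_in act_in s3 tp.TS_subspace m)
  also have "\<dots> = SWH h (\<lambda>h1 h2. tp.sw (SWY M (yact M h2 m) (?T2 h1)) F)"
    unfolding eq by (rule SWH_lin[OF LF])
      (auto intro!: SWY_in[OF pre] TY_in act_in s3 tp.TS_subspace m)
  also have "\<dots> = SWH h (\<lambda>h1 h2. SWY M (yact M h2 m) (\<lambda>m0 m1. F m0 (m1 * \<alpha> h1)))"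
    by (rule SWH_cong, subst push[OF act_in[OF m]])
      (auto intro!: TY_in act_in SWY_cong[OF pre] m simp: tp.sw_tau[OF s3 bF])
  finally show ?thesis .
qed

end

lemma yd_modulesI:
  assumes pre: "precoaction M" and deg: "ydeg M = (\<alpha>, \<beta>)" "\<alpha> \<in> Aut" "\<beta> \<in> Aut"
    and act: "\<And>h. yact M h \<in> ycar M \<rightarrow>\<^sub>E ycar M" "\<And>h. linear_on (ycar M) s s (yact M h)"
      "\<And>m. m \<in> ycar M \<Longrightarrow> linear_on UNIV hs s (\<lambda>h. yact M h m)"
      "\<And>m. m \<in> ycar M \<Longrightarrow> yact M 1 m = m" "\<And>g h m. m \<in> ycar M \<Longrightarrow> yact M (g * h) m = yact M g (yact M h m)"
    and coassoc: "\<And>m. m \<in> ycar M \<Longrightarrow>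
      SWY M m (\<lambda>x c. SWY M x (\<lambda>y d. tenYHH y d c)) = SWY M m (\<lambda>x c. SWH c (\<lambda>d e. tenYHH x d e))"
    and counit: "\<And>m. m \<in> ycar M \<Longrightarrow> SWY M m (\<lambda>x c. s (eps c) x) = m"
    and compat: "\<And>h m. m \<in> ycar M \<Longrightarrow> SWH h (\<lambda>h1 h2. SWY M m (\<lambda>m0 m1. tenY (yact M h1 m0) (\<beta> h2 * m1))) =
      SWH h (\<lambda>h1 h2. SWY M (yact M h2 m) (\<lambda>m0 m1. tenY m0 (m1 * \<alpha> h1)))"
  shows "yd M"
proof -
  have act_in: "yact M h m \<in> ycar M" if "m \<in> ycar M" for h m using act(1) that by auto
  note L = lin lin_aut[OF deg(2)] lin_aut[OF deg(3)] lin_comp[OF act(2)] lin_comp[OF act(3) _ UNIV_I]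
    lin_SWY[OF pre] lin_SWY_body[OF pre] vector_space_fscale
  have "swH H h (\<lambda>h1 h2. swY s H M m (\<lambda>m0 m1. tenY (yact M h1 m0) (\<beta> h2 * m1))) =
      SWH h (\<lambda>h1 h2. SWY M m (\<lambda>m0 m1. tenY (yact M h1 m0) (\<beta> h2 * m1)))"
    if m: "m \<in> ycar M" for m h
  proof -
    have "swH H h (\<lambda>h1 h2. swY s H M m (\<lambda>m0 m1. tenY (yact M h1 m0) (\<beta> h2 * m1))) =
      swH H h (\<lambda>h1 h2. SWY M m (\<lambda>m0 m1. tenY (yact M h1 m0) (\<beta> h2 * m1)))"
      by (rule sweedler_cong, rule swY_eq[OF pre vector_space_fscale]) (intro L act_in m | simp)+
    also have "\<dots> = SWH h (\<lambda>h1 h2. SWY M m (\<lambda>m0 m1. tenY (yact M h1 m0) (\<beta> h2 * m1)))"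
      by (rule swH_eq[OF vector_space_fscale]) (intro L act_in m | simp)+
    finally show ?thesis .
  qed
  moreover have "swH H h (\<lambda>h1 h2. swY s H M (yact M h2 m) (\<lambda>m0 m1. tenY m0 (m1 * \<alpha> h1))) =
      SWH h (\<lambda>h1 h2. SWY M (yact M h2 m) (\<lambda>m0 m1. tenY m0 (m1 * \<alpha> h1)))"
    if m: "m \<in> ycar M" for m h
  proof -
    have "swH H h (\<lambda>h1 h2. swY s H M (yact M h2 m) (\<lambda>m0 m1. tenY m0 (m1 * \<alpha> h1))) =
      swH H h (\<lambda>h1 h2. SWY M (yact M h2 m) (\<lambda>m0 m1. tenY m0 (m1 * \<alpha> h1)))"
      by (rule sweedler_cong, rule swY_eq[OF pre vector_space_fscale]) (intro L act_in m | simp)+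
    also have "\<dots> = SWH h (\<lambda>h1 h2. SWY M (yact M h2 m) (\<lambda>m0 m1. tenY m0 (m1 * \<alpha> h1)))"
      by (rule swH_eq[OF vector_space_fscale]) (intro L act_in m | simp)+
    finally show ?thesis .
  qed
  moreover have "comodule s hs UNIV (hcomult H) eps (ycar M) (ycoact M)"
    unfolding comodule_iff[OF pre] using coassoc counit by blast
  ultimately show ?thesis
    using assms by (simp add: yd_modules_def carrier_G pre_U)
qed

end

context yd_setting
begin

lemmas yd_lin = lin_act lin_act_h lin_SWY[OF yd_precoaction] lin_SWY_body[OF yd_precoaction]
lemmas yd_SWY_cong = SWY_cong[OF yd_precoaction]

lemma SWY_single:
  assumes "precoaction M" "ycoact M m = tenY x y" "x \<in> ycar M"
    "\<And>c. linear_on (ycar M) s s3 (\<lambda>x. F x c)" "\<And>x. x \<in> ycar M \<Longrightarrow> linear_on UNIV hs s3 (\<lambda>c. F x c)"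
    "vector_space s3" "m \<in> ycar M"
  shows "SWY M m F = F x y"
  by (subst SWY_tenY[OF assms(1), where A = "{()}" and x = "\<lambda>_. x" and y = "\<lambda>_. y", OF _ _ assms(4-7)])
    (use assms in simp_all)

subsection \<open>The unit object\<close>

abbreviation "yunit \<equiv> yd_unit s H"

lemma unit_sel: "ydeg yunit = (id, id)" "ycar yunit = uni.span {1}"
  "x \<in> uni.span {1} \<Longrightarrow> yact yunit h x = s (eps h) x" "x \<in> uni.span {1} \<Longrightarrow> ycoact yunit x = tenY x 1"
  by (simp_all add: yd_unit_def)

lemma unit_precoaction: "precoaction yunit"
  unfolding precoaction_def yd_unit_def
  by (auto intro!: uni.universe_unit TY_in
      simp: linear_on_def uni.span_add uni.span_scale pure_tensor_add_left pure_tensor_scale_left)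

lemma SWY_unit:
  assumes "x \<in> uni.span {1}" "vector_space s3"
    "\<And>c. linear_on (uni.span {1}) s s3 (\<lambda>x. F x c)" "\<And>x. x \<in> uni.span {1} \<Longrightarrow> linear_on UNIV hs s3 (\<lambda>c. F x c)"
  shows "SWY yunit x F = F x 1"
  by (rule SWY_single[OF unit_precoaction]) (use assms in \<open>auto simp: unit_sel\<close>)

lemma yd_unit_yd: "yd yunit"
proof (rule yd_modulesI[OF unit_precoaction unit_sel(1) aut_id aut_id], unfold unit_sel(2))
  have sc: "s c x \<in> uni.span {1}" if "x \<in> uni.span {1}" for c x using that by (rule uni.span_scale)
  show "yact yunit h \<in> uni.span {1} \<rightarrow>\<^sub>E uni.span {1}" for h
    by (auto simp: yd_unit_def sc)
  show "linear_on (uni.span {1}) s s (yact yunit h)" for h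
    by (auto simp: linear_on_def unit_sel sc uni.span_add uni.scale_right_distrib mult.commute)
  fix m assume m: "m \<in> uni.span {1}"
  show "linear_on UNIV hs s (\<lambda>h. yact yunit h m)"
    unfolding unit_sel(3)[OF m] by (intro lin vs_s)
  show "yact yunit 1 m = m" by (simp add: unit_sel m hop.counit_one)
  show "yact yunit (g * h) m = yact yunit g (yact yunit h m)" for g h
    by (simp add: unit_sel m hop.counit_mult sc)
  show "SWY yunit m (\<lambda>x c. s (eps c) x) = m"
    by (subst SWY_unit[OF m vs_s]) (intro lin vs_s | simp add: hop.counit_one)+
  show "SWY yunit m (\<lambda>x c. SWY yunit x (\<lambda>y d. tenYHH y d c)) = SWY yunit m (\<lambda>x c. SWH c (\<lambda>d e. tenYHH x d e))"
  proof -
    have "SWY yunit m (\<lambda>x c. SWY yunit x (\<lambda>y d. tenYHH y d c)) = SWY yunit m (\<lambda>x c. tenYHH x 1 c)"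
      by (rule SWY_cong[OF unit_precoaction], unfold unit_sel, rule m, rule SWY_unit[OF _ vector_space_fscale]) (intro lin vss | simp)+
    also have "\<dots> = tenYHH m 1 1" by (rule SWY_unit[OF m vector_space_fscale]) (intro lin vss)+
    also have "\<dots> = SWH 1 (\<lambda>d e. tenYHH m d e)" by (rule SWH_one[OF vector_space_fscale, symmetric]) (intro lin vss)+
    also have "\<dots> = SWY yunit m (\<lambda>x c. SWH c (\<lambda>d e. tenYHH x d e))"
      by (rule SWY_unit[OF m vector_space_fscale, symmetric]) (intro lin vss)+
    finally show ?thesis .
  qed
  show "SWH h (\<lambda>h1 h2. SWY yunit m (\<lambda>m0 m1. tenY (yact yunit h1 m0) (id h2 * m1))) =
      SWH h (\<lambda>h1 h2. SWY yunit (yact yunit h2 m) (\<lambda>m0 m1. tenY m0 (m1 * id h1)))" for h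
  proof -
    have "SWH h (\<lambda>h1 h2. SWY yunit m (\<lambda>m0 m1. tenY (yact yunit h1 m0) (id h2 * m1))) =
        SWH h (\<lambda>h1 h2. SWY yunit m (\<lambda>m0 m1. tenY (s (eps h1) m0) (h2 * m1)))"
      by (rule SWH_cong, rule SWY_cong[OF unit_precoaction]) (simp_all add: unit_sel m)
    also have "\<dots> = SWH h (\<lambda>h1 h2. fscale (eps h1) (tenY m h2))"
      by (rule SWH_cong, subst SWY_unit[OF m vector_space_fscale]) (intro lin vss | simp add: pure_tensor_scale_left)+
    also have "\<dots> = tenY m h" by (rule SWH_counit_left[OF vector_space_fscale]) (intro lin)
    also have "\<dots> = SWH h (\<lambda>h1 h2. fscale (eps h2) (tenY m h1))"
      by (rule SWH_counit_right[OF vector_space_fscale, symmetric]) (intro lin)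
    also have "\<dots> = SWH h (\<lambda>h1 h2. SWY yunit (s (eps h2) m) (\<lambda>m0 m1. tenY m0 (m1 * h1)))"
      by (rule SWH_cong, subst SWY_unit[OF sc[OF m] vector_space_fscale]) (intro lin vss | simp add: pure_tensor_scale_left)+
    finally show ?thesis by (simp add: unit_sel m)
  qed
qed

subsection \<open>Conjugation\<close>

abbreviation "yconj \<equiv> yd_conj s H"

lemma conj_sel: "ydeg (yconj a N) = a \<otimes>\<^bsub>G\<^esub> ydeg N \<otimes>\<^bsub>G\<^esub> inv\<^bsub>G\<^esub> a" "ycar (yconj a N) = ycar N"
  "yact (yconj (\<alpha>, \<beta>) N) h = yact N (finv \<alpha> (\<beta> h))"
  by (simp_all add: yd_conj_def split: prod.splits)

context
  fixes N \<alpha> \<beta> \<gamma> \<delta>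
  assumes N: "yd N" and deg: "ydeg N = (\<gamma>, \<delta>)" and a: "\<alpha> \<in> Aut" and b: "\<beta> \<in> Aut"
begin

private abbreviation (input) "\<theta> \<equiv> finv \<beta> \<circ> \<delta> \<circ> \<alpha> \<circ> finv \<delta>"
private abbreviation (input) "\<phi> \<equiv> finv \<alpha> \<circ> \<beta>"
private abbreviation (input) "N' \<equiv> yconj (\<alpha>, \<beta>) N"

lemma conj_auts: "\<gamma> \<in> Aut" "\<delta> \<in> Aut" "\<theta> \<in> Aut" "\<phi> \<in> Aut"
proof -
  show "\<gamma> \<in> Aut" "\<delta> \<in> Aut" using yd_deg[OF N] deg by (auto simp: carrier_G)
  then show "\<theta> \<in> Aut" "\<phi> \<in> Aut" using a b by simp_all
qed

lemma conj_coact: "n \<in> ycar N \<Longrightarrow> ycoact N' n = SWY N n (\<lambda>x c. tenY x (\<theta> c))"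
proof -
  assume n: "n \<in> ycar N"
  show ?thesis
    unfolding yd_conj_def using deg n
    by (simp, intro swY_eq[OF yd_precoaction[OF N] vector_space_fscale])
      (intro lin lin_aut[OF conj_auts(3), unfolded comp_def] n | simp)+
qed

lemma conj_precoaction: "precoaction N'"
  unfolding precoaction_def conj_sel
proof (intro conjI)
  note L = lin yd_lin[OF N] lin_aut[OF conj_auts(3)] vss
  show "ycar N \<in> \<U>" by (rule yd_U[OF N])
  show "ycoact N' \<in> ycar N \<rightarrow>\<^sub>E TY (ycar N)"
  proof (rule PiE_I)
    fix n assume n: "n \<in> ycar N"
    show "ycoact N' n \<in> TY (ycar N)"
      unfolding conj_coact[OF n]
      by (rule SWY_in[OF yd_precoaction[OF N] n vector_space_fscale TY_subspace[OF yd_U[OF N]]]) (rule TY_in)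
  qed (simp add: yd_conj_def deg)
  have "linear_on (ycar N) s fscale (\<lambda>n. SWY N n (\<lambda>x c. tenY x (\<theta> c)))"
    by (intro L)
  then show "linear_on (ycar N) s fscale (ycoact N')"
    by (simp add: linear_on_def conj_coact uni.subspace_add[OF subU[OF yd_U[OF N]]] scale_in[OF yd_U[OF N]])
qed

lemma SWY_conj:
  assumes "n \<in> ycar N" "vector_space s3" "\<And>c. linear_on (ycar N) s s3 (\<lambda>x. F x c)"
    "\<And>x. x \<in> ycar N \<Longrightarrow> linear_on UNIV hs s3 (\<lambda>c. F x c)"
  shows "SWY N' n F = SWY N n (\<lambda>x c. F x (\<theta> c))"
  unfolding SWY_def[of N n]
  by (rule SWY_tenY[OF conj_precoaction])
    (use assms yco_in[OF yd_precoaction[OF N]] in \<open>auto simp: conj_sel conj_coact SWY_def\<close>)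

text \<open>The condition for the conjugate at h is the condition for N at \<phi>(h) with \<theta>
  applied to the factor in H, where \<phi> twists the action and \<theta> the coaction.\<close>

lemma yd_conj_yd: "yd N'"
proof -
  \<comment> \<open>Opaque names keep the composites together, so that the rules for automorphisms
    see each of them as one map.\<close>
  define \<theta>' \<phi>' where "\<theta>' = \<theta>" and "\<phi>' = \<phi>"
  have \<theta>: "\<theta>' \<in> Aut" and \<phi>: "\<phi>' \<in> Aut" using conj_auts by (simp_all add: \<theta>'_def \<phi>'_def)
  note S = SWY_conj[folded \<theta>'_def]
  have act: "yact N' h = yact N (\<phi>' h)" for h by (simp add: conj_sel \<phi>'_def)
  note P' = conj_precoaction
  note L = lin yd_lin[OF N] lin_aut[OF \<theta>] lin_aut[OF \<phi>] lin_aut[OF conj_auts(1)] lin_aut[OF conj_auts(2)]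
    lin_SWY[OF P', unfolded conj_sel] lin_SWY_body[OF P', unfolded conj_sel] vss act_in[OF N]
  have d: "ydeg N' = (finv \<beta> \<circ> \<delta> \<circ> \<alpha> \<circ> finv \<delta> \<circ> \<gamma> \<circ> finv \<alpha> \<circ> \<beta>, finv \<beta> \<circ> \<delta> \<circ> \<beta>)"
    by (simp add: conj_sel deg conj_G a b conj_auts)
  show ?thesis
  proof (rule yd_modulesI[OF P' d], unfold conj_sel(2) act)
    show "finv \<beta> \<circ> \<delta> \<circ> \<alpha> \<circ> finv \<delta> \<circ> \<gamma> \<circ> finv \<alpha> \<circ> \<beta> \<in> Aut" "finv \<beta> \<circ> \<delta> \<circ> \<beta> \<in> Aut"
      using a b conj_auts(1,2) by simp_all
    show "yact N (\<phi>' h) \<in> ycar N \<rightarrow>\<^sub>E ycar N" for h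
      using act_in[OF N] act_ext[OF N] by (auto simp: PiE_def)
    show "linear_on (ycar N) s s (yact N (\<phi>' h))" for h
      using lin_act[OF N lin_id] by simp
    fix n assume n: "n \<in> ycar N"
    show "linear_on UNIV hs s (\<lambda>h. yact N (\<phi>' h) n)" by (intro L n)
    show "yact N (\<phi>' 1) n = n" by (simp add: aut_one[OF \<phi>] act_one[OF N n])
    show "yact N (\<phi>' (g * h)) n = yact N (\<phi>' g) (yact N (\<phi>' h) n)" for g h
      by (simp add: aut_mult[OF \<phi>] act_mult[OF N n])
    show "SWY N' n (\<lambda>x c. s (eps c) x) = n"
      by (subst S[OF n vs_s]) (intro L | simp add: aut_eps[OF \<theta>] SWY_counit[OF N vs_s lin_id n])+
    show "SWY N' n (\<lambda>x c. SWY N' x (\<lambda>y d. tenYHH y d c)) = SWY N' n (\<lambda>x c. SWH c (\<lambda>d e. tenYHH x d e))"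
    proof -
      have "SWY N' n (\<lambda>x c. SWY N' x (\<lambda>y d. tenYHH y d c)) = SWY N n (\<lambda>x c. SWY N' x (\<lambda>y d. tenYHH y d (\<theta>' c)))"
        by (rule S[OF n vector_space_fscale]) (intro L | simp)+
      also have "\<dots> = SWY N n (\<lambda>x c. SWY N x (\<lambda>y d. tenYHH y (\<theta>' d) (\<theta>' c)))"
        by (rule yd_SWY_cong[OF N n], rule S[OF _ vector_space_fscale]) (intro L | simp)+
      also have "\<dots> = SWY N n (\<lambda>x c. SWH c (\<lambda>d e. tenYHH x (\<theta>' d) (\<theta>' e)))"
        by (rule SWY_coassoc[OF N vector_space_fscale _ _ _ n]) (intro L | simp)+
      also have "\<dots> = SWY N n (\<lambda>x c. SWH (\<theta>' c) (\<lambda>d e. tenYHH x d e))"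
        by (rule yd_SWY_cong[OF N n], rule SWH_aut[OF \<theta> vector_space_fscale, symmetric]) (intro L)+
      also have "\<dots> = SWY N' n (\<lambda>x c. SWH c (\<lambda>d e. tenYHH x d e))"
        by (rule S[OF n vector_space_fscale, symmetric]) (intro L | simp)+
      finally show ?thesis .
    qed
    fix h
    \<comment> \<open>These two identities account for the degree of the conjugate: once \<theta> is
      pulled out, its components turn back into \<delta> and \<gamma>, evaluated at
      \<phi>(x).\<close>
    have e1: "(finv \<beta> \<circ> \<delta> \<circ> \<beta>) x * \<theta>' y = \<theta>' (\<delta> (\<phi>' x) * y)" for x y
      by (simp add: aut_mult[OF \<theta>]) (simp add: \<theta>'_def \<phi>'_def a b conj_auts)
    have e2: "\<theta>' y * (finv \<beta> \<circ> \<delta> \<circ> \<alpha> \<circ> finv \<delta> \<circ> \<gamma> \<circ> finv \<alpha> \<circ> \<beta>) x = \<theta>' (y * \<gamma> (\<phi>' x))" for x y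
      by (simp add: aut_mult[OF \<theta>]) (simp add: \<theta>'_def \<phi>'_def a b conj_auts)
    have "SWH h (\<lambda>h1 h2. SWY N' n (\<lambda>m0 m1. tenY (yact N (\<phi>' h1) m0) ((finv \<beta> \<circ> \<delta> \<circ> \<beta>) h2 * m1))) =
        SWH h (\<lambda>h1 h2. SWY N n (\<lambda>m0 m1. tenY (yact N (\<phi>' h1) m0) (\<theta>' (\<delta> (\<phi>' h2) * m1))))"
      unfolding e1[symmetric] by (rule SWH_cong, rule S[OF n vector_space_fscale]) (intro L | simp)+
    also have "\<dots> = SWH (\<phi>' h) (\<lambda>h1 h2. SWY N n (\<lambda>m0 m1. tenY (yact N h1 m0) (\<theta>' (\<delta> h2 * m1))))"
      by (rule SWH_aut[OF \<phi> vector_space_fscale, symmetric]) (intro L n | simp)+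
    also have "\<dots> = SWH (\<phi>' h) (\<lambda>h1 h2. SWY N (yact N h2 n) (\<lambda>m0 m1. tenY m0 (\<theta>' (m1 * \<gamma> h1))))"
      by (rule SWY_yd[OF N deg vector_space_fscale _ _ n]) (intro L | simp)+
    also have "\<dots> = SWH h (\<lambda>h1 h2. SWY N (yact N (\<phi>' h2) n) (\<lambda>m0 m1. tenY m0 (\<theta>' (m1 * \<gamma> (\<phi>' h1)))))"
      by (rule SWH_aut[OF \<phi> vector_space_fscale]) (intro L n | simp)+
    also have "\<dots> = SWH h (\<lambda>h1 h2. SWY N' (yact N (\<phi>' h2) n) (\<lambda>m0 m1. tenY m0 (m1 * (finv \<beta> \<circ> \<delta> \<circ> \<alpha> \<circ> finv \<delta> \<circ> \<gamma> \<circ> finv \<alpha> \<circ> \<beta>) h1)))"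
      unfolding e2[symmetric]
      by (rule SWH_cong, rule S[OF act_in[OF N n] vector_space_fscale, symmetric]) (intro L | simp)+
    finally show "SWH h (\<lambda>h1 h2. SWY N' n (\<lambda>m0 m1. tenY (yact N (\<phi>' h1) m0) ((finv \<beta> \<circ> \<delta> \<circ> \<beta>) h2 * m1))) =
        SWH h (\<lambda>h1 h2. SWY N' (yact N (\<phi>' h2) n) (\<lambda>m0 m1. tenY m0 (m1 * (finv \<beta> \<circ> \<delta> \<circ> \<alpha> \<circ> finv \<delta> \<circ> \<gamma> \<circ> finv \<alpha> \<circ> \<beta>) h1)))" .
  qed
qed

end

end

context yd_setting
begin

subsection \<open>Tensor products\<close>

abbreviation "yten \<equiv> yd_tensor s H"

lemma ten_sel: "ydeg (yten M N) = ydeg M \<otimes>\<^bsub>G\<^esub> ydeg N" "ycar (yten M N) = ten (ycar M) (ycar N)"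
  by (simp_all add: yd_tensor_def split: prod.splits)

context
  fixes M N \<alpha> \<beta> \<gamma> \<delta>
  assumes M: "yd M" and N: "yd N" and degM: "ydeg M = (\<alpha>, \<beta>)" and degN: "ydeg N = (\<gamma>, \<delta>)"
begin

private abbreviation (input) "\<Theta> \<equiv> \<delta> \<circ> \<alpha> \<circ> finv \<delta>"
private abbreviation (input) "V \<equiv> ycar M"
private abbreviation (input) "W \<equiv> ycar N"

lemma ten_auts: "\<alpha> \<in> Aut" "\<beta> \<in> Aut" "\<gamma> \<in> Aut" "\<delta> \<in> Aut" "\<Theta> \<in> Aut"
proof -
  show "\<alpha> \<in> Aut" "\<beta> \<in> Aut" "\<gamma> \<in> Aut" "\<delta> \<in> Aut"
    using yd_deg[OF M] yd_deg[OF N] degM degN by (auto simp: carrier_G)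
  then show "\<Theta> \<in> Aut" by simp
qed

lemmas ten_lins = lin yd_lin[OF M] yd_lin[OF N] lin_aut[OF ten_auts(1)] lin_aut[OF ten_auts(2)] lin_aut[OF ten_auts(3)]
    lin_aut[OF ten_auts(4)] lin_aut[OF ten_auts(5)] vss act_in[OF M] act_in[OF N]

lemma ten_act: 
  assumes x: "x \<in> ten V W"
  shows "yact (yten M N) h x = swt V W x (\<lambda>m n. SWH h (\<lambda>h1 h2. yact M h2 m * yact N h1 n))"
proof -
  have "yact (yten M N) h x = swt V W x (\<lambda>m n. swH H h (\<lambda>h1 h2. yact M h2 m * yact N h1 n))"
    using x by (simp add: yd_tensor_def degM degN)
  also have "\<dots> = swt V W x (\<lambda>m n. SWH h (\<lambda>h1 h2. yact M h2 m * yact N h1 n))"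
    by (rule sweedler_cong, rule swH_eq[OF vs_s]) (intro ten_lins | simp)+
  finally show ?thesis .
qed

lemma ten_act_mult:
  assumes "m \<in> V" "n \<in> W"
  shows "yact (yten M N) h (m * n) = SWH h (\<lambda>h1 h2. yact M h2 m * yact N h1 n)"
  unfolding ten_act[OF ten_in[OF assms]]
  by (rule swt_mult[OF yd_U[OF M] yd_U[OF N] vs_s]) (intro ten_lins assms | simp)+

lemma ten_act_linear: "linear_on (ten V W) s s (\<lambda>x. yact (yten M N) h x)"
proof -
  have "linear_on (ten V W) s s (\<lambda>x. swt V W x (\<lambda>m n. SWH h (\<lambda>h1 h2. yact M h2 m * yact N h1 n)))"
    by (rule swt_linear[OF yd_U[OF M] yd_U[OF N] vs_s]) (intro ten_lins | simp)+
  then show ?thesis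
    using subU[OF ten_U[OF yd_U[OF M] yd_U[OF N]]]
    by (simp add: linear_on_def ten_act uni.subspace_add uni.subspace_scale)
qed

lemma ten_act_in: "x \<in> ten V W \<Longrightarrow> yact (yten M N) h x \<in> ten V W"
  unfolding ten_act
  by (rule swt_in[OF yd_U[OF M] yd_U[OF N] vs_s _ _ subU[OF ten_U[OF yd_U[OF M] yd_U[OF N]]]])
    (intro ten_lins SWH_in[OF vs_s subU[OF ten_U[OF yd_U[OF M] yd_U[OF N]]]] ten_in | assumption)+

lemma ten_coact:
  assumes x: "x \<in> ten V W"
  shows "ycoact (yten M N) x = swt V W x (\<lambda>m n. SWY M m (\<lambda>m0 m1. SWY N n (\<lambda>n0 n1. tenY (m0 * n0) (\<delta> m1 * \<Theta> n1))))"
proof -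
  have "ycoact (yten M N) x = swt V W x (\<lambda>m n. swY s H M m (\<lambda>m0 m1. swY s H N n (\<lambda>n0 n1. tenY (m0 * n0) (\<delta> m1 * \<Theta> n1))))"
    using x by (simp add: yd_tensor_def degM degN)
  also have "\<dots> = swt V W x (\<lambda>m n. swY s H M m (\<lambda>m0 m1. SWY N n (\<lambda>n0 n1. tenY (m0 * n0) (\<delta> m1 * \<Theta> n1))))"
    by (rule sweedler_cong, rule sweedler_cong, rule swY_eq[OF yd_precoaction[OF N] vector_space_fscale])
      (intro ten_lins | assumption)+
  also have "\<dots> = swt V W x (\<lambda>m n. SWY M m (\<lambda>m0 m1. SWY N n (\<lambda>n0 n1. tenY (m0 * n0) (\<delta> m1 * \<Theta> n1))))"
    by (rule sweedler_cong, rule swY_eq[OF yd_precoaction[OF M] vector_space_fscale])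
      (intro ten_lins | assumption)+
  finally show ?thesis .
qed

lemma ten_coact_mult:
  assumes "m \<in> V" "n \<in> W"
  shows "ycoact (yten M N) (m * n) = SWY M m (\<lambda>m0 m1. SWY N n (\<lambda>n0 n1. tenY (m0 * n0) (\<delta> m1 * \<Theta> n1)))"
  unfolding ten_coact[OF ten_in[OF assms]]
  by (rule swt_mult[OF yd_U[OF M] yd_U[OF N] vector_space_fscale]) (intro ten_lins assms | assumption)+

lemma ten_precoaction: "precoaction (yten M N)"
  unfolding precoaction_def ten_sel
proof (intro conjI)
  show U: "ten V W \<in> \<U>" by (rule ten_U[OF yd_U[OF M] yd_U[OF N]])
  show "ycoact (yten M N) \<in> ten V W \<rightarrow>\<^sub>E TY (ten V W)"
  proof (rule PiE_I)
    fix x assume x: "x \<in> ten V W"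
    show "ycoact (yten M N) x \<in> TY (ten V W)"
      unfolding ten_coact[OF x]
      by (rule swt_in[OF yd_U[OF M] yd_U[OF N] vector_space_fscale _ _ TY_subspace[OF U] x])
        (intro ten_lins SWY_in[OF yd_precoaction[OF M] _ vector_space_fscale TY_subspace[OF U]]
            SWY_in[OF yd_precoaction[OF N] _ vector_space_fscale TY_subspace[OF U]] TY_in ten_in
          | assumption)+
  qed (simp add: yd_tensor_def degM degN)
  have "linear_on (ten V W) s fscale (\<lambda>x. swt V W x (\<lambda>m n. SWY M m (\<lambda>m0 m1. SWY N n (\<lambda>n0 n1. tenY (m0 * n0) (\<delta> m1 * \<Theta> n1)))))"
    by (rule swt_linear[OF yd_U[OF M] yd_U[OF N] vector_space_fscale]) (intro ten_lins | assumption)+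
  then show "linear_on (ten V W) s fscale (ycoact (yten M N))"
    using subU[OF U] by (simp add: linear_on_def ten_coact uni.subspace_add uni.subspace_scale)
qed

lemma SWY_ten:
  assumes s3: "vector_space s3" and F: "\<And>c. linear_on (ten V W) s s3 (\<lambda>x. F x c)"
      "\<And>x. x \<in> ten V W \<Longrightarrow> linear_on UNIV hs s3 (\<lambda>c. F x c)"
    and m: "m \<in> V" and n: "n \<in> W"
  shows "SWY (yten M N) (m * n) F = SWY M m (\<lambda>m0 m1. SWY N n (\<lambda>n0 n1. F (m0 * n0) (\<delta> m1 * \<Theta> n1)))"
proof -
  have "SWY (yten M N) (m * n) F = (\<Sum>(b, c)\<in>B \<times> B. F (yco M b m * yco N c n) (\<delta> b * \<Theta> c))"
    unfolding case_prod_beta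
    by (rule SWY_tenY[OF ten_precoaction])
      (use m n F s3 yco_in[OF yd_precoaction[OF M] m] yco_in[OF yd_precoaction[OF N] n]
        in \<open>auto simp: ten_sel ten_in ten_coact_mult SWY_def sum.cartesian_product case_prod_beta\<close>)
  then show ?thesis by (simp add: SWY_def sum.cartesian_product)
qed

private lemmas A = ten_auts
private lemmas PM = yd_precoaction[OF M]
private lemmas PN = yd_precoaction[OF N]
private lemmas P = ten_precoaction
private lemmas SM = SWY_cong[OF PM]
private lemmas SN = SWY_cong[OF PN]
private lemmas L = ten_lins lin_SWY[OF P, unfolded ten_sel] lin_SWY_body[OF P, unfolded ten_sel]
  lin_comp[OF ten_act_linear] ten_in ten_act_in
private lemmas SW = SWY_ten[OF vector_space_fscale]
private lemmas E = ten_ext[OF yd_U[OF M] yd_U[OF N]]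

text \<open>For the compatibility condition, the condition of M is applied to the last two legs of h
  and that of N to the first two. The twists in the coaction make this possible: since \<Theta>
  \<circ> \<delta> = \<delta> \<circ> \<alpha>, the factor \<alpha>(p) released by M becomes the
  factor \<delta>(p) required by N.\<close>

lemma yd_tensor_yd: "yd (yten M N)"
proof (rule yd_modulesI[OF P])
  show "ydeg (yten M N) = (\<Theta> \<circ> \<gamma>, \<delta> \<circ> \<beta>)"
    by (simp add: ten_sel degM degN mult_G)
  show "\<Theta> \<circ> \<gamma> \<in> Aut" "\<delta> \<circ> \<beta> \<in> Aut" using A by simp_all
  show "yact (yten M N) h \<in> ycar (yten M N) \<rightarrow>\<^sub>E ycar (yten M N)" for h
    unfolding ten_sel
    by (rule PiE_I, rule ten_act_in) (simp_all add: yd_tensor_def degM degN)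
  show "linear_on (ycar (yten M N)) s s (yact (yten M N) h)" for h
    unfolding ten_sel by (rule ten_act_linear)
  fix x assume x: "x \<in> ycar (yten M N)"
  then have x': "x \<in> ten V W" by (simp add: ten_sel)
  have lin_h: "linear_on UNIV hs s (\<lambda>h. yact (yten M N) h y)" if "y \<in> ten V W" for y
  proof (rule linear_onI)
    fix g h c
    have "yact (yten M N) (g + h) (m * n) = yact (yten M N) g (m * n) + yact (yten M N) h (m * n)" if "m \<in> V" "n \<in> W" for m n
      unfolding ten_act_mult[OF that]
      by (rule linear_on_add[of UNIV hs s]) (intro L that | simp)+
    then show "yact (yten M N) (g + h) y = yact (yten M N) g y + yact (yten M N) h y"
      by (rule E[OF vs_s _ _ \<open>y \<in> ten V W\<close>, rotated 2]) (assumption | intro L)+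
    have "yact (yten M N) (hs c h) (m * n) = s c (yact (yten M N) h (m * n))" if "m \<in> V" "n \<in> W" for m n
      unfolding ten_act_mult[OF that]
      by (rule linear_on_scale[of UNIV hs s]) (intro L that | simp)+
    then show "yact (yten M N) (hs c h) y = s c (yact (yten M N) h y)"
      by (rule E[OF vs_s _ _ \<open>y \<in> ten V W\<close>, rotated 2]) (assumption | intro L)+
  qed
  then show "linear_on UNIV hs s (\<lambda>h. yact (yten M N) h x)" using x' .
  note L = L lin_comp[OF lin_h _ UNIV_I]
  show "yact (yten M N) 1 x = x"
  proof (rule E[OF vs_s _ _ x'])
    fix m n assume mn: "m \<in> V" "n \<in> W"
    have "yact (yten M N) 1 (m * n) = yact M 1 m * yact N 1 n"
      unfolding ten_act_mult[OF mn]
      by (rule SWH_one[OF vs_s]) (intro L mn)+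
    then show "yact (yten M N) 1 (m * n) = m * n" by (simp add: act_one[OF M] act_one[OF N] mn)
  qed (intro L | simp)+
  show "yact (yten M N) (g * h) x = yact (yten M N) g (yact (yten M N) h x)" for g h
  proof (rule E[OF vs_s _ _ x'])
    fix m n assume mn: "m \<in> V" "n \<in> W"
    have "yact (yten M N) (g * h) (m * n) = SWH g (\<lambda>a b. SWH h (\<lambda>c d. yact M (b * d) m * yact N (a * c) n))"
      unfolding ten_act_mult[OF mn]
      by (rule SWH_mult[OF vs_s]) (intro L mn)+
    also have "\<dots> = SWH h (\<lambda>c d. SWH g (\<lambda>a b. yact M b (yact M d m) * yact N a (yact N c n)))"
      by (subst SWH_swap) (simp add: act_mult[OF M] act_mult[OF N] mn)
    also have "\<dots> = SWH h (\<lambda>c d. yact (yten M N) g (yact M d m * yact N c n))"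
      by (simp add: ten_act_mult act_in[OF M] act_in[OF N] mn)
    also have "\<dots> = yact (yten M N) g (yact (yten M N) h (m * n))"
      unfolding ten_act_mult[OF mn]
      by (rule SWH_lin[OF ten_act_linear vs_s vs_s subU[OF ten_U[OF yd_U[OF M] yd_U[OF N]]], symmetric])
        (intro L mn)
    finally show "yact (yten M N) (g * h) (m * n) = yact (yten M N) g (yact (yten M N) h (m * n))" .
  qed (intro L | simp)+
  show "SWY (yten M N) x (\<lambda>x c. s (eps c) x) = x"
  proof (rule E[OF vs_s _ _ x'])
    fix m n assume mn: "m \<in> V" "n \<in> W"
    have "SWY (yten M N) (m * n) (\<lambda>x c. s (eps c) x) = SWY M m (\<lambda>m0 m1. SWY N n (\<lambda>n0 n1. s (eps (\<delta> m1 * \<Theta> n1)) (m0 * n0)))"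
      by (rule SWY_ten[OF vs_s _ _ mn]) (intro L)+
    also have "\<dots> = SWY M m (\<lambda>m0 m1. s (eps m1) (SWY N n (\<lambda>n0 n1. s (eps n1) (m0 * n0))))"
      using A by (simp add: hop.counit_mult aut_eps SWY_scale)
    also have "\<dots> = SWY M m (\<lambda>m0 m1. s (eps m1) (m0 * n))"
      by (rule SM[OF mn(1)], subst SWY_counit[OF N vs_s _ mn(2)]) (intro L | simp)+
    also have "\<dots> = m * n" by (rule SWY_counit[OF M vs_s _ mn(1)]) (intro L)
    finally show "SWY (yten M N) (m * n) (\<lambda>x c. s (eps c) x) = m * n" .
  qed (intro L | simp)+
  show "SWY (yten M N) x (\<lambda>x c. SWY (yten M N) x (\<lambda>y d. tenYHH y d c)) =
      SWY (yten M N) x (\<lambda>x c. SWH c (\<lambda>d e. tenYHH x d e))"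
  proof (rule E[OF vector_space_fscale _ _ x'])
    fix m n assume mn: "m \<in> V" "n \<in> W"
    have "SWY (yten M N) (m * n) (\<lambda>x c. SWY (yten M N) x (\<lambda>y d. tenYHH y d c)) =
        SWY M m (\<lambda>m0 m1. SWY N n (\<lambda>n0 n1. SWY (yten M N) (m0 * n0) (\<lambda>y d. tenYHH y d (\<delta> m1 * \<Theta> n1))))"
      by (rule SW[OF _ _ mn]) (intro L | assumption)+
    also have "\<dots> = SWY M m (\<lambda>m0 m1. SWY N n (\<lambda>n0 n1. SWY M m0 (\<lambda>x d. SWY N n0 (\<lambda>y e.
        tenYHH (x * y) (\<delta> d * \<Theta> e) (\<delta> m1 * \<Theta> n1)))))"
      by (rule SM[OF mn(1)], rule SN[OF mn(2)], rule SW) (intro L | assumption)+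
    also have "\<dots> = SWY M m (\<lambda>m0 m1. SWY M m0 (\<lambda>x d. SWY N n (\<lambda>n0 n1. SWY N n0 (\<lambda>y e.
        tenYHH (x * y) (\<delta> d * \<Theta> e) (\<delta> m1 * \<Theta> n1)))))"
      by (rule SM[OF mn(1)], rule SWY_swap)
    also have "\<dots> = SWY M m (\<lambda>m0 m1. SWY M m0 (\<lambda>x d. SWY N n (\<lambda>n0 n1. SWH n1 (\<lambda>e f.
        tenYHH (x * n0) (\<delta> d * \<Theta> e) (\<delta> m1 * \<Theta> f)))))"
      by (rule SM[OF mn(1)], rule SM, assumption, rule SWY_coassoc[OF N vector_space_fscale _ _ _ mn(2)])
        (intro L | assumption)+
    also have "\<dots> = SWY M m (\<lambda>m0 m1. SWH m1 (\<lambda>d g. SWY N n (\<lambda>n0 n1. SWH n1 (\<lambda>e f.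
        tenYHH (m0 * n0) (\<delta> d * \<Theta> e) (\<delta> g * \<Theta> f)))))"
      by (rule SWY_coassoc[OF M vector_space_fscale _ _ _ mn(1)]) (intro L mn | assumption)+
    also have "\<dots> = SWY M m (\<lambda>m0 m1. SWY N n (\<lambda>n0 n1. SWH m1 (\<lambda>d g. SWH n1 (\<lambda>e f.
        tenYHH (m0 * n0) (\<delta> d * \<Theta> e) (\<delta> g * \<Theta> f)))))"
      by (rule SM[OF mn(1)], rule SWY_SWH_swap[symmetric])
    also have "\<dots> = SWY M m (\<lambda>m0 m1. SWY N n (\<lambda>n0 n1. SWH (\<delta> m1 * \<Theta> n1) (\<lambda>d e. tenYHH (m0 * n0) d e)))"
    proof (rule SM[OF mn(1)], rule SN[OF mn(2)])
      fix m0 m1 n0 n1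
      have "SWH (\<delta> m1 * \<Theta> n1) (\<lambda>d e. tenYHH (m0 * n0) d e) =
          SWH (\<delta> m1) (\<lambda>d g. SWH (\<Theta> n1) (\<lambda>e f. tenYHH (m0 * n0) (d * e) (g * f)))"
        by (rule SWH_mult[OF vector_space_fscale]) (intro L)+
      also have "\<dots> = SWH m1 (\<lambda>d g. SWH (\<Theta> n1) (\<lambda>e f. tenYHH (m0 * n0) (\<delta> d * e) (\<delta> g * f)))"
        by (rule SWH_aut[OF A(4) vector_space_fscale]) (intro L)+
      also have "\<dots> = SWH m1 (\<lambda>d g. SWH n1 (\<lambda>e f. tenYHH (m0 * n0) (\<delta> d * \<Theta> e) (\<delta> g * \<Theta> f)))"
        by (rule SWH_cong, rule SWH_aut[OF A(5) vector_space_fscale]) (intro L)+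
      finally show "SWH m1 (\<lambda>d g. SWH n1 (\<lambda>e f. tenYHH (m0 * n0) (\<delta> d * \<Theta> e) (\<delta> g * \<Theta> f))) =
          SWH (\<delta> m1 * \<Theta> n1) (\<lambda>d e. tenYHH (m0 * n0) d e)" ..
    qed
    also have "\<dots> = SWY (yten M N) (m * n) (\<lambda>x c. SWH c (\<lambda>d e. tenYHH x d e))"
      by (rule SW[OF _ _ mn, symmetric]) (intro L | assumption)+
    finally show "SWY (yten M N) (m * n) (\<lambda>x c. SWY (yten M N) x (\<lambda>y d. tenYHH y d c)) =
        SWY (yten M N) (m * n) (\<lambda>x c. SWH c (\<lambda>d e. tenYHH x d e))" .
  qed (intro L | assumption)+
  fix h
  show "SWH h (\<lambda>h1 h2. SWY (yten M N) x (\<lambda>m0 m1. tenY (yact (yten M N) h1 m0) ((\<delta> \<circ> \<beta>) h2 * m1))) =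
      SWH h (\<lambda>h1 h2. SWY (yten M N) (yact (yten M N) h2 x) (\<lambda>m0 m1. tenY m0 (m1 * (\<Theta> \<circ> \<gamma>) h1)))"
    unfolding comp_apply[of \<delta> \<beta>] comp_apply[of \<Theta> \<gamma>]
  proof (rule E[OF vector_space_fscale _ _ x'])
    fix m n assume mn: "m \<in> V" "n \<in> W"
    have "SWH h (\<lambda>h1 h2. SWY (yten M N) (m * n) (\<lambda>x c. tenY (yact (yten M N) h1 x) (\<delta> (\<beta> h2) * c))) =
        SWH h (\<lambda>h1 h2. SWY M m (\<lambda>m0 m1. SWY N n (\<lambda>n0 n1. tenY (yact (yten M N) h1 (m0 * n0)) (\<delta> (\<beta> h2) * (\<delta> m1 * \<Theta> n1)))))"
      by (rule SWH_cong, rule SW[OF _ _ mn]) (intro L | assumption)+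
    also have "\<dots> = SWH h (\<lambda>h1 h2. SWY M m (\<lambda>m0 m1. SWY N n (\<lambda>n0 n1. SWH h1 (\<lambda>u v.
        tenY (yact M v m0 * yact N u n0) (\<delta> (\<beta> h2 * m1) * \<Theta> n1)))))"
    proof (rule SWH_cong, rule SM[OF mn(1)], rule SN[OF mn(2)])
      fix h1 h2 m0 m1 n0 n1 assume "m0 \<in> V" "n0 \<in> W"
      then show "tenY (yact (yten M N) h1 (m0 * n0)) (\<delta> (\<beta> h2) * (\<delta> m1 * \<Theta> n1)) =
          SWH h1 (\<lambda>u v. tenY (yact M v m0 * yact N u n0) (\<delta> (\<beta> h2 * m1) * \<Theta> n1))"
        using SWH_lin[OF lin_pure_tensor_left[OF lin_id], of s UNIV]
        by (simp add: ten_act_mult aut_mult[OF A(4)] mult.assoc)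
    qed
    also have "\<dots> = SWH h (\<lambda>h1 h2. SWY M m (\<lambda>m0 m1. SWH h1 (\<lambda>u v. SWY N n (\<lambda>n0 n1.
        tenY (yact M v m0 * yact N u n0) (\<delta> (\<beta> h2 * m1) * \<Theta> n1)))))"
      by (rule SWH_cong, rule SM[OF mn(1)], rule SWY_SWH_swap)
    also have "\<dots> = SWH h (\<lambda>h1 h2. SWH h1 (\<lambda>u v. SWY M m (\<lambda>m0 m1. SWY N n (\<lambda>n0 n1.
        tenY (yact M v m0 * yact N u n0) (\<delta> (\<beta> h2 * m1) * \<Theta> n1)))))"
      by (rule SWH_cong, rule SWY_SWH_swap)
    \<comment> \<open>Regrouping puts v and h2, the legs that meet M, next to each other.\<close>
    also have "\<dots> = SWH h (\<lambda>u w. SWH w (\<lambda>v h2. SWY M m (\<lambda>m0 m1. SWY N n (\<lambda>n0 n1.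
        tenY (yact M v m0 * yact N u n0) (\<delta> (\<beta> h2 * m1) * \<Theta> n1)))))"
      by (rule SWH_coassoc[OF vector_space_fscale]) (intro L mn | assumption)+
    also have "\<dots> = SWH h (\<lambda>u w. SWH w (\<lambda>v h2. SWY N n (\<lambda>n0 n1. SWY M m (\<lambda>m0 m1.
        tenY (yact M v m0 * yact N u n0) (\<delta> (\<beta> h2 * m1) * \<Theta> n1)))))"
      by (rule SWH_cong, rule SWH_cong, rule SWY_swap)
    also have "\<dots> = SWH h (\<lambda>u w. SWY N n (\<lambda>n0 n1. SWH w (\<lambda>v h2. SWY M m (\<lambda>m0 m1.
        tenY (yact M v m0 * yact N u n0) (\<delta> (\<beta> h2 * m1) * \<Theta> n1)))))"
      by (rule SWH_cong, rule SWY_SWH_swap[symmetric])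
    also have "\<dots> = SWH h (\<lambda>u w. SWY N n (\<lambda>n0 n1. SWH w (\<lambda>p q. SWY M (yact M q m) (\<lambda>m0 m1.
        tenY (m0 * yact N u n0) (\<delta> (m1 * \<alpha> p) * \<Theta> n1)))))"
      by (rule SWH_cong, rule SN[OF mn(2)], rule SWY_yd[OF M degM vector_space_fscale _ _ mn(1)])
        (intro L | assumption)+
    \<comment> \<open>The factor \<alpha>(p) changes sides: \<delta>(m1 \<alpha>(p)) \<Theta>(n1) =
      \<delta>(m1) \<Theta>(\<delta>(p) n1).\<close>
    also have "\<dots> = SWH h (\<lambda>u w. SWY N n (\<lambda>n0 n1. SWH w (\<lambda>p q. SWY M (yact M q m) (\<lambda>m0 m1.
        tenY (m0 * yact N u n0) (\<delta> m1 * \<Theta> (\<delta> p * n1))))))"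
      using A by (simp add: aut_mult mult.assoc)
    also have "\<dots> = SWH h (\<lambda>u w. SWH w (\<lambda>p q. SWY N n (\<lambda>n0 n1. SWY M (yact M q m) (\<lambda>m0 m1.
        tenY (m0 * yact N u n0) (\<delta> m1 * \<Theta> (\<delta> p * n1))))))"
      by (rule SWH_cong, rule SWY_SWH_swap)
    also have "\<dots> = SWH h (\<lambda>u w. SWH w (\<lambda>p q. SWY M (yact M q m) (\<lambda>m0 m1. SWY N n (\<lambda>n0 n1.
        tenY (m0 * yact N u n0) (\<delta> m1 * \<Theta> (\<delta> p * n1))))))"
      by (rule SWH_cong, rule SWH_cong, rule SWY_swap)
    \<comment> \<open>Now u and p are adjacent legs, as the condition of N requires.\<close>
    also have "\<dots> = SWH h (\<lambda>w q. SWH w (\<lambda>u p. SWY M (yact M q m) (\<lambda>m0 m1. SWY N n (\<lambda>n0 n1.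
        tenY (m0 * yact N u n0) (\<delta> m1 * \<Theta> (\<delta> p * n1))))))"
      by (rule SWH_coassoc[OF vector_space_fscale, symmetric]) (intro L mn | assumption)+
    also have "\<dots> = SWH h (\<lambda>w q. SWY M (yact M q m) (\<lambda>m0 m1. SWH w (\<lambda>u p. SWY N n (\<lambda>n0 n1.
        tenY (m0 * yact N u n0) (\<delta> m1 * \<Theta> (\<delta> p * n1))))))"
      by (rule SWH_cong, rule SWY_SWH_swap[symmetric])
    also have "\<dots> = SWH h (\<lambda>w q. SWY M (yact M q m) (\<lambda>m0 m1. SWH w (\<lambda>r t. SWY N (yact N t n) (\<lambda>n0 n1.
        tenY (m0 * n0) (\<delta> m1 * \<Theta> (n1 * \<gamma> r))))))"
      by (rule SWH_cong, rule SM[OF act_in[OF M mn(1)]], rule SWY_yd[OF N degN vector_space_fscale _ _ mn(2)])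
        (intro L | assumption)+
    also have "\<dots> = SWH h (\<lambda>w q. SWH w (\<lambda>r t. SWY M (yact M q m) (\<lambda>m0 m1. SWY N (yact N t n) (\<lambda>n0 n1.
        tenY (m0 * n0) (\<delta> m1 * \<Theta> (n1 * \<gamma> r))))))"
      by (rule SWH_cong, rule SWY_SWH_swap)
    also have "\<dots> = SWH h (\<lambda>r w. SWH w (\<lambda>t q. SWY M (yact M q m) (\<lambda>m0 m1. SWY N (yact N t n) (\<lambda>n0 n1.
        tenY (m0 * n0) (\<delta> m1 * \<Theta> (n1 * \<gamma> r))))))"
      by (rule SWH_coassoc[OF vector_space_fscale]) (intro L mn | assumption)+
    also have "\<dots> = SWH h (\<lambda>r w. SWH w (\<lambda>t q. SWY (yten M N) (yact M q m * yact N t n) (\<lambda>x c. tenY x (c * \<Theta> (\<gamma> r)))))"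
    proof (rule SWH_cong, rule SWH_cong)
      fix r w t q
      have "SWY (yten M N) (yact M q m * yact N t n) (\<lambda>x c. tenY x (c * \<Theta> (\<gamma> r))) =
          SWY M (yact M q m) (\<lambda>m0 m1. SWY N (yact N t n) (\<lambda>n0 n1. tenY (m0 * n0) (\<delta> m1 * \<Theta> n1 * \<Theta> (\<gamma> r))))"
        by (rule SW) (intro L mn | assumption)+
      then show "SWY M (yact M q m) (\<lambda>m0 m1. SWY N (yact N t n) (\<lambda>n0 n1. tenY (m0 * n0) (\<delta> m1 * \<Theta> (n1 * \<gamma> r)))) =
          SWY (yten M N) (yact M q m * yact N t n) (\<lambda>x c. tenY x (c * \<Theta> (\<gamma> r)))"
        by (simp only: aut_mult[OF A(5)] mult.assoc)
    qed
    also have "\<dots> = SWH h (\<lambda>r w. SWY (yten M N) (yact (yten M N) w (m * n)) (\<lambda>x c. tenY x (c * \<Theta> (\<gamma> r))))"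
      unfolding ten_act_mult[OF mn]
      by (rule SWH_cong, rule SWH_lin[symmetric, where X = "ten V W" and ?s3.0 = s and ?s4.0 = fscale])
        (intro L mn subU[OF ten_U[OF yd_U[OF M] yd_U[OF N]]] | assumption)+
    finally show "SWH h (\<lambda>h1 h2. SWY (yten M N) (m * n) (\<lambda>x c. tenY (yact (yten M N) h1 x) (\<delta> (\<beta> h2) * c))) =
        SWH h (\<lambda>r w. SWY (yten M N) (yact (yten M N) w (m * n)) (\<lambda>x c. tenY x (c * \<Theta> (\<gamma> r))))" .
  qed (intro L | assumption)+
qed

end

end

section \<open>Transport of braided T-categories\<close>

text \<open>C enters as raw data. All its objects and arrows are images under the bijections GO and
  GA, and each operation on images is the image of the operation of D, so every axiom of C is an
  axiom of D read through the bijections.\<close>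

locale tcat_transport =
  fixes G :: "('g, 'y) monoid_scheme" and D :: "('o, 'm, 'g, 'z) tcat_data_scheme"
    and C :: "('p, 'n, 'g, 'x) tcat_data_scheme" and GO :: "'o \<Rightarrow> 'p" and GA :: "'m \<Rightarrow> 'n"
  assumes D: "braided_T_category G D"
    and GO: "bij_betw GO (Obj D) (Obj C)" and GA: "bij_betw GA (Arr D) (Arr C)"
    and Dom: "f \<in> Arr D \<Longrightarrow> Dom C (GA f) = GO (Dom D f)"
    and Cod: "f \<in> Arr D \<Longrightarrow> Cod C (GA f) = GO (Cod D f)"
    and Id: "X \<in> Obj D \<Longrightarrow> Id C (GO X) = GA (Id D X)"
    and Comp: "\<lbrakk>f \<in> Arr D; g \<in> Arr D; Cod D f = Dom D g\<rbrakk> \<Longrightarrow> Comp C (GA g) (GA f) = GA (Comp D g f)"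
    and TenO: "\<lbrakk>X \<in> Obj D; Y \<in> Obj D\<rbrakk> \<Longrightarrow> TenO C (GO X) (GO Y) = GO (TenO D X Y)"
    and TenA: "\<lbrakk>f \<in> Arr D; g \<in> Arr D\<rbrakk> \<Longrightarrow> TenA C (GA f) (GA g) = GA (TenA D f g)"
    and UnitO: "UnitO C = GO (UnitO D)"
    and Deg: "X \<in> Obj D \<Longrightarrow> Deg C (GO X) = Deg D X"
    and ConjO: "\<lbrakk>a \<in> carrier G; X \<in> Obj D\<rbrakk> \<Longrightarrow> ConjO C a (GO X) = GO (ConjO D a X)"
    and ConjA: "\<lbrakk>a \<in> carrier G; f \<in> Arr D\<rbrakk> \<Longrightarrow> ConjA C a (GA f) = GA (ConjA D a f)"
    and Braid: "\<lbrakk>X \<in> Obj D; Y \<in> Obj D\<rbrakk> \<Longrightarrow> Braid C (GO X) (GO Y) = GA (Braid D X Y)"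
begin

interpretation D: braided_T_category G D by (rule D)

lemma GO_obj: "X \<in> Obj D \<Longrightarrow> GO X \<in> Obj C" and GA_arr: "f \<in> Arr D \<Longrightarrow> GA f \<in> Arr C"
  using GO GA by (auto simp: bij_betw_def)

lemma GO_inj: "\<lbrakk>X \<in> Obj D; Y \<in> Obj D\<rbrakk> \<Longrightarrow> GO X = GO Y \<longleftrightarrow> X = Y"
  using GO by (auto simp: bij_betw_def inj_on_def)

lemma objE: "X \<in> Obj C \<Longrightarrow> (\<And>X'. X' \<in> Obj D \<Longrightarrow> X = GO X' \<Longrightarrow> P) \<Longrightarrow> P"
  and arrE: "f \<in> Arr C \<Longrightarrow> (\<And>f'. f' \<in> Arr D \<Longrightarrow> f = GA f' \<Longrightarrow> P) \<Longrightarrow> P"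
  using GO GA unfolding bij_betw_def by blast+

lemma D_conjO: "\<lbrakk>a \<in> carrier G; X \<in> Obj D\<rbrakk> \<Longrightarrow> ConjO D a X \<in> Obj D"
  and D_conjA: "\<lbrakk>a \<in> carrier G; f \<in> Arr D\<rbrakk> \<Longrightarrow> ConjA D a f \<in> Arr D \<and>
    Dom D (ConjA D a f) = ConjO D a (Dom D f) \<and> Cod D (ConjA D a f) = ConjO D a (Cod D f)"
  and D_conj_id: "\<lbrakk>a \<in> carrier G; X \<in> Obj D\<rbrakk> \<Longrightarrow> ConjA D a (Id D X) = Id D (ConjO D a X)"
  and D_conj_comp: "\<lbrakk>a \<in> carrier G; f \<in> Arr D; g \<in> Arr D; Cod D f = Dom D g\<rbrakk> \<Longrightarrow>
    ConjA D a (Comp D g f) = Comp D (ConjA D a g) (ConjA D a f)"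
  and D_conj_tenO: "\<lbrakk>a \<in> carrier G; X \<in> Obj D; Y \<in> Obj D\<rbrakk> \<Longrightarrow> ConjO D a (TenO D X Y) = TenO D (ConjO D a X) (ConjO D a Y)"
  and D_conj_tenA: "\<lbrakk>a \<in> carrier G; f \<in> Arr D; g \<in> Arr D\<rbrakk> \<Longrightarrow> ConjA D a (TenA D f g) = TenA D (ConjA D a f) (ConjA D a g)"
  and D_conj_unit: "a \<in> carrier G \<Longrightarrow> ConjO D a (UnitO D) = UnitO D"
  using D.conj_functor[of a] by (simp_all add: strict_tensor_functor_def is_functor_def)

lemma D_braid: "\<lbrakk>U \<in> Obj D; V \<in> Obj D\<rbrakk> \<Longrightarrow> Braid D U V \<in> Arr D \<and>
   Dom D (Braid D U V) = TenO D U V \<and> Cod D (Braid D U V) = TenO D (ConjO D (Deg D U) V) U"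
  using D.braid_iso by (simp add: iso_arr_def)

lemmas D_simps = D.dom_obj D.cod_obj D.id_arr D.comp_arr D.tenO_obj D.tenA_arr D.unit_obj D_conjO D_conjA D_braid
  D.deg_carrier GO_obj GA_arr GO_inj Dom Cod Id Comp TenO TenA UnitO Deg ConjO ConjA Braid

lemma category_C: "category C"
proof
  fix f g h assume "f \<in> Arr C" "g \<in> Arr C" "h \<in> Arr C" "Cod C f = Dom C g" "Cod C g = Dom C h"
  then show "Comp C h (Comp C g f) = Comp C (Comp C h g) f"
    by (elim arrE) (simp add: D_simps D.comp_assoc)
qed ((elim objE arrE, simp add: D_simps D.comp_id_left D.comp_id_right)+)

lemma strict_monoidal_C: "strict_monoidal_category C"
proof (intro strict_monoidal_category.intro category_C strict_monoidal_category_axioms.intro)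
  fix f g f' g' assume "f \<in> Arr C" "g \<in> Arr C" "f' \<in> Arr C" "g' \<in> Arr C" "Cod C f = Dom C f'" "Cod C g = Dom C g'"
  then show "TenA C (Comp C f' f) (Comp C g' g) = Comp C (TenA C f' g') (TenA C f g)"
    by (elim arrE) (simp add: D_simps D.tenA_comp)
qed (((elim objE arrE)?, simp add: D_simps D.tenA_id D.tenO_assoc D.tenA_assoc D.unitO D.unitA)+)

lemma comp_objs_C: "comp_objs C a = GO ` comp_objs D a"
  by (auto simp: comp_objs_def D_simps elim: objE)

lemma comp_arrs_C: "comp_arrs C a = GA ` comp_arrs D a"
  by (auto simp: comp_arrs_def comp_objs_def D_simps elim!: arrE)

lemma conj_bij:
  assumes a: "a \<in> carrier G"
  shows "bij_betw (ConjO C a) (Obj C) (Obj C)" "bij_betw (ConjA C a) (Arr C) (Arr C)"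
proof -
  have O: "bij_betw (ConjO D a) (Obj D) (Obj D)" and A: "bij_betw (ConjA D a) (Arr D) (Arr D)"
    using D.conj_functor[OF a] by (simp_all add: cat_isomorphism_def)
  have "bij_betw (GO \<circ> ConjO D a) (Obj D) (Obj C)" by (rule bij_betw_trans[OF O GO])
  then have "bij_betw (ConjO C a \<circ> GO) (Obj D) (Obj C)"
    by (rule bij_betw_cong[THEN iffD1, rotated]) (simp add: D_simps a)
  then show "bij_betw (ConjO C a) (Obj C) (Obj C)" by (simp add: bij_betw_comp_iff[OF GO, symmetric])
  have "bij_betw (GA \<circ> ConjA D a) (Arr D) (Arr C)" by (rule bij_betw_trans[OF A GA])
  then have "bij_betw (ConjA C a \<circ> GA) (Arr D) (Arr C)"
    by (rule bij_betw_cong[THEN iffD1, rotated]) (simp add: D_simps a)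
  then show "bij_betw (ConjA C a) (Arr C) (Arr C)" by (simp add: bij_betw_comp_iff[OF GA, symmetric])
qed

lemma crossed_C: "crossed_category G C"
proof (intro crossed_category.intro D.group_axioms strict_monoidal_C crossed_category_axioms.intro conjI)
  fix a assume a: "a \<in> carrier G"
  have F: "is_functor C C (ConjO C a) (ConjA C a)"
    unfolding is_functor_def
    by (intro conjI ballI impI; elim objE arrE; simp add: D_simps a D_conj_id D_conj_comp)
  then show "strict_tensor_functor C C (ConjO C a) (ConjA C a)"
    unfolding strict_tensor_functor_def
    by (intro conjI ballI impI; (elim objE arrE)?; simp add: D_simps a D_conj_tenO D_conj_tenA D_conj_unit)
  show "cat_isomorphism C C (ConjO C a) (ConjA C a)"
    unfolding cat_isomorphism_def using F conj_bij[OF a] by simp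
next
  fix a b assume ab: "a \<in> carrier G" "b \<in> carrier G"
  have "ConjO C b ` comp_objs C a = GO ` (ConjO D b ` comp_objs D a)"
    unfolding comp_objs_C image_image
    by (intro image_cong refl) (use ab in \<open>auto simp: comp_objs_def D_simps\<close>)
  then show "ConjO C b ` comp_objs C a = comp_objs C (b \<otimes>\<^bsub>G\<^esub> a \<otimes>\<^bsub>G\<^esub> inv\<^bsub>G\<^esub> b)"
    by (simp add: D.conjO_comp[OF ab] comp_objs_C)
  have "ConjA C b ` comp_arrs C a = GA ` (ConjA D b ` comp_arrs D a)"
    unfolding comp_arrs_C image_image
    by (intro image_cong refl) (use ab in \<open>auto simp: comp_arrs_def D_simps\<close>)
  then show "ConjA C b ` comp_arrs C a = comp_arrs C (b \<otimes>\<^bsub>G\<^esub> a \<otimes>\<^bsub>G\<^esub> inv\<^bsub>G\<^esub> b)"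
    by (simp add: D.conjA_comp[OF ab] comp_arrs_C)
qed (((elim objE arrE)?, simp add: D_simps D.deg_arr D.deg_tenO D.conjO_mult D.conjA_mult)+)

lemma braided_C: "braided_T_category G C"
proof (intro braided_T_category.intro crossed_C braided_T_category_axioms.intro)
  fix U V assume "U \<in> Obj C" "V \<in> Obj C"
  then obtain U' V' where UV: "U' \<in> Obj D" "V' \<in> Obj D" "U = GO U'" "V = GO V'" by (elim objE)
  from D.braid_iso[OF UV(1,2)] obtain g where g: "g \<in> Arr D"
    "Dom D g = Cod D (Braid D U' V')" "Cod D g = Dom D (Braid D U' V')"
    "Comp D g (Braid D U' V') = Id D (Dom D (Braid D U' V'))"
    "Comp D (Braid D U' V') g = Id D (Cod D (Braid D U' V'))" unfolding iso_arr_def by blast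
  have "iso_arr C (Braid C U V)"
    unfolding iso_arr_def
    by (intro conjI bexI[of _ "GA g"]) (use UV g in \<open>simp_all add: D_simps\<close>)
  then show "iso_arr C (Braid C U V) \<and> Dom C (Braid C U V) = TenO C U V \<and>
      Cod C (Braid C U V) = TenO C (ConjO C (Deg C U) V) U"
    using UV by (simp add: D_simps)
next
  fix a b f g assume ab: "a \<in> carrier G" "b \<in> carrier G" and "f \<in> comp_arrs C a" "g \<in> comp_arrs C b"
  then obtain f' g' where fg: "f' \<in> comp_arrs D a" "g' \<in> comp_arrs D b" "f = GA f'" "g = GA g'"
    by (auto simp: comp_arrs_C)
  have *: "f' \<in> Arr D" "g' \<in> Arr D" "Deg D (Dom D f') = a" "Deg D (Cod D f') = a"
    using fg by (auto simp: comp_arrs_def comp_objs_def)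
  show "Comp C (TenA C (ConjA C a g) f) (Braid C (Dom C f) (Dom C g)) =
      Comp C (Braid C (Cod C f) (Cod C g)) (TenA C f g)"
    using D.braid_natural[OF ab fg(1,2)] * ab by (simp add: fg D_simps)
next
  fix U V W assume "U \<in> Obj C" "V \<in> Obj C" "W \<in> Obj C"
  then obtain U' V' W' where *: "U' \<in> Obj D" "V' \<in> Obj D" "W' \<in> Obj D" "U = GO U'" "V = GO V'" "W = GO W'"
    by (elim objE)
  show "Braid C (TenO C U V) W = Comp C (TenA C (Braid C U (ConjO C (Deg C V) W)) (Id C V)) (TenA C (Id C U) (Braid C V W))"
    using * by (simp add: D_simps D.braid_tensor_left D.tenO_assoc)
  show "Braid C U (TenO C V W) = Comp C (TenA C (Id C (ConjO C (Deg C U) V)) (Braid C U W)) (TenA C (Braid C U V) (Id C W))"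
    using * by (simp add: D_simps D.braid_tensor_right D.tenO_assoc)
qed (elim objE, simp add: D_simps D.braid_conj)

text \<open>The isomorphism has to run from C to D, so it consists of the inverses of GO and
  GA.\<close>

lemma isomorphic_C: "isomorphic_braided_T_categories G C D"
proof -
  define FO FA where "FO = inv_into (Obj D) GO" and "FA = inv_into (Arr D) GA"
  have FO: "FO (GO X) = X" if "X \<in> Obj D" for X
    unfolding FO_def using GO that by (simp add: bij_betw_def)
  have FA: "FA (GA f) = f" if "f \<in> Arr D" for f
    unfolding FA_def using GA that by (simp add: bij_betw_def)
  note S = FO FA D_simps
  have F: "is_functor C D FO FA"
    unfolding is_functor_def by (intro conjI ballI impI; elim objE arrE; simp add: S)
  have iso: "cat_isomorphism C D FO FA"
    unfolding cat_isomorphism_def FO_def FA_def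
    using F bij_betw_inv_into[OF GO] bij_betw_inv_into[OF GA] by (simp add: FO_def FA_def)
  have "strict_tensor_functor C D FO FA"
    unfolding strict_tensor_functor_def using F
    by (intro conjI ballI impI; (elim objE arrE)?; simp add: S)
  moreover have "FO ` comp_objs C a = comp_objs D a" for a
    unfolding comp_objs_C by (force simp: comp_objs_def image_image FO)
  moreover have "FA ` comp_arrs C a = comp_arrs D a" for a
    unfolding comp_arrs_C by (force simp: comp_arrs_def image_image FA)
  moreover have "FO (ConjO C a X) = ConjO D a (FO X)" if "a \<in> carrier G" "X \<in> Obj C" for a X
    using that by (elim objE) (simp add: S)
  moreover have "FA (ConjA C a f) = ConjA D a (FA f)" if "a \<in> carrier G" "f \<in> Arr C" for a f
    using that by (elim arrE) (simp add: S)
  moreover have "FA (Braid C X Y) = Braid D (FO X) (FO Y)" if "X \<in> Obj C" "Y \<in> Obj C" for X Y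
    using that by (elim objE) (simp add: S)
  ultimately have "braided_T_isomorphism G C D FO FA"
    using iso by (simp add: braided_T_isomorphism_def)
  then show ?thesis
    unfolding isomorphic_braided_T_categories_def using braided_C D by blast
qed

end

section \<open>Braided T-categories of structured vector spaces\<close>

context strict_tensor_universe
begin

lemma tensor_map_bilinear:
  assumes "linear_on V s s f" "linear_on W s s g"
  shows "bilinear_on V W s s s (\<lambda>v w. f v * g w)"
  using assms by (simp add: bilinear_on_def linear_on_def distrib_left distrib_right scale_mult_left scale_mult_right)

lemma tensor_map_mult:
  assumes "V \<in> \<U>" "W \<in> \<U>" "linear_on V s s f" "linear_on W s s g" "v \<in> V" "w \<in> W"
  shows "tensor_map V W f g (v * w) = f v * g w"
proof -
  interpret tp: tensor_product "(*)" s s s V W by (rule tensor_product_universe[OF assms(1,2)])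
  show ?thesis
    by (simp add: tensor_map_def tp.tensor_in assms tp.sw_tau[OF vector_space_axioms tensor_map_bilinear])
qed

lemma tensor_map_linear:
  assumes "V \<in> \<U>" "W \<in> \<U>" "linear_on V s s f" "linear_on W s s g"
  shows "linear_on (tensor_space (*) V W) s s (tensor_map V W f g)"
proof -
  interpret tp: tensor_product "(*)" s s s V W by (rule tensor_product_universe[OF assms(1,2)])
  show ?thesis
    using tp.sw_linear[OF vector_space_axioms tensor_map_bilinear[OF assms(3,4)]] tp.TS_subspace
    by (simp add: tensor_map_def linear_on_def subspace_add subspace_scale)
qed

lemma tensor_map_PiE:
  assumes "V \<in> \<U>" "W \<in> \<U>" "V' \<in> \<U>" "W' \<in> \<U>" "linear_on V s s f" "linear_on W s s g" "f \<in> V \<rightarrow> V'" "g \<in> W \<rightarrow> W'"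
  shows "tensor_map V W f g \<in> tensor_space (*) V W \<rightarrow>\<^sub>E tensor_space (*) V' W'"
proof -
  interpret tp: tensor_product "(*)" s s s V W by (rule tensor_product_universe[OF assms(1,2)])
  interpret tp': tensor_product "(*)" s s s V' W' by (rule tensor_product_universe[OF assms(3,4)])
  show ?thesis
    unfolding tensor_map_def
    by (auto intro!: tp.sw_in[OF vector_space_axioms tensor_map_bilinear[OF assms(5,6)] tp'.TS_subspace] tp'.tensor_in
        dest: funcset_mem[OF assms(7)] funcset_mem[OF assms(8)])
qed

lemma tensor_ext:
  assumes "V \<in> \<U>" "W \<in> \<U>" "linear_on (tensor_space (*) V W) s s f" "linear_on (tensor_space (*) V W) s s g"
    "\<And>v w. \<lbrakk>v \<in> V; w \<in> W\<rbrakk> \<Longrightarrow> f (v * w) = g (v * w)"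
    "f \<in> extensional (tensor_space (*) V W)" "g \<in> extensional (tensor_space (*) V W)"
  shows "f = g"
proof (rule extensionalityI[OF assms(6,7)])
  interpret tp: tensor_product "(*)" s s s V W by (rule tensor_product_universe[OF assms(1,2)])
  show "f x = g x" if "x \<in> tensor_space (*) V W" for x
    by (rule tp.linear_ext[OF vector_space_axioms assms(3,4) that assms(5)])
qed

text \<open>Strict associativity: the two spaces coincide as subsets of the algebra, because a
  product of a sum of products regroups by distributivity and associativity.\<close>

lemma tensor_space_assoc:
  "tensor_space (*) (tensor_space (*) V W) X = tensor_space (*) V (tensor_space (*) W X)"
  if U: "V \<in> \<U>" "W \<in> \<U>" "X \<in> \<U>"
proof -
  interpret VW: tensor_product "(*)" s s s V W by (rule tensor_product_universe[OF U(1,2)])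
  interpret WX: tensor_product "(*)" s s s W X by (rule tensor_product_universe[OF U(2,3)])
  interpret L: tensor_product "(*)" s s s "tensor_space (*) V W" X
    by (rule tensor_product_universe[OF universe_tensor[OF U(1,2)] U(3)])
  interpret R: tensor_product "(*)" s s s V "tensor_space (*) W X"
    by (rule tensor_product_universe[OF U(1) universe_tensor[OF U(2,3)]])
  have in_R: "t * x \<in> R.TS" if "t \<in> VW.TS" "x \<in> X" for t x
    using that(1)
  proof (induction rule: VW.tensor_induct)
    case (add a b u)
    then show ?case using that(2) by (auto simp: distrib_right mult.assoc intro!: subspace_add[OF R.TS_subspace] R.tensor_in WX.tensor_in)
  qed (simp add: subspace_0[OF R.TS_subspace])
  have LR: "t \<in> R.TS" if "t \<in> L.TS" for t
    using that by (induction rule: L.tensor_induct)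
      (simp_all add: in_R subspace_0[OF R.TS_subspace] subspace_add[OF R.TS_subspace])
  have in_L: "v * t \<in> L.TS" if "t \<in> WX.TS" "v \<in> V" for t v
    using that(1)
  proof (induction rule: WX.tensor_induct)
    case (add a b u)
    then show ?case using that(2) by (auto simp: distrib_left mult.assoc[symmetric] intro!: subspace_add[OF L.TS_subspace] L.tensor_in VW.tensor_in)
  qed (simp add: subspace_0[OF L.TS_subspace])
  have RL: "t \<in> L.TS" if "t \<in> R.TS" for t
    using that by (induction rule: R.tensor_induct)
      (simp_all add: in_L subspace_0[OF L.TS_subspace] subspace_add[OF L.TS_subspace])
  show ?thesis by (auto intro: LR RL)
qed

lemma tensor_space_unit:
  assumes V: "V \<in> \<U>"
  shows "tensor_space (*) (span {1}) V = V" "tensor_space (*) V (span {1}) = V"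
proof -
  interpret L: tensor_product "(*)" s s s "span {1}" V by (rule tensor_product_universe[OF universe_unit V])
  interpret R: tensor_product "(*)" s s s V "span {1}" by (rule tensor_product_universe[OF V universe_unit])
  note sub = universe_subspace[OF V]
  have k: "\<exists>c. a = s c 1" if "a \<in> span {1}" for a using that by (auto simp: span_singleton)
  have "t \<in> V" if "t \<in> L.TS" for t
    using that
  proof (induction rule: L.tensor_induct)
    case (add a b u)
    then show ?case using k[of a] by (auto simp: scale_mult_left intro!: subspace_add[OF sub] subspace_scale[OF sub])
  qed (simp add: subspace_0[OF sub])
  moreover have "t \<in> L.TS" if "t \<in> V" for t using L.tensor_in[OF span_base[of 1] that] by simp
  ultimately show "tensor_space (*) (span {1}) V = V" by blast
  have "t \<in> V" if "t \<in> R.TS" for t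
    using that
  proof (induction rule: R.tensor_induct)
    case (add a b u)
    then show ?case using k[of b] by (auto simp: scale_mult_right intro!: subspace_add[OF sub] subspace_scale[OF sub])
  qed (simp add: subspace_0[OF sub])
  moreover have "t \<in> R.TS" if "t \<in> V" for t using R.tensor_in[OF that span_base[of 1]] by simp
  ultimately show "tensor_space (*) V (span {1}) = V" by blast
qed

end

text \<open>Conditions on objects and underlying maps that yield a braided T-category. Those on the
  braiding that involve tensors are asked for products of elements only, since linear extensional
  maps are determined by their values there. Associativity and units of the tensor product are
  equations of objects.\<close>

locale concrete_T_category = grp: group G + strict_tensor_universe s \<U>
  for G :: "('g, 'y) monoid_scheme" and s :: "'k::field \<Rightarrow> 'v::ring_1 \<Rightarrow> 'v" and \<U> :: "'v set set" +
  fixes car :: "'o \<Rightarrow> 'v set" and objs :: "'o set" and mor :: "'o \<Rightarrow> 'o \<Rightarrow> ('v \<Rightarrow> 'v) \<Rightarrow> bool"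
    and ten :: "'o \<Rightarrow> 'o \<Rightarrow> 'o" and unit :: "'o" and deg :: "'o \<Rightarrow> 'g" and cng :: "'g \<Rightarrow> 'o \<Rightarrow> 'o"
    and br :: "'o \<Rightarrow> 'o \<Rightarrow> 'v \<Rightarrow> 'v"
  assumes car_U: "X \<in> objs \<Longrightarrow> car X \<in> \<U>"
    and deg_G: "X \<in> objs \<Longrightarrow> deg X \<in> carrier G"
    and mor_deg: "\<lbrakk>X \<in> objs; Y \<in> objs; mor X Y f\<rbrakk> \<Longrightarrow> deg X = deg Y"
    and mor_fun: "\<lbrakk>X \<in> objs; Y \<in> objs; mor X Y f\<rbrakk> \<Longrightarrow> f \<in> car X \<rightarrow>\<^sub>E car Y"
    and mor_linear: "\<lbrakk>X \<in> objs; Y \<in> objs; mor X Y f\<rbrakk> \<Longrightarrow> linear_on (car X) s s f"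
    and mor_id: "X \<in> objs \<Longrightarrow> mor X X (\<lambda>x\<in>car X. x)"
    and mor_comp: "\<lbrakk>X \<in> objs; Y \<in> objs; Z \<in> objs; mor X Y f; mor Y Z g\<rbrakk> \<Longrightarrow> mor X Z (\<lambda>x\<in>car X. g (f x))"
    and ten_obj: "\<lbrakk>X \<in> objs; Y \<in> objs\<rbrakk> \<Longrightarrow> ten X Y \<in> objs"
    and ten_car: "\<lbrakk>X \<in> objs; Y \<in> objs\<rbrakk> \<Longrightarrow> car (ten X Y) = tensor_space (*) (car X) (car Y)"
    and ten_deg: "\<lbrakk>X \<in> objs; Y \<in> objs\<rbrakk> \<Longrightarrow> deg (ten X Y) = deg X \<otimes>\<^bsub>G\<^esub> deg Y"
    and ten_mor: "\<lbrakk>X \<in> objs; Y \<in> objs; X' \<in> objs; Y' \<in> objs; mor X Y f; mor X' Y' g\<rbrakk> \<Longrightarrow>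
      mor (ten X X') (ten Y Y') (tensor_map (car X) (car X') f g)"
    and ten_assoc: "\<lbrakk>X \<in> objs; Y \<in> objs; Z \<in> objs\<rbrakk> \<Longrightarrow> ten (ten X Y) Z = ten X (ten Y Z)"
    and unit_obj: "unit \<in> objs"
    and unit_car: "car unit = span {1}"
    and ten_unit: "X \<in> objs \<Longrightarrow> ten unit X = X" "X \<in> objs \<Longrightarrow> ten X unit = X"
    and cng_obj: "\<lbrakk>a \<in> carrier G; X \<in> objs\<rbrakk> \<Longrightarrow> cng a X \<in> objs"
    and cng_car: "\<lbrakk>a \<in> carrier G; X \<in> objs\<rbrakk> \<Longrightarrow> car (cng a X) = car X"
    and cng_deg: "\<lbrakk>a \<in> carrier G; X \<in> objs\<rbrakk> \<Longrightarrow> deg (cng a X) = a \<otimes>\<^bsub>G\<^esub> deg X \<otimes>\<^bsub>G\<^esub> inv\<^bsub>G\<^esub> a"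
    and cng_mor: "\<lbrakk>a \<in> carrier G; X \<in> objs; Y \<in> objs; mor X Y f\<rbrakk> \<Longrightarrow> mor (cng a X) (cng a Y) f"
    and cng_one: "X \<in> objs \<Longrightarrow> cng \<one>\<^bsub>G\<^esub> X = X"
    and cng_mult: "\<lbrakk>a \<in> carrier G; b \<in> carrier G; X \<in> objs\<rbrakk> \<Longrightarrow> cng (a \<otimes>\<^bsub>G\<^esub> b) X = cng a (cng b X)"
    and cng_ten: "\<lbrakk>a \<in> carrier G; X \<in> objs; Y \<in> objs\<rbrakk> \<Longrightarrow> cng a (ten X Y) = ten (cng a X) (cng a Y)"
    and cng_unit: "a \<in> carrier G \<Longrightarrow> cng a unit = unit"
    and br_mor: "\<lbrakk>X \<in> objs; Y \<in> objs\<rbrakk> \<Longrightarrow> mor (ten X Y) (ten (cng (deg X) Y) X) (br X Y)"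
    and br_inv: "\<lbrakk>X \<in> objs; Y \<in> objs\<rbrakk> \<Longrightarrow> \<exists>g. mor (ten (cng (deg X) Y) X) (ten X Y) g \<and>
      (\<forall>x\<in>car X. \<forall>y\<in>car Y. g (br X Y (x * y)) = x * y \<and> br X Y (g (y * x)) = y * x)"
    and br_nat: "\<lbrakk>X \<in> objs; Y \<in> objs; X' \<in> objs; Y' \<in> objs; mor X X' f; mor Y Y' g; x \<in> car X; y \<in> car Y\<rbrakk> \<Longrightarrow>
      tensor_map (car Y) (car X) g f (br X Y (x * y)) = br X' Y' (f x * g y)"
    and br_left: "\<lbrakk>X \<in> objs; Y \<in> objs; Z \<in> objs; x \<in> car X; y \<in> car Y; z \<in> car Z\<rbrakk> \<Longrightarrow>
      br (ten X Y) Z (x * y * z) =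
      tensor_map (tensor_space (*) (car X) (car Z)) (car Y) (br X (cng (deg Y) Z)) (\<lambda>y\<in>car Y. y) (x * br Y Z (y * z))"
    and br_right: "\<lbrakk>X \<in> objs; Y \<in> objs; Z \<in> objs; x \<in> car X; y \<in> car Y; z \<in> car Z\<rbrakk> \<Longrightarrow>
      br X (ten Y Z) (x * (y * z)) =
      tensor_map (car Y) (tensor_space (*) (car X) (car Z)) (\<lambda>y\<in>car Y. y) (br X Z) (br X Y (x * y) * z)"
    and br_cng: "\<lbrakk>a \<in> carrier G; X \<in> objs; Y \<in> objs\<rbrakk> \<Longrightarrow> br (cng a X) (cng a Y) = br X Y"
begin

abbreviation "C \<equiv> concrete_tcat car objs mor ten unit deg cng br"

lemma sel: "Obj C = objs" "Arr C = {(X, Y, f). X \<in> objs \<and> Y \<in> objs \<and> mor X Y f}"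
  "Dom C (X, Y, f) = X" "Cod C (X, Y, f) = Y" "Id C X = (X, X, \<lambda>x\<in>car X. x)"
  "Comp C (Y, Z, g) (X, Y', f) = (X, Z, \<lambda>x\<in>car X. g (f x))" "TenO C X Y = ten X Y"
  "TenA C (X, Y, f) (X', Y', f') = (ten X X', ten Y Y', tensor_map (car X) (car X') f f')"
  "UnitO C = unit" "Deg C X = deg X" "ConjO C a X = cng a X" "ConjA C a (X, Y, f) = (cng a X, cng a Y, f)"
  "Braid C X Y = (ten X Y, ten (cng (deg X) Y) X, br X Y)"
  by (simp_all add: concrete_tcat_def)

lemma mor_in: "\<lbrakk>X \<in> objs; Y \<in> objs; mor X Y f; x \<in> car X\<rbrakk> \<Longrightarrow> f x \<in> car Y"
  using mor_fun by (auto simp: PiE_def)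

lemma mor_restrict: "\<lbrakk>X \<in> objs; Y \<in> objs; mor X Y f\<rbrakk> \<Longrightarrow> (\<lambda>x\<in>car X. f x) = f"
  using mor_fun by (auto simp: PiE_def extensional_restrict)

lemma tmap_mult:
  "\<lbrakk>X \<in> objs; Y \<in> objs; X' \<in> objs; Y' \<in> objs; mor X Y f; mor X' Y' g; x \<in> car X; x' \<in> car X'\<rbrakk> \<Longrightarrow>
   tensor_map (car X) (car X') f g (x * x') = f x * g x'"
  by (rule tensor_map_mult) (simp_all add: car_U mor_linear[of X Y] mor_linear[of X' Y'])

text \<open>Morphisms are linear and extensional, which reduces the equations of arrows below to
  products of elements.\<close>

lemma mor_ext:
  assumes "X \<in> objs" "Y \<in> objs" "Z \<in> objs" "mor (ten X Y) Z f" "mor (ten X Y) Z g"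
    "\<And>x y. \<lbrakk>x \<in> car X; y \<in> car Y\<rbrakk> \<Longrightarrow> f (x * y) = g (x * y)"
  shows "f = g"
  using mor_linear[OF ten_obj[OF assms(1,2)] assms(3,4)] mor_linear[OF ten_obj[OF assms(1,2)] assms(3,5)]
    mor_fun[OF ten_obj[OF assms(1,2)] assms(3,4)] mor_fun[OF ten_obj[OF assms(1,2)] assms(3,5)]
  by (intro tensor_ext[OF car_U[OF assms(1)] car_U[OF assms(2)], where f = f and g = g])
    (simp_all add: ten_car assms PiE_def)

lemma mult_in: "\<lbrakk>X \<in> objs; Y \<in> objs; x \<in> car X; y \<in> car Y\<rbrakk> \<Longrightarrow> x * y \<in> car (ten X Y)"
  unfolding ten_car by (rule tensor_product.tensor_in[OF tensor_product_universe]) (simp_all add: car_U)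

section \<open>The axioms of a braided T-category for structured vector spaces\<close>

lemma category: "category C"
proof (unfold_locales, goal_cases)
  case (4 f g)
  then show ?case by (auto simp: sel intro: mor_comp)
next
  case (5 f)
  then obtain X Y f1 where *: "f = (X, Y, f1)" "X \<in> objs" "Y \<in> objs" "mor X Y f1" by (auto simp: sel)
  have "(\<lambda>x\<in>car X. (\<lambda>y\<in>car Y. y) (f1 x)) = (\<lambda>x\<in>car X. f1 x)"
    by (rule restrict_ext) (simp add: mor_in[OF *(2-4)])
  then show ?case using * by (simp add: sel mor_restrict)
next
  case (6 f)
  then obtain X Y f1 where *: "f = (X, Y, f1)" "X \<in> objs" "Y \<in> objs" "mor X Y f1" by (auto simp: sel)
  have "(\<lambda>x\<in>car X. f1 ((\<lambda>x\<in>car X. x) x)) = (\<lambda>x\<in>car X. f1 x)"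
    by (rule restrict_ext) simp
  then show ?case using * by (simp add: sel mor_restrict)
next
  case (7 f g h)
  then show ?case by (auto simp: sel mor_in intro!: restrict_ext)
qed (auto simp: sel intro: mor_id)

lemma strict_monoidal: "strict_monoidal_category C"
proof (intro strict_monoidal_category.intro category strict_monoidal_category_axioms.intro, goal_cases)
  case (2 f g)
  then show ?case by (auto simp: sel ten_obj ten_mor)
next
  case (3 X Y)
  then have "tensor_map (car X) (car Y) (\<lambda>x\<in>car X. x) (\<lambda>x\<in>car Y. x) = (\<lambda>x\<in>car (ten X Y). x)"
    by (intro mor_ext[of X Y "ten X Y"]) (auto simp: sel ten_obj ten_mor mor_id mult_in tmap_mult[of X X Y Y])
  then show ?case by (simp add: sel)
next
  case (4 f g f' g')
  then obtain X Y Z X' Y' Z' f1 f2 g1 g2 where *: "f = (X, Y, f1)" "f' = (Y, Z, f2)" "g = (X', Y', g1)" "g' = (Y', Z', g2)"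
    by (cases f; cases f'; cases g; cases g') (auto simp: sel)
  then have o: "X \<in> objs" "Y \<in> objs" "Z \<in> objs" "X' \<in> objs" "Y' \<in> objs" "Z' \<in> objs"
    and m: "mor X Y f1" "mor Y Z f2" "mor X' Y' g1" "mor Y' Z' g2"
    using 4 by (simp_all add: sel)
  note t1 = ten_mor[OF o(1,2,4,5) m(1,3)] and t2 = ten_mor[OF o(2,3,5,6) m(2,4)]
  have "tensor_map (car X) (car X') (\<lambda>x\<in>car X. f2 (f1 x)) (\<lambda>x\<in>car X'. g2 (g1 x)) =
      (\<lambda>x\<in>car (ten X X'). tensor_map (car Y) (car Y') f2 g2 (tensor_map (car X) (car X') f1 g1 x))"
  proof (rule mor_ext[OF o(1,4) ten_obj[OF o(3,6)]])
    show "mor (ten X X') (ten Z Z') (tensor_map (car X) (car X') (\<lambda>x\<in>car X. f2 (f1 x)) (\<lambda>x\<in>car X'. g2 (g1 x)))"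
      using o m by (intro ten_mor mor_comp)
    show "mor (ten X X') (ten Z Z') (\<lambda>x\<in>car (ten X X'). tensor_map (car Y) (car Y') f2 g2 (tensor_map (car X) (car X') f1 g1 x))"
      using o t1 t2 by (intro mor_comp[where Y = "ten Y Y'"] ten_obj)
    fix x y assume xy: "x \<in> car X" "y \<in> car X'"
    have "tensor_map (car X) (car X') (\<lambda>x\<in>car X. f2 (f1 x)) (\<lambda>x\<in>car X'. g2 (g1 x)) (x * y) = f2 (f1 x) * g2 (g1 y)"
      using xy by (subst tmap_mult[OF o(1,3,4,6) mor_comp[OF o(1,2,3) m(1,2)] mor_comp[OF o(4,5,6) m(3,4)]]) simp_all
    then show "tensor_map (car X) (car X') (\<lambda>x\<in>car X. f2 (f1 x)) (\<lambda>x\<in>car X'. g2 (g1 x)) (x * y) =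
        (\<lambda>x\<in>car (ten X X'). tensor_map (car Y) (car Y') f2 g2 (tensor_map (car X) (car X') f1 g1 x)) (x * y)"
      using xy o m by (simp add: mult_in tmap_mult[OF o(1,2,4,5) m(1,3)] tmap_mult[OF o(2,3,5,6) m(2,4)]
          mor_in[OF o(1,2) m(1)] mor_in[OF o(4,5) m(3)])
  qed
  then show ?case by (simp add: * sel)
next
  case (6 f g h)
  then obtain X Y X' Y' X'' Y'' f1 g1 h1 where *: "f = (X, Y, f1)" "g = (X', Y', g1)" "h = (X'', Y'', h1)"
    by (cases f; cases g; cases h) auto
  then have o: "X \<in> objs" "Y \<in> objs" "X' \<in> objs" "Y' \<in> objs" "X'' \<in> objs" "Y'' \<in> objs"
    and m: "mor X Y f1" "mor X' Y' g1" "mor X'' Y'' h1"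
    using 6 by (simp_all add: sel)
  let ?L = "tensor_map (car (ten X X')) (car X'') (tensor_map (car X) (car X') f1 g1) h1"
  let ?R = "tensor_map (car X) (car (ten X' X'')) f1 (tensor_map (car X') (car X'') g1 h1)"
  have mL: "mor (ten (ten X X') X'') (ten (ten Y Y') Y'') ?L"
    using o m by (intro ten_mor ten_obj)
  have "mor (ten X (ten X' X'')) (ten Y (ten Y' Y'')) ?R"
    using o m by (intro ten_mor ten_obj)
  then have mR: "mor (ten (ten X X') X'') (ten (ten Y Y') Y'') ?R" using o by (simp add: ten_assoc)
  have "?L = ?R"
  proof (rule mor_ext[OF _ o(5) _ mL mR])
    show "ten X X' \<in> objs" "ten (ten Y Y') Y'' \<in> objs" using o by (simp_all add: ten_obj)
    fix t z assume t: "t \<in> car (ten X X')" and z: "z \<in> car X''"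
    \<comment> \<open>For a threefold product the test is done in two stages: with z fixed, both
      sides are linear in t, so t may itself be taken to be a product.\<close>
    have lin1: "linear_on (car (ten X X')) s s (\<lambda>t. F (t * z))"
      if "linear_on (car (ten (ten X X') X'')) s s F" for F
      using that o z by (auto simp: linear_on_def distrib_right scale_mult_left mult_in ten_obj)
    note TX = tensor_product_universe[OF car_U[OF o(1)] car_U[OF o(3)], folded ten_car[OF o(1,3)]]
    show "?L (t * z) = ?R (t * z)"
    proof (rule tensor_product.linear_ext[OF TX vector_space_axioms, where f = "\<lambda>t. ?L (t * z)" and g = "\<lambda>t. ?R (t * z)"])
      show "linear_on (tensor_space (*) (car X) (car X')) s s (\<lambda>t. ?L (t * z))"
        "linear_on (tensor_space (*) (car X) (car X')) s s (\<lambda>t. ?R (t * z))"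
        using lin1 mor_linear[OF _ _ mL] mor_linear[OF _ _ mR] o by (simp_all add: ten_car[symmetric] ten_obj)
      show "t \<in> tensor_space (*) (car X) (car X')" using t o by (simp add: ten_car)
      fix x y assume xy: "x \<in> car X" "y \<in> car X'"
      have "?L (x * y * z) = f1 x * g1 y * h1 z"
        using xy z o m by (subst tmap_mult[OF _ _ o(5,6) ten_mor[OF o(1-4) m(1,2)] m(3)])
          (simp_all add: ten_obj mult_in tmap_mult[OF o(1-4) m(1,2)])
      moreover have "?R (x * (y * z)) = f1 x * (g1 y * h1 z)"
        using xy z o m by (subst tmap_mult[OF o(1,2) _ _ m(1) ten_mor[OF o(3-6) m(2,3)]])
          (simp_all add: ten_obj mult_in tmap_mult[OF o(3-6) m(2,3)])
      ultimately show "?L (x * y * z) = ?R (x * y * z)" by (simp add: mult.assoc)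
    qed
  qed
  then show ?case using o by (simp add: * sel ten_assoc)
next
  case (9 f)
  then obtain X Y f1 where *: "f = (X, Y, f1)" "X \<in> objs" "Y \<in> objs" "mor X Y f1" by (auto simp: sel)
  have "tensor_map (car unit) (car X) (\<lambda>x\<in>car unit. x) f1 = f1"
  proof (rule mor_ext[OF unit_obj *(2,3)])
    show "mor (ten unit X) Y (tensor_map (car unit) (car X) (\<lambda>x\<in>car unit. x) f1)"
      using ten_mor[OF unit_obj unit_obj *(2,3) mor_id[OF unit_obj] *(4)] * by (simp add: ten_unit)
    show "mor (ten unit X) Y f1" using * by (simp add: ten_unit)
    fix x y assume xy: "x \<in> car unit" "y \<in> car X"
    then obtain c where c: "x = s c 1" by (auto simp: unit_car span_singleton)
    then show "tensor_map (car unit) (car X) (\<lambda>x\<in>car unit. x) f1 (x * y) = f1 (x * y)"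
      using xy * by (subst tmap_mult[OF unit_obj unit_obj *(2,3) mor_id[OF unit_obj] *(4)])
        (simp_all add: scale_mult_left linear_on_scale[OF mor_linear[OF *(2,3,4)]])
  qed
  moreover have "tensor_map (car X) (car unit) f1 (\<lambda>x\<in>car unit. x) = f1"
  proof (rule mor_ext[OF *(2) unit_obj *(3)])
    show "mor (ten X unit) Y (tensor_map (car X) (car unit) f1 (\<lambda>x\<in>car unit. x))"
      using ten_mor[OF *(2,3) unit_obj unit_obj *(4) mor_id[OF unit_obj]] * by (simp add: ten_unit)
    show "mor (ten X unit) Y f1" using * by (simp add: ten_unit)
    fix x y assume xy: "x \<in> car X" "y \<in> car unit"
    then obtain c where c: "y = s c 1" by (auto simp: unit_car span_singleton)
    then show "tensor_map (car X) (car unit) f1 (\<lambda>x\<in>car unit. x) (x * y) = f1 (x * y)"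
      using xy * by (subst tmap_mult[OF *(2,3) unit_obj unit_obj *(4) mor_id[OF unit_obj]])
        (simp_all add: scale_mult_right linear_on_scale[OF mor_linear[OF *(2,3,4)]])
  qed
  ultimately show ?case using * by (simp add: sel ten_unit)
qed (auto simp: sel ten_obj ten_assoc unit_obj ten_unit)

text \<open>Conjugation by the inverse group element is the witness for bijectivity of the
  conjugation functors.\<close>

lemma cng_inv:
  assumes "a \<in> carrier G" "X \<in> objs"
  shows "cng a (cng (inv\<^bsub>G\<^esub> a) X) = X" "cng (inv\<^bsub>G\<^esub> a) (cng a X) = X"
  using assms cng_mult[of a "inv\<^bsub>G\<^esub> a" X, symmetric] cng_mult[of "inv\<^bsub>G\<^esub> a" a X, symmetric]
  by (simp_all add: cng_one)

lemma cng_objs: "a \<in> carrier G \<Longrightarrow> bij_betw (cng a) objs objs"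
  by (rule bij_betw_byWitness[where f' = "cng (inv\<^bsub>G\<^esub> a)"]) (auto simp: cng_inv cng_obj)

lemma conjA_inv:
  assumes "a \<in> carrier G" "f \<in> Arr C"
  shows "ConjA C a f \<in> Arr C" "ConjA C a (ConjA C (inv\<^bsub>G\<^esub> a) f) = f" "ConjA C (inv\<^bsub>G\<^esub> a) (ConjA C a f) = f"
  using assms by (auto simp: sel cng_inv cng_obj cng_mor)

lemma conjA_arrs: "a \<in> carrier G \<Longrightarrow> bij_betw (ConjA C a) (Arr C) (Arr C)"
  by (rule bij_betw_byWitness[where f' = "ConjA C (inv\<^bsub>G\<^esub> a)"]) (auto simp only: conjA_inv grp.inv_closed)

lemma conj_deg_cancel:
  assumes "a \<in> carrier G" "b \<in> carrier G" "c \<in> carrier G" "inv\<^bsub>G\<^esub> b \<otimes>\<^bsub>G\<^esub> c \<otimes>\<^bsub>G\<^esub> b = a \<or> c = b \<otimes>\<^bsub>G\<^esub> a \<otimes>\<^bsub>G\<^esub> inv\<^bsub>G\<^esub> b"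
  shows "inv\<^bsub>G\<^esub> b \<otimes>\<^bsub>G\<^esub> c \<otimes>\<^bsub>G\<^esub> b = a" "c = b \<otimes>\<^bsub>G\<^esub> a \<otimes>\<^bsub>G\<^esub> inv\<^bsub>G\<^esub> b"
  using assms by (auto simp: grp.m_assoc) (simp_all add: grp.m_assoc[symmetric])

lemma crossed: "crossed_category G C"
proof (intro crossed_category.intro grp.group_axioms strict_monoidal crossed_category_axioms.intro conjI)
  fix a assume a: "a \<in> carrier G"
  have F: "is_functor C C (ConjO C a) (ConjA C a)"
    unfolding is_functor_def using a by (auto simp: sel cng_obj cng_car cng_mor)
  show "strict_tensor_functor C C (ConjO C a) (ConjA C a)"
    unfolding strict_tensor_functor_def using F a by (auto simp: sel cng_ten cng_unit cng_car)
  have "bij_betw (ConjO C a) (Obj C) (Obj C)" using cng_objs[OF a] by (simp add: concrete_tcat_def)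
  then show "cat_isomorphism C C (ConjO C a) (ConjA C a)"
    unfolding cat_isomorphism_def using F conjA_arrs[OF a] by simp
next
  fix a b assume ab: "a \<in> carrier G" "b \<in> carrier G"
  let ?c = "b \<otimes>\<^bsub>G\<^esub> a \<otimes>\<^bsub>G\<^esub> inv\<^bsub>G\<^esub> b"
  have deg_back: "X \<in> objs \<Longrightarrow> deg X = ?c \<Longrightarrow> deg (cng (inv\<^bsub>G\<^esub> b) X) = a" for X
    using ab conj_deg_cancel(1)[of a b ?c] by (simp add: cng_deg)
  show "ConjO C b ` comp_objs C a = comp_objs C ?c"
  proof (intro equalityI subsetI)
    fix X assume "X \<in> comp_objs C ?c"
    then have "X \<in> objs" "deg X = ?c" by (auto simp: comp_objs_def sel)
    then show "X \<in> ConjO C b ` comp_objs C a"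
      using ab by (intro image_eqI[of _ _ "cng (inv\<^bsub>G\<^esub> b) X"]) (auto simp: comp_objs_def sel cng_inv deg_back cng_obj)
  qed (use ab in \<open>auto simp: comp_objs_def sel cng_obj cng_deg\<close>)
  show "ConjA C b ` comp_arrs C a = comp_arrs C ?c"
  proof (intro equalityI subsetI)
    fix f assume "f \<in> comp_arrs C ?c"
    then obtain X Y f1 where "f = (X, Y, f1)" "X \<in> objs" "Y \<in> objs" "mor X Y f1" "deg X = ?c" "deg Y = ?c"
      by (auto simp: comp_arrs_def comp_objs_def sel)
    then show "f \<in> ConjA C b ` comp_arrs C a"
      using ab by (intro image_eqI[of _ _ "ConjA C (inv\<^bsub>G\<^esub> b) f"])
        (auto simp: comp_arrs_def comp_objs_def sel cng_inv deg_back cng_obj cng_mor)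
  qed (use ab in \<open>auto simp: comp_arrs_def comp_objs_def sel cng_obj cng_deg cng_mor\<close>)
qed (auto simp: sel deg_G mor_deg ten_deg cng_mult)

lemma braid_arr: "\<lbrakk>X \<in> objs; Y \<in> objs\<rbrakk> \<Longrightarrow> Braid C X Y \<in> Arr C"
  by (simp add: sel ten_obj cng_obj deg_G br_mor)

lemma braided: "braided_T_category G C"
proof (intro braided_T_category.intro crossed braided_T_category_axioms.intro)
  fix X Y assume "X \<in> Obj C" "Y \<in> Obj C"
  then have o: "X \<in> objs" "Y \<in> objs" by (simp_all add: sel)
  let ?Z = "ten (cng (deg X) Y) X"
  have Z: "cng (deg X) Y \<in> objs" "?Z \<in> objs" using o by (simp_all add: ten_obj cng_obj deg_G)
  obtain g where g: "mor ?Z (ten X Y) g"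
    and inv: "\<And>x y. \<lbrakk>x \<in> car X; y \<in> car Y\<rbrakk> \<Longrightarrow> g (br X Y (x * y)) = x * y"
      "\<And>x y. \<lbrakk>x \<in> car X; y \<in> car Y\<rbrakk> \<Longrightarrow> br X Y (g (y * x)) = y * x"
    using br_inv[OF o] by blast
  have 1: "(\<lambda>x\<in>car (ten X Y). g (br X Y x)) = (\<lambda>x\<in>car (ten X Y). x)"
    using o Z by (intro mor_ext[of X Y "ten X Y"] mor_comp[of _ ?Z] mor_id br_mor g ten_obj) (auto simp: mult_in inv)
  have 2: "(\<lambda>x\<in>car ?Z. br X Y (g x)) = (\<lambda>x\<in>car ?Z. x)"
    using o Z by (intro mor_ext[of "cng (deg X) Y" X ?Z] mor_comp[of _ "ten X Y"] mor_id br_mor g ten_obj)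
      (auto simp: mult_in inv cng_car deg_G)
  have "iso_arr C (Braid C X Y)"
    unfolding iso_arr_def
  proof (intro conjI bexI[of _ "(?Z, ten X Y, g)"])
    show "(?Z, ten X Y, g) \<in> Arr C" using o Z g by (simp add: sel ten_obj)
  qed (use o Z 1 2 braid_arr in \<open>simp_all add: sel\<close>)
  then show "iso_arr C (Braid C X Y) \<and> Dom C (Braid C X Y) = TenO C X Y \<and>
      Cod C (Braid C X Y) = TenO C (ConjO C (Deg C X) Y) X"
    by (simp add: sel)
next
  fix a b f g assume ab: "a \<in> carrier G" "b \<in> carrier G" and f: "f \<in> comp_arrs C a" and g: "g \<in> comp_arrs C b"
  obtain X X' Y Y' f1 g1 where fg: "f = (X, X', f1)" "g = (Y, Y', g1)" by (cases f; cases g) auto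
  have o: "X \<in> objs" "X' \<in> objs" "Y \<in> objs" "Y' \<in> objs" and m: "mor X X' f1" "mor Y Y' g1"
    and d: "deg X = a" "deg X' = a"
    using f g fg by (auto simp: comp_arrs_def comp_objs_def sel)
  have c: "cng a Y \<in> objs" "cng a Y' \<in> objs" and cm: "mor (cng a Y) (cng a Y') g1"
    using ab o m by (auto simp: cng_obj cng_mor)
  have "(\<lambda>x\<in>car (ten X Y). tensor_map (car (cng a Y)) (car X) g1 f1 (br X Y x)) =
      (\<lambda>x\<in>car (ten X Y). br X' Y' (tensor_map (car X) (car Y) f1 g1 x))"
  proof (rule mor_ext[OF o(1,3)])
    show "ten (cng a Y') X' \<in> objs" using c o by (simp add: ten_obj)
    show "mor (ten X Y) (ten (cng a Y') X') (\<lambda>x\<in>car (ten X Y). tensor_map (car (cng a Y)) (car X) g1 f1 (br X Y x))"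
      using o c m cm br_mor[of X Y] d by (intro mor_comp[of _ "ten (cng a Y) X"] ten_obj ten_mor) auto
    show "mor (ten X Y) (ten (cng a Y') X') (\<lambda>x\<in>car (ten X Y). br X' Y' (tensor_map (car X) (car Y) f1 g1 x))"
      using o c m cm br_mor[of X' Y'] d by (intro mor_comp[of _ "ten X' Y'"] ten_obj ten_mor) auto
    fix x y assume xy: "x \<in> car X" "y \<in> car Y"
    show "(\<lambda>x\<in>car (ten X Y). tensor_map (car (cng a Y)) (car X) g1 f1 (br X Y x)) (x * y) =
      (\<lambda>x\<in>car (ten X Y). br X' Y' (tensor_map (car X) (car Y) f1 g1 x)) (x * y)"
      using xy o m by (simp add: mult_in cng_car ab br_nat[OF o(1,3,2,4) m] tmap_mult[OF o m])
  qed
  then show "Comp C (TenA C (ConjA C a g) f) (Braid C (Dom C f) (Dom C g)) =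
      Comp C (Braid C (Cod C f) (Cod C g)) (TenA C f g)"
    by (simp add: fg sel d)
next
  fix X Y Z assume "X \<in> Obj C" "Y \<in> Obj C" "Z \<in> Obj C"
  then have o: "X \<in> objs" "Y \<in> objs" "Z \<in> objs" by (simp_all add: sel)
  have d: "deg X \<in> carrier G" "deg Y \<in> carrier G" using o by (simp_all add: deg_G)
  let ?YZ = "cng (deg Y) Z" and ?XY = "cng (deg X) Y" and ?XZ = "cng (deg X) Z"
  let ?XYZ = "cng (deg X) ?YZ"
  have c: "?YZ \<in> objs" "?XY \<in> objs" "?XZ \<in> objs" "?XYZ \<in> objs" using o d by (simp_all add: cng_obj)
  \<comment> \<open>Both hexagon identities are equations between maps on X \<otimes> (Y \<otimes>
    Z); two uses of linearity reduce them to products of three elements.\<close>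
  have ext3: "f = g" if "W \<in> objs" "mor (ten X (ten Y Z)) W f" "mor (ten X (ten Y Z)) W g"
    and fg: "\<And>x y z. \<lbrakk>x \<in> car X; y \<in> car Y; z \<in> car Z\<rbrakk> \<Longrightarrow> f (x * (y * z)) = g (x * (y * z))" for f g W
  proof (rule mor_ext[OF o(1) ten_obj[OF o(2,3)] that(1-3)])
    fix x t assume x: "x \<in> car X" and t: "t \<in> car (ten Y Z)"
    have lin1: "linear_on (car (ten Y Z)) s s (\<lambda>t. F (x * t))" if "linear_on (car (ten X (ten Y Z))) s s F" for F
      using that o x by (auto simp: linear_on_def distrib_left scale_mult_right mult_in ten_obj)
    show "f (x * t) = g (x * t)"
    proof (rule tensor_product.linear_ext[OF tensor_product_universe[OF car_U[OF o(2)] car_U[OF o(3)]] vector_space_axioms,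
          where f = "\<lambda>t. f (x * t)" and g = "\<lambda>t. g (x * t)"])
      show "linear_on (tensor_space (*) (car Y) (car Z)) s s (\<lambda>t. f (x * t))"
        "linear_on (tensor_space (*) (car Y) (car Z)) s s (\<lambda>t. g (x * t))"
        using lin1 mor_linear[OF _ _ that(2)] mor_linear[OF _ _ that(3)] that(1) o
        by (simp_all add: ten_car[symmetric] ten_obj)
      show "t \<in> tensor_space (*) (car Y) (car Z)" using t o by (simp add: ten_car)
    qed (rule fg[OF x])
  qed
  have "br (ten X Y) Z = (\<lambda>x\<in>car (ten X (ten Y Z)).
      tensor_map (car (ten X ?YZ)) (car Y) (br X ?YZ) (\<lambda>x\<in>car Y. x) (tensor_map (car X) (car (ten Y Z)) (\<lambda>x\<in>car X. x) (br Y Z) x))"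
  proof (rule ext3)
    show "ten (ten ?XYZ X) Y \<in> objs" using o c by (simp add: ten_obj)
    show "mor (ten X (ten Y Z)) (ten (ten ?XYZ X) Y) (br (ten X Y) Z)"
      using br_mor[OF ten_obj[OF o(1,2)] o(3)] o c d by (simp add: ten_assoc ten_deg cng_mult)
    have "mor (ten X (ten Y Z)) (ten X (ten ?YZ Y)) (tensor_map (car X) (car (ten Y Z)) (\<lambda>x\<in>car X. x) (br Y Z))"
      using o c by (intro ten_mor ten_obj mor_id br_mor)
    moreover have "mor (ten (ten X ?YZ) Y) (ten (ten ?XYZ X) Y) (tensor_map (car (ten X ?YZ)) (car Y) (br X ?YZ) (\<lambda>x\<in>car Y. x))"
      using o c by (intro ten_mor ten_obj mor_id br_mor)
    then have "mor (ten X (ten ?YZ Y)) (ten (ten ?XYZ X) Y) (tensor_map (car (ten X ?YZ)) (car Y) (br X ?YZ) (\<lambda>x\<in>car Y. x))"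
      using o c by (simp add: ten_assoc)
    ultimately show "mor (ten X (ten Y Z)) (ten (ten ?XYZ X) Y) (\<lambda>x\<in>car (ten X (ten Y Z)).
      tensor_map (car (ten X ?YZ)) (car Y) (br X ?YZ) (\<lambda>x\<in>car Y. x) (tensor_map (car X) (car (ten Y Z)) (\<lambda>x\<in>car X. x) (br Y Z) x))"
      using o c by (intro mor_comp[of _ "ten X (ten ?YZ Y)"] ten_obj)
    fix x y z assume xyz: "x \<in> car X" "y \<in> car Y" "z \<in> car Z"
    have "tensor_map (car X) (car (ten Y Z)) (\<lambda>x\<in>car X. x) (br Y Z) (x * (y * z)) = x * br Y Z (y * z)"
      using xyz o by (subst tmap_mult[OF o(1,1) ten_obj[OF o(2,3)] ten_obj[OF c(1) o(2)] mor_id[OF o(1)] br_mor[OF o(2,3)]])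
        (simp_all add: mult_in)
    then show "br (ten X Y) Z (x * (y * z)) = (\<lambda>x\<in>car (ten X (ten Y Z)).
      tensor_map (car (ten X ?YZ)) (car Y) (br X ?YZ) (\<lambda>x\<in>car Y. x) (tensor_map (car X) (car (ten Y Z)) (\<lambda>x\<in>car X. x) (br Y Z) x)) (x * (y * z))"
      using xyz o c d br_left[OF o xyz] mult_in[OF o(1) ten_obj[OF o(2,3)] xyz(1) mult_in[OF o(2,3) xyz(2,3)]]
      by (simp add: ten_obj mult.assoc ten_car cng_car)
  qed
  then show "Braid C (TenO C X Y) Z = Comp C (TenA C (Braid C X (ConjO C (Deg C Y) Z)) (Id C Y)) (TenA C (Id C X) (Braid C Y Z))"
    using o c d by (simp add: sel ten_assoc ten_deg cng_mult)
  have "br X (ten Y Z) = (\<lambda>x\<in>car (ten (ten X Y) Z).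
      tensor_map (car ?XY) (car (ten X Z)) (\<lambda>x\<in>car ?XY. x) (br X Z) (tensor_map (car (ten X Y)) (car Z) (br X Y) (\<lambda>x\<in>car Z. x) x))"
  proof (rule ext3)
    show "ten ?XY (ten ?XZ X) \<in> objs" using o c by (simp add: ten_obj)
    show "mor (ten X (ten Y Z)) (ten ?XY (ten ?XZ X)) (br X (ten Y Z))"
      using br_mor[OF o(1) ten_obj[OF o(2,3)]] o c d by (simp add: ten_assoc cng_ten)
    have "mor (ten (ten X Y) Z) (ten (ten ?XY X) Z) (tensor_map (car (ten X Y)) (car Z) (br X Y) (\<lambda>x\<in>car Z. x))"
      using o c by (intro ten_mor ten_obj mor_id br_mor)
    moreover have "mor (ten ?XY (ten X Z)) (ten ?XY (ten ?XZ X)) (tensor_map (car ?XY) (car (ten X Z)) (\<lambda>x\<in>car ?XY. x) (br X Z))"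
      using o c by (intro ten_mor ten_obj mor_id br_mor)
    then have "mor (ten (ten ?XY X) Z) (ten ?XY (ten ?XZ X)) (tensor_map (car ?XY) (car (ten X Z)) (\<lambda>x\<in>car ?XY. x) (br X Z))"
      using o c by (simp add: ten_assoc)
    ultimately have "mor (ten (ten X Y) Z) (ten ?XY (ten ?XZ X)) (\<lambda>x\<in>car (ten (ten X Y) Z).
      tensor_map (car ?XY) (car (ten X Z)) (\<lambda>x\<in>car ?XY. x) (br X Z) (tensor_map (car (ten X Y)) (car Z) (br X Y) (\<lambda>x\<in>car Z. x) x))"
      using o c by (intro mor_comp[of _ "ten (ten ?XY X) Z"] ten_obj)
    then show "mor (ten X (ten Y Z)) (ten ?XY (ten ?XZ X)) (\<lambda>x\<in>car (ten (ten X Y) Z).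
      tensor_map (car ?XY) (car (ten X Z)) (\<lambda>x\<in>car ?XY. x) (br X Z) (tensor_map (car (ten X Y)) (car Z) (br X Y) (\<lambda>x\<in>car Z. x) x))"
      using o by (simp add: ten_assoc)
    fix x y z assume xyz: "x \<in> car X" "y \<in> car Y" "z \<in> car Z"
    have "tensor_map (car (ten X Y)) (car Z) (br X Y) (\<lambda>x\<in>car Z. x) (x * y * z) = br X Y (x * y) * z"
      using xyz o by (subst tmap_mult[OF ten_obj[OF o(1,2)] ten_obj[OF c(2) o(1)] o(3,3) br_mor[OF o(1,2)] mor_id[OF o(3)]])
        (simp_all add: mult_in)
    then show "br X (ten Y Z) (x * (y * z)) = (\<lambda>x\<in>car (ten (ten X Y) Z).
      tensor_map (car ?XY) (car (ten X Z)) (\<lambda>x\<in>car ?XY. x) (br X Z) (tensor_map (car (ten X Y)) (car Z) (br X Y) (\<lambda>x\<in>car Z. x) x)) (x * (y * z))"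
      using xyz o c d br_right[OF o xyz] mult_in[OF ten_obj[OF o(1,2)] o(3) mult_in[OF o(1,2) xyz(1,2)] xyz(3)]
      by (simp add: mult.assoc ten_obj ten_car cng_car)
  qed
  then show "Braid C X (TenO C Y Z) = Comp C (TenA C (Id C (ConjO C (Deg C X) Y)) (Braid C X Z)) (TenA C (Braid C X Y) (Id C Z))"
    using o c d by (simp add: sel ten_assoc cng_ten)
next
  fix a X Y assume a: "a \<in> carrier G" and "X \<in> Obj C" "Y \<in> Obj C"
  then have o: "X \<in> objs" "Y \<in> objs" by (simp_all add: sel)
  have "deg X \<in> carrier G" using o by (simp add: deg_G)
  then have "cng a (cng (deg X) Y) = cng (deg (cng a X)) (cng a Y)"
    using a o by (simp add: cng_deg cng_mult[symmetric] grp.m_assoc)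
  then show "ConjA C a (Braid C X Y) = Braid C (ConjO C a X) (ConjO C a Y)"
    using a o \<open>deg X \<in> carrier G\<close> by (simp add: sel cng_ten cng_obj br_cng)
qed

end

context yd_setting
begin

section \<open>The braided T-category of generalized Yetter-Drinfel'd modules\<close>

lemma yd_degE:
  assumes "yd M"
  obtains \<alpha> \<beta> where "ydeg M = (\<alpha>, \<beta>)" "\<alpha> \<in> Aut" "\<beta> \<in> Aut"
  using yd_deg[OF assms] by (cases "ydeg M") (auto simp: carrier_G)

text \<open>Strictness asks for equality of objects. Structure maps are extensional, so agreement on
  the carrier is enough for equality of the records.\<close>

lemma yd_eqI:
  assumes M: "yd M" and N: "yd N" and "ydeg M = ydeg N" and car: "ycar M = ycar N"
    and act: "\<And>h x. x \<in> ycar N \<Longrightarrow> yact M h x = yact N h x"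
    and coact: "\<And>x. x \<in> ycar N \<Longrightarrow> ycoact M x = ycoact N x"
  shows "M = N"
proof -
  have "yact M h = yact N h" for h
    using act_ext[OF M, of h] act_ext[OF N, of h] act by (intro extensionalityI[of _ "ycar N"]) (simp_all add: car)
  moreover have "ycoact M = ycoact N"
    using yd_precoaction[OF M] yd_precoaction[OF N] coact
    by (intro extensionalityI[of _ "ycar N"]) (auto simp: precoaction_def PiE_def car)
  ultimately show ?thesis using assms by (intro yd_module.equality) auto
qed

subsection \<open>Morphisms\<close>

abbreviation "ymor \<equiv> yd_morphism s H"

lemma ymor_iff:
  assumes M: "yd M" and N: "yd N"
  shows "ymor M N f \<longleftrightarrow> ydeg M = ydeg N \<and> f \<in> ycar M \<rightarrow>\<^sub>E ycar N \<and> linear_on (ycar M) s s f \<and>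
     (\<forall>h. \<forall>m\<in>ycar M. f (yact M h m) = yact N h (f m)) \<and>
     (\<forall>m\<in>ycar M. ycoact N (f m) = SWY M m (\<lambda>x c. tenY (f x) c))"
proof -
  have "swY s H M m (\<lambda>x c. tenY (f x) c) = SWY M m (\<lambda>x c. tenY (f x) c)"
    if "linear_on (ycar M) s s f" "m \<in> ycar M" for m
    by (rule swY_eq[OF yd_precoaction[OF M] vector_space_fscale _ _ that(2)])
      (intro lin lin_comp[OF that(1)] | assumption)+
  then show ?thesis unfolding yd_morphism_def colinear_def by auto
qed

lemma SWY_mor:
  assumes M: "yd M" and N: "yd N" and f: "ymor M N f" and m: "m \<in> ycar M"
    and F: "vector_space s3" "\<And>c. linear_on (ycar N) s s3 (\<lambda>x. F x c)" "\<And>x. x \<in> ycar N \<Longrightarrow> linear_on UNIV hs s3 (\<lambda>c. F x c)"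
  shows "SWY N (f m) F = SWY M m (\<lambda>x c. F (f x) c)"
proof -
  have *: "f \<in> ycar M \<rightarrow>\<^sub>E ycar N" "ycoact N (f m) = SWY M m (\<lambda>x c. tenY (f x) c)" using f m by (auto simp: ymor_iff[OF M N])
  show ?thesis
    unfolding SWY_def[of M]
    by (rule SWY_tenY[OF yd_precoaction[OF N]])
      (use * F m in \<open>auto simp: SWY_def yco_in[OF yd_precoaction[OF M]]\<close>)
qed

lemma ymor_id:
  assumes M: "yd M"
  shows "ymor M M (\<lambda>m\<in>ycar M. m)"
  unfolding ymor_iff[OF M M]
proof (intro conjI allI ballI)
  fix m assume m: "m \<in> ycar M"
  have "SWY M m (\<lambda>x c. tenY ((\<lambda>m\<in>ycar M. m) x) c) = SWY M m tenY"
    by (rule yd_SWY_cong[OF M m]) simp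
  then show "ycoact M ((\<lambda>m\<in>ycar M. m) m) = SWY M m (\<lambda>x c. tenY ((\<lambda>m\<in>ycar M. m) x) c)"
    using m by (simp add: coact_eq[OF yd_precoaction[OF M]])
qed (auto simp: act_in[OF M] linear_on_def uni.subspace_add[OF subU[OF yd_U[OF M]]] scale_in[OF yd_U[OF M]])

lemma ymor_comp:
  assumes M: "yd M" and N: "yd N" and P: "yd P" and f: "ymor M N f" and g: "ymor N P g"
  shows "ymor M P (\<lambda>m\<in>ycar M. g (f m))"
  unfolding ymor_iff[OF M P]
proof (intro conjI allI ballI)
  have f1: "f \<in> ycar M \<rightarrow>\<^sub>E ycar N" "linear_on (ycar M) s s f" and g1: "g \<in> ycar N \<rightarrow>\<^sub>E ycar P" "linear_on (ycar N) s s g"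
    and fh: "\<And>h m. m \<in> ycar M \<Longrightarrow> f (yact M h m) = yact N h (f m)"
    and gh: "\<And>h m. m \<in> ycar N \<Longrightarrow> g (yact N h m) = yact P h (g m)"
    and gc: "\<And>m. m \<in> ycar N \<Longrightarrow> ycoact P (g m) = SWY N m (\<lambda>x c. tenY (g x) c)"
    using f g by (auto simp: ymor_iff[OF M N] ymor_iff[OF N P])
  have fin: "m \<in> ycar M \<Longrightarrow> f m \<in> ycar N" for m using f1 by auto
  show "(\<lambda>m\<in>ycar M. g (f m)) \<in> ycar M \<rightarrow>\<^sub>E ycar P" using f1 g1 by auto
  show "ydeg M = ydeg P" using f g by (auto simp: ymor_iff[OF M N] ymor_iff[OF N P])
  show "linear_on (ycar M) s s (\<lambda>m\<in>ycar M. g (f m))"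
    using lin_comp[OF g1(2) f1(2) fin] by (simp add: linear_on_def uni.subspace_add[OF subU[OF yd_U[OF M]]] scale_in[OF yd_U[OF M]])
  fix m assume m: "m \<in> ycar M"
  show "(\<lambda>m\<in>ycar M. g (f m)) (yact M h m) = yact P h ((\<lambda>m\<in>ycar M. g (f m)) m)" for h
    using m by (simp add: act_in[OF M] fh gh fin)
  have "ycoact P (g (f m)) = SWY M m (\<lambda>x c. tenY (g (f x)) c)"
    unfolding gc[OF fin[OF m]]
    by (rule SWY_mor[OF M N f m vector_space_fscale]) (intro lin lin_comp[OF g1(2)] | assumption)+
  also have "\<dots> = SWY M m (\<lambda>x c. tenY ((\<lambda>m\<in>ycar M. g (f m)) x) c)"
    by (rule yd_SWY_cong[OF M m]) simp
  finally show "ycoact P ((\<lambda>m\<in>ycar M. g (f m)) m) = SWY M m (\<lambda>x c. tenY ((\<lambda>m\<in>ycar M. g (f m)) x) c)"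
    using m by simp
qed

lemma ymor_ten:
  assumes M: "yd M" and M': "yd M'" and N: "yd N" and N': "yd N'" and f: "ymor M M' f" and g: "ymor N N' g"
  shows "ymor (yten M N) (yten M' N') (tensor_map (ycar M) (ycar N) f g)"
proof -
  obtain \<alpha> \<beta> where dM: "ydeg M = (\<alpha>, \<beta>)" by (cases "ydeg M") auto
  obtain \<gamma> \<delta> where dN: "ydeg N = (\<gamma>, \<delta>)" by (cases "ydeg N") auto
  have f1: "f \<in> ycar M \<rightarrow>\<^sub>E ycar M'" "linear_on (ycar M) s s f" "ydeg M' = (\<alpha>, \<beta>)"
    and g1: "g \<in> ycar N \<rightarrow>\<^sub>E ycar N'" "linear_on (ycar N) s s g" "ydeg N' = (\<gamma>, \<delta>)"
    and fh: "\<And>h m. m \<in> ycar M \<Longrightarrow> f (yact M h m) = yact M' h (f m)"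
    and gh: "\<And>h m. m \<in> ycar N \<Longrightarrow> g (yact N h m) = yact N' h (g m)"
    using f g by (auto simp: ymor_iff[OF M M'] ymor_iff[OF N N'] dM dN)
  have fin: "m \<in> ycar M \<Longrightarrow> f m \<in> ycar M'" for m using f1 by auto
  have gin: "m \<in> ycar N \<Longrightarrow> g m \<in> ycar N'" for m using g1 by auto
  let ?t = "tensor_map (ycar M) (ycar N) f g"
  note UM = yd_U[OF M] and UN = yd_U[OF N]
  have T: "yd (yten M N)" "yd (yten M' N')" by (rule yd_tensor_yd[OF M N dM dN] yd_tensor_yd[OF M' N' f1(3) g1(3)])+
  have tl: "linear_on (ten (ycar M) (ycar N)) s s ?t" by (rule uni.tensor_map_linear[OF UM UN f1(2) g1(2)])
  have tm: "?t (m * n) = f m * g n" if "m \<in> ycar M" "n \<in> ycar N" for m n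
    by (rule uni.tensor_map_mult[OF UM UN f1(2) g1(2) that])
  have tp: "?t \<in> ten (ycar M) (ycar N) \<rightarrow>\<^sub>E ten (ycar M') (ycar N')"
    by (rule uni.tensor_map_PiE[OF UM UN yd_U[OF M'] yd_U[OF N'] f1(2) g1(2)]) (use f1 g1 in auto)
  then have tin: "x \<in> ten (ycar M) (ycar N) \<Longrightarrow> ?t x \<in> ten (ycar M') (ycar N')" for x by auto
  note L = lin yd_lin[OF T(1), unfolded ten_sel] yd_lin[OF T(2), unfolded ten_sel] lin_comp[OF tl] vss
    lin_comp[OF lin_coact[OF yd_precoaction[OF T(2)], unfolded ten_sel]] act_in[OF T(1), unfolded ten_sel] tin
  note act = ten_act_mult[OF M N dM dN] ten_act_mult[OF M' N' f1(3) g1(3)]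
  show ?thesis
    unfolding ymor_iff[OF T] ten_sel
  proof (intro conjI allI ballI)
    show "ydeg M \<otimes>\<^bsub>G\<^esub> ydeg N = ydeg M' \<otimes>\<^bsub>G\<^esub> ydeg N'" using f1 g1 dM dN by simp
    fix x assume x: "x \<in> ten (ycar M) (ycar N)"
    show "?t (yact (yten M N) h x) = yact (yten M' N') h (?t x)" for h
    proof (rule ten_ext[OF UM UN vs_s _ _ x])
      fix m n assume mn: "m \<in> ycar M" "n \<in> ycar N"
      have "?t (yact (yten M N) h (m * n)) = SWH h (\<lambda>h1 h2. ?t (yact M h2 m * yact N h1 n))"
        unfolding act(1)[OF mn]
        by (rule SWH_lin[OF tl]) (simp_all add: subU ten_U UM UN ten_in act_in[OF M] act_in[OF N] mn)
      then show "?t (yact (yten M N) h (m * n)) = yact (yten M' N') h (?t (m * n))"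
        by (simp add: tm mn fin gin act act_in[OF M] act_in[OF N] fh gh)
    qed (intro L | assumption)+
    show "ycoact (yten M' N') (?t x) = SWY (yten M N) x (\<lambda>x c. tenY (?t x) c)"
    proof (rule ten_ext[OF UM UN vector_space_fscale _ _ x])
      fix m n assume mn: "m \<in> ycar M" "n \<in> ycar N"
      note L = L ten_lins[OF M N dM dN] ten_lins[OF M' N' f1(3) g1(3)] ten_in fin gin lin_comp[OF f1(2)] lin_comp[OF g1(2)]
      have "SWY (yten M N) (m * n) (\<lambda>x c. tenY (?t x) c) =
          SWY M m (\<lambda>m0 m1. SWY N n (\<lambda>n0 n1. tenY (?t (m0 * n0)) (\<delta> m1 * (\<delta> \<circ> \<alpha> \<circ> finv \<delta>) n1)))"
        by (rule SWY_ten[OF M N dM dN vector_space_fscale _ _ mn]) (intro L | assumption)+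
      also have "\<dots> = SWY M m (\<lambda>m0 m1. SWY N n (\<lambda>n0 n1. tenY (f m0 * g n0) (\<delta> m1 * (\<delta> \<circ> \<alpha> \<circ> finv \<delta>) n1)))"
        by (rule yd_SWY_cong[OF M mn(1)], rule yd_SWY_cong[OF N mn(2)]) (simp add: tm)
      also have "\<dots> = SWY M m (\<lambda>m0 m1. SWY N' (g n) (\<lambda>n0 n1. tenY (f m0 * n0) (\<delta> m1 * (\<delta> \<circ> \<alpha> \<circ> finv \<delta>) n1)))"
        by (rule yd_SWY_cong[OF M mn(1)], rule SWY_mor[OF N N' g mn(2) vector_space_fscale, symmetric])
          (intro L | assumption)+
      also have "\<dots> = SWY M' (f m) (\<lambda>m0 m1. SWY N' (g n) (\<lambda>n0 n1. tenY (m0 * n0) (\<delta> m1 * (\<delta> \<circ> \<alpha> \<circ> finv \<delta>) n1)))"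
        by (rule SWY_mor[OF M M' f mn(1) vector_space_fscale, symmetric]) (intro L mn | assumption)+
      also have "\<dots> = ycoact (yten M' N') (f m * g n)"
        by (rule ten_coact_mult[OF M' N' f1(3) g1(3) fin gin, symmetric]) (fact mn)+
      finally show "ycoact (yten M' N') (?t (m * n)) = SWY (yten M N) (m * n) (\<lambda>x c. tenY (?t x) c)"
        by (simp add: tm mn)
    qed (intro L | assumption)+
  qed (use tl tp in auto)
qed

lemma yconj_yd: "\<lbrakk>a \<in> carrier G; yd N\<rbrakk> \<Longrightarrow> yd (yconj a N)"
  by (cases a; cases "ydeg N") (simp add: yd_conj_yd carrier_G)

lemma yten_yd: "\<lbrakk>yd M; yd N\<rbrakk> \<Longrightarrow> yd (yten M N)"
  by (cases "ydeg M"; cases "ydeg N") (simp add: yd_tensor_yd)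

lemma ymor_conj:
  assumes a: "a \<in> carrier G" and M: "yd M" and N: "yd N" and f: "ymor M N f"
  shows "ymor (yconj a M) (yconj a N) f"
proof -
  obtain \<alpha> \<beta> where ab: "a = (\<alpha>, \<beta>)" "\<alpha> \<in> Aut" "\<beta> \<in> Aut" using a by (auto simp: carrier_G)
  obtain \<gamma> \<delta> where dM: "ydeg M = (\<gamma>, \<delta>)" by (cases "ydeg M") auto
  have f1: "f \<in> ycar M \<rightarrow>\<^sub>E ycar N" "linear_on (ycar M) s s f" and dN: "ydeg N = (\<gamma>, \<delta>)"
    and fh: "\<And>h m. m \<in> ycar M \<Longrightarrow> f (yact M h m) = yact N h (f m)"
    using f by (auto simp: ymor_iff[OF M N] dM)
  have fin: "m \<in> ycar M \<Longrightarrow> f m \<in> ycar N" for m using f1 by auto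
  note \<theta> = conj_auts[OF M dM ab(2,3)]
  show ?thesis
    unfolding ab(1) ymor_iff[OF yconj_yd[OF a M, unfolded ab(1)] yconj_yd[OF a N, unfolded ab(1)]] conj_sel
  proof (intro conjI allI ballI)
    fix m assume m: "m \<in> ycar M"
    show "f (yact M (finv \<alpha> (\<beta> h)) m) = yact N (finv \<alpha> (\<beta> h)) (f m)" for h by (rule fh[OF m])
    have "ycoact (yconj (\<alpha>, \<beta>) N) (f m) = SWY N (f m) (\<lambda>x c. tenY x ((finv \<beta> \<circ> \<delta> \<circ> \<alpha> \<circ> finv \<delta>) c))"
      by (rule conj_coact[OF N dN ab(2,3) fin[OF m]])
    also have "\<dots> = SWY M m (\<lambda>x c. tenY (f x) ((finv \<beta> \<circ> \<delta> \<circ> \<alpha> \<circ> finv \<delta>) c))"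
      by (rule SWY_mor[OF M N f m vector_space_fscale]) (intro lin lin_aut[OF \<theta>(3)])+
    also have "\<dots> = SWY (yconj (\<alpha>, \<beta>) M) m (\<lambda>x c. tenY (f x) c)"
      by (rule SWY_conj[OF M dM ab(2,3) m vector_space_fscale, symmetric]) (intro lin lin_comp[OF f1(2)] | assumption)+
    finally show "ycoact (yconj (\<alpha>, \<beta>) N) (f m) = SWY (yconj (\<alpha>, \<beta>) M) m (\<lambda>x c. tenY (f x) c)" .
  qed (use f1 dM dN in auto)
qed

subsection \<open>Strictness\<close>

lemma ten_deg_eq: "\<lbrakk>ydeg M = (\<alpha>, \<beta>); ydeg N = (\<gamma>, \<delta>)\<rbrakk> \<Longrightarrow> ydeg (yten M N) = (\<delta> \<circ> \<alpha> \<circ> finv \<delta> \<circ> \<gamma>, \<delta> \<circ> \<beta>)"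
  by (simp add: ten_sel mult_G)

lemma ten3_ext:
  assumes "V \<in> \<U>" "W \<in> \<U>" "X \<in> \<U>" "vector_space s3" "linear_on (ten V (ten W X)) s s3 f" "linear_on (ten V (ten W X)) s s3 g"
    and t: "t \<in> ten V (ten W X)" and eq: "\<And>a b c. \<lbrakk>a \<in> V; b \<in> W; c \<in> X\<rbrakk> \<Longrightarrow> f (a * (b * c)) = g (a * (b * c))"
  shows "f t = g t"
proof (rule ten_ext[OF assms(1) ten_U[OF assms(2,3)] assms(4-7)])
  fix a u assume a: "a \<in> V" and u: "u \<in> ten W X"
  show "f (a * u) = g (a * u)"
    by (rule ten_ext[OF assms(2,3,4) _ _ u, where f = "\<lambda>u. f (a * u)" and g = "\<lambda>u. g (a * u)"])
      (rule eq[OF a] | intro lin lin_comp[OF assms(5)] lin_comp[OF assms(6)] ten_in a | assumption)+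
qed

lemma yten_assoc:
  assumes M: "yd M" and N: "yd N" and P: "yd P"
  shows "yten (yten M N) P = yten M (yten N P)"
proof -
  obtain \<alpha> \<beta> where dM: "ydeg M = (\<alpha>, \<beta>)" "\<alpha> \<in> Aut" "\<beta> \<in> Aut" using yd_degE[OF M] .
  obtain \<gamma> \<delta> where dN: "ydeg N = (\<gamma>, \<delta>)" "\<gamma> \<in> Aut" "\<delta> \<in> Aut" using yd_degE[OF N] .
  obtain \<kappa> \<zeta> where dP: "ydeg P = (\<kappa>, \<zeta>)" "\<kappa> \<in> Aut" "\<zeta> \<in> Aut" using yd_degE[OF P] .
  note MN = yten_yd[OF M N] and NP = yten_yd[OF N P]
  note dMN = ten_deg_eq[OF dM(1) dN(1)] and dNP = ten_deg_eq[OF dN(1) dP(1)]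
  note T = yten_yd[OF MN P] yten_yd[OF M NP]
  note U = yd_U[OF M] yd_U[OF N] yd_U[OF P]
  note assoc = uni.tensor_space_assoc[OF U]
  note L = ten_lins[OF M N dM(1) dN(1)] ten_lins[OF N P dN(1) dP(1)]
    ten_lins[OF MN P dMN dP(1), unfolded ten_sel] ten_lins[OF M NP dM(1) dNP, unfolded ten_sel]
    yd_lin[OF T(1), unfolded ten_sel] yd_lin[OF T(2), unfolded ten_sel] ten_in
    lin_coact[OF yd_precoaction[OF T(1)], unfolded ten_sel] lin_coact[OF yd_precoaction[OF T(2)], unfolded ten_sel]
  show ?thesis
  proof (rule yd_eqI[OF T], unfold ten_sel)
    show "ydeg M \<otimes>\<^bsub>G\<^esub> ydeg N \<otimes>\<^bsub>G\<^esub> ydeg P = ydeg M \<otimes>\<^bsub>G\<^esub> (ydeg N \<otimes>\<^bsub>G\<^esub> ydeg P)"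
      using yd_deg[OF M] yd_deg[OF N] yd_deg[OF P] by (rule monoid.m_assoc[OF group.is_monoid[OF group_G]])
    show "ten (ten (ycar M) (ycar N)) (ycar P) = ten (ycar M) (ten (ycar N) (ycar P))" by (rule assoc)
    fix x assume x: "x \<in> ten (ycar M) (ten (ycar N) (ycar P))"
    show "yact (yten (yten M N) P) h x = yact (yten M (yten N P)) h x" for h
    proof (rule ten3_ext[OF U vs_s _ _ x])
      fix m n p assume m: "m \<in> ycar M" and n: "n \<in> ycar N" and p: "p \<in> ycar P"
      have mn: "m * n \<in> ycar (yten M N)" and np: "n * p \<in> ycar (yten N P)" by (simp_all add: ten_sel ten_in m n p)
      have "yact (yten (yten M N) P) h (m * n * p) = SWH h (\<lambda>h1 h2. SWH h2 (\<lambda>u v. yact M v m * (yact N u n * yact P h1 p)))"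
        by (subst ten_act_mult[OF MN P dMN dP(1) mn p])
          (simp add: ten_act_mult[OF M N dM(1) dN(1) m n] SWH_mult_right mult.assoc)
      also have "\<dots> = SWH h (\<lambda>h1 h2. SWH h1 (\<lambda>u v. yact M h2 m * (yact N v n * yact P u p)))"
        by (rule SWH_coassoc[OF vs_s, symmetric]) (intro L m n p)+
      also have "\<dots> = yact (yten M (yten N P)) h (m * (n * p))"
        by (simp add: ten_act_mult[OF M NP dM(1) dNP m np] ten_act_mult[OF N P dN(1) dP(1) n p] SWH_mult_left)
      finally show "yact (yten (yten M N) P) h (m * (n * p)) = yact (yten M (yten N P)) h (m * (n * p))"
        by (simp add: mult.assoc)
    qed (use L assoc in \<open>simp_all add: lin_act[OF T(1) lin_id, unfolded ten_sel assoc] lin_act[OF T(2) lin_id, unfolded ten_sel]\<close>)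
    show "ycoact (yten (yten M N) P) x = ycoact (yten M (yten N P)) x"
    proof (rule ten3_ext[OF U vector_space_fscale _ _ x])
      fix m n p assume m: "m \<in> ycar M" and n: "n \<in> ycar N" and p: "p \<in> ycar P"
      have mn: "m * n \<in> ycar (yten M N)" and np: "n * p \<in> ycar (yten N P)" by (simp_all add: ten_sel ten_in m n p)
      let ?E = "\<lambda>m0 m1 n0 n1 p0 p1. tenY (m0 * n0 * p0) (\<zeta> (\<delta> m1 * (\<delta> \<circ> \<alpha> \<circ> finv \<delta>) n1) * (\<zeta> \<circ> (\<delta> \<circ> \<alpha> \<circ> finv \<delta> \<circ> \<gamma>) \<circ> finv \<zeta>) p1)"
      have "ycoact (yten (yten M N) P) (m * n * p) = SWY (yten M N) (m * n) (\<lambda>x c. SWY P p (\<lambda>p0 p1.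
          tenY (x * p0) (\<zeta> c * (\<zeta> \<circ> (\<delta> \<circ> \<alpha> \<circ> finv \<delta> \<circ> \<gamma>) \<circ> finv \<zeta>) p1)))"
        by (rule ten_coact_mult[OF MN P dMN dP(1) mn p])
      also have "\<dots> = SWY M m (\<lambda>m0 m1. SWY N n (\<lambda>n0 n1. SWY P p (\<lambda>p0 p1. ?E m0 m1 n0 n1 p0 p1)))"
        by (rule SWY_ten[OF M N dM(1) dN(1) vector_space_fscale _ _ m n]) (intro L p | assumption)+
      finally have 1: "ycoact (yten (yten M N) P) (m * n * p) =
          SWY M m (\<lambda>m0 m1. SWY N n (\<lambda>n0 n1. SWY P p (\<lambda>p0 p1. ?E m0 m1 n0 n1 p0 p1)))" .
      \<comment> \<open>In either bracketing the three coaction legs are twisted by \<zeta>\<delta>,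
        by \<zeta>\<delta>\<alpha>\<delta>^-1 and by
        \<zeta>\<delta>\<alpha>\<delta>^-1\<gamma>\<zeta>^-1.\<close>
      have e: "(\<zeta> \<circ> \<delta>) m1 * ((\<zeta> \<circ> \<delta>) \<circ> \<alpha> \<circ> finv (\<zeta> \<circ> \<delta>)) (\<zeta> n1 * (\<zeta> \<circ> \<gamma> \<circ> finv \<zeta>) p1) =
          \<zeta> (\<delta> m1 * (\<delta> \<circ> \<alpha> \<circ> finv \<delta>) n1) * (\<zeta> \<circ> (\<delta> \<circ> \<alpha> \<circ> finv \<delta> \<circ> \<gamma>) \<circ> finv \<zeta>) p1" for m1 n1 p1
        using dM dN dP by (simp add: finv_comp aut_mult mult.assoc)
      have "ycoact (yten M (yten N P)) (m * (n * p)) = SWY M m (\<lambda>m0 m1. SWY (yten N P) (n * p) (\<lambda>x c.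
          tenY (m0 * x) ((\<zeta> \<circ> \<delta>) m1 * ((\<zeta> \<circ> \<delta>) \<circ> \<alpha> \<circ> finv (\<zeta> \<circ> \<delta>)) c)))"
        by (rule ten_coact_mult[OF M NP dM(1) dNP m np])
      also have "\<dots> = SWY M m (\<lambda>m0 m1. SWY N n (\<lambda>n0 n1. SWY P p (\<lambda>p0 p1. tenY (m0 * (n0 * p0))
          ((\<zeta> \<circ> \<delta>) m1 * ((\<zeta> \<circ> \<delta>) \<circ> \<alpha> \<circ> finv (\<zeta> \<circ> \<delta>)) (\<zeta> n1 * (\<zeta> \<circ> \<gamma> \<circ> finv \<zeta>) p1)))))"
        by (rule yd_SWY_cong[OF M m], rule SWY_ten[OF N P dN(1) dP(1) vector_space_fscale _ _ n p])
          (intro L | assumption)+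
      finally show "ycoact (yten (yten M N) P) (m * (n * p)) = ycoact (yten M (yten N P)) (m * (n * p))"
        unfolding e mult.assoc[symmetric, of _ _ "_ :: 'v"] 1[symmetric] by simp
    qed (use L assoc in \<open>simp_all add: lin_coact[OF yd_precoaction[OF T(1)], unfolded ten_sel assoc]
          lin_coact[OF yd_precoaction[OF T(2)], unfolded ten_sel]\<close>)
  qed
qed

end

context yd_setting
begin

lemma yten_unit_left:
  assumes N: "yd N"
  shows "yten yunit N = N"
proof -
  obtain \<gamma> \<delta> where dN: "ydeg N = (\<gamma>, \<delta>)" "\<gamma> \<in> Aut" "\<delta> \<in> Aut" using yd_degE[OF N] .
  have one: "1 \<in> ycar yunit" by (simp add: unit_sel uni.span_base)
  note T = yten_yd[OF yd_unit_yd N]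
  have car: "ten (ycar yunit) (ycar N) = ycar N" by (simp add: unit_sel uni.tensor_space_unit yd_U[OF N])
  note L = ten_lins[OF yd_unit_yd N unit_sel(1) dN(1)]
  show ?thesis
  proof (rule yd_eqI[OF T N], unfold ten_sel)
    show "ydeg yunit \<otimes>\<^bsub>G\<^esub> ydeg N = ydeg N" using dN by (simp add: unit_sel mult_G fun_eq_iff)
    show "ten (ycar yunit) (ycar N) = ycar N" by (rule car)
    fix x assume x: "x \<in> ycar N"
    show "yact (yten yunit N) h x = yact N h x" for h
    proof -
      have "yact (yten yunit N) h (1 * x) = SWH h (\<lambda>h1 h2. s (eps h2) (yact N h1 x))"
        unfolding ten_act_mult[OF yd_unit_yd N unit_sel(1) dN(1) one x]
        using one by (simp add: unit_sel uni.scale_mult_left)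
      also have "\<dots> = yact N h x" by (rule SWH_counit_right[OF vs_s]) (intro L x)
      finally show ?thesis by simp
    qed
    have "ycoact (yten yunit N) (1 * x) = SWY yunit 1 (\<lambda>m0 m1. SWY N x (\<lambda>n0 n1. tenY (m0 * n0) (\<delta> m1 * (\<delta> \<circ> id \<circ> finv \<delta>) n1)))"
      by (rule ten_coact_mult[OF yd_unit_yd N unit_sel(1) dN(1) one x])
    also have "\<dots> = SWY N x (\<lambda>n0 n1. tenY (1 * n0) (\<delta> 1 * (\<delta> \<circ> id \<circ> finv \<delta>) n1))"
      by (rule SWY_unit[OF one[unfolded unit_sel] vector_space_fscale]) (intro L x | assumption)+
    also have "\<dots> = ycoact N x"
      using dN by (simp add: aut_one coact_eq[OF yd_precoaction[OF N] x])
    finally show "ycoact (yten yunit N) x = ycoact N x" by simp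
  qed
qed

lemma yten_unit_right:
  assumes M: "yd M"
  shows "yten M yunit = M"
proof -
  obtain \<alpha> \<beta> where dM: "ydeg M = (\<alpha>, \<beta>)" "\<alpha> \<in> Aut" "\<beta> \<in> Aut" using yd_degE[OF M] .
  have one: "1 \<in> ycar yunit" by (simp add: unit_sel uni.span_base)
  note T = yten_yd[OF M yd_unit_yd]
  have car: "ten (ycar M) (ycar yunit) = ycar M" by (simp add: unit_sel uni.tensor_space_unit yd_U[OF M])
  note L = ten_lins[OF M yd_unit_yd dM(1) unit_sel(1)]
  show ?thesis
  proof (rule yd_eqI[OF T M], unfold ten_sel)
    show "ydeg M \<otimes>\<^bsub>G\<^esub> ydeg yunit = ydeg M" using dM by (simp add: unit_sel mult_G fun_eq_iff)
    show "ten (ycar M) (ycar yunit) = ycar M" by (rule car)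
    fix x assume x: "x \<in> ycar M"
    show "yact (yten M yunit) h x = yact M h x" for h
    proof -
      have "yact (yten M yunit) h (x * 1) = SWH h (\<lambda>h1 h2. s (eps h1) (yact M h2 x))"
        unfolding ten_act_mult[OF M yd_unit_yd dM(1) unit_sel(1) x one]
        using one by (simp add: unit_sel uni.scale_mult_right)
      also have "\<dots> = yact M h x" by (rule SWH_counit_left[OF vs_s]) (intro L x)
      finally show ?thesis by simp
    qed
    have "ycoact (yten M yunit) (x * 1) = SWY M x (\<lambda>m0 m1. SWY yunit 1 (\<lambda>n0 n1. tenY (m0 * n0) (id m1 * (id \<circ> \<alpha> \<circ> finv id) n1)))"
      by (rule ten_coact_mult[OF M yd_unit_yd dM(1) unit_sel(1) x one])
    also have "\<dots> = SWY M x (\<lambda>m0 m1. tenY (m0 * 1) (id m1 * (id \<circ> \<alpha> \<circ> finv id) 1))"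
      by (rule yd_SWY_cong[OF M x], rule SWY_unit[OF one[unfolded unit_sel] vector_space_fscale]) (intro L x | assumption)+
    also have "\<dots> = ycoact M x"
      using dM by (simp add: aut_one coact_eq[OF yd_precoaction[OF M] x] inv_id)
    finally show "ycoact (yten M yunit) x = ycoact M x" by simp
  qed
qed

lemma conj_deg_eq:
  "\<lbrakk>ydeg N = (\<gamma>, \<delta>); \<gamma> \<in> Aut; \<delta> \<in> Aut; \<alpha> \<in> Aut; \<beta> \<in> Aut\<rbrakk> \<Longrightarrow> ydeg (yconj (\<alpha>, \<beta>) N) =
    (finv \<beta> \<circ> \<delta> \<circ> \<alpha> \<circ> finv \<delta> \<circ> \<gamma> \<circ> finv \<alpha> \<circ> \<beta>, finv \<beta> \<circ> \<delta> \<circ> \<beta>)"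
  by (simp add: conj_sel conj_G)

lemma yconj_one:
  assumes N: "yd N"
  shows "yconj \<one>\<^bsub>G\<^esub> N = N"
proof -
  interpret G: group G by (rule group_G)
  obtain \<gamma> \<delta> where dN: "ydeg N = (\<gamma>, \<delta>)" "\<gamma> \<in> Aut" "\<delta> \<in> Aut" using yd_degE[OF N] .
  show ?thesis
  proof (rule yd_eqI[OF yconj_yd[OF G.one_closed N] N], unfold conj_sel)
    show "\<one>\<^bsub>G\<^esub> \<otimes>\<^bsub>G\<^esub> ydeg N \<otimes>\<^bsub>G\<^esub> inv\<^bsub>G\<^esub> \<one>\<^bsub>G\<^esub> = ydeg N" using yd_deg[OF N] by simp
    fix x assume x: "x \<in> ycar N"
    show "yact (yconj \<one>\<^bsub>G\<^esub> N) h x = yact N h x" for h by (simp add: one_G conj_sel inv_id)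
    have "ycoact (yconj \<one>\<^bsub>G\<^esub> N) x = SWY N x (\<lambda>y c. tenY y ((finv id \<circ> \<delta> \<circ> id \<circ> finv \<delta>) c))"
      unfolding one_G by (rule conj_coact[OF N dN(1) _ _ x]) simp_all
    then show "ycoact (yconj \<one>\<^bsub>G\<^esub> N) x = ycoact N x"
      using dN by (simp add: inv_id coact_eq[OF yd_precoaction[OF N] x])
  qed simp
qed

lemma yconj_mult:
  assumes a: "a \<in> carrier G" and b: "b \<in> carrier G" and N: "yd N"
  shows "yconj (a \<otimes>\<^bsub>G\<^esub> b) N = yconj a (yconj b N)"
proof -
  interpret G: group G by (rule group_G)
  obtain \<gamma> \<delta> where dN: "ydeg N = (\<gamma>, \<delta>)" "\<gamma> \<in> Aut" "\<delta> \<in> Aut" using yd_degE[OF N] .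
  obtain \<alpha> \<beta> where a': "a = (\<alpha>, \<beta>)" "\<alpha> \<in> Aut" "\<beta> \<in> Aut" using a by (auto simp: carrier_G)
  obtain \<kappa> \<zeta> where b': "b = (\<kappa>, \<zeta>)" "\<kappa> \<in> Aut" "\<zeta> \<in> Aut" using b by (auto simp: carrier_G)
  note bN = yconj_yd[OF b N]
  have ab: "a \<otimes>\<^bsub>G\<^esub> b = (\<zeta> \<circ> \<alpha> \<circ> finv \<zeta> \<circ> \<kappa>, \<zeta> \<circ> \<beta>)" by (simp add: a' b' mult_G)
  have auts: "\<zeta> \<circ> \<alpha> \<circ> finv \<zeta> \<circ> \<kappa> \<in> Aut" "\<zeta> \<circ> \<beta> \<in> Aut" using a' b' by simp_all
  note dbN = conj_deg_eq[OF dN b'(2,3)]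
  show ?thesis
  proof (rule yd_eqI[OF yconj_yd[OF G.m_closed[OF a b] N] yconj_yd[OF a bN]], unfold conj_sel)
    show "a \<otimes>\<^bsub>G\<^esub> b \<otimes>\<^bsub>G\<^esub> ydeg N \<otimes>\<^bsub>G\<^esub> inv\<^bsub>G\<^esub> (a \<otimes>\<^bsub>G\<^esub> b) =
      a \<otimes>\<^bsub>G\<^esub> (b \<otimes>\<^bsub>G\<^esub> ydeg N \<otimes>\<^bsub>G\<^esub> inv\<^bsub>G\<^esub> b) \<otimes>\<^bsub>G\<^esub> inv\<^bsub>G\<^esub> a"
      using a b yd_deg[OF N] by (simp add: G.inv_mult_group G.m_assoc)
    fix x assume x: "x \<in> ycar N"
    show "yact (yconj (a \<otimes>\<^bsub>G\<^esub> b) N) h x = yact (yconj a (yconj b N)) h x" for h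
      unfolding ab unfolding a'(1) b'(1) conj_sel using a' b' by (simp add: finv_comp finv_finv)
    have "ycoact (yconj (a \<otimes>\<^bsub>G\<^esub> b) N) x = SWY N x (\<lambda>y c. tenY y ((finv (\<zeta> \<circ> \<beta>) \<circ> \<delta> \<circ> (\<zeta> \<circ> \<alpha> \<circ> finv \<zeta> \<circ> \<kappa>) \<circ> finv \<delta>) c))"
      unfolding ab by (rule conj_coact[OF N dN(1) auts x])
    also have "\<dots> = SWY N x (\<lambda>y c. tenY y ((finv \<beta> \<circ> (finv \<zeta> \<circ> \<delta> \<circ> \<zeta>) \<circ> \<alpha> \<circ> finv (finv \<zeta> \<circ> \<delta> \<circ> \<zeta>)) ((finv \<zeta> \<circ> \<delta> \<circ> \<kappa> \<circ> finv \<delta>) c)))"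
      using a' b' dN by (simp add: finv_comp finv_finv)
    also have "\<dots> = SWY (yconj (\<kappa>, \<zeta>) N) x (\<lambda>y c. tenY y ((finv \<beta> \<circ> (finv \<zeta> \<circ> \<delta> \<circ> \<zeta>) \<circ> \<alpha> \<circ> finv (finv \<zeta> \<circ> \<delta> \<circ> \<zeta>)) c))"
      by (rule SWY_conj[OF N dN(1) b'(2,3) x vector_space_fscale, symmetric])
        (intro lin lin_comp[OF lin_aut[OF conj_auts(3)[OF bN[unfolded b'] dbN a'(2,3)] lin_id] _ UNIV_I])+
    also have "\<dots> = ycoact (yconj a (yconj b N)) x"
      unfolding a'(1) b'(1)
      by (rule conj_coact[OF bN[unfolded b'] dbN a'(2,3), symmetric]) (simp add: x conj_sel)
    finally show "ycoact (yconj (a \<otimes>\<^bsub>G\<^esub> b) N) x = ycoact (yconj a (yconj b N)) x" .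
  qed simp
qed

lemma yconj_ten:
  assumes a: "a \<in> carrier G" and M: "yd M" and N: "yd N"
  shows "yconj a (yten M N) = yten (yconj a M) (yconj a N)"
proof -
  interpret G: group G by (rule group_G)
  obtain \<alpha> \<beta> where dM: "ydeg M = (\<alpha>, \<beta>)" "\<alpha> \<in> Aut" "\<beta> \<in> Aut" using yd_degE[OF M] .
  obtain \<gamma> \<delta> where dN: "ydeg N = (\<gamma>, \<delta>)" "\<gamma> \<in> Aut" "\<delta> \<in> Aut" using yd_degE[OF N] .
  obtain \<kappa> \<zeta> where a': "a = (\<kappa>, \<zeta>)" "\<kappa> \<in> Aut" "\<zeta> \<in> Aut" using a by (auto simp: carrier_G)
  note MN = yten_yd[OF M N] and aM = yconj_yd[OF a M] and aN = yconj_yd[OF a N]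
  note dMN = ten_deg_eq[OF dM(1) dN(1)]
  note daM = conj_deg_eq[OF dM a'(2,3)] and daN = conj_deg_eq[OF dN a'(2,3)]
  note T = yconj_yd[OF a MN] yten_yd[OF aM aN]
  have \<phi>: "finv \<kappa> \<circ> \<zeta> \<in> Aut" using a' by simp
  note \<theta> = conj_auts(3)[OF MN dMN a'(2,3)]
  note L = ten_lins[OF M N dM(1) dN(1)] lin_aut[OF \<phi>] lin_aut[OF \<theta>]
    yd_lin[OF T(1), unfolded conj_sel ten_sel] yd_lin[OF T(2), unfolded conj_sel ten_sel]
    lin_aut[OF conj_auts(3)[OF M dM(1) a'(2,3)]] lin_aut[OF conj_auts(3)[OF N dN(1) a'(2,3)]]
    lin_coact[OF yd_precoaction[OF T(1)], unfolded conj_sel ten_sel] lin_coact[OF yd_precoaction[OF T(2)], unfolded conj_sel ten_sel]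
  show ?thesis
  proof (rule yd_eqI[OF T], unfold conj_sel ten_sel)
    show "a \<otimes>\<^bsub>G\<^esub> (ydeg M \<otimes>\<^bsub>G\<^esub> ydeg N) \<otimes>\<^bsub>G\<^esub> inv\<^bsub>G\<^esub> a =
      (a \<otimes>\<^bsub>G\<^esub> ydeg M \<otimes>\<^bsub>G\<^esub> inv\<^bsub>G\<^esub> a) \<otimes>\<^bsub>G\<^esub> (a \<otimes>\<^bsub>G\<^esub> ydeg N \<otimes>\<^bsub>G\<^esub> inv\<^bsub>G\<^esub> a)"
    proof -
      have "(a \<otimes>\<^bsub>G\<^esub> ydeg M \<otimes>\<^bsub>G\<^esub> inv\<^bsub>G\<^esub> a) \<otimes>\<^bsub>G\<^esub> (a \<otimes>\<^bsub>G\<^esub> ydeg N \<otimes>\<^bsub>G\<^esub> inv\<^bsub>G\<^esub> a) =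
          a \<otimes>\<^bsub>G\<^esub> ydeg M \<otimes>\<^bsub>G\<^esub> (inv\<^bsub>G\<^esub> a \<otimes>\<^bsub>G\<^esub> a) \<otimes>\<^bsub>G\<^esub> ydeg N \<otimes>\<^bsub>G\<^esub> inv\<^bsub>G\<^esub> a"
        using a yd_deg[OF M] yd_deg[OF N] by (simp only: G.m_assoc G.m_closed G.inv_closed)
      then show ?thesis using a yd_deg[OF M] yd_deg[OF N] by (simp add: G.m_assoc)
    qed
    fix x assume x: "x \<in> ten (ycar M) (ycar N)"
    show "yact (yconj a (yten M N)) h x = yact (yten (yconj a M) (yconj a N)) h x" for h
    proof (rule ten_ext[OF yd_U[OF M] yd_U[OF N] vs_s _ _ x])
      fix m n assume mn: "m \<in> ycar M" "n \<in> ycar N"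
      have "yact (yconj a (yten M N)) h (m * n) = SWH ((finv \<kappa> \<circ> \<zeta>) h) (\<lambda>h1 h2. yact M h2 m * yact N h1 n)"
        by (simp add: a'(1) conj_sel ten_act_mult[OF M N dM(1) dN(1) mn])
      also have "\<dots> = SWH h (\<lambda>h1 h2. yact M ((finv \<kappa> \<circ> \<zeta>) h2) m * yact N ((finv \<kappa> \<circ> \<zeta>) h1) n)"
        by (rule SWH_aut[OF \<phi> vs_s]) (intro L mn)+
      also have "\<dots> = yact (yten (yconj a M) (yconj a N)) h (m * n)"
        unfolding a'(1)
        by (subst ten_act_mult[OF aM[unfolded a'(1)] aN[unfolded a'(1)] daM daN, unfolded conj_sel, OF mn]) simp
      finally show "yact (yconj a (yten M N)) h (m * n) = yact (yten (yconj a M) (yconj a N)) h (m * n)" .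
    qed (intro L | assumption)+
    show "ycoact (yconj a (yten M N)) x = ycoact (yten (yconj a M) (yconj a N)) x"
    proof (rule ten_ext[OF yd_U[OF M] yd_U[OF N] vector_space_fscale _ _ x])
      fix m n assume mn: "m \<in> ycar M" "n \<in> ycar N"
      let ?d = "finv \<zeta> \<circ> \<delta> \<circ> \<zeta>" and ?a = "finv \<zeta> \<circ> \<beta> \<circ> \<kappa> \<circ> finv \<beta> \<circ> \<alpha> \<circ> finv \<kappa> \<circ> \<zeta>"
      let ?tM = "finv \<zeta> \<circ> \<beta> \<circ> \<kappa> \<circ> finv \<beta>" and ?tN = "finv \<zeta> \<circ> \<delta> \<circ> \<kappa> \<circ> finv \<delta>"
      let ?T = "?d \<circ> ?a \<circ> finv ?d"
      have dT: "?d \<in> Aut" "?T \<in> Aut" using a' dM dN by simp_all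
      note L = L lin_aut[OF dT(1)] lin_aut[OF dT(2)]
      have "ycoact (yconj a (yten M N)) (m * n) = SWY (yten M N) (m * n) (\<lambda>y c. tenY y ((finv \<zeta> \<circ> (\<delta> \<circ> \<beta>) \<circ> \<kappa> \<circ> finv (\<delta> \<circ> \<beta>)) c))"
        unfolding a'(1) by (rule conj_coact[OF MN dMN a'(2,3)]) (simp add: ten_sel ten_in mn)
      also have "\<dots> = SWY M m (\<lambda>m0 m1. SWY N n (\<lambda>n0 n1. tenY (m0 * n0)
          ((finv \<zeta> \<circ> (\<delta> \<circ> \<beta>) \<circ> \<kappa> \<circ> finv (\<delta> \<circ> \<beta>)) (\<delta> m1 * (\<delta> \<circ> \<alpha> \<circ> finv \<delta>) n1))))"
        by (rule SWY_ten[OF M N dM(1) dN(1) vector_space_fscale _ _ mn]) (intro L)+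
      \<comment> \<open>Twisting the product of the two legs by the conjugation of the tensor
        product agrees, leg by leg, with twisting each leg by its own conjugation and then by the
        conjugated degrees; all inverses cancel.\<close>
      also have "\<dots> = SWY M m (\<lambda>m0 m1. SWY N n (\<lambda>n0 n1. tenY (m0 * n0) (?d (?tM m1) * ?T (?tN n1))))"
        unfolding aut_mult[OF \<theta>] using a' dM dN by (simp add: finv_comp finv_finv)
      also have "\<dots> = SWY M m (\<lambda>m0 m1. SWY (yconj (\<kappa>, \<zeta>) N) n (\<lambda>n0 n1. tenY (m0 * n0) (?d (?tM m1) * ?T n1)))"
        by (rule yd_SWY_cong[OF M mn(1)], rule SWY_conj[OF N dN(1) a'(2,3) mn(2) vector_space_fscale, symmetric]) (intro L)+
      also have "\<dots> = SWY (yconj (\<kappa>, \<zeta>) M) m (\<lambda>m0 m1. SWY (yconj (\<kappa>, \<zeta>) N) n (\<lambda>n0 n1. tenY (m0 * n0) (?d m1 * ?T n1)))"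
        by (rule SWY_conj[OF M dM(1) a'(2,3) mn(1) vector_space_fscale, symmetric])
          (intro L lin_SWY_body[OF yd_precoaction[OF aN[unfolded a'(1)]], unfolded conj_sel] mn)+
      also have "\<dots> = ycoact (yten (yconj a M) (yconj a N)) (m * n)"
        unfolding a'(1)
        by (rule ten_coact_mult[OF aM[unfolded a'(1)] aN[unfolded a'(1)] daM daN, symmetric, unfolded conj_sel, OF mn])
      finally show "ycoact (yconj a (yten M N)) (m * n) = ycoact (yten (yconj a M) (yconj a N)) (m * n)" .
    qed (intro L | assumption)+
  qed simp
qed

lemma yconj_unit:
  assumes a: "a \<in> carrier G"
  shows "yconj a yunit = yunit"
proof -
  interpret G: group G by (rule group_G)
  obtain \<alpha> \<beta> where a': "a = (\<alpha>, \<beta>)" "\<alpha> \<in> Aut" "\<beta> \<in> Aut" using a by (auto simp: carrier_G)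
  show ?thesis
  proof (rule yd_eqI[OF yconj_yd[OF a yd_unit_yd] yd_unit_yd], unfold conj_sel)
    show "a \<otimes>\<^bsub>G\<^esub> ydeg yunit \<otimes>\<^bsub>G\<^esub> inv\<^bsub>G\<^esub> a = ydeg yunit"
      using a by (simp add: unit_sel one_G[symmetric])
    fix x assume x: "x \<in> ycar yunit"
    show "yact (yconj a yunit) h x = yact yunit h x" for h
      using x a' by (simp add: conj_sel unit_sel aut_eps)
    have "ycoact (yconj a yunit) x = SWY yunit x (\<lambda>y c. tenY y ((finv \<beta> \<circ> id \<circ> \<alpha> \<circ> finv id) c))"
      unfolding a' by (rule conj_coact[OF yd_unit_yd unit_sel(1) a'(2,3) x])
    also have "\<dots> = tenY x ((finv \<beta> \<circ> id \<circ> \<alpha> \<circ> finv id) 1)"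
      using a' by (intro SWY_unit[OF x[unfolded unit_sel] vector_space_fscale]) (intro lin lin_aut[OF aut_comp] aut_comp aut_finv aut_id)+
    finally show "ycoact (yconj a yunit) x = ycoact yunit x"
      using x a' by (simp add: unit_sel inv_id aut_one)
  qed simp
qed

end

context yd_setting
begin

subsection \<open>The braiding\<close>

abbreviation "ybr \<equiv> yd_braiding s H"

text \<open>Supplies the inverse of the braiding as a morphism: its compatibility with action and
  coaction follows from that of f.\<close>

lemma ymor_inverse:
  assumes M: "yd M" and N: "yd N" and f: "ymor M N f" and g: "g \<in> ycar N \<rightarrow>\<^sub>E ycar M" "linear_on (ycar N) s s g"
    and gf: "\<And>x. x \<in> ycar M \<Longrightarrow> g (f x) = x" and fg: "\<And>y. y \<in> ycar N \<Longrightarrow> f (g y) = y"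
  shows "ymor N M g"
proof -
  have gin: "y \<in> ycar N \<Longrightarrow> g y \<in> ycar M" for y using g by auto
  have f1: "ydeg M = ydeg N" and fh: "\<And>h m. m \<in> ycar M \<Longrightarrow> f (yact M h m) = yact N h (f m)"
    using f by (auto simp: ymor_iff[OF M N])
  show ?thesis
    unfolding ymor_iff[OF N M]
  proof (intro conjI allI ballI)
    fix y assume y: "y \<in> ycar N"
    show "g (yact N h y) = yact M h (g y)" for h
      using fh[OF gin[OF y], of h] gf[of "yact M h (g y)"] act_in[OF M gin[OF y]] fg[OF y] by simp
    have "SWY N (f (g y)) (\<lambda>x c. tenY (g x) c) = SWY M (g y) (\<lambda>x c. tenY (g (f x)) c)"
      by (rule SWY_mor[OF M N f gin[OF y] vector_space_fscale]) (intro lin lin_comp[OF g(2)] | assumption)+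
    also have "\<dots> = SWY M (g y) tenY" by (rule yd_SWY_cong[OF M gin[OF y]]) (simp add: gf)
    finally show "ycoact M (g y) = SWY N y (\<lambda>x c. tenY (g x) c)"
      by (simp add: fg[OF y] coact_eq[OF yd_precoaction[OF M] gin[OF y]])
  qed (use f1 g in auto)
qed

context
  fixes M N \<alpha> \<beta> \<gamma> \<delta>
  assumes M: "yd M" and N: "yd N" and dM: "ydeg M = (\<alpha>, \<beta>)" and dN: "ydeg N = (\<gamma>, \<delta>)"
begin

private lemmas br_deg_auts = ten_auts[OF M N dM dN]
private lemmas br_U = yd_U[OF M] yd_U[OF N]

lemma br_auts: "finv \<alpha> \<in> Aut"
  using br_deg_auts by simp

lemmas br_lins = ten_lins[OF M N dM dN] lin_aut[OF br_auts]

lemma br_mult: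
  assumes "m \<in> ycar M" "n \<in> ycar N"
  shows "ybr M N (m * n) = SWY M m (\<lambda>m0 m1. yact N (finv \<alpha> m1) n * m0)"
proof -
  have "ybr M N (m * n) = swt (ycar M) (ycar N) (m * n) (\<lambda>m n. swY s H M m (\<lambda>m0 m1. yact N (finv \<alpha> m1) n * m0))"
    by (simp add: yd_braiding_def dM ten_in assms)
  also have "\<dots> = swt (ycar M) (ycar N) (m * n) (\<lambda>m n. SWY M m (\<lambda>m0 m1. yact N (finv \<alpha> m1) n * m0))"
    by (rule sweedler_cong, rule swY_eq[OF yd_precoaction[OF M] vs_s]) (intro br_lins | assumption)+
  also have "\<dots> = SWY M m (\<lambda>m0 m1. yact N (finv \<alpha> m1) n * m0)"
    by (rule swt_mult[OF br_U vs_s]) (intro br_lins assms | assumption)+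
  finally show ?thesis .
qed

lemma br_eq: "x \<in> ten (ycar M) (ycar N) \<Longrightarrow>
    ybr M N x = swt (ycar M) (ycar N) x (\<lambda>m n. SWY M m (\<lambda>m0 m1. yact N (finv \<alpha> m1) n * m0))"
proof -
  assume x: "x \<in> ten (ycar M) (ycar N)"
  have "ybr M N x = swt (ycar M) (ycar N) x (\<lambda>m n. swY s H M m (\<lambda>m0 m1. yact N (finv \<alpha> m1) n * m0))"
    by (simp add: yd_braiding_def dM x)
  also have "\<dots> = swt (ycar M) (ycar N) x (\<lambda>m n. SWY M m (\<lambda>m0 m1. yact N (finv \<alpha> m1) n * m0))"
    by (rule sweedler_cong, rule swY_eq[OF yd_precoaction[OF M] vs_s]) (intro br_lins | assumption)+
  finally show ?thesis .
qed

lemma br_linear: "linear_on (ten (ycar M) (ycar N)) s s (ybr M N)"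
proof -
  have "linear_on (ten (ycar M) (ycar N)) s s (\<lambda>x. swt (ycar M) (ycar N) x (\<lambda>m n. SWY M m (\<lambda>m0 m1. yact N (finv \<alpha> m1) n * m0)))"
    by (rule swt_linear[OF br_U vs_s]) (intro br_lins | assumption)+
  then show ?thesis
    using subU[OF ten_U[OF br_U]] by (simp add: linear_on_def br_eq uni.subspace_add uni.subspace_scale)
qed

lemma br_PiE: "ybr M N \<in> ten (ycar M) (ycar N) \<rightarrow>\<^sub>E ten (ycar N) (ycar M)"
proof (rule PiE_I)
  fix x assume x: "x \<in> ten (ycar M) (ycar N)"
  show "ybr M N x \<in> ten (ycar N) (ycar M)"
    unfolding br_eq[OF x]
    by (rule swt_in[OF br_U vs_s _ _ subU[OF ten_U[OF br_U(2,1)]] x])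
      (intro br_lins SWY_in[OF yd_precoaction[OF M] _ vs_s subU[OF ten_U[OF br_U(2,1)]]] ten_in | assumption)+
qed (simp add: yd_braiding_def dM)

lemma br_in: "x \<in> ten (ycar M) (ycar N) \<Longrightarrow> ybr M N x \<in> ten (ycar N) (ycar M)"
  using br_PiE by auto

text \<open>H-linearity is the compatibility condition of M, with \<alpha>^-1 in the braiding
  turning \<alpha>(h1) into h1. Colinearity is the condition of N at \<alpha>^-1 of a leg of m,
  reached by coassociativity of M.\<close>

lemma br_mor: "ymor (yten M N) (yten (yconj (ydeg M) N) M) (ybr M N)"
proof -
  interpret G: group G by (rule group_G)
  let ?N' = "yconj (\<alpha>, \<beta>) N"
  let ?\<Theta> = "\<delta> \<circ> \<alpha> \<circ> finv \<delta>"
  have a: "(\<alpha>, \<beta>) \<in> carrier G" using br_deg_auts by (simp add: carrier_G)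
  note MN = yten_yd[OF M N] and N' = yconj_yd[OF a N]
  note N'M = yten_yd[OF N' M]
  note dN' = conj_deg_eq[OF dN br_deg_auts(3,4) br_deg_auts(1,2)]
  note P' = yd_precoaction[OF N'M]
  note L = br_lins lin_comp[OF br_linear] br_in ten_in yd_lin[OF MN, unfolded ten_sel] yd_lin[OF N'M, unfolded ten_sel conj_sel]
    act_in[OF MN, unfolded ten_sel] yd_lin[OF N', unfolded conj_sel]
    lin_comp[OF lin_coact[OF P', unfolded ten_sel conj_sel]]
  have deg: "ydeg (yten M N) = ydeg (yten ?N' M)"
    using a br_deg_auts yd_deg[OF N] by (simp add: ten_sel conj_sel dM G.m_assoc)
  show ?thesis
    unfolding dM ymor_iff[OF MN N'M] ten_sel(2) conj_sel(2)
  proof (intro conjI allI ballI deg br_linear br_PiE)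
    fix x assume x: "x \<in> ten (ycar M) (ycar N)"
    show "ybr M N (yact (yten M N) h x) = yact (yten ?N' M) h (ybr M N x)" for h
    proof (rule ten_ext[OF br_U vs_s _ _ x])
      fix m n assume m: "m \<in> ycar M" and n: "n \<in> ycar N"
      have "ybr M N (yact (yten M N) h (m * n)) = SWH h (\<lambda>h1 h2. ybr M N (yact M h2 m * yact N h1 n))"
        unfolding ten_act_mult[OF M N dM dN m n]
        by (rule SWH_lin[OF br_linear vs_s vs_s subU[OF ten_U[OF br_U]]]) (intro L m n)
      also have "\<dots> = SWH h (\<lambda>h1 h2. SWY M (yact M h2 m) (\<lambda>m0 m1. yact N (finv \<alpha> (m1 * \<alpha> h1)) n * m0))"
        using br_deg_auts by (simp add: br_mult act_in[OF M m] act_in[OF N n] act_mult[OF N n] aut_mult[OF br_auts])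
      also have "\<dots> = SWH h (\<lambda>h1 h2. SWY M m (\<lambda>m0 m1. yact N (finv \<alpha> (\<beta> h2 * m1)) n * yact M h1 m0))"
        by (rule SWY_yd[OF M dM vs_s _ _ m, symmetric]) (intro L n | assumption)+
      also have "\<dots> = SWY M m (\<lambda>m0 m1. SWH h (\<lambda>h1 h2. yact N (finv \<alpha> (\<beta> h2 * m1)) n * yact M h1 m0))"
        by (rule SWY_SWH_swap[symmetric])
      also have "\<dots> = SWY M m (\<lambda>m0 m1. yact (yten ?N' M) h (yact N (finv \<alpha> m1) n * m0))"
        by (rule yd_SWY_cong[OF M m], subst ten_act_mult[OF N' M dN' dM])
          (simp_all add: conj_sel act_in[OF N n] aut_mult[OF br_auts] act_mult[OF N n])
      also have "\<dots> = yact (yten ?N' M) h (ybr M N (m * n))"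
        unfolding br_mult[OF m n]
        by (rule SWY_lin[OF yd_precoaction[OF M] m lin_act[OF N'M lin_id], symmetric, where X = "ten (ycar N) (ycar M)"])
          (simp_all add: ten_sel conj_sel subU ten_U br_U ten_in act_in[OF N n])
      finally show "ybr M N (yact (yten M N) h (m * n)) = yact (yten ?N' M) h (ybr M N (m * n))" .
    qed (intro L | assumption)+
    show "ycoact (yten ?N' M) (ybr M N x) = SWY (yten M N) x (\<lambda>x c. tenY (ybr M N x) c)"
    proof (rule ten_ext[OF br_U vector_space_fscale _ _ x])
      fix m n assume m: "m \<in> ycar M" and n: "n \<in> ycar N"
      let ?a = "finv \<beta> \<circ> \<delta> \<circ> \<alpha> \<circ> finv \<delta> \<circ> \<gamma> \<circ> finv \<alpha> \<circ> \<beta>"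
      have lin_ba: "\<beta> \<circ> ?a \<circ> finv \<beta> \<in> Aut" using br_deg_auts by simp
      note L = L lin_aut[OF lin_ba]
      have "ycoact (yten ?N' M) (ybr M N (m * n)) = SWY M m (\<lambda>m0 m1. ycoact (yten ?N' M) (yact N (finv \<alpha> m1) n * m0))"
        unfolding br_mult[OF m n]
        by (rule SWY_lin[OF yd_precoaction[OF M] m lin_coact[OF P', unfolded ten_sel conj_sel]])
          (simp_all add: subU ten_U br_U ten_in act_in[OF N n])
      also have "\<dots> = SWY M m (\<lambda>m0 m1. SWY ?N' (yact N (finv \<alpha> m1) n) (\<lambda>n0 n1. SWY M m0 (\<lambda>x c.
          tenY (n0 * x) (\<beta> n1 * (\<beta> \<circ> ?a \<circ> finv \<beta>) c))))"
        by (rule yd_SWY_cong[OF M m], rule ten_coact_mult[OF N' M dN' dM]) (simp_all add: conj_sel act_in[OF N n])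
      also have "\<dots> = SWY M m (\<lambda>m0 m1. SWY N (yact N (finv \<alpha> m1) n) (\<lambda>n0 n1. SWY M m0 (\<lambda>x c.
          tenY (n0 * x) (\<beta> ((finv \<beta> \<circ> \<delta> \<circ> \<alpha> \<circ> finv \<delta>) n1) * (\<beta> \<circ> ?a \<circ> finv \<beta>) c))))"
        by (rule yd_SWY_cong[OF M m], rule SWY_conj[OF N dN br_deg_auts(1,2) act_in[OF N n] vector_space_fscale]) (intro L | assumption)+
      \<comment> \<open>This is where the conjugate of N in the target matters: \<beta> cancels in
        both twists, which become \<Theta> and \<Theta>\<gamma>\<alpha>^-1, so that \<Theta> can be
        pulled out in front of n1 \<gamma>(\<alpha>^-1(c)).\<close>
      also have "\<dots> = SWY M m (\<lambda>m0 m1. SWY N (yact N (finv \<alpha> m1) n) (\<lambda>n0 n1. SWY M m0 (\<lambda>x c.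
          tenY (n0 * x) (?\<Theta> (n1 * \<gamma> (finv \<alpha> c))))))"
        unfolding aut_mult[OF br_deg_auts(5)] using br_deg_auts by simp
      also have "\<dots> = SWY M m (\<lambda>m0 m1. SWY M m0 (\<lambda>x c. SWY N (yact N (finv \<alpha> m1) n) (\<lambda>n0 n1.
          tenY (n0 * x) (?\<Theta> (n1 * \<gamma> (finv \<alpha> c))))))"
        by (rule yd_SWY_cong[OF M m], rule SWY_swap)
      \<comment> \<open>Coassociativity makes c and d the legs of one element e, so the condition of
        N applies at \<alpha>^-1(e).\<close>
      also have "\<dots> = SWY M m (\<lambda>x e. SWH e (\<lambda>c d. SWY N (yact N (finv \<alpha> d) n) (\<lambda>n0 n1.
          tenY (n0 * x) (?\<Theta> (n1 * \<gamma> (finv \<alpha> c))))))"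
        by (rule SWY_coassoc[OF M vector_space_fscale _ _ _ m]) (intro L n | assumption)+
      also have "\<dots> = SWY M m (\<lambda>x e. SWH e (\<lambda>c d. SWY N n (\<lambda>n0 n1.
          tenY (yact N (finv \<alpha> c) n0 * x) (?\<Theta> (\<delta> (finv \<alpha> d) * n1)))))"
      proof (rule yd_SWY_cong[OF M m])
        fix x e assume x: "x \<in> ycar M"
        have "SWH e (\<lambda>c d. SWY N (yact N (finv \<alpha> d) n) (\<lambda>n0 n1. tenY (n0 * x) (?\<Theta> (n1 * \<gamma> (finv \<alpha> c))))) =
            SWH (finv \<alpha> e) (\<lambda>c d. SWY N (yact N d n) (\<lambda>n0 n1. tenY (n0 * x) (?\<Theta> (n1 * \<gamma> c))))"
          by (rule SWH_aut[OF br_auts vector_space_fscale, symmetric]) (intro L n | assumption)+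
        also have "\<dots> = SWH (finv \<alpha> e) (\<lambda>c d. SWY N n (\<lambda>n0 n1. tenY (yact N c n0 * x) (?\<Theta> (\<delta> d * n1))))"
          by (rule SWY_yd[OF N dN vector_space_fscale _ _ n, symmetric]) (intro L | assumption)+
        also have "\<dots> = SWH e (\<lambda>c d. SWY N n (\<lambda>n0 n1. tenY (yact N (finv \<alpha> c) n0 * x) (?\<Theta> (\<delta> (finv \<alpha> d) * n1))))"
          by (rule SWH_aut[OF br_auts vector_space_fscale]) (intro L n | assumption)+
        finally show "SWH e (\<lambda>c d. SWY N (yact N (finv \<alpha> d) n) (\<lambda>n0 n1. tenY (n0 * x) (?\<Theta> (n1 * \<gamma> (finv \<alpha> c))))) =
          SWH e (\<lambda>c d. SWY N n (\<lambda>n0 n1. tenY (yact N (finv \<alpha> c) n0 * x) (?\<Theta> (\<delta> (finv \<alpha> d) * n1))))" .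
      qed
      also have "\<dots> = SWY M m (\<lambda>x e. SWH e (\<lambda>c d. SWY N n (\<lambda>n0 n1.
          tenY (yact N (finv \<alpha> c) n0 * x) (\<delta> d * ?\<Theta> n1))))"
        unfolding aut_mult[OF br_deg_auts(5)] using br_deg_auts by simp
      also have "\<dots> = SWY M m (\<lambda>m0 m1. SWY M m0 (\<lambda>x c. SWY N n (\<lambda>n0 n1.
          tenY (yact N (finv \<alpha> c) n0 * x) (\<delta> m1 * ?\<Theta> n1))))"
        by (rule SWY_coassoc[OF M vector_space_fscale _ _ _ m, symmetric]) (intro L n | assumption)+
      also have "\<dots> = SWY M m (\<lambda>m0 m1. SWY N n (\<lambda>n0 n1. SWY M m0 (\<lambda>x c.
          tenY (yact N (finv \<alpha> c) n0 * x) (\<delta> m1 * ?\<Theta> n1))))"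
        by (rule yd_SWY_cong[OF M m], rule SWY_swap)
      also have "\<dots> = SWY M m (\<lambda>m0 m1. SWY N n (\<lambda>n0 n1. tenY (ybr M N (m0 * n0)) (\<delta> m1 * ?\<Theta> n1)))"
      proof (rule yd_SWY_cong[OF M m], rule yd_SWY_cong[OF N n])
        fix m0 m1 n0 n1 assume m0: "m0 \<in> ycar M" and n0: "n0 \<in> ycar N"
        show "SWY M m0 (\<lambda>x c. tenY (yact N (finv \<alpha> c) n0 * x) (\<delta> m1 * ?\<Theta> n1)) = tenY (ybr M N (m0 * n0)) (\<delta> m1 * ?\<Theta> n1)"
          unfolding br_mult[OF m0 n0]
          by (rule SWY_lin[OF yd_precoaction[OF M] m0 lin_pure_tensor_left[OF lin_id], symmetric, of s UNIV]) simp_all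
      qed
      also have "\<dots> = SWY (yten M N) (m * n) (\<lambda>x c. tenY (ybr M N x) c)"
        by (rule SWY_ten[OF M N dM dN vector_space_fscale _ _ m n, symmetric]) (intro L | assumption)+
      finally show "ycoact (yten ?N' M) (ybr M N (m * n)) = SWY (yten M N) (m * n) (\<lambda>x c. tenY (ybr M N x) c)" .
    qed (intro L | assumption)+
  qed
qed

text \<open>The inverse is n \<otimes> m \<mapsto> \<Sum> m0 \<otimes> \<alpha>^-1(S(m1)) \<cdot> n.
  In the two composites the coaction legs of m meet as S(m1) m2 and as m1 S(m2). That the inverse is
  a morphism comes from \<open>ymor_inverse\<close>.\<close>

lemma br_inverse:
  "\<exists>g. ymor (yten (yconj (ydeg M) N) M) (yten M N) g \<and>
    (\<forall>m\<in>ycar M. \<forall>n\<in>ycar N. g (ybr M N (m * n)) = m * n \<and> ybr M N (g (n * m)) = n * m)"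
proof -
  have a: "(\<alpha>, \<beta>) \<in> carrier G" using br_deg_auts by (simp add: carrier_G)
  define g where "g = (\<lambda>y\<in>ten (ycar N) (ycar M). swt (ycar N) (ycar M) y
    (\<lambda>n m. SWY M m (\<lambda>m0 m1. m0 * yact N (finv \<alpha> (S m1)) n)))"
  have gm: "g (n * m) = SWY M m (\<lambda>m0 m1. m0 * yact N (finv \<alpha> (S m1)) n)" if "m \<in> ycar M" "n \<in> ycar N" for m n
    unfolding g_def by (simp add: ten_in that, rule swt_mult[OF br_U(2,1) vs_s]) (intro br_lins that | assumption)+
  have "linear_on (ten (ycar N) (ycar M)) s s (\<lambda>y. swt (ycar N) (ycar M) y
      (\<lambda>n m. SWY M m (\<lambda>m0 m1. m0 * yact N (finv \<alpha> (S m1)) n)))"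
    by (rule swt_linear[OF br_U(2,1) vs_s]) (intro br_lins | assumption)+
  then have gl: "linear_on (ten (ycar N) (ycar M)) s s g"
    using subU[OF ten_U[OF br_U(2,1)]] by (simp add: linear_on_def g_def uni.subspace_add uni.subspace_scale)
  have gp: "g \<in> ten (ycar N) (ycar M) \<rightarrow>\<^sub>E ten (ycar M) (ycar N)"
  proof (rule PiE_I)
    fix y assume y: "y \<in> ten (ycar N) (ycar M)"
    have "swt (ycar N) (ycar M) y (\<lambda>n m. SWY M m (\<lambda>m0 m1. m0 * yact N (finv \<alpha> (S m1)) n)) \<in> ten (ycar M) (ycar N)"
      by (rule swt_in[OF br_U(2,1) vs_s _ _ subU[OF ten_U[OF br_U]] y])
        (intro br_lins SWY_in[OF yd_precoaction[OF M] _ vs_s subU[OF ten_U[OF br_U]]] ten_in | assumption)+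
    then show "g y \<in> ten (ycar M) (ycar N)" using y by (simp add: g_def)
  qed (simp add: g_def)
  then have gin: "y \<in> ten (ycar N) (ycar M) \<Longrightarrow> g y \<in> ten (ycar M) (ycar N)" for y by auto
  have 1: "g (ybr M N (m * n)) = m * n" if m: "m \<in> ycar M" and n: "n \<in> ycar N" for m n
  proof -
    have "g (ybr M N (m * n)) = SWY M m (\<lambda>m0 m1. g (yact N (finv \<alpha> m1) n * m0))"
      unfolding br_mult[OF m n]
      by (rule SWY_lin[OF yd_precoaction[OF M] m gl]) (simp_all add: subU ten_U br_U ten_in act_in[OF N n])
    also have "\<dots> = SWY M m (\<lambda>m0 m1. SWY M m0 (\<lambda>x c. x * yact N (finv \<alpha> (S c * m1)) n))"
      by (rule yd_SWY_cong[OF M m]) (simp add: gm act_in[OF N n] aut_mult[OF br_auts] act_mult[OF N n])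
    also have "\<dots> = SWY M m (\<lambda>x e. SWH e (\<lambda>c d. x * yact N (finv \<alpha> (S c * d)) n))"
      by (rule SWY_coassoc[OF M vs_s _ _ _ m]) (intro br_lins n)+
    also have "\<dots> = SWY M m (\<lambda>x e. s (eps e) (x * yact N (finv \<alpha> 1) n))"
      by (rule yd_SWY_cong[OF M m], rule SWH_antipode_left[OF vs_s]) (intro br_lins n)
    also have "\<dots> = m * yact N (finv \<alpha> 1) n"
      by (rule SWY_counit[OF M vs_s _ m]) (intro br_lins)
    finally show ?thesis by (simp add: aut_one[OF br_auts] act_one[OF N n])
  qed
  have 2: "ybr M N (g (n * m)) = n * m" if m: "m \<in> ycar M" and n: "n \<in> ycar N" for m n
  proof -
    have "ybr M N (g (n * m)) = SWY M m (\<lambda>m0 m1. ybr M N (m0 * yact N (finv \<alpha> (S m1)) n))"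
      unfolding gm[OF m n]
      by (rule SWY_lin[OF yd_precoaction[OF M] m br_linear]) (simp_all add: subU ten_U br_U ten_in act_in[OF N n])
    also have "\<dots> = SWY M m (\<lambda>m0 m1. SWY M m0 (\<lambda>x c. yact N (finv \<alpha> (c * S m1)) n * x))"
      by (rule yd_SWY_cong[OF M m]) (simp add: br_mult act_in[OF N n] aut_mult[OF br_auts] act_mult[OF N n])
    also have "\<dots> = SWY M m (\<lambda>x e. SWH e (\<lambda>c d. yact N (finv \<alpha> (c * S d)) n * x))"
      by (rule SWY_coassoc[OF M vs_s _ _ _ m]) (intro br_lins n)+
    also have "\<dots> = SWY M m (\<lambda>x e. s (eps e) (yact N (finv \<alpha> 1) n * x))"
      by (rule yd_SWY_cong[OF M m], rule SWH_antipode_right[OF vs_s]) (intro br_lins n)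
    also have "\<dots> = yact N (finv \<alpha> 1) n * m"
      by (rule SWY_counit[OF M vs_s _ m]) (intro br_lins)
    finally show ?thesis by (simp add: aut_one[OF br_auts] act_one[OF N n])
  qed
  have "ymor (yten (yconj (ydeg M) N) M) (yten M N) g"
  proof (rule ymor_inverse[OF yten_yd[OF M N] _ br_mor], unfold ten_sel conj_sel)
    show "yd (yten (yconj (ydeg M) N) M)" using a M N by (intro yten_yd yconj_yd) (simp_all add: dM)
    show "g (ybr M N x) = x" if "x \<in> ten (ycar M) (ycar N)" for x
      by (rule ten_ext[OF br_U vs_s _ _ that]) (intro lin_comp[OF gl br_linear] br_in lin 1 | assumption)+
    show "ybr M N (g y) = y" if "y \<in> ten (ycar N) (ycar M)" for y
      by (rule ten_ext[OF br_U(2,1) vs_s _ _ that]) (intro lin_comp[OF br_linear gl] gin lin 2 | assumption)+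
  qed (rule gp gl)+
  then show ?thesis using 1 2 by blast
qed

end

section \<open>Naturality of the braiding, the hexagon identities and conjugation\<close>

lemma br_natural:
  assumes M: "yd M" and N: "yd N" and M': "yd M'" and N': "yd N'" and f: "ymor M M' f" and g: "ymor N N' g"
    and m: "m \<in> ycar M" and n: "n \<in> ycar N"
  shows "tensor_map (ycar N) (ycar M) g f (ybr M N (m * n)) = ybr M' N' (f m * g n)"
proof -
  obtain \<alpha> \<beta> where dM: "ydeg M = (\<alpha>, \<beta>)" by (cases "ydeg M") auto
  obtain \<gamma> \<delta> where dN: "ydeg N = (\<gamma>, \<delta>)" by (cases "ydeg N") auto
  have f1: "f \<in> ycar M \<rightarrow>\<^sub>E ycar M'" "linear_on (ycar M) s s f" "ydeg M' = (\<alpha>, \<beta>)"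
    and g1: "g \<in> ycar N \<rightarrow>\<^sub>E ycar N'" "linear_on (ycar N) s s g" "ydeg N' = (\<gamma>, \<delta>)"
    and gh: "\<And>h m. m \<in> ycar N \<Longrightarrow> g (yact N h m) = yact N' h (g m)"
    using f g by (auto simp: ymor_iff[OF M M'] ymor_iff[OF N N'] dM dN)
  have fin: "f m \<in> ycar M'" and gin: "g n \<in> ycar N'" using f1 g1 m n by auto
  have "tensor_map (ycar N) (ycar M) g f (ybr M N (m * n)) =
      SWY M m (\<lambda>m0 m1. tensor_map (ycar N) (ycar M) g f (yact N (finv \<alpha> m1) n * m0))"
    unfolding br_mult[OF M N dM dN m n]
    by (rule SWY_lin[OF yd_precoaction[OF M] m uni.tensor_map_linear[OF yd_U[OF N] yd_U[OF M] g1(2) f1(2)]])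
      (simp_all add: subU ten_U yd_U[OF M] yd_U[OF N] ten_in act_in[OF N n])
  also have "\<dots> = SWY M m (\<lambda>m0 m1. yact N' (finv \<alpha> m1) (g n) * f m0)"
    by (rule yd_SWY_cong[OF M m])
      (simp add: uni.tensor_map_mult[OF yd_U[OF N] yd_U[OF M] g1(2) f1(2)] act_in[OF N n] gh[OF n])
  also have "\<dots> = SWY M' (f m) (\<lambda>m0 m1. yact N' (finv \<alpha> m1) (g n) * m0)"
    by (rule SWY_mor[OF M M' f m vs_s, symmetric]) (intro br_lins[OF M' N' f1(3) g1(3)] gin)+
  also have "\<dots> = ybr M' N' (f m * g n)"
    by (rule br_mult[OF M' N' f1(3) g1(3) fin gin, symmetric])
  finally show ?thesis .
qed

lemma br_hexagon_left:
  assumes X: "yd X" and Y: "yd Y" and Z: "yd Z" and x: "x \<in> ycar X" and y: "y \<in> ycar Y" and z: "z \<in> ycar Z"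
  shows "ybr (yten X Y) Z (x * y * z) =
    tensor_map (ten (ycar X) (ycar Z)) (ycar Y) (ybr X (yconj (ydeg Y) Z)) (\<lambda>y\<in>ycar Y. y) (x * ybr Y Z (y * z))"
proof -
  obtain \<alpha> \<beta> where dX: "ydeg X = (\<alpha>, \<beta>)" "\<alpha> \<in> Aut" "\<beta> \<in> Aut" using yd_degE[OF X] .
  obtain \<gamma> \<delta> where dY: "ydeg Y = (\<gamma>, \<delta>)" "\<gamma> \<in> Aut" "\<delta> \<in> Aut" using yd_degE[OF Y] .
  obtain \<kappa> \<zeta> where dZ: "ydeg Z = (\<kappa>, \<zeta>)" "\<kappa> \<in> Aut" "\<zeta> \<in> Aut" using yd_degE[OF Z] .
  let ?Z' = "yconj (\<gamma>, \<delta>) Z"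
  note XY = yten_yd[OF X Y] and dXY = ten_deg_eq[OF dX(1) dY(1)]
  have g: "(\<gamma>, \<delta>) \<in> carrier G" using dY by (simp add: carrier_G)
  note Z' = yconj_yd[OF g Z] and dZ' = conj_deg_eq[OF dZ dY(2,3)]
  note L = br_lins[OF X Z dX(1) dZ(1)] br_lins[OF Y Z dY(1) dZ(1)] br_lins[OF XY Z dXY dZ(1), unfolded ten_sel]
  note br_U = yd_U[OF X] yd_U[OF Y] yd_U[OF Z]
  have xy: "x * y \<in> ycar (yten X Y)" by (simp add: ten_sel ten_in x y)
  have idl: "linear_on (ycar Y) s s (\<lambda>y\<in>ycar Y. y)"
    by (simp add: linear_on_def uni.subspace_add[OF subU[OF br_U(2)]] scale_in[OF br_U(2)])
  have bl: "linear_on (ten (ycar X) (ycar Z)) s s (ybr X ?Z')"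
    using br_linear[OF X Z' dX(1) dZ'] by (simp add: conj_sel)
  note UXZ = ten_U[OF br_U(1,3)]
  note tl = uni.tensor_map_linear[OF UXZ br_U(2) bl idl]
  \<comment> \<open>The inverse of the first component of the degree of X \<otimes> Y undoes the
    twists of its coaction. What remains on the leg of x is \<gamma>^-1\<delta>\<alpha>^-1, that is,
    \<alpha>^-1 followed by the twist of the action on the conjugate of Z.\<close>
  have e: "finv (\<delta> \<circ> \<alpha> \<circ> finv \<delta> \<circ> \<gamma>) (\<delta> a * (\<delta> \<circ> \<alpha> \<circ> finv \<delta>) b) = finv \<gamma> (\<delta> (finv \<alpha> a)) * finv \<gamma> b" for a b
    using dX dY dZ aut_mult[of "finv (\<delta> \<circ> \<alpha> \<circ> finv \<delta> \<circ> \<gamma>)"] by (simp add: finv_comp finv_finv)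
  have "ybr (yten X Y) Z (x * y * z) = SWY (yten X Y) (x * y) (\<lambda>w c. yact Z (finv (\<delta> \<circ> \<alpha> \<circ> finv \<delta> \<circ> \<gamma>) c) z * w)"
    by (rule br_mult[OF XY Z dXY dZ(1) xy z])
  also have "\<dots> = SWY X x (\<lambda>x0 x1. SWY Y y (\<lambda>y0 y1. yact Z (finv (\<delta> \<circ> \<alpha> \<circ> finv \<delta> \<circ> \<gamma>) (\<delta> x1 * (\<delta> \<circ> \<alpha> \<circ> finv \<delta>) y1)) z * (x0 * y0)))"
    by (rule SWY_ten[OF X Y dX(1) dY(1) vs_s _ _ x y]) (intro L z)+
  also have "\<dots> = SWY Y y (\<lambda>y0 y1. SWY X x (\<lambda>x0 x1. yact ?Z' (finv \<alpha> x1) (yact Z (finv \<gamma> y1) z) * x0 * y0))"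
    unfolding e by (subst SWY_swap) (simp add: conj_sel act_mult[OF Z z] mult.assoc)
  also have "\<dots> = SWY Y y (\<lambda>y0 y1. ybr X ?Z' (x * yact Z (finv \<gamma> y1) z) * y0)"
    by (simp add: br_mult[OF X Z' dX(1) dZ'] conj_sel(2) act_in[OF Z z] x SWY_mult_right)
  also have "\<dots> = SWY Y y (\<lambda>y0 y1. tensor_map (ten (ycar X) (ycar Z)) (ycar Y) (ybr X ?Z') (\<lambda>y\<in>ycar Y. y) (x * yact Z (finv \<gamma> y1) z * y0))"
    by (rule yd_SWY_cong[OF Y y], subst uni.tensor_map_mult[OF UXZ br_U(2) bl idl]) (simp_all add: ten_in x act_in[OF Z z])
  also have "\<dots> = tensor_map (ten (ycar X) (ycar Z)) (ycar Y) (ybr X ?Z') (\<lambda>y\<in>ycar Y. y) (SWY Y y (\<lambda>y0 y1. x * yact Z (finv \<gamma> y1) z * y0))"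
    by (rule SWY_lin[OF yd_precoaction[OF Y] y tl, symmetric])
      (simp_all add: subU ten_U UXZ br_U ten_in x act_in[OF Z z])
  also have "SWY Y y (\<lambda>y0 y1. x * yact Z (finv \<gamma> y1) z * y0) = x * ybr Y Z (y * z)"
    by (simp add: br_mult[OF Y Z dY(1) dZ(1) y z] SWY_mult_left mult.assoc)
  finally show ?thesis unfolding dY(1) .
qed

lemma br_hexagon_right:
  assumes X: "yd X" and Y: "yd Y" and Z: "yd Z" and x: "x \<in> ycar X" and y: "y \<in> ycar Y" and z: "z \<in> ycar Z"
  shows "ybr X (yten Y Z) (x * (y * z)) =
    tensor_map (ycar Y) (ten (ycar X) (ycar Z)) (\<lambda>y\<in>ycar Y. y) (ybr X Z) (ybr X Y (x * y) * z)"
proof -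
  obtain \<alpha> \<beta> where dX: "ydeg X = (\<alpha>, \<beta>)" "\<alpha> \<in> Aut" "\<beta> \<in> Aut" using yd_degE[OF X] .
  obtain \<gamma> \<delta> where dY: "ydeg Y = (\<gamma>, \<delta>)" "\<gamma> \<in> Aut" "\<delta> \<in> Aut" using yd_degE[OF Y] .
  obtain \<kappa> \<zeta> where dZ: "ydeg Z = (\<kappa>, \<zeta>)" "\<kappa> \<in> Aut" "\<zeta> \<in> Aut" using yd_degE[OF Z] .
  note YZ = yten_yd[OF Y Z] and dYZ = ten_deg_eq[OF dY(1) dZ(1)]
  note L = br_lins[OF X Y dX(1) dY(1)] br_lins[OF X Z dX(1) dZ(1)] br_lins[OF X YZ dX(1) dYZ, unfolded ten_sel]
  note br_U = yd_U[OF X] yd_U[OF Y] yd_U[OF Z]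
  have yz: "y * z \<in> ycar (yten Y Z)" by (simp add: ten_sel ten_in y z)
  have idl: "linear_on (ycar Y) s s (\<lambda>y\<in>ycar Y. y)"
    by (simp add: linear_on_def uni.subspace_add[OF subU[OF br_U(2)]] scale_in[OF br_U(2)])
  note bl = br_linear[OF X Z dX(1) dZ(1)] and UXZ = ten_U[OF br_U(1,3)]
  note tl = uni.tensor_map_linear[OF br_U(2) UXZ idl bl]
  have "ybr X (yten Y Z) (x * (y * z)) = SWY X x (\<lambda>x0 x1. yact (yten Y Z) (finv \<alpha> x1) (y * z) * x0)"
    by (rule br_mult[OF X YZ dX(1) dYZ x yz])
  also have "\<dots> = SWY X x (\<lambda>x0 x1. SWH (finv \<alpha> x1) (\<lambda>a b. yact Y b y * yact Z a z * x0))"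
    by (simp add: ten_act_mult[OF Y Z dY(1) dZ(1) y z] SWH_mult_right)
  also have "\<dots> = SWY X x (\<lambda>x0 x1. SWH x1 (\<lambda>a b. yact Y (finv \<alpha> b) y * yact Z (finv \<alpha> a) z * x0))"
    by (rule yd_SWY_cong[OF X x], rule SWH_aut[OF aut_finv[OF dX(2)] vs_s]) (intro L y z)+
  \<comment> \<open>The reversed legs in the action on Y \<otimes> Z fit the two braidings: the
    outer leg x1 acts on y when x passes y, and the inner leg c acts on z when x0 passes z.\<close>
  also have "\<dots> = SWY X x (\<lambda>x0 x1. SWY X x0 (\<lambda>u c. yact Y (finv \<alpha> x1) y * yact Z (finv \<alpha> c) z * u))"
    by (rule SWY_coassoc[OF X vs_s _ _ _ x, symmetric]) (intro L y z)+
  also have "\<dots> = SWY X x (\<lambda>x0 x1. yact Y (finv \<alpha> x1) y * ybr X Z (x0 * z))"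
    by (rule yd_SWY_cong[OF X x]) (simp add: br_mult[OF X Z dX(1) dZ(1) _ z] SWY_mult_left mult.assoc)
  also have "\<dots> = SWY X x (\<lambda>x0 x1. tensor_map (ycar Y) (ten (ycar X) (ycar Z)) (\<lambda>y\<in>ycar Y. y) (ybr X Z) (yact Y (finv \<alpha> x1) y * (x0 * z)))"
    by (rule yd_SWY_cong[OF X x], subst uni.tensor_map_mult[OF br_U(2) UXZ idl bl]) (simp_all add: ten_in z act_in[OF Y y])
  also have "\<dots> = tensor_map (ycar Y) (ten (ycar X) (ycar Z)) (\<lambda>y\<in>ycar Y. y) (ybr X Z) (SWY X x (\<lambda>x0 x1. yact Y (finv \<alpha> x1) y * (x0 * z)))"
    by (rule SWY_lin[OF yd_precoaction[OF X] x tl, symmetric])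
      (simp_all add: subU ten_U UXZ br_U ten_in z act_in[OF Y y])
  also have "SWY X x (\<lambda>x0 x1. yact Y (finv \<alpha> x1) y * (x0 * z)) = ybr X Y (x * y) * z"
    by (simp add: br_mult[OF X Y dX(1) dY(1) x y] SWY_mult_right mult.assoc)
  finally show ?thesis .
qed

lemma br_conj:
  assumes a: "a \<in> carrier G" and M: "yd M" and N: "yd N"
  shows "ybr (yconj a M) (yconj a N) = ybr M N"
proof -
  obtain \<alpha> \<beta> where dM: "ydeg M = (\<alpha>, \<beta>)" "\<alpha> \<in> Aut" "\<beta> \<in> Aut" using yd_degE[OF M] .
  obtain \<gamma> \<delta> where dN: "ydeg N = (\<gamma>, \<delta>)" "\<gamma> \<in> Aut" "\<delta> \<in> Aut" using yd_degE[OF N] .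
  obtain \<kappa> \<zeta> where a': "a = (\<kappa>, \<zeta>)" "\<kappa> \<in> Aut" "\<zeta> \<in> Aut" using a by (auto simp: carrier_G)
  note aM = yconj_yd[OF a M, unfolded a'(1)] and aN = yconj_yd[OF a N, unfolded a'(1)]
  note daM = conj_deg_eq[OF dM a'(2,3)] and daN = conj_deg_eq[OF dN a'(2,3)]
  show ?thesis
    unfolding a'(1)
  proof (rule uni.tensor_ext[OF yd_U[OF M] yd_U[OF N]])
    show "linear_on (ten (ycar M) (ycar N)) s s (ybr M N)" by (rule br_linear[OF M N dM(1) dN(1)])
    show "linear_on (ten (ycar M) (ycar N)) s s (ybr (yconj (\<kappa>, \<zeta>) M) (yconj (\<kappa>, \<zeta>) N))"
      using br_linear[OF aM aN daM daN] by (simp add: conj_sel)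
    show "ybr M N \<in> extensional (ten (ycar M) (ycar N))" using br_PiE[OF M N dM(1) dN(1)] by (simp add: PiE_def)
    show "ybr (yconj (\<kappa>, \<zeta>) M) (yconj (\<kappa>, \<zeta>) N) \<in> extensional (ten (ycar M) (ycar N))"
      using br_PiE[OF aM aN daM daN] by (simp add: PiE_def conj_sel)
    fix m n assume m: "m \<in> ycar M" and n: "n \<in> ycar N"
    let ?a = "finv \<zeta> \<circ> \<beta> \<circ> \<kappa> \<circ> finv \<beta> \<circ> \<alpha> \<circ> finv \<kappa> \<circ> \<zeta>"
    have "ybr (yconj (\<kappa>, \<zeta>) M) (yconj (\<kappa>, \<zeta>) N) (m * n) =
        SWY (yconj (\<kappa>, \<zeta>) M) m (\<lambda>m0 m1. yact (yconj (\<kappa>, \<zeta>) N) (finv ?a m1) n * m0)"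
      by (rule br_mult[OF aM aN daM daN, unfolded conj_sel(2), OF m n])
    also have "\<dots> = SWY M m (\<lambda>m0 m1. yact (yconj (\<kappa>, \<zeta>) N) (finv ?a ((finv \<zeta> \<circ> \<beta> \<circ> \<kappa> \<circ> finv \<beta>) m1)) n * m0)"
      unfolding conj_sel(3) by (rule SWY_conj[OF M dM(1) a'(2,3) m vs_s])
        (intro lin lin_act_h[OF N] n lin_aut[OF a'(3)] lin_aut[OF aut_finv[OF a'(2)]] lin_aut[OF br_auts[OF aM aN daM daN]])+
    \<comment> \<open>The twists of the action and of the coaction cancel against the conjugated
      degree and leave \<alpha>^-1.\<close>
    also have "\<dots> = SWY M m (\<lambda>m0 m1. yact N (finv \<alpha> m1) n * m0)"
      using a' dM dN by (simp add: conj_sel finv_comp finv_finv)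
    also have "\<dots> = ybr M N (m * n)" by (rule br_mult[OF M N dM(1) dN(1) m n, symmetric])
    finally show "ybr (yconj (\<kappa>, \<zeta>) M) (yconj (\<kappa>, \<zeta>) N) (m * n) = ybr M N (m * n)" .
  qed
qed

lemma YDhat_braided: "braided_T_category G (YDhat s \<U> H)"
proof -
  interpret G: group G by (rule group_G)
  interpret concrete_T_category G s \<U> ycar "yd_modules s \<U> H" ymor yten yunit ydeg yconj ybr
  proof (unfold_locales, goal_cases)
    case (1 X) then show ?case by (rule yd_U)
  next case (2 X) then show ?case by (rule yd_deg)
  next case (3 X Y f) then show ?case by (simp add: ymor_iff)
  next case (4 X Y f) then show ?case by (simp add: ymor_iff)
  next case (5 X Y f) then show ?case by (simp add: ymor_iff)
  next case (6 X) then show ?case by (rule ymor_id)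
  next case (7 X Y Z f g) then show ?case by (rule ymor_comp)
  next case (8 X Y) then show ?case by (rule yten_yd)
  next case (9 X Y) show ?case by (rule ten_sel)
  next case (10 X Y) show ?case by (rule ten_sel)
  next case (11 X Y X' Y' f g) then show ?case by (intro ymor_ten)
  next case (12 X Y Z) then show ?case by (rule yten_assoc)
  next case 13 show ?case by (rule yd_unit_yd)
  next case 14 show ?case by (rule unit_sel)
  next case (15 X) then show ?case by (rule yten_unit_left)
  next case (16 X) then show ?case by (rule yten_unit_right)
  next case (17 a X) then show ?case by (rule yconj_yd)
  next case (18 a X) show ?case by (rule conj_sel)
  next case (19 a X) show ?case by (rule conj_sel)
  next case (20 a X Y f) then show ?case by (rule ymor_conj)
  next case (21 X) then show ?case by (rule yconj_one)
  next case (22 a b X) then show ?case by (rule yconj_mult)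
  next case (23 a X Y) then show ?case by (rule yconj_ten)
  next case (24 a) then show ?case by (rule yconj_unit)
  next case (25 X Y) then show ?case by (cases "ydeg X"; cases "ydeg Y") (rule br_mor)
  next case (26 X Y) then show ?case by (cases "ydeg X"; cases "ydeg Y") (rule br_inverse)
  next case (27 X Y X' Y' f g x y) then show ?case by (intro br_natural)
  next case (28 X Y Z x y z) then show ?case by (rule br_hexagon_left)
  next case (29 X Y Z x y z) then show ?case by (rule br_hexagon_right)
  next case (30 a X Y) then show ?case by (rule br_conj)
  qed
  show ?thesis unfolding YDhat_def by (rule braided)
qed

end

section \<open>The crossed Turaev algebra\<close>

context fd_hopf
begin

lemma module_fscale: "module (fscale :: 'k \<Rightarrow> ('x \<Rightarrow> 'k) \<Rightarrow> _)"
  by (simp add: module_iff_vector_space)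

abbreviation "bow \<equiv> pure_tensor (fscale :: 'k \<Rightarrow> ('h \<Rightarrow> 'k) \<Rightarrow> 'h \<Rightarrow> 'k) hs"
abbreviation "A \<equiv> tensor_space bow Hd UNIV"
abbreviation "swb \<equiv> sweedler bow Hd UNIV"
abbreviation "tenA \<equiv> pure_tensor (fscale :: 'k \<Rightarrow> ('k, 'h) ct \<Rightarrow> ('k, 'h) ct) (fscale :: 'k \<Rightarrow> ('k, 'h) ct \<Rightarrow> ('k, 'h) ct)"
abbreviation "swA \<equiv> sweedler tenA A A"

lemma tpA: "tensor_product bow fscale hs fscale Hd UNIV"
  by (rule tensor_product_pure_tensor) simp_all

lemma A_subspace [simp]: "module.subspace fscale A"
  by (rule tensor_product.TS_subspace[OF tpA])

lemma bow_in [simp]: "p \<in> Hd \<Longrightarrow> bow p h \<in> A"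
  by (rule tensor_product.tensor_in[OF tpA]) simp_all

lemma tpAA: "tensor_product tenA fscale fscale fscale A A"
  by (rule tensor_product_pure_tensor) simp_all

lemma A_ext:
  assumes "vector_space s3" "linear_on A fscale s3 f" "linear_on A fscale s3 g" "t \<in> A"
    "\<And>p h. p \<in> Hd \<Longrightarrow> f (bow p h) = g (bow p h)"
  shows "f t = g t"
  by (rule tensor_product.linear_ext[OF tpA assms(1-4)]) (rule assms(5))

lemma swb_bow:
  assumes "vector_space s3" "\<And>h. linear_on Hd fscale s3 (\<lambda>p. F p h)" "\<And>p. p \<in> Hd \<Longrightarrow> linear_on UNIV hs s3 (\<lambda>h. F p h)"
    "p \<in> Hd"
  shows "swb (bow p h) F = F p h"
  by (rule tensor_product.sw_tau[OF tpA assms(1)]) (auto intro: bilinear_onI assms)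

lemma lin_swb:
  assumes "vector_space s3" "linear_on V s' fscale f" "\<And>x. x \<in> V \<Longrightarrow> f x \<in> A"
    "\<And>h. linear_on Hd fscale s3 (\<lambda>p. F p h)" "\<And>p. p \<in> Hd \<Longrightarrow> linear_on UNIV hs s3 (\<lambda>h. F p h)"
  shows "linear_on V s' s3 (\<lambda>x. swb (f x) F)"
  by (rule lin_comp[OF tensor_product.sw_linear[OF tpA assms(1)] assms(2,3)]) (auto intro: bilinear_onI assms)

section \<open>Dual bases and the comultiplication of the dual\<close>

lemma lin_dual_var: "linear_on V s' fscale f \<Longrightarrow> linear_on V s' fscale (\<lambda>x. (\<lambda>h. f x (g h)))"
  by (simp add: linear_on_def fscale_def fun_eq_iff)

lemma dual_shift [simp]: "p \<in> Hd \<Longrightarrow> (\<lambda>h. p (b * h)) \<in> Hd"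
  unfolding dual_iff by (rule lin_comp[of UNIV]) (auto simp: dual_iff intro: lin)

text \<open>The canonical element does not distinguish between f on H and its transpose on the dual:
  \<Sum> h_l \<otimes> (h^l \<circ> f) = \<Sum> f(h_n) \<otimes> h^n.\<close>

lemma dual_basis_transpose:
  assumes s: "vector_space s" and f: "linear_on UNIV hs hs f"
    and K: "\<And>p. p \<in> Hd \<Longrightarrow> linear_on UNIV hs s (\<lambda>a. K a p)" "\<And>a. linear_on Hd fscale s (\<lambda>p. K a p)"
  shows "(\<Sum>l\<in>B. K l (\<lambda>h. ds l (f h))) = (\<Sum>n\<in>B. K (f n) (ds n))"
proof -
  have d: "(\<lambda>h. ds l (f h)) \<in> Hd" for l unfolding dual_iff by (intro lin f)
  have "(\<Sum>l\<in>B. K l (\<lambda>h. ds l (f h))) = (\<Sum>l\<in>B. \<Sum>n\<in>B. s (ds l (f n)) (K l (ds n)))"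
    by (intro sum.cong refl sum_dual_linear[OF s K(2) d, symmetric])
  also have "\<dots> = (\<Sum>n\<in>B. \<Sum>l\<in>B. s (ds l (f n)) (K l (ds n)))" by (rule sum.swap)
  also have "\<dots> = (\<Sum>n\<in>B. K (f n) (ds n))"
    by (intro sum.cong refl sum_ds_linear[OF s K(1)] ds_dual)
  finally show ?thesis .
qed

text \<open>\<open>dual_basis_comult\<close> used twice. The threefold products h^i h^n h^j are
  those that the comultiplication of CT(H) produces from p = h^n.\<close>

lemma dual_basis_comult3:
  assumes s: "vector_space s"
    and F: "\<And>b c p. p \<in> Hd \<Longrightarrow> linear_on UNIV hs s (\<lambda>a. F a b c p)" "\<And>a c p. p \<in> Hd \<Longrightarrow> linear_on UNIV hs s (\<lambda>b. F a b c p)"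
      "\<And>a b p. p \<in> Hd \<Longrightarrow> linear_on UNIV hs s (\<lambda>c. F a b c p)" "\<And>a b c. linear_on Hd fscale s (\<lambda>p. F a b c p)"
  shows "(\<Sum>k\<in>B. SWH k (\<lambda>a r. SWH r (\<lambda>b c. F a b c (ds k)))) =
    (\<Sum>i\<in>B. \<Sum>n\<in>B. \<Sum>j\<in>B. F i n j (cnv (cnv (ds i) (ds n)) (ds j)))"
proof -
  note L = lin F s lin_comp[OF F(1) _ UNIV_I] lin_comp[OF F(2) _ UNIV_I] lin_comp[OF F(3) _ UNIV_I]
  have "(\<Sum>k\<in>B. SWH k (\<lambda>a r. SWH r (\<lambda>b c. F a b c (ds k)))) = (\<Sum>k\<in>B. SWH k (\<lambda>r c. SWH r (\<lambda>a b. F a b c (ds k))))"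
    by (rule sum.cong[OF refl], rule SWH_coassoc[OF s, symmetric]) (intro F ds_dual)+
  also have "\<dots> = (\<Sum>m\<in>B. \<Sum>j\<in>B. SWH m (\<lambda>a b. F a b j (cnv (ds m) (ds j))))"
    by (rule dual_basis_comult[OF s]) (intro L | assumption)+
  also have "\<dots> = (\<Sum>j\<in>B. \<Sum>m\<in>B. SWH m (\<lambda>a b. F a b j (cnv (ds m) (ds j))))" by (rule sum.swap)
  also have "\<dots> = (\<Sum>j\<in>B. \<Sum>i\<in>B. \<Sum>n\<in>B. F i n j (cnv (cnv (ds i) (ds n)) (ds j)))"
    by (rule sum.cong[OF refl], rule dual_basis_comult[OF s, where F = "\<lambda>a b p. F a b j (cnv p (ds j))" for j])
      (intro L cnv_dual lin_comp[OF F(4)] | assumption)+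
  also have "\<dots> = (\<Sum>i\<in>B. \<Sum>j\<in>B. \<Sum>n\<in>B. F i n j (cnv (cnv (ds i) (ds n)) (ds j)))" by (rule sum.swap)
  also have "\<dots> = (\<Sum>i\<in>B. \<Sum>n\<in>B. \<Sum>j\<in>B. F i n j (cnv (cnv (ds i) (ds n)) (ds j)))"
    by (intro sum.cong refl sum.swap)
  finally show ?thesis .
qed

text \<open>Expanding g in the basis shows that \<Sum> h^b \<otimes> p(h_b \<cdot>) has the property
  that describes the comultiplication of the dual. It is the only such tensor, since a tensor over
  the dual is determined by its values on pairs of basis elements.\<close>

lemma dual_comult_eq:
  assumes p: "p \<in> Hd"
  shows "dual_comult H p = (\<Sum>b\<in>B. pure_tensor fscale fscale (ds b) (\<lambda>h. p (b * h)))"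
proof -
  let ?T = "pure_tensor (fscale :: 'k \<Rightarrow> ('h \<Rightarrow> 'k) \<Rightarrow> _) (fscale :: 'k \<Rightarrow> ('h \<Rightarrow> 'k) \<Rightarrow> _)"
  interpret tp: tensor_product ?T fscale fscale fscale Hd Hd
    by (rule tensor_product_pure_tensor) simp_all
  have bil: "bilinear_on Hd Hd fscale fscale (*) (\<lambda>p1 p2. p1 g * p2 h)" for g h
    by (intro bilinear_onI lin vector_space_mult)
  show ?thesis
    unfolding dual_comult_def
  proof (rule the_equality)
    have expand: "p (g * h) = (\<Sum>b\<in>B. ds b g * p (b * h))" for g h
    proof -
      have "linear_on UNIV hs (*) (\<lambda>b. p (b * h))" by (rule lin_dual[OF p]) (intro lin)
      then show ?thesis using sum_ds_linear[OF vector_space_mult, of "\<lambda>b. p (b * h)" g] by simp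
    qed
    have "tp.sw (\<Sum>b\<in>B. ?T (ds b) (\<lambda>h. p (b * h))) (\<lambda>p1 p2. p1 g * p2 h) = (\<Sum>b\<in>B. ds b g * p (b * h))" for g h
      by (rule tp.sw_sum[OF vector_space_mult bil]) (simp_all add: p)
    from trans[OF expand this[symmetric]]
    show "(\<Sum>b\<in>B. ?T (ds b) (\<lambda>h. p (b * h))) \<in> tp.TS \<and>
        (\<forall>g h. p (g * h) = tp.sw (\<Sum>b\<in>B. ?T (ds b) (\<lambda>h. p (b * h))) (\<lambda>p1 p2. p1 g * p2 h))"
      by (intro conjI allI module.subspace_sum[OF module_fscale tp.TS_subspace] tp.tensor_in dual_shift p ds_dual)
  next
    fix t assume t: "t \<in> tp.TS \<and> (\<forall>g h. p (g * h) = tp.sw t (\<lambda>p1 p2. p1 g * p2 h))"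
    have bil2: "bilinear_on Hd Hd fscale fscale fscale (\<lambda>p1 p2. \<Sum>b\<in>B. \<Sum>c\<in>B. fscale (p1 b * p2 c) (?T (ds b) (ds c)))"
      by (intro bilinear_onI lin vector_space_mult vector_space_fscale)
    have bil3: "bilinear_on Hd Hd fscale fscale fscale (\<lambda>p1 p2. fscale (p1 b * p2 c) (?T (ds b) (ds c)))" for b c
      by (intro bilinear_onI lin vector_space_mult vector_space_fscale)
    \<comment> \<open>A tensor is rebuilt from its values on pairs (b, c); for a competitor t these
      values are p(bc).\<close>
    have "t = tp.sw t (\<lambda>p1 p2. \<Sum>b\<in>B. \<Sum>c\<in>B. fscale (p1 b * p2 c) (?T (ds b) (ds c)))"
    proof (rule tp.linear_ext[OF vector_space_fscale lin_id tp.sw_linear[OF vector_space_fscale bil2]])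
      fix p1 p2 assume d: "p1 \<in> Hd" "p2 \<in> Hd"
      have "?T p1 p2 = (\<Sum>b\<in>B. fscale (p1 b) (?T (ds b) p2))"
        by (rule sum_dual_linear[symmetric, OF vector_space_fscale _ d(1)]) (intro lin)
      also have "\<dots> = (\<Sum>b\<in>B. fscale (p1 b) (\<Sum>c\<in>B. fscale (p2 c) (?T (ds b) (ds c))))"
        by (intro sum.cong refl, subst sum_dual_linear[OF vector_space_fscale _ d(2)]) (intro lin | rule refl)+
      also have "\<dots> = (\<Sum>b\<in>B. \<Sum>c\<in>B. fscale (p1 b * p2 c) (?T (ds b) (ds c)))"
        by (simp add: module.scale_sum_right[OF module_fscale] module.scale_scale[OF module_fscale])
      finally show "?T p1 p2 = tp.sw (?T p1 p2) (\<lambda>p1 p2. \<Sum>b\<in>B. \<Sum>c\<in>B. fscale (p1 b * p2 c) (?T (ds b) (ds c)))"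
        unfolding tp.sw_tau[OF vector_space_fscale bil2 d] .
    qed (use t in simp)
    also have "\<dots> = (\<Sum>b\<in>B. \<Sum>c\<in>B. fscale (p (b * c)) (?T (ds b) (ds c)))"
    proof -
      have "tp.sw t (\<lambda>p1 p2. \<Sum>b\<in>B. \<Sum>c\<in>B. fscale (p1 b * p2 c) (?T (ds b) (ds c))) =
          (\<Sum>b\<in>B. tp.sw t (\<lambda>p1 p2. \<Sum>c\<in>B. fscale (p1 b * p2 c) (?T (ds b) (ds c))))"
        by (rule tp.sw_sum_body[OF vector_space_fscale])
          (use t in simp, intro bilinear_onI lin vector_space_mult vector_space_fscale)
      also have "\<dots> = (\<Sum>b\<in>B. \<Sum>c\<in>B. tp.sw t (\<lambda>p1 p2. fscale (p1 b * p2 c) (?T (ds b) (ds c))))"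
        by (rule sum.cong[OF refl], rule tp.sw_sum_body[OF vector_space_fscale _ bil3]) (use t in simp)
      also have "\<dots> = (\<Sum>b\<in>B. \<Sum>c\<in>B. fscale (tp.sw t (\<lambda>p1 p2. p1 b * p2 c)) (?T (ds b) (ds c)))"
        by (intro sum.cong refl, rule tp.sw_comp[symmetric, OF vector_space_mult vector_space_fscale bil, where X = UNIV])
          (use t in simp_all, intro lin vector_space_fscale)
      finally show ?thesis using t by simp
    qed
    also have "\<dots> = (\<Sum>b\<in>B. ?T (ds b) (\<lambda>h. p (b * h)))"
      by (rule sum.cong[OF refl], rule sum_dual_linear[OF vector_space_fscale _ dual_shift[OF p]]) (intro lin)
    finally show "t = (\<Sum>b\<in>B. ?T (ds b) (\<lambda>h. p (b * h)))" .
  qed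
qed

lemma swD_eq:
  assumes p: "p \<in> Hd" and s3: "vector_space s3"
    and F: "\<And>q. q \<in> Hd \<Longrightarrow> linear_on Hd fscale s3 (\<lambda>p. F p q)" "\<And>p. p \<in> Hd \<Longrightarrow> linear_on Hd fscale s3 (\<lambda>q. F p q)"
  shows "swD H p F = (\<Sum>b\<in>B. F (ds b) (\<lambda>h. p (b * h)))"
proof -
  interpret tp: tensor_product "pure_tensor fscale fscale" "fscale :: 'k \<Rightarrow> ('h \<Rightarrow> 'k) \<Rightarrow> _" "fscale :: 'k \<Rightarrow> ('h \<Rightarrow> 'k) \<Rightarrow> _" fscale Hd Hd
    by (rule tensor_product_pure_tensor) simp_all
  show ?thesis
    unfolding dual_comult_eq[OF p]
    by (rule tp.sw_sum[OF s3 bilinear_onI]) (use F p in auto)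
qed

section \<open>The comultiplication of CT(H)\<close>

lemma CT_sel: "tcar (CT H B) a = A" "tscale (CT H B) = fscale" "tone (CT H B) = bow eps 1"
  "tcounit (CT H B) a t = swb t (\<lambda>p h. p 1 * eps h)"
  by (simp_all add: CT_def bowtie_def)

abbreviation "\<Delta>A \<equiv> tcomult (CT H B)"

text \<open>The Sweedler sum of F over the comultiplication of p \<bowtie> h, with the
  comultiplication of p already written out as \<Sum> h^b \<otimes> p(h_b \<cdot>). For F =
  \<open>tenA\<close> it is the comultiplication itself.\<close>

definition comultA :: "('h \<Rightarrow> 'h) \<Rightarrow> ('h \<Rightarrow> 'h) \<Rightarrow> ('h \<Rightarrow> 'k) \<Rightarrow> 'h \<Rightarrow> (('k, 'h) ct \<Rightarrow> ('k, 'h) ct \<Rightarrow> 'c::comm_monoid_add) \<Rightarrow> 'c" where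
  "comultA \<alpha> \<beta> p h F = (\<Sum>b\<in>B. SWH h (\<lambda>h1 h2. \<Sum>i\<in>B. \<Sum>j\<in>B.
     F (bow (ds b) (\<beta> j * h1 * Si (\<alpha> i))) (bow (cnv (cnv (ds i) (\<lambda>x. p (b * x))) (ds j)) h2)))"

context
  fixes \<alpha> \<beta> assumes a: "\<alpha> \<in> Aut" and b: "\<beta> \<in> Aut"
begin

lemma lin_comultA_left:
  assumes "vector_space s3" "\<And>t. t \<in> A \<Longrightarrow> linear_on A fscale s3 (\<lambda>u. F t u)"
  shows "linear_on Hd fscale s3 (\<lambda>p. comultA \<alpha> \<beta> p h F)"
  unfolding comultA_def
  by (intro lin assms(1) lin_comp[OF assms(2)] lin_dual_var bow_in cnv_dual ds_dual)

lemma lin_comultA_right: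
  assumes "vector_space s3" "\<And>t. t \<in> A \<Longrightarrow> linear_on A fscale s3 (\<lambda>u. F t u)"
    "\<And>t. t \<in> A \<Longrightarrow> linear_on A fscale s3 (\<lambda>u. F u t)" "p \<in> Hd"
  shows "linear_on UNIV hs s3 (\<lambda>h. comultA \<alpha> \<beta> p h F)"
  unfolding comultA_def
  by (intro lin assms(1) lin_comp[OF assms(3)] bow_in cnv_dual ds_dual)

lemma DeltaA_eq:
  "\<Delta>A (\<alpha>, \<beta>) t = swb t (\<lambda>p h. comultA \<alpha> \<beta> p h tenA)"
proof -
  note L = lin lin_dual_var lin_aut[OF a] lin_aut[OF b] vector_space_fscale
  have 1: "swH H h (\<lambda>h1 h2. \<Sum>i\<in>B. \<Sum>j\<in>B. tenA (bow p1 (\<beta> j * h1 * Si (\<alpha> i)))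
        (bow (conv H (conv H (ds i) p2) (ds j)) h2)) =
      SWH h (\<lambda>h1 h2. \<Sum>i\<in>B. \<Sum>j\<in>B. tenA (bow p1 (\<beta> j * h1 * Si (\<alpha> i)))
        (bow (cnv (cnv (ds i) p2) (ds j)) h2))" if "p2 \<in> Hd" for h p1 p2
    unfolding conv_eq[OF ds_dual that] conv_eq[OF cnv_dual[OF ds_dual] ds_dual]
    by (rule swH_eq[OF vector_space_fscale]) (intro L)+
  have 2: "swD H p (\<lambda>p1 p2. swH H h (\<lambda>h1 h2. \<Sum>i\<in>B. \<Sum>j\<in>B. tenA (bow p1 (\<beta> j * h1 * Si (\<alpha> i)))
        (bow (conv H (conv H (ds i) p2) (ds j)) h2))) = comultA \<alpha> \<beta> p h tenA" if p: "p \<in> Hd" for p h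
  proof -
    have "swD H p (\<lambda>p1 p2. swH H h (\<lambda>h1 h2. \<Sum>i\<in>B. \<Sum>j\<in>B. tenA (bow p1 (\<beta> j * h1 * Si (\<alpha> i)))
        (bow (conv H (conv H (ds i) p2) (ds j)) h2))) =
      swD H p (\<lambda>p1 p2. SWH h (\<lambda>h1 h2. \<Sum>i\<in>B. \<Sum>j\<in>B. tenA (bow p1 (\<beta> j * h1 * Si (\<alpha> i)))
        (bow (cnv (cnv (ds i) p2) (ds j)) h2)))"
      by (rule sweedler_cong) (rule 1)
    also have "\<dots> = comultA \<alpha> \<beta> p h tenA"
      unfolding comultA_def by (rule swD_eq[OF p vector_space_fscale]) (intro L)+
    finally show ?thesis .
  qed
  show ?thesis
    unfolding CT_def bowtie_def by simp (rule sweedler_cong, rule 2)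
qed

lemma comultA_in: "p \<in> Hd \<Longrightarrow> comultA \<alpha> \<beta> p h tenA \<in> tensor_space tenA A A"
  unfolding comultA_def
  by (intro module.subspace_sum[OF module_fscale tensor_product.TS_subspace[OF tpAA]]
      SWH_in[OF vector_space_fscale tensor_product.TS_subspace[OF tpAA]] tensor_product.tensor_in[OF tpAA] bow_in cnv_dual ds_dual
      dual_shift)

lemma DeltaA_in: "t \<in> A \<Longrightarrow> \<Delta>A (\<alpha>, \<beta>) t \<in> tensor_space tenA A A"
  unfolding DeltaA_eq
  by (rule tensor_product.sw_in[OF tpA vector_space_fscale _ tensor_product.TS_subspace[OF tpAA]])
    (auto intro!: bilinear_onI lin_comultA_left lin_comultA_right comultA_in lin)

lemma lin_DeltaA: "linear_on A fscale fscale (\<Delta>A (\<alpha>, \<beta>))"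
  unfolding DeltaA_eq[abs_def]
  by (intro lin_swb lin_comultA_left lin_comultA_right lin vector_space_fscale)

lemma swA_Delta:
  assumes s3: "vector_space s3" and F: "\<And>t. t \<in> A \<Longrightarrow> linear_on A fscale s3 (\<lambda>u. F t u)"
    "\<And>t. t \<in> A \<Longrightarrow> linear_on A fscale s3 (\<lambda>u. F u t)"
  shows "p \<in> Hd \<Longrightarrow> swA (\<Delta>A (\<alpha>, \<beta>) (bow p h)) F = comultA \<alpha> \<beta> p h F"
    and "t \<in> A \<Longrightarrow> swA (\<Delta>A (\<alpha>, \<beta>) t) F = swb t (\<lambda>p h. comultA \<alpha> \<beta> p h F)"
    and "linear_on A fscale s3 (\<lambda>t. swA (\<Delta>A (\<alpha>, \<beta>) t) F)"
proof -
  interpret tp: tensor_product tenA fscale fscale fscale A A by (rule tpAA)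
  have bil: "bilinear_on A A fscale fscale s3 F" by (intro bilinear_onI F)
  note LF = tp.sw_linear[OF s3 bil]
  show linS: "linear_on A fscale s3 (\<lambda>t. swA (\<Delta>A (\<alpha>, \<beta>) t) F)"
    by (rule lin_comp[OF LF lin_DeltaA DeltaA_in])
  show *: "swA (\<Delta>A (\<alpha>, \<beta>) (bow p h)) F = comultA \<alpha> \<beta> p h F" if p: "p \<in> Hd" for p h
  proof -
    have "\<Delta>A (\<alpha>, \<beta>) (bow p h) = comultA \<alpha> \<beta> p h tenA"
      unfolding DeltaA_eq
      by (rule swb_bow[OF vector_space_fscale _ _ p]) (intro lin_comultA_left lin_comultA_right lin vector_space_fscale | assumption)+
    moreover have "tp.sw (comultA \<alpha> \<beta> p h tenA) F = comultA \<alpha> \<beta> p h F"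
      unfolding comultA_def SWH_def sum.cartesian_product case_prod_beta
      by (rule tp.sw_sum[OF s3 bil]) simp_all
    ultimately show ?thesis by simp
  qed
  show "swA (\<Delta>A (\<alpha>, \<beta>) t) F = swb t (\<lambda>p h. comultA \<alpha> \<beta> p h F)" if t: "t \<in> A"
  proof (rule A_ext[OF s3 linS _ t])
    have LL: "\<And>h. linear_on Hd fscale s3 (\<lambda>p. comultA \<alpha> \<beta> p h F)" "\<And>p. p \<in> Hd \<Longrightarrow> linear_on UNIV hs s3 (\<lambda>h. comultA \<alpha> \<beta> p h F)"
      by (intro lin_comultA_left lin_comultA_right s3 F | assumption)+
    show "linear_on A fscale s3 (\<lambda>t. swb t (\<lambda>p h. comultA \<alpha> \<beta> p h F))"
      by (rule lin_swb[OF s3 lin_id _ LL])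
    show "swA (\<Delta>A (\<alpha>, \<beta>) (bow p h)) F = swb (bow p h) (\<lambda>p h. comultA \<alpha> \<beta> p h F)" if p: "p \<in> Hd" for p h
      by (simp add: *[OF p] swb_bow[OF s3 LL p])
  qed
qed

end

end

context fd_hopf
begin

lemma swb_cong: "(\<And>p h. p \<in> Hd \<Longrightarrow> F p h = F' p h) \<Longrightarrow> swb t F = swb t F'"
  by (rule sweedler_cong) simp

lemma swb_in:
  assumes "vector_space s3" "\<And>h. linear_on Hd fscale s3 (\<lambda>p. F p h)"
    "\<And>p. p \<in> Hd \<Longrightarrow> linear_on UNIV hs s3 (\<lambda>h. F p h)" "t \<in> A" "module.subspace s3 X"
    "\<And>p h. p \<in> Hd \<Longrightarrow> F p h \<in> X"
  shows "swb t F \<in> X"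
  by (rule tensor_product.sw_in[OF tpA assms(1) _ assms(5,4)]) (auto intro: bilinear_onI assms)

lemma lin_swb_body:
  assumes "vector_space s3" "vector_space s'" "module.subspace s' X" "t \<in> A"
    "\<And>x h. x \<in> X \<Longrightarrow> linear_on Hd fscale s3 (\<lambda>p. F x p h)"
    "\<And>x p. x \<in> X \<Longrightarrow> p \<in> Hd \<Longrightarrow> linear_on UNIV hs s3 (\<lambda>h. F x p h)"
    "\<And>p h. p \<in> Hd \<Longrightarrow> linear_on X s' s3 (\<lambda>x. F x p h)"
  shows "linear_on X s' s3 (\<lambda>x. swb t (F x))"
  by (rule tensor_product.sw_body_linear[OF tpA assms(1-4)]) (auto intro: bilinear_onI assms)

text \<open>On the corepresentation of a Yetter-Drinfel'd module, \<open>ev g\<close> recovers the action of \<open>g\<close>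
  and \<open>pr\<close> the coaction of \<open>H\<close>.\<close>

definition ev :: "'h \<Rightarrow> ('k, 'h) ct \<Rightarrow> 'k" where
  "ev g t = swb t (\<lambda>p h. p g * eps h)"

definition pr :: "('k, 'h) ct \<Rightarrow> 'h" where
  "pr t = swb t (\<lambda>p h. hs (p 1) h)"

lemma ev_bilin: "linear_on Hd fscale (*) (\<lambda>p. p g * eps h)" "p \<in> Hd \<Longrightarrow> linear_on UNIV hs (*) (\<lambda>h. p g * eps h)"
  by (intro lin vector_space_mult)+

lemma pr_bilin: "linear_on Hd fscale hs (\<lambda>p. hs (p g) h)" "p \<in> Hd \<Longrightarrow> linear_on UNIV hs hs (\<lambda>h. hs (p g) h)"
  by (intro lin vs_hs)+

lemma ev_bow [simp]: "p \<in> Hd \<Longrightarrow> ev g (bow p h) = p g * eps h"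
  unfolding ev_def by (rule swb_bow[OF vector_space_mult ev_bilin])

lemma pr_bow [simp]: "p \<in> Hd \<Longrightarrow> pr (bow p h) = hs (p 1) h"
  unfolding pr_def by (rule swb_bow[OF vs_hs pr_bilin])

lemma lin_ev: "\<lbrakk>linear_on V s' fscale f; \<And>x. x \<in> V \<Longrightarrow> f x \<in> A\<rbrakk> \<Longrightarrow> linear_on V s' (*) (\<lambda>x. ev g (f x))"
  unfolding ev_def by (rule lin_swb[OF vector_space_mult _ _ ev_bilin])

lemma lin_pr: "\<lbrakk>linear_on V s' fscale f; \<And>x. x \<in> V \<Longrightarrow> f x \<in> A\<rbrakk> \<Longrightarrow> linear_on V s' hs (\<lambda>x. pr (f x))"
  unfolding pr_def by (rule lin_swb[OF vs_hs _ _ pr_bilin])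

lemma lin_ev_arg: "t \<in> A \<Longrightarrow> linear_on V s' hs f \<Longrightarrow> linear_on V s' (*) (\<lambda>x. ev (f x) t)"
  unfolding ev_def
  by (rule lin_comp[of UNIV hs _ "\<lambda>g. swb t (\<lambda>p h. p g * eps h)"], rule lin_swb_body)
    (auto intro!: ev_bilin lin_kmult_left lin_dual lin_id)

lemma ev_one: "t \<in> A \<Longrightarrow> ev 1 t = eps (pr t)"
  by (rule A_ext[OF vector_space_mult lin_ev[OF lin_id] lin_eps[OF lin_pr[OF lin_id]]]) (simp_all add: eps_scale)

lemma lin_shift: "p \<in> Hd \<Longrightarrow> linear_on V s' hs f \<Longrightarrow> linear_on V s' fscale (\<lambda>b. (\<lambda>x. p (f b * x)))"
  by (simp add: linear_on_def fun_eq_iff fscale_def dual_iff distrib_right hop.scale_mult_left)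

section \<open>The comultiplication of CT(H) paired with \<open>ev\<close> and
  \<open>pr\<close>\<close>

context
  fixes \<alpha> \<beta> assumes a: "\<alpha> \<in> Aut" and b: "\<beta> \<in> Aut"
begin

text \<open>On the left factor \<open>ev g\<close> applies \<epsilon> to \<beta>(h_j) h1
  S^-1(\<alpha>(h_i)). Both dual-basis sums then become \<Sum> \<epsilon>(h_i) h^i = \<epsilon>, the
  unit of convolution, and p1(g) p2 is the translate p(g \<cdot>).\<close>

lemma comultA_ev_left:
  assumes s3: "vector_space s3" and K: "linear_on A fscale s3 K" and p: "p \<in> Hd"
  shows "comultA \<alpha> \<beta> p h (\<lambda>t u. s3 (ev g t) (K u)) = K (bow (\<lambda>x. p (g * x)) h)"
proof -
  interpret S3: vector_space s3 by (rule s3)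
  note L = lin s3 lin_comp[OF K] lin_shift[OF p] bow_in cnv_dual ds_dual dual_shift p eps_dual
  have inner: "(\<Sum>i\<in>B. \<Sum>j\<in>B. s3 (ev g (bow (ds c) (\<beta> j * h1 * Si (\<alpha> i)))) (K (bow (cnv (cnv (ds i) q) (ds j)) h2))) =
      s3 (ds c g) (s3 (eps h1) (K (bow q h2)))" if q: "q \<in> Hd" for c h1 h2 q
  proof -
    have "(\<Sum>i\<in>B. \<Sum>j\<in>B. s3 (ev g (bow (ds c) (\<beta> j * h1 * Si (\<alpha> i)))) (K (bow (cnv (cnv (ds i) q) (ds j)) h2))) =
        s3 (ds c g) (s3 (eps h1) (\<Sum>i\<in>B. s3 (eps i) (\<Sum>j\<in>B. s3 (eps j) (K (bow (cnv (cnv (ds i) q) (ds j)) h2)))))"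
      by (simp add: hop.counit_mult aut_eps a b S3.scale_sum_right mult_ac)
    also have "(\<Sum>i\<in>B. s3 (eps i) (\<Sum>j\<in>B. s3 (eps j) (K (bow (cnv (cnv (ds i) q) (ds j)) h2)))) =
        (\<Sum>i\<in>B. s3 (eps i) (K (bow (cnv (cnv (ds i) q) eps) h2)))"
      by (rule sum.cong[OF refl], rule arg_cong[where f = "s3 _"], rule sum_dual_linear[OF s3 _ eps_dual]) (intro L)
    also have "\<dots> = K (bow (cnv (cnv eps q) eps) h2)"
      by (rule sum_dual_linear[OF s3 _ eps_dual, of "\<lambda>r. K (bow (cnv (cnv r q) eps) h2)"]) (intro L | assumption)+
    finally show ?thesis using q by (simp add: cnv_eps_left cnv_eps_right)
  qed
  have "comultA \<alpha> \<beta> p h (\<lambda>t u. s3 (ev g t) (K u)) =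
      (\<Sum>c\<in>B. s3 (ds c g) (SWH h (\<lambda>h1 h2. s3 (eps h1) (K (bow (\<lambda>x. p (c * x)) h2)))))"
    unfolding comultA_def by (simp only: inner[OF dual_shift[OF p]] SWH_scale[OF s3])
  also have "\<dots> = (\<Sum>c\<in>B. s3 (ds c g) (K (bow (\<lambda>x. p (c * x)) h)))"
    by (rule sum.cong[OF refl], rule arg_cong[where f = "s3 _"], rule SWH_counit_left[OF s3]) (intro L)
  also have "\<dots> = K (bow (\<lambda>x. p (g * x)) h)"
    by (rule sum_ds_linear[OF s3]) (intro L)
  finally show ?thesis .
qed

text \<open>\<open>pr\<close> evaluates p1 at 1 and p1(1) p2 = p, so the sum coming from the
  comultiplication of p disappears; the outer factors \<beta>(h_j) and S^-1(\<alpha>(h_i))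
  survive.\<close>

lemma comultA_pr_left:
  assumes s3: "vector_space s3" and K: "\<And>u. u \<in> A \<Longrightarrow> linear_on UNIV hs s3 (\<lambda>x. K x u)" "\<And>x. linear_on A fscale s3 (\<lambda>u. K x u)"
    and p: "p \<in> Hd"
  shows "comultA \<alpha> \<beta> p h (\<lambda>t u. K (pr t) u) =
    SWH h (\<lambda>h1 h2. \<Sum>i\<in>B. \<Sum>j\<in>B. K (\<beta> j * h1 * Si (\<alpha> i)) (bow (cnv (cnv (ds i) p) (ds j)) h2))"
proof -
  interpret S3: vector_space s3 by (rule s3)
  note L = lin s3 lin_comp[OF K(1) _ UNIV_I] lin_comp[OF K(2)] lin_shift[OF p] bow_in cnv_dual ds_dual dual_shift p
  have sc: "K (hs c x) u = s3 c (K x u)" if "u \<in> A" for c x u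
    using linear_on_scale[OF K(1)[OF that]] by simp
  have "comultA \<alpha> \<beta> p h (\<lambda>t u. K (pr t) u) =
      SWH h (\<lambda>h1 h2. \<Sum>i\<in>B. \<Sum>j\<in>B. \<Sum>c\<in>B. s3 (ds c 1) (K (\<beta> j * h1 * Si (\<alpha> i)) (bow (cnv (cnv (ds i) (\<lambda>x. p (c * x))) (ds j)) h2)))"
  proof -
    have "comultA \<alpha> \<beta> p h (\<lambda>t u. K (pr t) u) = SWH h (\<lambda>h1 h2. \<Sum>c\<in>B. \<Sum>i\<in>B. \<Sum>j\<in>B.
        s3 (ds c 1) (K (\<beta> j * h1 * Si (\<alpha> i)) (bow (cnv (cnv (ds i) (\<lambda>x. p (c * x))) (ds j)) h2)))"
      unfolding comultA_def SWH_sum_swap by (simp add: sc p)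
    also have "\<dots> = SWH h (\<lambda>h1 h2. \<Sum>i\<in>B. \<Sum>c\<in>B. \<Sum>j\<in>B.
        s3 (ds c 1) (K (\<beta> j * h1 * Si (\<alpha> i)) (bow (cnv (cnv (ds i) (\<lambda>x. p (c * x))) (ds j)) h2)))"
      by (rule SWH_cong, rule sum.swap)
    also have "\<dots> = SWH h (\<lambda>h1 h2. \<Sum>i\<in>B. \<Sum>j\<in>B. \<Sum>c\<in>B.
        s3 (ds c 1) (K (\<beta> j * h1 * Si (\<alpha> i)) (bow (cnv (cnv (ds i) (\<lambda>x. p (c * x))) (ds j)) h2)))"
      by (rule SWH_cong, intro sum.cong refl sum.swap)
    finally show ?thesis .
  qed
  also have "\<dots> = SWH h (\<lambda>h1 h2. \<Sum>i\<in>B. \<Sum>j\<in>B. K (\<beta> j * h1 * Si (\<alpha> i)) (bow (cnv (cnv (ds i) (\<lambda>x. p (1 * x))) (ds j)) h2))"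
    by (rule SWH_cong, rule sum.cong[OF refl], rule sum.cong[OF refl], rule sum_ds_linear[OF s3]) (intro L)
  finally show ?thesis by simp
qed

text \<open>After \<open>comultA_ev_left\<close> the translate p(g \<cdot>) is evaluated at g'. For
  a comodule this becomes associativity of the action.\<close>

lemma Delta_ev_ev:
  assumes s3: "vector_space s3" and t: "t \<in> A"
  shows "swA (\<Delta>A (\<alpha>, \<beta>) t) (\<lambda>u v. s3 (ev g u) (s3 (ev g' v) x)) = s3 (ev (g * g') t) x"
proof -
  have L: "\<And>t. t \<in> A \<Longrightarrow> linear_on A fscale s3 (\<lambda>v. s3 (ev g t) (s3 (ev g' v) x))"
    "\<And>t. t \<in> A \<Longrightarrow> linear_on A fscale s3 (\<lambda>u. s3 (ev g u) (s3 (ev g' t) x))"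
    by (intro lin s3 lin_ev | assumption)+
  have K: "linear_on A fscale s3 (\<lambda>v. s3 (ev g' v) x)" by (intro lin s3 lin_ev | assumption)+
  show ?thesis
  proof (rule A_ext[OF s3 swA_Delta(3)[OF a b s3 L] _ t])
    show "linear_on A fscale s3 (\<lambda>t. s3 (ev (g * g') t) x)" by (intro lin s3 lin_ev | assumption)+
    fix p h assume p: "p \<in> Hd"
    show "swA (\<Delta>A (\<alpha>, \<beta>) (bow p h)) (\<lambda>u v. s3 (ev g u) (s3 (ev g' v) x)) = s3 (ev (g * g') (bow p h)) x"
      by (simp add: swA_Delta(1)[OF a b s3 L p] comultA_ev_left[OF s3 K p] p)
  qed
qed

text \<open>The pairing yields p(g) and h from p \<bowtie> h. As g is arbitrary, this is why action
  and coaction together determine the corepresentation.\<close>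

lemma Delta_ev_pr:
  assumes s3: "vector_space s3" and f: "linear_on UNIV hs s3 f" and t: "t \<in> A"
  shows "swA (\<Delta>A (\<alpha>, \<beta>) t) (\<lambda>u v. s3 (ev g u) (f (pr v))) = swb t (\<lambda>p h. s3 (p g) (f h))"
proof -
  note ff = lin_comp[OF f _ UNIV_I]
  have L: "\<And>t. t \<in> A \<Longrightarrow> linear_on A fscale s3 (\<lambda>v. s3 (ev g t) (f (pr v)))"
    "\<And>t. t \<in> A \<Longrightarrow> linear_on A fscale s3 (\<lambda>u. s3 (ev g u) (f (pr t)))"
    by (intro lin s3 lin_ev ff lin_pr | assumption)+
  have K: "linear_on A fscale s3 (\<lambda>v. f (pr v))" by (intro lin s3 ff lin_pr | assumption)+
  have R: "\<And>h. linear_on Hd fscale s3 (\<lambda>p. s3 (p g) (f h))" "\<And>p. p \<in> Hd \<Longrightarrow> linear_on UNIV hs s3 (\<lambda>h. s3 (p g) (f h))"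
    by (intro lin s3 ff)+
  have LR: "linear_on A fscale s3 (\<lambda>t. swb t (\<lambda>p h. s3 (p g) (f h)))"
    by (rule lin_swb[OF s3 lin_id]) (assumption | rule R)+
  show ?thesis
  proof (rule A_ext[OF s3 swA_Delta(3)[OF a b s3 L] LR t])
    fix p h assume p: "p \<in> Hd"
    show "swA (\<Delta>A (\<alpha>, \<beta>) (bow p h)) (\<lambda>u v. s3 (ev g u) (f (pr v))) = swb (bow p h) (\<lambda>p h. s3 (p g) (f h))"
    proof -
      have "swb (bow p h) (\<lambda>p h. s3 (p g) (f h)) = s3 (p g) (f h)"
        by (rule swb_bow[OF s3 _ _ p]) (assumption | rule R)+
      then show ?thesis
        by (simp add: swA_Delta(1)[OF a b s3 L p] comultA_ev_left[OF s3 K p] p linear_on_scale[OF f])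
    qed
  qed
qed

text \<open>\<open>pr\<close> is compatible with the comultiplications: evaluating h^i p h^j at 1
  gives h^i(1) p(1) h^j(1), which puts 1 in place of h_i and h_j, so the outer factors become
  1.\<close>

lemma Delta_pr_pr:
  assumes s3: "vector_space s3" and K: "\<And>y. linear_on UNIV hs s3 (\<lambda>x. K x y)" "\<And>x. linear_on UNIV hs s3 (\<lambda>y. K x y)" and t: "t \<in> A"
  shows "swA (\<Delta>A (\<alpha>, \<beta>) t) (\<lambda>u v. K (pr u) (pr v)) = SWH (pr t) K"
proof -
  interpret S3: vector_space s3 by (rule s3)
  note KK = lin_comp[OF K(1) _ UNIV_I] lin_comp[OF K(2) _ UNIV_I]
  have L: "\<And>t. t \<in> A \<Longrightarrow> linear_on A fscale s3 (\<lambda>v. K (pr t) (pr v))" "\<And>t. t \<in> A \<Longrightarrow> linear_on A fscale s3 (\<lambda>u. K (pr u) (pr t))"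
    by (intro lin lin_pr KK | assumption)+
  show ?thesis
  proof (rule A_ext[OF s3 swA_Delta(3)[OF a b s3 L] _ t])
    show "linear_on A fscale s3 (\<lambda>t. SWH (pr t) K)" by (intro lin s3 lin_pr K | assumption)+
    fix p h assume p: "p \<in> Hd"
    have one: "cnv q r 1 = q 1 * r 1" if "q \<in> Hd" "r \<in> Hd" for q r
      unfolding cnv_def by (rule SWH_one[OF vector_space_mult]) (use that in \<open>auto simp: dual_iff linear_on_def algebra_simps\<close>)
    have "swA (\<Delta>A (\<alpha>, \<beta>) (bow p h)) (\<lambda>u v. K (pr u) (pr v)) =
        SWH h (\<lambda>h1 h2. \<Sum>i\<in>B. \<Sum>j\<in>B. K (\<beta> j * h1 * Si (\<alpha> i)) (pr (bow (cnv (cnv (ds i) p) (ds j)) h2)))"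
    proof -
      have "swA (\<Delta>A (\<alpha>, \<beta>) (bow p h)) (\<lambda>u v. K (pr u) (pr v)) = comultA \<alpha> \<beta> p h (\<lambda>u v. K (pr u) (pr v))"
        by (rule swA_Delta(1)[OF a b s3 _ _ p]) (assumption | rule L)+
      also have "\<dots> = SWH h (\<lambda>h1 h2. \<Sum>i\<in>B. \<Sum>j\<in>B. K (\<beta> j * h1 * Si (\<alpha> i)) (pr (bow (cnv (cnv (ds i) p) (ds j)) h2)))"
        by (rule comultA_pr_left[OF s3 _ _ p, where K = "\<lambda>x v. K x (pr v)"]) (intro lin lin_pr KK | assumption)+
      finally show ?thesis .
    qed
    also have "\<dots> = SWH h (\<lambda>h1 h2. s3 (p 1) (\<Sum>i\<in>B. s3 (ds i 1) (\<Sum>j\<in>B. s3 (ds j 1) (K (\<beta> j * h1 * Si (\<alpha> i)) h2))))"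
      by (simp add: p one linear_on_scale[OF K(2)] S3.scale_sum_right mult_ac)
    also have "\<dots> = SWH h (\<lambda>h1 h2. s3 (p 1) (\<Sum>i\<in>B. s3 (ds i 1) (K (\<beta> 1 * h1 * Si (\<alpha> i)) h2)))"
      by (rule SWH_cong, rule arg_cong[where f = "s3 _"], rule sum.cong[OF refl], rule arg_cong[where f = "s3 _"], rule sum_ds_linear[OF s3])
        (intro lin lin_aut[OF b] KK)
    also have "\<dots> = SWH h (\<lambda>h1 h2. s3 (p 1) (K (\<beta> 1 * h1 * Si (\<alpha> 1)) h2))"
      by (rule SWH_cong, rule arg_cong[where f = "s3 _"], rule sum_ds_linear[OF s3]) (intro lin lin_aut[OF a] KK)
    also have "\<dots> = s3 (p 1) (SWH h K)" by (simp add: aut_one a b SWH_scale[OF s3])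
    also have "\<dots> = SWH (hs (p 1) h) K"
      by (rule linear_on_scale[where V = UNIV and ?s1.0 = hs, OF lin_SWH[OF s3 lin_id], symmetric]) (simp_all add: K)
    finally show "swA (\<Delta>A (\<alpha>, \<beta>) (bow p h)) (\<lambda>u v. K (pr u) (pr v)) = SWH (pr (bow p h)) K" by (simp add: p)
  qed
qed

text \<open>The source of the compatibility condition. Evaluating h^i p h^j at g spreads g over
  three legs, and the dual-basis sums put g1 for h_i and g3 for h_j in the factors around h.\<close>

lemma Delta_pr_ev:
  assumes s3: "vector_space s3" and f: "linear_on UNIV hs s3 f" and t: "t \<in> A"
  shows "swA (\<Delta>A (\<alpha>, \<beta>) t) (\<lambda>u v. s3 (ev g v) (f (pr u))) =
    SWH g (\<lambda>g1 r. SWH r (\<lambda>g2 g3. swb t (\<lambda>p h. s3 (p g2) (f (\<beta> g3 * h * Si (\<alpha> g1))))))"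
proof -
  interpret S3: vector_space s3 by (rule s3)
  note ff = lin_comp[OF f _ UNIV_I]
  note LL = lin s3 lin_ev ff lin_pr lin_aut[OF a] lin_aut[OF b]
  have L: "\<And>t. t \<in> A \<Longrightarrow> linear_on A fscale s3 (\<lambda>v. s3 (ev g v) (f (pr t)))"
    "\<And>t. t \<in> A \<Longrightarrow> linear_on A fscale s3 (\<lambda>u. s3 (ev g t) (f (pr u)))"
    by (intro LL | assumption)+
  have R: "\<And>h. linear_on Hd fscale s3 (\<lambda>p. s3 (p x) (f (y * h * z)))" "\<And>p. p \<in> Hd \<Longrightarrow> linear_on UNIV hs s3 (\<lambda>h. s3 (p x) (f (y * h * z)))" for x y z
    by (intro LL)+
  have LR: "linear_on A fscale s3 (\<lambda>t. SWH g (\<lambda>g1 r. SWH r (\<lambda>g2 g3. swb t (\<lambda>p h. s3 (p g2) (f (\<beta> g3 * h * Si (\<alpha> g1)))))))"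
    by (rule lin_SWH_body[OF s3], rule lin_SWH_body[OF s3], rule lin_swb[OF s3 lin_id]) (assumption | rule R)+
  show ?thesis
  proof (rule A_ext[OF s3 swA_Delta(3)[OF a b s3 L] LR t])
    fix p h assume p: "p \<in> Hd"
    note P = lin_dual[OF p]
    have c3: "cnv (cnv (ds i) p) (ds j) g = SWH g (\<lambda>g1 r. SWH r (\<lambda>g2 g3. ds i g1 * (p g2 * ds j g3)))" for i j
    proof -
      have "cnv (cnv (ds i) p) (ds j) g = SWH g (\<lambda>r g3. SWH r (\<lambda>g1 g2. ds i g1 * (p g2 * ds j g3)))"
        by (simp add: cnv_def SWH_mult_right mult.assoc)
      also have "\<dots> = SWH g (\<lambda>g1 r. SWH r (\<lambda>g2 g3. ds i g1 * (p g2 * ds j g3)))"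
        by (rule SWH_coassoc[OF vector_space_mult]) (intro lin lin_scale[OF vector_space_mult] P vector_space_mult)+
      finally show ?thesis .
    qed
    have "swA (\<Delta>A (\<alpha>, \<beta>) (bow p h)) (\<lambda>u v. s3 (ev g v) (f (pr u))) =
        SWH h (\<lambda>h1 h2. \<Sum>i\<in>B. \<Sum>j\<in>B. s3 (ev g (bow (cnv (cnv (ds i) p) (ds j)) h2)) (f (\<beta> j * h1 * Si (\<alpha> i))))"
    proof -
      have "swA (\<Delta>A (\<alpha>, \<beta>) (bow p h)) (\<lambda>u v. s3 (ev g v) (f (pr u))) = comultA \<alpha> \<beta> p h (\<lambda>u v. s3 (ev g v) (f (pr u)))"
        by (rule swA_Delta(1)[OF a b s3 _ _ p]) (assumption | rule L)+
      also have "\<dots> = SWH h (\<lambda>h1 h2. \<Sum>i\<in>B. \<Sum>j\<in>B. s3 (ev g (bow (cnv (cnv (ds i) p) (ds j)) h2)) (f (\<beta> j * h1 * Si (\<alpha> i))))"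
        by (rule comultA_pr_left[OF s3 _ _ p, where K = "\<lambda>x v. s3 (ev g v) (f x)"]) (intro LL | assumption)+
      finally show ?thesis .
    qed
    also have "\<dots> = SWH h (\<lambda>h1 h2. s3 (eps h2) (\<Sum>i\<in>B. \<Sum>j\<in>B. s3 (cnv (cnv (ds i) p) (ds j) g) (f (\<beta> j * h1 * Si (\<alpha> i)))))"
      by (simp add: S3.scale_sum_right mult.commute)
    also have "\<dots> = (\<Sum>i\<in>B. \<Sum>j\<in>B. s3 (cnv (cnv (ds i) p) (ds j) g) (f (\<beta> j * h * Si (\<alpha> i))))"
      by (rule SWH_counit_right[OF s3]) (intro LL)
    also have "\<dots> = (\<Sum>i\<in>B. \<Sum>j\<in>B. SWH g (\<lambda>g1 r. SWH r (\<lambda>g2 g3. s3 (ds i g1 * (p g2 * ds j g3)) (f (\<beta> j * h * Si (\<alpha> i))))))"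
    proof (intro sum.cong refl)
      fix i j
      note sl = lin_scale_left[OF s3 lin_id]
      show "s3 (cnv (cnv (ds i) p) (ds j) g) (f (\<beta> j * h * Si (\<alpha> i))) =
          SWH g (\<lambda>g1 r. SWH r (\<lambda>g2 g3. s3 (ds i g1 * (p g2 * ds j g3)) (f (\<beta> j * h * Si (\<alpha> i)))))"
        unfolding c3
        by (subst SWH_lin[OF sl, of UNIV], simp_all add: s3, rule SWH_cong, rule SWH_lin[OF sl, of UNIV]) (simp_all add: s3)
    qed
    also have "\<dots> = SWH g (\<lambda>g1 r. SWH r (\<lambda>g2 g3. \<Sum>i\<in>B. s3 (ds i g1) (\<Sum>j\<in>B. s3 (ds j g3) (s3 (p g2) (f (\<beta> j * h * Si (\<alpha> i)))))))"
      by (simp add: SWH_sum_swap S3.scale_sum_right mult_ac)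
    also have "\<dots> = SWH g (\<lambda>g1 r. SWH r (\<lambda>g2 g3. \<Sum>i\<in>B. s3 (ds i g1) (s3 (p g2) (f (\<beta> g3 * h * Si (\<alpha> i))))))"
      by (rule SWH_cong, rule SWH_cong, rule sum.cong[OF refl], rule arg_cong[where f = "s3 _"], rule sum_ds_linear[OF s3]) (intro LL)
    also have "\<dots> = SWH g (\<lambda>g1 r. SWH r (\<lambda>g2 g3. s3 (p g2) (f (\<beta> g3 * h * Si (\<alpha> g1)))))"
      by (rule SWH_cong, rule SWH_cong, rule sum_ds_linear[OF s3]) (intro LL)
    finally have fin: "swA (\<Delta>A (\<alpha>, \<beta>) (bow p h)) (\<lambda>u v. s3 (ev g v) (f (pr u))) = SWH g (\<lambda>g1 r. SWH r (\<lambda>g2 g3. s3 (p g2) (f (\<beta> g3 * h * Si (\<alpha> g1)))))" .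
    show "swA (\<Delta>A (\<alpha>, \<beta>) (bow p h)) (\<lambda>u v. s3 (ev g v) (f (pr u))) =
        SWH g (\<lambda>g1 r. SWH r (\<lambda>g2 g3. swb (bow p h) (\<lambda>p h. s3 (p g2) (f (\<beta> g3 * h * Si (\<alpha> g1))))))"
    proof -
      have "swb (bow p h) (\<lambda>p h. s3 (p x) (f (y * h * z))) = s3 (p x) (f (y * h * z))" for x y z
        by (rule swb_bow[OF s3 _ _ p]) (assumption | rule R)+
      then show ?thesis by (simp add: fin)
    qed
  qed
qed

end

end

section \<open>Corepresentations in coordinates\<close>

context yd_setting
begin

abbreviation "CTH \<equiv> CT H B"
abbreviation "tenC \<equiv> pure_tensor s (fscale :: 'k \<Rightarrow> ('k, 'h) ct \<Rightarrow> ('k, 'h) ct)"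
abbreviation "TC V \<equiv> tensor_space tenC V A"
abbreviation "tenCAA \<equiv> (\<lambda>x u v. pure_tensor s fscale x (tenA u v))"

lemma tpC: "V \<in> \<U> \<Longrightarrow> tensor_product tenC s fscale fscale V A"
  by (rule tensor_product_pure_tensor) (simp_all add: subU)

text \<open>Kept as a \<open>sweedler\<close> sum, because no basis of CT(H) is chosen; exchanging
  it with other sums is therefore a matter of bilinearity, as in \<open>SWC_SWH\<close>.\<close>

definition SWC :: "('k, ('h \<Rightarrow> 'h) \<times> ('h \<Rightarrow> 'h), ('k, 'h) ct, 'v) corep \<Rightarrow> 'v \<Rightarrow>
    ('v \<Rightarrow> ('k, 'h) ct \<Rightarrow> 'c::comm_monoid_add) \<Rightarrow> 'c" where
  "SWC N m F = sweedler tenC (ccar N) A (ccoact N m) F"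

lemma swC_eq: "swC s CTH N m F = SWC N m F"
  by (simp add: SWC_def CT_sel)

definition precorep :: "('k, ('h \<Rightarrow> 'h) \<times> ('h \<Rightarrow> 'h), ('k, 'h) ct, 'v) corep \<Rightarrow> bool" where
  "precorep N \<longleftrightarrow> ccar N \<in> \<U> \<and> ccoact N \<in> ccar N \<rightarrow>\<^sub>E TC (ccar N) \<and> linear_on (ccar N) s fscale (ccoact N)"

context
  fixes N assumes N: "precorep N"
begin

lemma corep_U: "ccar N \<in> \<U>"
  using N by (simp add: precorep_def)

lemma ccoact_in: "m \<in> ccar N \<Longrightarrow> ccoact N m \<in> TC (ccar N)"
  using N by (auto simp: precorep_def)

lemma lin_ccoact: "linear_on (ccar N) s fscale (ccoact N)"
  using N by (simp add: precorep_def)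

lemma SWC_cong: "(\<And>x t. \<lbrakk>x \<in> ccar N; t \<in> A\<rbrakk> \<Longrightarrow> F x t = F' x t) \<Longrightarrow> SWC N m F = SWC N m F'"
  unfolding SWC_def by (rule sweedler_cong)

lemma SWC_tenC: "m \<in> ccar N \<Longrightarrow> SWC N m tenC = ccoact N m"
proof -
  assume m: "m \<in> ccar N"
  interpret tp: tensor_product tenC s fscale fscale "ccar N" A by (rule tpC[OF corep_U])
  have bil: "bilinear_on (ccar N) A s fscale fscale tenC" by (intro bilinear_onI lin)
  show ?thesis
    unfolding SWC_def
    by (rule tp.linear_ext[OF vector_space_fscale tp.sw_linear[OF vector_space_fscale bil] lin_id ccoact_in[OF m]])
      (rule tp.sw_tau[OF vector_space_fscale bil])
qed

context
  fixes s3 :: "'k \<Rightarrow> 'x::ab_group_add \<Rightarrow> 'x" and F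
  assumes s3: "vector_space s3" and F: "\<And>t. t \<in> A \<Longrightarrow> linear_on (ccar N) s s3 (\<lambda>x. F x t)"
    "\<And>x. x \<in> ccar N \<Longrightarrow> linear_on A fscale s3 (\<lambda>t. F x t)"
begin

lemma SWC_bil: "bilinear_on (ccar N) A s fscale s3 F"
  by (intro bilinear_onI F)

lemma lin_SWC: "\<lbrakk>linear_on X s' s f; \<And>x. x \<in> X \<Longrightarrow> f x \<in> ccar N\<rbrakk> \<Longrightarrow> linear_on X s' s3 (\<lambda>x. SWC N (f x) F)"
  unfolding SWC_def
  by (rule lin_comp[OF tensor_product.sw_linear[OF tpC[OF corep_U] s3 SWC_bil] lin_comp[OF lin_ccoact] ccoact_in])

lemma SWC_comp:
  assumes "vector_space s4" "module.subspace s3 X" "m \<in> ccar N" "\<And>x t. \<lbrakk>x \<in> ccar N; t \<in> A\<rbrakk> \<Longrightarrow> F x t \<in> X" "linear_on X s3 s4 f"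
  shows "f (SWC N m F) = SWC N m (\<lambda>x t. f (F x t))"
  unfolding SWC_def
  by (rule tensor_product.sw_comp[OF tpC[OF corep_U] s3 assms(1) SWC_bil assms(2) ccoact_in[OF assms(3)] assms(4,5)])

lemma SWC_in:
  assumes "module.subspace s3 X" "m \<in> ccar N" "\<And>x t. \<lbrakk>x \<in> ccar N; t \<in> A\<rbrakk> \<Longrightarrow> F x t \<in> X"
  shows "SWC N m F \<in> X"
  unfolding SWC_def
  by (rule tensor_product.sw_in[OF tpC[OF corep_U] s3 SWC_bil assms(1) ccoact_in[OF assms(2)] assms(3)])

lemma SWC_sum:
  assumes "ccoact N m = (\<Sum>i\<in>I. tenC (x i) (t i))" "\<And>i. i \<in> I \<Longrightarrow> x i \<in> ccar N" "\<And>i. i \<in> I \<Longrightarrow> t i \<in> A"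
  shows "SWC N m F = (\<Sum>i\<in>I. F (x i) (t i))"
  unfolding SWC_def assms(1) by (rule tensor_product.sw_sum[OF tpC[OF corep_U] s3 SWC_bil assms(2,3)])

end

lemma lin_SWC_body:
  assumes "vector_space s3" "vector_space s'" "module.subspace s' X" "m \<in> ccar N"
    "\<And>y t. \<lbrakk>y \<in> X; t \<in> A\<rbrakk> \<Longrightarrow> linear_on (ccar N) s s3 (\<lambda>x. F y x t)"
    "\<And>y x. \<lbrakk>y \<in> X; x \<in> ccar N\<rbrakk> \<Longrightarrow> linear_on A fscale s3 (\<lambda>t. F y x t)"
    "\<And>x t. \<lbrakk>x \<in> ccar N; t \<in> A\<rbrakk> \<Longrightarrow> linear_on X s' s3 (\<lambda>y. F y x t)"
  shows "linear_on X s' s3 (\<lambda>y. SWC N m (F y))"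
  unfolding SWC_def
  by (rule tensor_product.sw_body_linear[OF tpC[OF corep_U] assms(1-3) ccoact_in[OF assms(4)]])
    (auto intro: bilinear_onI assms)

lemma SWC_SWH:
  assumes "vector_space s3" "m \<in> ccar N"
    "\<And>a b t. t \<in> A \<Longrightarrow> linear_on (ccar N) s s3 (\<lambda>x. F a b x t)"
    "\<And>a b x. x \<in> ccar N \<Longrightarrow> linear_on A fscale s3 (\<lambda>t. F a b x t)"
  shows "SWC N m (\<lambda>x t. SWH h (\<lambda>a b. F a b x t)) = SWH h (\<lambda>a b. SWC N m (F a b))"
  unfolding SWC_def SWH_def
  by (rule tensor_product.sw_sum_body[OF tpC[OF corep_U] assms(1) ccoact_in[OF assms(2)]])
    (auto intro: bilinear_onI assms)

lemma SWC_sum_body: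
  assumes "vector_space s3" "m \<in> ccar N"
    "\<And>i t. t \<in> A \<Longrightarrow> linear_on (ccar N) s s3 (\<lambda>x. F i x t)"
    "\<And>i x. x \<in> ccar N \<Longrightarrow> linear_on A fscale s3 (\<lambda>t. F i x t)"
  shows "SWC N m (\<lambda>x t. \<Sum>i\<in>I. F i x t) = (\<Sum>i\<in>I. SWC N m (F i))"
  unfolding SWC_def
  by (rule tensor_product.sw_sum_body[OF tpC[OF corep_U] assms(1) ccoact_in[OF assms(2)]])
    (auto intro: bilinear_onI assms)

end

abbreviation "corep_obj N \<equiv> N \<in> coreps s \<U> G CTH"

lemma corep_iff: "corep_obj N \<longleftrightarrow> precorep N \<and> cdeg N \<in> carrier G \<and>
   (\<forall>m\<in>ccar N. SWC N m (\<lambda>x t. SWC N x (\<lambda>y u. tenCAA y u t)) = SWC N m (\<lambda>x t. swA (\<Delta>A (cdeg N) t) (\<lambda>u v. tenCAA x u v)) \<and>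
     SWC N m (\<lambda>x t. s (tcounit CTH (cdeg N) t) x) = m)"
  by (auto simp: coreps_def comodule_def precorep_def CT_sel(1,2) SWC_def)

lemma tcounit_eq: "tcounit CTH a t = ev 1 t"
  by (simp add: CT_sel ev_def)

context
  fixes N \<alpha> \<beta> assumes N: "corep_obj N" and deg: "cdeg N = (\<alpha>, \<beta>)"
begin

lemma corep_pre: "precorep N"
  using N by (simp add: corep_iff)

lemma corep_auts: "\<alpha> \<in> Aut" "\<beta> \<in> Aut"
  using N deg by (auto simp: corep_iff carrier_G)

lemma SWC_counit: "m \<in> ccar N \<Longrightarrow> SWC N m (\<lambda>x t. s (ev 1 t) x) = m"
  using N by (simp add: corep_iff tcounit_eq)

text \<open>As for \<open>SWH_coassoc\<close>, F induces a linear function on N \<otimes> (A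
  \<otimes> A), with A the space of CT(H), which is applied to the comodule axiom.\<close>

lemma SWC_coassoc:
  assumes s3: "vector_space s3"
    and F: "\<And>u t. \<lbrakk>u \<in> A; t \<in> A\<rbrakk> \<Longrightarrow> linear_on (ccar N) s s3 (\<lambda>x. F x u t)"
      "\<And>x t. \<lbrakk>x \<in> ccar N; t \<in> A\<rbrakk> \<Longrightarrow> linear_on A fscale s3 (\<lambda>u. F x u t)"
      "\<And>x u. \<lbrakk>x \<in> ccar N; u \<in> A\<rbrakk> \<Longrightarrow> linear_on A fscale s3 (\<lambda>t. F x u t)"
    and m: "m \<in> ccar N"
  shows "SWC N m (\<lambda>x t. SWC N x (\<lambda>y u. F y u t)) = SWC N m (\<lambda>x t. swA (\<Delta>A (\<alpha>, \<beta>) t) (\<lambda>u v. F x u v))"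
proof -
  note pre = corep_pre and U = corep_U[OF corep_pre]
  interpret t: tensor_product tenA fscale fscale fscale A A by (rule tpAA)
  interpret T: tensor_product "pure_tensor s fscale" s fscale fscale "ccar N" t.TS
    by (rule tensor_product_pure_tensor) (simp_all add: t.TS_subspace subU U)
  let ?G = "\<lambda>x T. t.sw T (F x)"
  have bF: "bilinear_on A A fscale fscale s3 (F x)" if "x \<in> ccar N" for x by (intro bilinear_onI F that)
  have G: "bilinear_on (ccar N) t.TS s fscale s3 ?G"
  proof (rule bilinear_onI)
    show "linear_on (ccar N) s s3 (\<lambda>v. t.sw w (F v))" if "w \<in> t.TS" for w
      by (rule t.sw_body_linear[OF s3 vs_s subU[OF U] that bF F(1)])
  qed (rule t.sw_linear[OF s3 bF])
  note LG = T.sw_linear[OF s3 G]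
  have in1: "tenCAA x u v \<in> T.TS" if "x \<in> ccar N" "u \<in> A" "v \<in> A" for x u v
    using that by (intro T.tensor_in t.tensor_in)
  have T_eq: "T.sw (tenCAA x u v) ?G = F x u v" if "x \<in> ccar N" "u \<in> A" "v \<in> A" for x u v
    using that by (subst T.sw_tau[OF s3 G]) (simp_all add: t.tensor_in t.sw_tau[OF s3 bF])
  have eq: "SWC N m (\<lambda>x t. SWC N x (\<lambda>y u. tenCAA y u t)) = SWC N m (\<lambda>x t. swA (\<Delta>A (\<alpha>, \<beta>) t) (\<lambda>u v. tenCAA x u v))"
    using N m deg by (simp add: corep_iff)
  have Din: "\<Delta>A (\<alpha>, \<beta>) u \<in> t.TS" if "u \<in> A" for u by (rule DeltaA_in[OF corep_auts that])
  have bT: "bilinear_on A A fscale fscale fscale (tenCAA x)" for x by (intro bilinear_onI lin)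
  \<comment> \<open>Summing elementary tensors over a tensor w gives w back. This turns the right
    side of the axiom into x \<otimes> \<Delta>(t), to which the induced function applies
    directly.\<close>
  have id_sw: "t.sw w (\<lambda>u v. tenCAA x u v) = pure_tensor s fscale x w" if "w \<in> t.TS" for x w
    by (rule t.linear_ext[OF vector_space_fscale t.sw_linear[OF vector_space_fscale bT] _ that])
      (intro lin | simp add: t.sw_tau[OF vector_space_fscale bT])+
  have "SWC N m (\<lambda>x t. SWC N x (\<lambda>y u. F y u t)) = SWC N m (\<lambda>x t. T.sw (SWC N x (\<lambda>y u. tenCAA y u t)) ?G)"
  proof (rule SWC_cong[OF pre])
    fix x t assume x: "x \<in> ccar N" and t: "t \<in> A"
    have "T.sw (SWC N x (\<lambda>y u. tenCAA y u t)) ?G = SWC N x (\<lambda>y u. T.sw (tenCAA y u t) ?G)"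
      by (rule SWC_comp[OF pre vector_space_fscale _ _ s3 T.TS_subspace x _ LG]) (intro lin in1 t | assumption)+
    also have "\<dots> = SWC N x (\<lambda>y u. F y u t)" by (rule SWC_cong[OF pre]) (simp add: T_eq t)
    finally show "SWC N x (\<lambda>y u. F y u t) = T.sw (SWC N x (\<lambda>y u. tenCAA y u t)) ?G" ..
  qed
  also have "\<dots> = T.sw (SWC N m (\<lambda>x t. SWC N x (\<lambda>y u. tenCAA y u t))) ?G"
    by (rule SWC_comp[OF pre vector_space_fscale _ _ s3 T.TS_subspace m _ LG, symmetric])
      (intro lin in1 lin_SWC[OF pre] lin_SWC_body[OF pre] SWC_in[OF pre _ _ _ T.TS_subspace] vector_space_fscale A_subspace | assumption)+
  also have "\<dots> = T.sw (SWC N m (\<lambda>x t. pure_tensor s fscale x (\<Delta>A (\<alpha>, \<beta>) t))) ?G"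
    unfolding eq by (subst SWC_cong[OF pre]) (auto simp: id_sw[OF Din])
  also have "\<dots> = SWC N m (\<lambda>x t. T.sw (pure_tensor s fscale x (\<Delta>A (\<alpha>, \<beta>) t)) ?G)"
    by (rule SWC_comp[OF pre vector_space_fscale _ _ s3 T.TS_subspace m _ LG])
      (intro lin T.tensor_in Din lin_comp[OF lin_DeltaA[OF corep_auts] lin_id] lin_pure_tensor_right | assumption)+
  also have "\<dots> = SWC N m (\<lambda>x t. swA (\<Delta>A (\<alpha>, \<beta>) t) (\<lambda>u v. F x u v))"
    by (rule SWC_cong[OF pre]) (simp add: T.sw_tau[OF s3 G] Din)
  finally show ?thesis .
qed

end

lemma corep_eqI:
  assumes M: "precorep M" and N: "precorep N" and "cdeg M = cdeg N" and car: "ccar M = ccar N"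
    and coact: "\<And>x. x \<in> ccar N \<Longrightarrow> ccoact M x = ccoact N x"
  shows "M = N"
proof -
  have "ccoact M = ccoact N"
    using M N coact by (intro extensionalityI[of _ "ccar N"]) (auto simp: precorep_def PiE_def car)
  then show ?thesis using assms by (intro corep.equality) auto
qed

section \<open>From Yetter-Drinfel'd modules to corepresentations\<close>

definition GO :: "('k, 'h, 'v) yd_module \<Rightarrow> ('k, ('h \<Rightarrow> 'h) \<times> ('h \<Rightarrow> 'h), ('k, 'h) ct, 'v) corep" where
  "GO M = \<lparr>cdeg = ydeg M, ccar = ycar M,
     ccoact = (\<lambda>m\<in>ycar M. \<Sum>i\<in>B. SWY M m (\<lambda>x c. tenC (yact M i x) (bow (ds i) c)))\<rparr>"

lemma GO_sel: "cdeg (GO M) = ydeg M" "ccar (GO M) = ycar M"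
  "m \<in> ycar M \<Longrightarrow> ccoact (GO M) m = (\<Sum>i\<in>B. SWY M m (\<lambda>x c. tenC (yact M i x) (bow (ds i) c)))"
  by (simp_all add: GO_def)

context
  fixes M \<alpha> \<beta> assumes M: "yd M" and deg: "ydeg M = (\<alpha>, \<beta>)"
begin

private lemma GO_auts: "\<alpha> \<in> Aut" "\<beta> \<in> Aut"
  using yd_deg[OF M] deg by (auto simp: carrier_G)

text \<open>The compatibility condition solved for the coaction of g \<cdot> m: multiply it on the
  right by S^-1(\<alpha>(g1)) and cancel g2 S^-1(g1). This is the place where the inverse antipode
  enters the comultiplication of CT(H).\<close>

lemma SWY_act:
  assumes s3: "vector_space s3" and F: "\<And>c. linear_on (ycar M) s s3 (\<lambda>x. F x c)" "\<And>x. x \<in> ycar M \<Longrightarrow> linear_on UNIV hs s3 (\<lambda>c. F x c)"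
    and m: "m \<in> ycar M"
  shows "SWY M (yact M g m) F = SWH g (\<lambda>g1 r. SWH r (\<lambda>g2 g3. SWY M m (\<lambda>x c. F (yact M g2 x) (\<beta> g3 * c * Si (\<alpha> g1)))))"
proof -
  note L = lin yd_lin[OF M] lin_aut[OF GO_auts(1)] lin_aut[OF GO_auts(2)] lin_comp[OF F(1)] lin_comp[OF F(2) _ UNIV_I] act_in[OF M] s3
  have "SWH g (\<lambda>g1 r. SWH r (\<lambda>g2 g3. SWY M m (\<lambda>x c. F (yact M g2 x) (\<beta> g3 * c * Si (\<alpha> g1))))) =
      SWH g (\<lambda>g1 r. SWH r (\<lambda>g2 g3. SWY M (yact M g3 m) (\<lambda>x c. F x (c * \<alpha> g2 * Si (\<alpha> g1)))))"
    by (rule SWH_cong, rule SWY_yd[OF M deg s3 _ _ m, where F = "\<lambda>x c. F x (c * Si (\<alpha> g))" for g]) (intro L | assumption)+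
  also have "\<dots> = SWH g (\<lambda>g1 r. SWH r (\<lambda>g2 g3. SWY M (yact M g3 m) (\<lambda>x c. F x (c * \<alpha> (g2 * Si g1)))))"
    by (simp add: aut_mult GO_auts aut_Si mult.assoc)
  also have "\<dots> = SWH g (\<lambda>r g3. SWH r (\<lambda>g1 g2. SWY M (yact M g3 m) (\<lambda>x c. F x (c * \<alpha> (g2 * Si g1)))))"
    by (rule SWH_coassoc[OF s3, symmetric]) (intro L m | assumption)+
  also have "\<dots> = SWH g (\<lambda>r g3. s3 (eps r) (SWY M (yact M g3 m) (\<lambda>x c. F x (c * \<alpha> 1))))"
    by (rule SWH_cong, rule SWH_Si_right[OF s3]) (intro L m | assumption)+
  also have "\<dots> = SWY M (yact M g m) (\<lambda>x c. F x (c * \<alpha> 1))"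
    by (rule SWH_counit_left[OF s3]) (intro L m | assumption)+
  finally show ?thesis by (simp add: aut_one GO_auts)
qed

lemma GO_precorep: "precorep (GO M)"
  unfolding precorep_def GO_sel(2)
proof (intro conjI)
  note tp = tpC[OF yd_U[OF M]]
  show "ycar M \<in> \<U>" by (rule yd_U[OF M])
  show "ccoact (GO M) \<in> ycar M \<rightarrow>\<^sub>E TC (ycar M)"
  proof (rule PiE_I)
    fix m assume m: "m \<in> ycar M"
    show "ccoact (GO M) m \<in> TC (ycar M)"
      unfolding GO_sel(3)[OF m]
      by (intro module.subspace_sum[OF module_fscale tensor_product.TS_subspace[OF tp]]
          SWY_in[OF yd_precoaction[OF M] m vector_space_fscale tensor_product.TS_subspace[OF tp]]
          tensor_product.tensor_in[OF tp] act_in[OF M] bow_in ds_dual)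
  qed (simp add: GO_def)
  have "linear_on (ycar M) s fscale (\<lambda>m. \<Sum>i\<in>B. SWY M m (\<lambda>x c. tenC (yact M i x) (bow (ds i) c)))"
    by (intro lin yd_lin[OF M] vss | assumption)+
  then show "linear_on (ycar M) s fscale (ccoact (GO M))"
    by (simp add: linear_on_def GO_sel uni.subspace_add[OF subU[OF yd_U[OF M]]] scale_in[OF yd_U[OF M]])
qed

lemma SWC_GO:
  assumes s3: "vector_space s3" and F: "\<And>t. t \<in> A \<Longrightarrow> linear_on (ycar M) s s3 (\<lambda>x. F x t)"
    "\<And>x. x \<in> ycar M \<Longrightarrow> linear_on A fscale s3 (\<lambda>t. F x t)" and m: "m \<in> ycar M"
  shows "SWC (GO M) m F = (\<Sum>i\<in>B. SWY M m (\<lambda>x c. F (yact M i x) (bow (ds i) c)))"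
proof -
  have "SWC (GO M) m F = (\<Sum>(i, b)\<in>B \<times> B. F (yact M i (yco M b m)) (bow (ds i) b))"
    unfolding case_prod_beta
    by (rule SWC_sum[OF GO_precorep s3])
      (use F m yco_in[OF yd_precoaction[OF M] m] in
        \<open>auto simp: GO_sel SWY_def sum.cartesian_product case_prod_beta act_in[OF M]\<close>)
  then show ?thesis by (simp add: SWY_def sum.cartesian_product)
qed

text \<open>The counit removes the coaction, and \<Sum> h^i(h) h_i = h contracts the dual-basis sum
  to the action of h.\<close>

lemma GO_ev: "m \<in> ycar M \<Longrightarrow> SWC (GO M) m (\<lambda>x t. s (ev h t) x) = yact M h m"
proof -
  assume m: "m \<in> ycar M"
  have "SWC (GO M) m (\<lambda>x t. s (ev h t) x) = (\<Sum>i\<in>B. SWY M m (\<lambda>x c. s (ev h (bow (ds i) c)) (yact M i x)))"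
    by (rule SWC_GO[OF vs_s _ _ m]) (intro lin lin_ev vs_s | assumption)+
  also have "\<dots> = (\<Sum>i\<in>B. s (ds i h) (SWY M m (\<lambda>x c. s (eps c) (yact M i x))))"
    by (simp add: SWY_scale)
  also have "\<dots> = (\<Sum>i\<in>B. s (ds i h) (yact M i m))"
    by (rule sum.cong[OF refl], rule arg_cong[where f = "s _"], rule SWY_counit[OF M vs_s _ m]) (intro lin yd_lin[OF M] | assumption)+
  also have "\<dots> = yact M h m"
    by (rule sum_ds_linear[OF vs_s]) (intro lin yd_lin[OF M] m)
  finally show ?thesis .
qed

lemma GO_pr: "m \<in> ycar M \<Longrightarrow> SWC (GO M) m (\<lambda>x t. tenY x (pr t)) = ycoact M m"
proof -
  assume m: "m \<in> ycar M"
  have "SWC (GO M) m (\<lambda>x t. tenY x (pr t)) = (\<Sum>i\<in>B. SWY M m (\<lambda>x c. tenY (yact M i x) (pr (bow (ds i) c))))"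
    by (rule SWC_GO[OF vector_space_fscale _ _ m]) (intro lin lin_pr | assumption)+
  also have "\<dots> = SWY M m (\<lambda>x c. \<Sum>i\<in>B. fscale (ds i 1) (tenY (yact M i x) c))"
    by (simp add: SWY_sum_swap pure_tensor_scale_right)
  also have "\<dots> = SWY M m (\<lambda>x c. tenY (yact M 1 x) c)"
    by (rule yd_SWY_cong[OF M m], rule sum_ds_linear[OF vector_space_fscale]) (intro lin yd_lin[OF M] | assumption)+
  also have "\<dots> = SWY M m tenY" by (rule yd_SWY_cong[OF M m]) (simp add: act_one[OF M])
  finally show ?thesis by (simp add: coact_eq[OF yd_precoaction[OF M] m])
qed

text \<open>Both sides of coassociativity are brought to the sum over k, i, n, j of h_k \<cdot> (h_n
  \<cdot> m0) \<otimes> (h^k \<bowtie> \<beta>(h_j) m1 S^-1(\<alpha>(h_i))) \<otimes> (h^i h^n h^j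
  \<bowtie> m2). The iterated coaction reaches it by \<open>SWY_act\<close>, the comultiplication by
  associativity of the action.\<close>

lemma GO_corep: "corep_obj (GO M)"
  unfolding corep_iff
proof (intro conjI ballI GO_precorep)
  show "cdeg (GO M) \<in> carrier G" by (simp add: GO_sel yd_deg[OF M])
  fix m assume "m \<in> ccar (GO M)"
  then have m: "m \<in> ycar M" by (simp add: GO_sel)
  have "SWC (GO M) m (\<lambda>x t. s (ev 1 t) x) = m" by (simp add: GO_ev m act_one[OF M])
  then show "SWC (GO M) m (\<lambda>x t. s (tcounit CTH (cdeg (GO M)) t) x) = m" by (simp add: tcounit_eq)
  note L = lin yd_lin[OF M] lin_aut[OF GO_auts(1)] lin_aut[OF GO_auts(2)] act_in[OF M] vss bow_in ds_dual cnv_dual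
  note PC = GO_precorep
  have "SWC (GO M) m (\<lambda>x t. SWC (GO M) x (\<lambda>y u. tenCAA y u t)) =
      SWC (GO M) m (\<lambda>x t. \<Sum>k\<in>B. SWY M x (\<lambda>y d. tenCAA (yact M k y) (bow (ds k) d) t))"
    by (rule SWC_cong[OF PC], rule SWC_GO[OF vector_space_fscale]) (intro lin | simp add: GO_sel)+
  also have "\<dots> = (\<Sum>i\<in>B. SWY M m (\<lambda>x c. \<Sum>k\<in>B. SWY M (yact M i x) (\<lambda>y d. tenCAA (yact M k y) (bow (ds k) d) (bow (ds i) c))))"
    by (rule SWC_GO[OF vector_space_fscale _ _ m]) (intro L | assumption)+
  also have "\<dots> = (\<Sum>i\<in>B. SWY M m (\<lambda>x c. \<Sum>k\<in>B. SWH i (\<lambda>i1 r. SWH r (\<lambda>i2 i3. SWY M x (\<lambda>y d.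
      tenCAA (yact M k (yact M i2 y)) (bow (ds k) (\<beta> i3 * d * Si (\<alpha> i1))) (bow (ds i) c))))))"
    by (rule sum.cong[OF refl], rule yd_SWY_cong[OF M m], rule sum.cong[OF refl], rule SWY_act[OF vector_space_fscale])
      (intro L | assumption)+
  also have "\<dots> = (\<Sum>i\<in>B. \<Sum>k\<in>B. SWH i (\<lambda>i1 r. SWH r (\<lambda>i2 i3. SWY M m (\<lambda>x c. SWY M x (\<lambda>y d.
      tenCAA (yact M k (yact M i2 y)) (bow (ds k) (\<beta> i3 * d * Si (\<alpha> i1))) (bow (ds i) c))))))"
    by (simp only: SWY_sum_swap SWY_SWH_swap)
  also have "\<dots> = (\<Sum>k\<in>B. \<Sum>i\<in>B. SWH i (\<lambda>i1 r. SWH r (\<lambda>i2 i3. SWY M m (\<lambda>x c. SWY M x (\<lambda>y d.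
      tenCAA (yact M k (yact M i2 y)) (bow (ds k) (\<beta> i3 * d * Si (\<alpha> i1))) (bow (ds i) c))))))"
    by (rule sum.swap)
  \<comment> \<open>The three legs of one basis element become independent summation indices, and
    its dual element becomes the product h^i h^n h^j.\<close>
  also have "\<dots> = (\<Sum>k\<in>B. \<Sum>i\<in>B. \<Sum>n\<in>B. \<Sum>j\<in>B. SWY M m (\<lambda>x c. SWY M x (\<lambda>y d.
      tenCAA (yact M k (yact M n y)) (bow (ds k) (\<beta> j * d * Si (\<alpha> i))) (bow (cnv (cnv (ds i) (ds n)) (ds j)) c))))"
    by (rule sum.cong[OF refl], rule dual_basis_comult3[OF vector_space_fscale,
          where F = "\<lambda>i1 i2 i3 p. SWY M m (\<lambda>x c. SWY M x (\<lambda>y d.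
            tenCAA (yact M k (yact M i2 y)) (bow (ds k) (\<beta> i3 * d * Si (\<alpha> i1))) (bow p c)))" for k])
      (intro L m | assumption)+
  also have "\<dots> = (\<Sum>k\<in>B. \<Sum>i\<in>B. \<Sum>n\<in>B. \<Sum>j\<in>B. SWY M m (\<lambda>x c. SWH c (\<lambda>h1 h2.
      tenCAA (yact M k (yact M n x)) (bow (ds k) (\<beta> j * h1 * Si (\<alpha> i))) (bow (cnv (cnv (ds i) (ds n)) (ds j)) h2))))"
    by (intro sum.cong refl, rule SWY_coassoc[OF M vector_space_fscale _ _ _ m]) (intro L | assumption)+
  finally have 1: "SWC (GO M) m (\<lambda>x t. SWC (GO M) x (\<lambda>y u. tenCAA y u t)) =
    (\<Sum>k\<in>B. \<Sum>i\<in>B. \<Sum>n\<in>B. \<Sum>j\<in>B. SWY M m (\<lambda>x c. SWH c (\<lambda>h1 h2.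
      tenCAA (yact M k (yact M n x)) (bow (ds k) (\<beta> j * h1 * Si (\<alpha> i))) (bow (cnv (cnv (ds i) (ds n)) (ds j)) h2))))" .
  have D: "linear_on A fscale fscale (\<lambda>t. swA (\<Delta>A (\<alpha>, \<beta>) t) (\<lambda>u v. tenCAA x u v))" for x
    by (rule swA_Delta(3)[OF GO_auts vector_space_fscale]) (intro lin)+
  have Dx: "linear_on (ycar M) s fscale (\<lambda>x. swA (\<Delta>A (\<alpha>, \<beta>) t) (\<lambda>u v. tenCAA x u v))" if "t \<in> A" for t
    by (rule tensor_product.sw_body_linear[OF tpAA vector_space_fscale vs_s subU[OF yd_U[OF M]] DeltaA_in[OF GO_auts that]])
      (intro bilinear_onI lin)+
  have "SWC (GO M) m (\<lambda>x t. swA (\<Delta>A (cdeg (GO M)) t) (\<lambda>u v. tenCAA x u v)) =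
      (\<Sum>l\<in>B. SWY M m (\<lambda>x c. swA (\<Delta>A (\<alpha>, \<beta>) (bow (ds l) c)) (\<lambda>u v. tenCAA (yact M l x) u v)))"
    unfolding GO_sel deg by (rule SWC_GO[OF vector_space_fscale _ _ m]) (intro D Dx | assumption)+
  also have "\<dots> = (\<Sum>l\<in>B. SWY M m (\<lambda>x c. comultA \<alpha> \<beta> (ds l) c (\<lambda>u v. tenCAA (yact M l x) u v)))"
    by (rule sum.cong[OF refl], rule yd_SWY_cong[OF M m], rule swA_Delta(1)[OF GO_auts vector_space_fscale]) (intro lin ds_dual)+
  also have "\<dots> = (\<Sum>l\<in>B. \<Sum>k\<in>B. SWY M m (\<lambda>x c. SWH c (\<lambda>h1 h2. \<Sum>i\<in>B. \<Sum>j\<in>B.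
      tenCAA (yact M l x) (bow (ds k) (\<beta> j * h1 * Si (\<alpha> i))) (bow (cnv (cnv (ds i) (\<lambda>x. ds l (k * x))) (ds j)) h2))))"
    unfolding comultA_def by (simp only: SWY_sum_swap)
  also have "\<dots> = (\<Sum>k\<in>B. \<Sum>l\<in>B. SWY M m (\<lambda>x c. SWH c (\<lambda>h1 h2. \<Sum>i\<in>B. \<Sum>j\<in>B.
      tenCAA (yact M l x) (bow (ds k) (\<beta> j * h1 * Si (\<alpha> i))) (bow (cnv (cnv (ds i) (\<lambda>x. ds l (k * x))) (ds j)) h2))))"
    by (rule sum.swap)
  \<comment> \<open>Left multiplication by k is moved from the functional h^l to the acting element,
    which becomes h_k h_n.\<close>
  also have "\<dots> = (\<Sum>k\<in>B. \<Sum>n\<in>B. SWY M m (\<lambda>x c. SWH c (\<lambda>h1 h2. \<Sum>i\<in>B. \<Sum>j\<in>B.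
      tenCAA (yact M (k * n) x) (bow (ds k) (\<beta> j * h1 * Si (\<alpha> i))) (bow (cnv (cnv (ds i) (ds n)) (ds j)) h2))))"
    by (rule sum.cong[OF refl], rule dual_basis_transpose[OF vector_space_fscale, where f = "\<lambda>h. k * h" and
          K = "\<lambda>l p. SWY M m (\<lambda>x c. SWH c (\<lambda>h1 h2. \<Sum>i\<in>B. \<Sum>j\<in>B.
            tenCAA (yact M l x) (bow (ds k) (\<beta> j * h1 * Si (\<alpha> i))) (bow (cnv (cnv (ds i) p) (ds j)) h2)))" for k])
      (intro L m | assumption)+
  also have "\<dots> = (\<Sum>k\<in>B. \<Sum>n\<in>B. SWY M m (\<lambda>x c. SWH c (\<lambda>h1 h2. \<Sum>i\<in>B. \<Sum>j\<in>B.
      tenCAA (yact M k (yact M n x)) (bow (ds k) (\<beta> j * h1 * Si (\<alpha> i))) (bow (cnv (cnv (ds i) (ds n)) (ds j)) h2))))"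
    by (intro sum.cong refl, rule yd_SWY_cong[OF M m]) (simp add: act_mult[OF M])
  also have "\<dots> = (\<Sum>k\<in>B. \<Sum>n\<in>B. \<Sum>i\<in>B. \<Sum>j\<in>B. SWY M m (\<lambda>x c. SWH c (\<lambda>h1 h2.
      tenCAA (yact M k (yact M n x)) (bow (ds k) (\<beta> j * h1 * Si (\<alpha> i))) (bow (cnv (cnv (ds i) (ds n)) (ds j)) h2))))"
    by (simp only: SWH_sum_swap SWY_sum_swap)
  also have "\<dots> = (\<Sum>k\<in>B. \<Sum>i\<in>B. \<Sum>n\<in>B. \<Sum>j\<in>B. SWY M m (\<lambda>x c. SWH c (\<lambda>h1 h2.
      tenCAA (yact M k (yact M n x)) (bow (ds k) (\<beta> j * h1 * Si (\<alpha> i))) (bow (cnv (cnv (ds i) (ds n)) (ds j)) h2))))"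
    by (rule sum.cong[OF refl], rule sum.swap)
  finally show "SWC (GO M) m (\<lambda>x t. SWC (GO M) x (\<lambda>y u. tenCAA y u t)) =
      SWC (GO M) m (\<lambda>x t. swA (\<Delta>A (cdeg (GO M)) t) (\<lambda>u v. tenCAA x u v))"
    using 1 by simp
qed

end

end

section \<open>From corepresentations to Yetter-Drinfel'd modules\<close>

context yd_setting
begin

definition YO :: "('k, ('h \<Rightarrow> 'h) \<times> ('h \<Rightarrow> 'h), ('k, 'h) ct, 'v) corep \<Rightarrow> ('k, 'h, 'v) yd_module" where
  "YO N = \<lparr>ydeg = cdeg N, ycar = ccar N,
     yact = (\<lambda>h. \<lambda>m\<in>ccar N. SWC N m (\<lambda>x t. s (ev h t) x)),
     ycoact = (\<lambda>m\<in>ccar N. SWC N m (\<lambda>x t. tenY x (pr t)))\<rparr>"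

lemma YO_sel: "ydeg (YO N) = cdeg N" "ycar (YO N) = ccar N"
  "m \<in> ccar N \<Longrightarrow> yact (YO N) h m = SWC N m (\<lambda>x t. s (ev h t) x)"
  "m \<in> ccar N \<Longrightarrow> ycoact (YO N) m = SWC N m (\<lambda>x t. tenY x (pr t))"
  by (simp_all add: YO_def)

context
  fixes N \<alpha> \<beta> assumes N: "corep_obj N" and deg: "cdeg N = (\<alpha>, \<beta>)"
begin

private lemmas pre = corep_pre[OF N deg]
private lemmas YO_auts = corep_auts[OF N deg]
private lemmas YO_U = corep_U[OF pre]
private abbreviation (input) "M \<equiv> YO N"
private lemmas LC = lin lin_ev lin_pr lin_aut[OF YO_auts(1)] lin_aut[OF YO_auts(2)] vss

lemma YO_act_in: "m \<in> ccar N \<Longrightarrow> yact M h m \<in> ccar N"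
  unfolding YO_sel by (rule SWC_in[OF pre vs_s _ _ subU[OF YO_U]]) (intro LC scale_in[OF YO_U] | assumption)+

lemma YO_lin_act: "\<lbrakk>linear_on V s' s f; \<And>x. x \<in> V \<Longrightarrow> f x \<in> ccar N\<rbrakk> \<Longrightarrow> linear_on V s' s (\<lambda>x. yact M h (f x))"
proof (rule lin_comp[where W = "ccar N" and g = "\<lambda>m. yact M h m"])
  have "linear_on (ccar N) s s (\<lambda>m. SWC N m (\<lambda>x t. s (ev h t) x))"
    by (rule lin_SWC[OF pre vs_s]) (intro LC | assumption)+
  then show "linear_on (ccar N) s s (\<lambda>m. yact M h m)"
    by (simp add: linear_on_def YO_sel uni.subspace_add[OF subU[OF YO_U]] scale_in[OF YO_U])
qed

lemma YO_lin_act_h: "\<lbrakk>m \<in> ccar N; linear_on V s' hs f\<rbrakk> \<Longrightarrow> linear_on V s' s (\<lambda>x. yact M (f x) m)"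
proof (rule lin_comp[where W = UNIV and g = "\<lambda>h. yact M h m"])
  assume m: "m \<in> ccar N"
  show "linear_on UNIV hs s (\<lambda>h. yact M h m)"
    unfolding YO_sel(3)[OF m]
    by (rule lin_SWC_body[OF pre vs_s vs_hs _ m]) (intro LC lin_ev_arg | simp | assumption)+
qed simp_all

lemma YO_precoaction: "precoaction M"
  unfolding precoaction_def YO_sel(2)
proof (intro conjI YO_U)
  show "ycoact M \<in> ccar N \<rightarrow>\<^sub>E TY (ccar N)"
  proof (rule PiE_I)
    fix m assume m: "m \<in> ccar N"
    show "ycoact M m \<in> TY (ccar N)"
      unfolding YO_sel(4)[OF m]
      by (rule SWC_in[OF pre vector_space_fscale _ _ TY_subspace[OF YO_U] m]) (intro LC TY_in | assumption)+
  qed (simp add: YO_def)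
  have "linear_on (ccar N) s fscale (\<lambda>m. SWC N m (\<lambda>x t. tenY x (pr t)))"
    by (rule lin_SWC[OF pre vector_space_fscale]) (intro LC | assumption)+
  then show "linear_on (ccar N) s fscale (ycoact M)"
    by (simp add: linear_on_def YO_sel uni.subspace_add[OF subU[OF YO_U]] scale_in[OF YO_U])
qed

context
  fixes s3 :: "'k \<Rightarrow> 'x::ab_group_add \<Rightarrow> 'x" and F
  assumes s3: "vector_space s3"
    and F: "\<And>c. linear_on (ccar N) s s3 (\<lambda>x. F x c)" "\<And>x. x \<in> ccar N \<Longrightarrow> linear_on UNIV hs s3 (\<lambda>c. F x c)"
begin

private lemmas LF = LC lin_comp[OF F(1)] lin_comp[OF F(2) _ UNIV_I] s3

lemma SWY_YO:
  assumes m: "m \<in> ccar N"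
  shows "SWY M m F = SWC N m (\<lambda>x t. F x (pr t))"
proof -
  interpret tp: tensor_product tenY s hs fscale "ccar N" UNIV by (rule TY_product[OF YO_U])
  have bil: "bilinear_on (ccar N) UNIV s hs s3 F" by (intro bilinear_onI F)
  have "SWY M m F = swY s H M m F"
    by (rule swY_eq[OF YO_precoaction s3, symmetric]) (simp_all add: YO_sel F m)
  also have "\<dots> = tp.sw (SWC N m (\<lambda>x t. tenY x (pr t))) F" by (simp add: YO_sel m)
  also have "\<dots> = SWC N m (\<lambda>x t. tp.sw (tenY x (pr t)) F)"
    by (rule SWC_comp[OF pre vector_space_fscale _ _ s3 tp.TS_subspace m _ tp.sw_linear[OF s3 bil]])
      (intro LC TY_in | assumption)+
  also have "\<dots> = SWC N m (\<lambda>x t. F x (pr t))"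
    by (rule SWC_cong[OF pre]) (simp add: tp.sw_tau[OF s3 bil])
  finally show ?thesis .
qed

text \<open>The action of g on m_[0] is a second coaction paired with \<open>ev g\<close>.
  Coassociativity replaces it by \<open>ev g\<close> on the left and \<open>pr\<close> on the right
  factor of the comultiplication, which \<open>Delta_ev_pr\<close> evaluates.\<close>

lemma SWY_YO_act_left:
  assumes m: "m \<in> ccar N"
  shows "SWC N m (\<lambda>x t. F (yact M g x) (pr t)) = SWC N m (\<lambda>x t. swb t (\<lambda>p h. s3 (p g) (F x h)))"
proof -
  have "SWC N m (\<lambda>x t. F (yact M g x) (pr t)) = SWC N m (\<lambda>x t. SWC N x (\<lambda>y u. s3 (ev g u) (F y (pr t))))"
  proof (rule SWC_cong[OF pre])
    fix x t assume x: "x \<in> ccar N" and t: "t \<in> A"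
    have "F (yact M g x) (pr t) = SWC N x (\<lambda>y u. F (s (ev g u) y) (pr t))"
      unfolding YO_sel(3)[OF x]
      by (rule SWC_comp[OF pre vs_s _ _ s3 subU[OF YO_U] x, where f = "\<lambda>y. F y (pr t)"])
        (intro LC scale_in[OF YO_U] F | assumption)+
    also have "\<dots> = SWC N x (\<lambda>y u. s3 (ev g u) (F y (pr t)))"
      by (rule SWC_cong[OF pre]) (rule linear_on_scale[OF F(1)])
    finally show "F (yact M g x) (pr t) = SWC N x (\<lambda>y u. s3 (ev g u) (F y (pr t)))" .
  qed
  also have "\<dots> = SWC N m (\<lambda>x t. swA (\<Delta>A (\<alpha>, \<beta>) t) (\<lambda>u v. s3 (ev g u) (F x (pr v))))"
    by (rule SWC_coassoc[OF N deg s3 _ _ _ m]) (intro LF | assumption)+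
  also have "\<dots> = SWC N m (\<lambda>x t. swb t (\<lambda>p h. s3 (p g) (F x h)))"
    by (rule SWC_cong[OF pre], rule Delta_ev_pr[OF YO_auts s3]) (rule F | assumption)+
  finally show ?thesis .
qed

end

text \<open>The formula of \<open>SWY_act\<close>, obtained here from coassociativity tested with
  \<open>pr\<close> on the left and \<open>ev g\<close> on the right factor. It precedes the
  compatibility condition, which is derived from it in \<open>YO_yd\<close>.\<close>

lemma SWY_YO_act:
  assumes s3: "vector_space s3"
    and F: "\<And>c. linear_on (ccar N) s s3 (\<lambda>x. F x c)" "\<And>x. x \<in> ccar N \<Longrightarrow> linear_on UNIV hs s3 (\<lambda>c. F x c)"
    and m: "m \<in> ccar N"
  shows "SWY M (yact M g m) F = SWH g (\<lambda>g1 r. SWH r (\<lambda>g2 g3. SWY M m (\<lambda>x c. F (yact M g2 x) (\<beta> g3 * c * Si (\<alpha> g1)))))"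
proof -
  note LF = LC lin_comp[OF F(1)] lin_comp[OF F(2) _ UNIV_I] s3
  have LS: "linear_on (ccar N) s s3 (\<lambda>z. SWC N z (\<lambda>y u. F y (pr u)))"
    by (rule lin_SWC[OF pre s3]) (intro LF | assumption)+
  have "SWY M (yact M g m) F = SWC N (yact M g m) (\<lambda>y u. F y (pr u))"
    by (rule SWY_YO[OF s3 F YO_act_in[OF m]])
  also have "\<dots> = SWC N m (\<lambda>x t. SWC N (s (ev g t) x) (\<lambda>y u. F y (pr u)))"
    unfolding YO_sel(3)[OF m]
    by (rule SWC_comp[OF pre vs_s _ _ s3 subU[OF YO_U] m _ LS]) (intro LC scale_in[OF YO_U] | assumption)+
  also have "\<dots> = SWC N m (\<lambda>x t. SWC N x (\<lambda>y u. s3 (ev g t) (F y (pr u))))"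
  proof (rule SWC_cong[OF pre])
    fix x t assume x: "x \<in> ccar N" and t: "t \<in> A"
    have "SWC N (s (ev g t) x) (\<lambda>y u. F y (pr u)) = s3 (ev g t) (SWC N x (\<lambda>y u. F y (pr u)))"
      by (rule linear_on_scale[OF LS x])
    also have "\<dots> = SWC N x (\<lambda>y u. s3 (ev g t) (F y (pr u)))"
      by (rule SWC_comp[OF pre s3 _ _ s3 subspace_UNIV_of[OF s3] x, where f = "s3 (ev g t)"]) (intro LF UNIV_I | assumption)+
    finally show "SWC N (s (ev g t) x) (\<lambda>y u. F y (pr u)) = SWC N x (\<lambda>y u. s3 (ev g t) (F y (pr u)))" .
  qed
  also have "\<dots> = SWC N m (\<lambda>x t. swA (\<Delta>A (\<alpha>, \<beta>) t) (\<lambda>u v. s3 (ev g v) (F x (pr u))))"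
    by (rule SWC_coassoc[OF N deg s3 _ _ _ m]) (intro LF | assumption)+
  also have "\<dots> = SWC N m (\<lambda>x t. SWH g (\<lambda>g1 r. SWH r (\<lambda>g2 g3. swb t (\<lambda>p h. s3 (p g2) (F x (\<beta> g3 * h * Si (\<alpha> g1)))))))"
    by (rule SWC_cong[OF pre], rule Delta_pr_ev[OF YO_auts s3]) (rule F | assumption)+
  also have "\<dots> = SWH g (\<lambda>g1 r. SWC N m (\<lambda>x t. SWH r (\<lambda>g2 g3. swb t (\<lambda>p h. s3 (p g2) (F x (\<beta> g3 * h * Si (\<alpha> g1)))))))"
    by (rule SWC_SWH[OF pre s3 m]) (intro LF lin_swb lin_swb_body[OF s3 vs_s subU[OF YO_U]] | assumption)+
  also have "\<dots> = SWH g (\<lambda>g1 r. SWH r (\<lambda>g2 g3. SWC N m (\<lambda>x t. swb t (\<lambda>p h. s3 (p g2) (F x (\<beta> g3 * h * Si (\<alpha> g1)))))))"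
    by (rule SWH_cong, rule SWC_SWH[OF pre s3 m]) (intro LF lin_swb lin_swb_body[OF s3 vs_s subU[OF YO_U]] | assumption)+
  also have "\<dots> = SWH g (\<lambda>g1 r. SWH r (\<lambda>g2 g3. SWC N m (\<lambda>x t. F (yact M g2 x) (\<beta> g3 * pr t * Si (\<alpha> g1)))))"
    by (rule SWH_cong, rule SWH_cong, rule SWY_YO_act_left[OF s3 _ _ m, where F = "\<lambda>x c. F x (\<beta> g3 * c * Si (\<alpha> g1))" for g1 g3, symmetric])
      (intro LF | assumption)+
  also have "\<dots> = SWH g (\<lambda>g1 r. SWH r (\<lambda>g2 g3. SWY M m (\<lambda>x c. F (yact M g2 x) (\<beta> g3 * c * Si (\<alpha> g1)))))"
    by (rule SWH_cong, rule SWH_cong, rule SWY_YO[OF s3 _ _ m, symmetric]) (intro LF YO_lin_act YO_act_in | assumption)+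
  finally show ?thesis .
qed

lemma YO_yd: "yd M"
proof (rule yd_modulesI[OF YO_precoaction], unfold YO_sel(2))
  show "ydeg M = (\<alpha>, \<beta>)" "\<alpha> \<in> Aut" "\<beta> \<in> Aut" by (simp_all add: YO_sel deg YO_auts)
  show "yact M h \<in> ccar N \<rightarrow>\<^sub>E ccar N" for h
    by (rule PiE_I, rule YO_act_in) (simp_all add: YO_def)
  show "linear_on (ccar N) s s (yact M h)" for h by (rule YO_lin_act[OF lin_id])
  fix m assume m: "m \<in> ccar N"
  show "linear_on UNIV hs s (\<lambda>h. yact M h m)" by (rule YO_lin_act_h[OF m lin_id])
  show "yact M 1 m = m" by (simp add: YO_sel m SWC_counit[OF N deg])
  show "yact M (g * h) m = yact M g (yact M h m)" for g h
  proof -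
    have LA: "linear_on (ccar N) s s (\<lambda>z. yact M g z)" by (rule YO_lin_act[OF lin_id])
    have "yact M g (yact M h m) = SWC N m (\<lambda>x t. yact M g (s (ev h t) x))"
      unfolding YO_sel(3)[OF m, of h]
      by (rule SWC_comp[OF pre vs_s _ _ vs_s subU[OF YO_U] m _ LA]) (intro LC scale_in[OF YO_U] | assumption)+
    also have "\<dots> = SWC N m (\<lambda>x t. SWC N x (\<lambda>y u. s (ev g u) (s (ev h t) y)))"
    proof (rule SWC_cong[OF pre])
      fix x t assume x: "x \<in> ccar N" and t: "t \<in> A"
      have "yact M g (s (ev h t) x) = s (ev h t) (SWC N x (\<lambda>y u. s (ev g u) y))"
        by (simp add: linear_on_scale[OF LA x] YO_sel(3)[OF x])
      also have "\<dots> = SWC N x (\<lambda>y u. s (ev h t) (s (ev g u) y))"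
        by (rule SWC_comp[OF pre vs_s _ _ vs_s _ x, where X = UNIV]) (intro LC UNIV_I subspace_UNIV_of | assumption)+
      finally show "yact M g (s (ev h t) x) = SWC N x (\<lambda>y u. s (ev g u) (s (ev h t) y))"
        by (simp add: mult.commute)
    qed
    also have "\<dots> = SWC N m (\<lambda>x t. swA (\<Delta>A (\<alpha>, \<beta>) t) (\<lambda>u v. s (ev g u) (s (ev h v) x)))"
      by (rule SWC_coassoc[OF N deg vs_s _ _ _ m]) (intro LC | assumption)+
    also have "\<dots> = SWC N m (\<lambda>x t. s (ev (g * h) t) x)"
      by (rule SWC_cong[OF pre], rule Delta_ev_ev[OF YO_auts vs_s])
    finally show ?thesis by (simp add: YO_sel m)
  qed
  show "SWY M m (\<lambda>x c. s (eps c) x) = m"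
  proof -
    have "SWY M m (\<lambda>x c. s (eps c) x) = SWC N m (\<lambda>x t. s (eps (pr t)) x)"
      by (rule SWY_YO[OF vs_s _ _ m]) (intro LC)+
    also have "\<dots> = SWC N m (\<lambda>x t. s (ev 1 t) x)" by (rule SWC_cong[OF pre]) (simp add: ev_one)
    finally show ?thesis by (simp add: SWC_counit[OF N deg m])
  qed
  show "SWY M m (\<lambda>x c. SWY M x (\<lambda>y d. tenYHH y d c)) = SWY M m (\<lambda>x c. SWH c (\<lambda>d e. tenYHH x d e))"
  proof -
    note LM = LC lin_SWY[OF YO_precoaction, unfolded YO_sel] lin_SWY_body[OF YO_precoaction, unfolded YO_sel]
    have "SWY M m (\<lambda>x c. SWY M x (\<lambda>y d. tenYHH y d c)) = SWC N m (\<lambda>x t. SWY M x (\<lambda>y d. tenYHH y d (pr t)))"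
      by (rule SWY_YO[OF vector_space_fscale _ _ m]) (intro LM | assumption)+
    also have "\<dots> = SWC N m (\<lambda>x t. SWC N x (\<lambda>y u. tenYHH y (pr u) (pr t)))"
      by (rule SWC_cong[OF pre], rule SWY_YO[OF vector_space_fscale]) (intro LC | assumption)+
    also have "\<dots> = SWC N m (\<lambda>x t. swA (\<Delta>A (\<alpha>, \<beta>) t) (\<lambda>u v. tenYHH x (pr u) (pr v)))"
      by (rule SWC_coassoc[OF N deg vector_space_fscale _ _ _ m]) (intro LC | assumption)+
    also have "\<dots> = SWC N m (\<lambda>x t. SWH (pr t) (\<lambda>d e. tenYHH x d e))"
      by (rule SWC_cong[OF pre], rule Delta_pr_pr[OF YO_auts vector_space_fscale]) (intro LC | assumption)+
    also have "\<dots> = SWY M m (\<lambda>x c. SWH c (\<lambda>d e. tenYHH x d e))"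
      by (rule SWY_YO[OF vector_space_fscale _ _ m, symmetric]) (intro LC | assumption)+
    finally show ?thesis .
  qed
  fix h
  note LM = LC lin_SWY[OF YO_precoaction, unfolded YO_sel] lin_SWY_body[OF YO_precoaction, unfolded YO_sel]
    YO_lin_act YO_lin_act_h YO_act_in
  have "SWH h (\<lambda>h1 h2. SWY M (yact M h2 m) (\<lambda>x c. tenY x (c * \<alpha> h1))) =
      SWH h (\<lambda>h1 h2. SWH h2 (\<lambda>g1 r. SWH r (\<lambda>g2 g3. SWY M m (\<lambda>x c. tenY (yact M g2 x) (\<beta> g3 * c * Si (\<alpha> g1) * \<alpha> h1)))))"
    by (rule SWH_cong, rule SWY_YO_act[OF vector_space_fscale _ _ m]) (intro LC)+
  also have "\<dots> = SWH h (\<lambda>h1 h2. SWH h2 (\<lambda>g1 r. SWH r (\<lambda>g2 g3. SWY M m (\<lambda>x c. tenY (yact M g2 x) (\<beta> g3 * c * \<alpha> (Si g1 * h1))))))"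
    by (simp add: aut_mult YO_auts aut_Si mult.assoc)
  also have "\<dots> = SWH h (\<lambda>w r. SWH w (\<lambda>h1 g1. SWH r (\<lambda>g2 g3. SWY M m (\<lambda>x c. tenY (yact M g2 x) (\<beta> g3 * c * \<alpha> (Si g1 * h1))))))"
    by (rule SWH_coassoc[OF vector_space_fscale, symmetric]) (intro LM m | assumption)+
  \<comment> \<open>The factor \<alpha>(h1) has been combined with S^-1(\<alpha>(g1)); h1 and g1 are
    the two legs of w, and S^-1(w2) w1 cancels.\<close>
  also have "\<dots> = SWH h (\<lambda>w r. fscale (eps w) (SWH r (\<lambda>g2 g3. SWY M m (\<lambda>x c. tenY (yact M g2 x) (\<beta> g3 * c * \<alpha> 1)))))"
    by (rule SWH_cong, rule SWH_Si_left[OF vector_space_fscale]) (intro LM m | assumption)+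
  also have "\<dots> = SWH h (\<lambda>g2 g3. SWY M m (\<lambda>x c. tenY (yact M g2 x) (\<beta> g3 * c * \<alpha> 1)))"
    by (rule SWH_counit_left[OF vector_space_fscale]) (intro LM m | assumption)+
  finally show "SWH h (\<lambda>h1 h2. SWY M m (\<lambda>m0 m1. tenY (yact M h1 m0) (\<beta> h2 * m1))) =
      SWH h (\<lambda>h1 h2. SWY M (yact M h2 m) (\<lambda>m0 m1. tenY m0 (m1 * \<alpha> h1)))"
    by (simp add: aut_one YO_auts)
qed

text \<open>In the second tensor factor the rebuilt coaction has \<Sum> p(h_i) (h^i \<bowtie> h) in
  place of p \<bowtie> h, and the two agree by expansion of p in the dual basis.\<close>

lemma GO_YO: "GO M = N"
proof (rule corep_eqI[OF GO_precorep[OF YO_yd] pre])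
  show "ydeg M = (\<alpha>, \<beta>)" by (simp add: YO_sel deg)
  fix m assume m: "m \<in> ccar N"
  have L: "\<And>h. linear_on Hd fscale fscale (\<lambda>p. fscale (p i) (tenC x (bow (ds i) h)))"
    "\<And>p. p \<in> Hd \<Longrightarrow> linear_on UNIV hs fscale (\<lambda>h. fscale (p i) (tenC x (bow (ds i) h)))" for i x
    by (intro lin vss)+
  have "ccoact (GO M) m = (\<Sum>i\<in>B. SWY M m (\<lambda>x c. tenC (yact M i x) (bow (ds i) c)))"
    by (simp add: GO_sel YO_sel m)
  also have "\<dots> = (\<Sum>i\<in>B. SWC N m (\<lambda>x t. tenC (yact M i x) (bow (ds i) (pr t))))"
    by (rule sum.cong[OF refl], rule SWY_YO[OF vector_space_fscale _ _ m]) (intro LC YO_lin_act | assumption)+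
  also have "\<dots> = (\<Sum>i\<in>B. SWC N m (\<lambda>x t. swb t (\<lambda>p h. fscale (p i) (tenC x (bow (ds i) h)))))"
    by (rule sum.cong[OF refl], rule SWY_YO_act_left[OF vector_space_fscale _ _ m, where F = "\<lambda>x c. tenC x (bow (ds i) c)" for i])
      (intro LC)+
  also have "\<dots> = SWC N m (\<lambda>x t. \<Sum>i\<in>B. swb t (\<lambda>p h. fscale (p i) (tenC x (bow (ds i) h))))"
    by (rule SWC_sum_body[OF pre vector_space_fscale m, symmetric])
      (intro LC lin_swb lin_swb_body[OF vector_space_fscale vs_s subU[OF YO_U]] | assumption)+
  also have "\<dots> = SWC N m tenC"
  proof (rule SWC_cong[OF pre])
    fix x t assume t: "t \<in> A"
    have lhs: "linear_on A fscale fscale (\<lambda>t. \<Sum>i\<in>B. swb t (\<lambda>p h. fscale (p i) (tenC x (bow (ds i) h))))"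
      by (intro LC lin_swb | assumption)+
    have rhs: "linear_on A fscale fscale (\<lambda>t. tenC x t)" by (intro lin)
    show "(\<Sum>i\<in>B. swb t (\<lambda>p h. fscale (p i) (tenC x (bow (ds i) h)))) = tenC x t"
    proof (rule A_ext[OF vector_space_fscale lhs rhs t])
      fix p h assume p: "p \<in> Hd"
      have "(\<Sum>i\<in>B. swb (bow p h) (\<lambda>p h. fscale (p i) (tenC x (bow (ds i) h)))) = (\<Sum>i\<in>B. fscale (p i) (tenC x (bow (ds i) h)))"
        by (rule sum.cong[OF refl], rule swb_bow[OF vector_space_fscale _ _ p]) (rule L | assumption)+
      also have "\<dots> = tenC x (bow p h)"
        by (rule sum_dual_linear[OF vector_space_fscale _ p]) (intro lin)
      finally show "(\<Sum>i\<in>B. swb (bow p h) (\<lambda>p h. fscale (p i) (tenC x (bow (ds i) h)))) = tenC x (bow p h)" .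
    qed
  qed
  also have "\<dots> = ccoact N m" by (rule SWC_tenC[OF pre m])
  finally show "ccoact (GO M) m = ccoact N m" .
qed (simp_all add: GO_sel YO_sel)

end

text \<open>Injectivity holds because \<open>GO_ev\<close> and \<open>GO_pr\<close> read the action
  and the coaction off the corepresentation; \<open>GO_YO\<close> gives preimages.\<close>

lemma GO_bij: "bij_betw GO (yd_modules s \<U> H) (coreps s \<U> G CTH)"
proof (rule bij_betw_imageI)
  show "inj_on GO (yd_modules s \<U> H)"
  proof (rule inj_onI)
    fix M N assume M: "yd M" and N: "yd N" and eq: "GO M = GO N"
    obtain \<alpha> \<beta> where dM: "ydeg M = (\<alpha>, \<beta>)" by (cases "ydeg M") auto
    have d: "ydeg M = ydeg N" and c: "ycar M = ycar N"
      using arg_cong[OF eq, of cdeg] arg_cong[OF eq, of ccar] by (simp_all add: GO_sel)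
    have dN: "ydeg N = (\<alpha>, \<beta>)" using d dM by simp
    show "M = N"
    proof (rule yd_eqI[OF M N d c])
      fix x h assume "x \<in> ycar N"
      then have x: "x \<in> ycar M" "x \<in> ycar N" by (simp_all add: c)
      show "yact M h x = yact N h x" using GO_ev[OF M dM x(1), of h] GO_ev[OF N dN x(2), of h] eq by simp
      show "ycoact M x = ycoact N x" using GO_pr[OF M dM x(1)] GO_pr[OF N dN x(2)] eq by simp
    qed
  qed
  show "GO ` yd_modules s \<U> H = coreps s \<U> G CTH"
  proof (intro equalityI subsetI)
    fix N assume N: "corep_obj N"
    obtain \<alpha> \<beta> where d: "cdeg N = (\<alpha>, \<beta>)" by (cases "cdeg N") auto
    show "N \<in> GO ` yd_modules s \<U> H"
      using GO_YO[OF N d] YO_yd[OF N d] by (metis image_eqI)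
  next
    fix N assume "N \<in> GO ` yd_modules s \<U> H"
    then obtain M where "yd M" "N = GO M" by blast
    then show "corep_obj N" by (cases "ydeg M") (simp add: GO_corep)
  qed
qed

end

section \<open>Compatibility with the crossed and braided structure\<close>

context yd_setting
begin

abbreviation "cten \<equiv> corep_tensor s G CTH"
abbreviation "cconj \<equiv> corep_conj s G CTH"
abbreviation "cbr \<equiv> corep_braiding s G CTH"

lemma GO_ccoact: "ccoact (GO M) = (\<lambda>m\<in>ycar M. \<Sum>i\<in>B. SWY M m (\<lambda>x c. tenC (yact M i x) (bow (ds i) c)))"
  by (simp add: GO_def)

context
  fixes N \<alpha> \<beta> \<gamma> \<delta>
  assumes N: "yd N" and dN: "ydeg N = (\<gamma>, \<delta>)" and a: "\<alpha> \<in> Aut" and b: "\<beta> \<in> Aut"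
begin

private lemmas cauts = conj_auts[OF N dN a b]
private lemmas LN = lin yd_lin[OF N] lin_aut[OF cauts(3)] lin_aut[OF cauts(4)] lin_aut[OF a] lin_aut[OF b]
    lin_aut[OF aut_finv[OF a]] lin_aut[OF aut_finv[OF b]] vss act_in[OF N] bow_in ds_dual

lemma tcross_eq: "tcross CTH (\<alpha>, \<beta>) (\<gamma>, \<delta>) t = swb t (\<lambda>q h. bow (q \<circ> finv \<alpha> \<circ> \<beta>) ((finv \<beta> \<circ> \<delta> \<circ> \<alpha> \<circ> finv \<delta>) h))"
  by (simp add: CT_def bowtie_def)

lemma lin_dual_comp: "linear_on V s' fscale f \<Longrightarrow> linear_on V s' fscale (\<lambda>x. f x \<circ> g)"
  by (simp add: linear_on_def fscale_def fun_eq_iff)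

lemma dual_comp_auts: "p \<in> Hd \<Longrightarrow> p \<circ> finv \<alpha> \<circ> \<beta> \<in> Hd"
  using lin_dual[OF _ lin_aut[OF cauts(4) lin_id], of p UNIV] by (simp add: dual_iff comp_def)

lemma tcross_bow: "q \<in> Hd \<Longrightarrow> tcross CTH (\<alpha>, \<beta>) (\<gamma>, \<delta>) (bow q h) = bow (q \<circ> finv \<alpha> \<circ> \<beta>) ((finv \<beta> \<circ> \<delta> \<circ> \<alpha> \<circ> finv \<delta>) h)"
  unfolding tcross_eq by (rule swb_bow[OF vector_space_fscale]) (intro LN lin_dual_comp | assumption)+

lemma tcross_linear: "linear_on A fscale fscale (\<lambda>t. tcross CTH (\<alpha>, \<beta>) (\<gamma>, \<delta>) t)"
  unfolding tcross_eq by (rule lin_swb[OF vector_space_fscale lin_id]) (intro LN lin_dual_comp | assumption)+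

lemma tcross_in: "t \<in> A \<Longrightarrow> tcross CTH (\<alpha>, \<beta>) (\<gamma>, \<delta>) t \<in> A"
  unfolding tcross_eq
  by (rule swb_in[OF vector_space_fscale _ _ _ A_subspace]) (intro LN lin_dual_comp bow_in dual_comp_auts | assumption)+

lemma GO_conj: "cconj (\<alpha>, \<beta>) (GO N) = GO (yconj (\<alpha>, \<beta>) N)"
proof -
  let ?W = "ycar N" and ?\<theta> = "finv \<beta> \<circ> \<delta> \<circ> \<alpha> \<circ> finv \<delta>"
  have "SWC (GO N) n (\<lambda>x t. tenC x (tcross CTH (\<alpha>, \<beta>) (\<gamma>, \<delta>) t)) =
      (\<Sum>i\<in>B. SWY (yconj (\<alpha>, \<beta>) N) n (\<lambda>x c. tenC (yact (yconj (\<alpha>, \<beta>) N) i x) (bow (ds i) c)))" if n: "n \<in> ?W" for n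
  proof -
    have "SWC (GO N) n (\<lambda>x t. tenC x (tcross CTH (\<alpha>, \<beta>) (\<gamma>, \<delta>) t)) =
        (\<Sum>i\<in>B. SWY N n (\<lambda>x c. tenC (yact N i x) (tcross CTH (\<alpha>, \<beta>) (\<gamma>, \<delta>) (bow (ds i) c))))"
      by (rule SWC_GO[OF N dN vector_space_fscale _ _ n]) (intro lin tcross_linear)+
    also have "\<dots> = (\<Sum>i\<in>B. SWY N n (\<lambda>x c. tenC (yact N i x) (bow (\<lambda>h. ds i ((finv \<alpha> \<circ> \<beta>) h)) (?\<theta> c))))"
      by (simp add: tcross_bow comp_def)
    \<comment> \<open>By transposition, \<alpha>^-1\<beta> passes from the dual basis, where the
      crossing puts it, to the acting element, where conjugation of modules puts it.\<close>
    also have "\<dots> = (\<Sum>i\<in>B. SWY N n (\<lambda>x c. tenC (yact N ((finv \<alpha> \<circ> \<beta>) i) x) (bow (ds i) (?\<theta> c))))"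
      by (rule dual_basis_transpose[OF vector_space_fscale, where K = "\<lambda>a p. SWY N n (\<lambda>x c. tenC (yact N a x) (bow p (?\<theta> c)))"])
        (intro LN n | assumption)+
    also have "\<dots> = (\<Sum>i\<in>B. SWY (yconj (\<alpha>, \<beta>) N) n (\<lambda>x c. tenC (yact N ((finv \<alpha> \<circ> \<beta>) i) x) (bow (ds i) c)))"
      by (rule sum.cong[OF refl], rule SWY_conj[OF N dN a b n vector_space_fscale, symmetric]) (intro LN | assumption)+
    finally show ?thesis by (simp add: conj_sel)
  qed
  then have "(\<lambda>n\<in>?W. SWC (GO N) n (\<lambda>x t. tenC x (tcross CTH (\<alpha>, \<beta>) (\<gamma>, \<delta>) t))) =
      (\<lambda>n\<in>?W. \<Sum>i\<in>B. SWY (yconj (\<alpha>, \<beta>) N) n (\<lambda>x c. tenC (yact (yconj (\<alpha>, \<beta>) N) i x) (bow (ds i) c)))"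
    by (rule restrict_ext)
  then have "ccoact (cconj (\<alpha>, \<beta>) (GO N)) = ccoact (GO (yconj (\<alpha>, \<beta>) N))"
    unfolding corep_conj_def swC_eq GO_ccoact[of "yconj (\<alpha>, \<beta>) N"] by (simp add: GO_sel(1,2) CT_sel(2) conj_sel(2) dN)
  then show ?thesis by (intro corep.equality) (simp_all add: corep_conj_def GO_sel conj_sel)
qed

end

context
  fixes M N \<alpha> \<beta> \<gamma> \<delta>
  assumes M: "yd M" and N: "yd N" and dM: "ydeg M = (\<alpha>, \<beta>)" and dN: "ydeg N = (\<gamma>, \<delta>)"
begin

private lemmas MN_auts = ten_auts[OF M N dM dN]
private lemmas tcross = tcross_bow[OF N dN MN_auts(1,2)] tcross_linear[OF N dN MN_auts(1,2)] tcross_in[OF N dN MN_auts(1,2)] dual_comp_auts[OF N dN MN_auts(1,2)]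
private lemmas MN_lins = ten_lins[OF M N dM dN] bow_in ds_dual cnv_dual
private lemmas MN_PM = GO_precorep[OF M dM]
private lemmas MN_PN = GO_precorep[OF N dN]
private lemmas MN_U = yd_U[OF M] yd_U[OF N]

lemma tmult_eq: "u \<in> A \<Longrightarrow> tmult CTH (\<alpha>, \<beta>) (\<gamma>, \<delta>) t u =
    swb t (\<lambda>p h. swb u (\<lambda>q h'. bow (cnv q p) (\<delta> h * (\<delta> \<circ> \<alpha> \<circ> finv \<delta>) h')))"
  unfolding CT_def bowtie_def by simp (intro swb_cong, simp add: conv_eq)

lemma tmult_bow:
  assumes "p \<in> Hd" "q \<in> Hd"
  shows "tmult CTH (\<alpha>, \<beta>) (\<gamma>, \<delta>) (bow p h) (bow q h') = bow (cnv q p) (\<delta> h * (\<delta> \<circ> \<alpha> \<circ> finv \<delta>) h')"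
proof -
  have "tmult CTH (\<alpha>, \<beta>) (\<gamma>, \<delta>) (bow p h) (bow q h') =
      swb (bow p h) (\<lambda>p h. swb (bow q h') (\<lambda>q h'. bow (cnv q p) (\<delta> h * (\<delta> \<circ> \<alpha> \<circ> finv \<delta>) h')))"
    by (rule tmult_eq) (simp add: assms)
  also have "\<dots> = swb (bow p h) (\<lambda>p h. bow (cnv q p) (\<delta> h * (\<delta> \<circ> \<alpha> \<circ> finv \<delta>) h'))"
    by (rule swb_cong, rule swb_bow[OF vector_space_fscale _ _ assms(2)]) (intro MN_lins)+
  also have "\<dots> = bow (cnv q p) (\<delta> h * (\<delta> \<circ> \<alpha> \<circ> finv \<delta>) h')"
    by (rule swb_bow[OF vector_space_fscale _ _ assms(1)]) (intro MN_lins)+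
  finally show ?thesis .
qed

lemma tmult_linear:
  "u \<in> A \<Longrightarrow> linear_on A fscale fscale (\<lambda>t. tmult CTH (\<alpha>, \<beta>) (\<gamma>, \<delta>) t u)"
  "t \<in> A \<Longrightarrow> linear_on A fscale fscale (\<lambda>u. tmult CTH (\<alpha>, \<beta>) (\<gamma>, \<delta>) t u)"
proof -
  assume u: "u \<in> A"
  show "linear_on A fscale fscale (\<lambda>t. tmult CTH (\<alpha>, \<beta>) (\<gamma>, \<delta>) t u)"
    unfolding tmult_eq[OF u]
    by (intro lin_swb[OF vector_space_fscale lin_id])
      (intro MN_lins lin_swb_body[OF vector_space_fscale _ _ u] dual_subspace subspace_UNIV_of | assumption)+
next
  assume t: "t \<in> A"
  have "linear_on A fscale fscale (\<lambda>u. swb t (\<lambda>p h. swb u (\<lambda>q h'. bow (cnv q p) (\<delta> h * (\<delta> \<circ> \<alpha> \<circ> finv \<delta>) h'))))"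
    by (rule lin_swb_body[OF vector_space_fscale vector_space_fscale A_subspace t])
      (intro MN_lins lin_swb lin_swb_body[OF vector_space_fscale] dual_subspace subspace_UNIV_of | assumption)+
  then show "linear_on A fscale fscale (\<lambda>u. tmult CTH (\<alpha>, \<beta>) (\<gamma>, \<delta>) t u)"
    using module.subspace_add[OF module_fscale A_subspace] module.subspace_scale[OF module_fscale A_subspace]
    by (simp add: linear_on_def tmult_eq)
qed

text \<open>The reversed product qp in CT(H) corresponds to the reversed action on the tensor
  product: by \<open>dual_basis_comult\<close>, the sum over h^j h^i turns into the two legs of one
  basis element, the first acting on N and the second on M.\<close>

lemma GO_ten: "cten (GO M) (GO N) = GO (yten M N)"
proof -
  let ?V = "ycar M" and ?W = "ycar N" and ?\<Theta> = "\<delta> \<circ> \<alpha> \<circ> finv \<delta>"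
  note MN = yten_yd[OF M N]
  let ?L = "\<lambda>x. swt ?V ?W x (\<lambda>m n. SWC (GO M) m (\<lambda>m0 m1. SWC (GO N) n (\<lambda>n0 n1.
      tenC (m0 * n0) (tmult CTH (\<alpha>, \<beta>) (\<gamma>, \<delta>) m1 n1))))"
  let ?R = "\<lambda>x. \<Sum>i\<in>B. SWY (yten M N) x (\<lambda>x c. tenC (yact (yten M N) i x) (bow (ds i) c))"
  note LT = lin lin_comp[OF tmult_linear(1) lin_id] lin_comp[OF tmult_linear(2) lin_id]
    lin_comp[OF tmult_linear(1)] lin_comp[OF tmult_linear(2)] lin_SWC[OF MN_PM, unfolded GO_sel(2)] lin_SWC[OF MN_PN, unfolded GO_sel(2)]
    lin_SWC_body[OF MN_PN vector_space_fscale, unfolded GO_sel(2)] lin_SWC_body[OF MN_PM vector_space_fscale, unfolded GO_sel(2)]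
    vss subU[OF MN_U(1)] subU[OF MN_U(2)] A_subspace bow_in ds_dual
  have "?L x = ?R x" if x: "x \<in> ten ?V ?W" for x
  proof (rule ten_ext[OF MN_U vector_space_fscale _ _ x, where f = ?L and g = ?R])
    show "linear_on (ten ?V ?W) s fscale ?L"
      by (rule swt_linear[OF MN_U vector_space_fscale]) (intro LT | assumption)+
    show "linear_on (ten ?V ?W) s fscale ?R"
      by (intro MN_lins yd_lin[OF MN, unfolded ten_sel] | assumption)+
    fix m n assume m: "m \<in> ?V" and n: "n \<in> ?W"
    let ?E = "\<lambda>i j p. SWY M m (\<lambda>m0 m1. SWY N n (\<lambda>n0 n1. tenC (yact M i m0 * yact N j n0) (bow p (\<delta> m1 * ?\<Theta> n1))))"
    have "?L (m * n) = SWC (GO M) m (\<lambda>m0 m1. SWC (GO N) n (\<lambda>n0 n1. tenC (m0 * n0) (tmult CTH (\<alpha>, \<beta>) (\<gamma>, \<delta>) m1 n1)))"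
      by (rule swt_mult[OF MN_U vector_space_fscale]) (intro LT m n | assumption)+
    also have "\<dots> = (\<Sum>i\<in>B. SWY M m (\<lambda>m0 m1. SWC (GO N) n (\<lambda>n0 n1. tenC (yact M i m0 * n0) (tmult CTH (\<alpha>, \<beta>) (\<gamma>, \<delta>) (bow (ds i) m1) n1))))"
      by (rule SWC_GO[OF M dM vector_space_fscale _ _ m]) (intro LT n | assumption)+
    also have "\<dots> = (\<Sum>i\<in>B. SWY M m (\<lambda>m0 m1. \<Sum>j\<in>B. SWY N n (\<lambda>n0 n1. tenC (yact M i m0 * yact N j n0)
        (tmult CTH (\<alpha>, \<beta>) (\<gamma>, \<delta>) (bow (ds i) m1) (bow (ds j) n1)))))"
      by (rule sum.cong[OF refl], rule yd_SWY_cong[OF M m], rule SWC_GO[OF N dN vector_space_fscale _ _ n]) (intro LT | assumption)+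
    also have "\<dots> = (\<Sum>j\<in>B. \<Sum>i\<in>B. ?E i j (cnv (ds j) (ds i)))"
      unfolding tmult_bow[OF ds_dual ds_dual] SWY_sum_swap by (rule sum.swap)
    also have "\<dots> = (\<Sum>l\<in>B. SWH l (\<lambda>a b. ?E b a (ds l)))"
      by (rule dual_basis_comult[OF vector_space_fscale, symmetric, where F = "\<lambda>a b p. ?E b a p"]) (intro MN_lins m n | assumption)+
    also have "\<dots> = (\<Sum>l\<in>B. SWY M m (\<lambda>m0 m1. SWY N n (\<lambda>n0 n1. SWH l (\<lambda>a b. tenC (yact M b m0 * yact N a n0) (bow (ds l) (\<delta> m1 * ?\<Theta> n1))))))"
      by (simp only: SWY_SWH_swap)
    also have "\<dots> = (\<Sum>l\<in>B. SWY M m (\<lambda>m0 m1. SWY N n (\<lambda>n0 n1. tenC (yact (yten M N) l (m0 * n0)) (bow (ds l) (\<delta> m1 * ?\<Theta> n1)))))"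
    proof (rule sum.cong[OF refl], rule yd_SWY_cong[OF M m], rule yd_SWY_cong[OF N n])
      fix l m0 m1 n0 n1 assume mn: "m0 \<in> ?V" "n0 \<in> ?W"
      show "SWH l (\<lambda>a b. tenC (yact M b m0 * yact N a n0) (bow (ds l) (\<delta> m1 * ?\<Theta> n1))) =
          tenC (yact (yten M N) l (m0 * n0)) (bow (ds l) (\<delta> m1 * ?\<Theta> n1))"
        unfolding ten_act_mult[OF M N dM dN mn]
        by (rule SWH_lin[OF lin_pure_tensor_left[OF lin_id], symmetric, of s UNIV]) simp_all
    qed
    also have "\<dots> = ?R (m * n)"
      by (rule sum.cong[OF refl], rule SWY_ten[OF M N dM dN vector_space_fscale _ _ m n, symmetric])
        (intro MN_lins lin_comp[OF lin_act[OF MN lin_id, unfolded ten_sel]] | assumption)+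
    finally show "?L (m * n) = ?R (m * n)" .
  qed
  then have "(\<lambda>x\<in>ten ?V ?W. ?L x) = (\<lambda>x\<in>ten ?V ?W. ?R x)" by (rule restrict_ext)
  then have "ccoact (cten (GO M) (GO N)) = ccoact (GO (yten M N))"
    unfolding corep_tensor_def swC_eq GO_ccoact[of "yten M N"] by (simp add: GO_sel(1,2) CT_sel(2) ten_sel dM dN)
  then show ?thesis by (intro corep.equality) (simp_all add: corep_tensor_def GO_sel ten_sel)
qed

lemma tcqt_eq: "tcqt CTH (\<gamma>', \<delta>') (\<alpha>, \<beta>) t u = swb t (\<lambda>p h. swb u (\<lambda>q h'. p (finv \<beta> h') * q 1 * eps h))"
  by (simp add: CT_def bowtie_def)

private lemmas L2 = MN_lins lin_aut[OF aut_finv[OF MN_auts(2)]] lin_aut[OF aut_finv[OF MN_auts(1)]]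

lemma tcqt_bow:
  assumes "p \<in> Hd" "q \<in> Hd"
  shows "tcqt CTH (\<gamma>', \<delta>') (\<alpha>, \<beta>) (bow p h) (bow q h') = p (finv \<beta> h') * q 1 * eps h"
proof -
  have "tcqt CTH (\<gamma>', \<delta>') (\<alpha>, \<beta>) (bow p h) (bow q h') = swb (bow p h) (\<lambda>p h. p (finv \<beta> h') * q 1 * eps h)"
    unfolding tcqt_eq
    by (rule swb_cong, rule swb_bow[OF vector_space_mult _ _ assms(2)]) (intro L2 lin_dual | assumption)+
  also have "\<dots> = p (finv \<beta> h') * q 1 * eps h"
    by (rule swb_bow[OF vector_space_mult _ _ assms(1)]) (intro L2)+
  finally show ?thesis .
qed

lemma tcqt_linear:
  "u \<in> A \<Longrightarrow> linear_on A fscale (*) (\<lambda>t. tcqt CTH (\<gamma>', \<delta>') (\<alpha>, \<beta>) t u)"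
  "t \<in> A \<Longrightarrow> linear_on A fscale (*) (\<lambda>u. tcqt CTH (\<gamma>', \<delta>') (\<alpha>, \<beta>) t u)"
proof -
  have E: "linear_on UNIV hs (*) (\<lambda>h'. p (finv \<beta> h') * c * d)" if "p \<in> Hd" for p c d
    by (intro lin_kmult_left lin_dual[OF that] L2)
  assume u: "u \<in> A"
  show "linear_on A fscale (*) (\<lambda>t. tcqt CTH (\<gamma>', \<delta>') (\<alpha>, \<beta>) t u)"
    unfolding tcqt_eq
    by (rule lin_swb[OF vector_space_mult lin_id])
      (intro MN_lins lin_swb_body[OF vector_space_mult _ _ u] dual_subspace subspace_UNIV_of E | assumption)+
next
  have E: "linear_on UNIV hs (*) (\<lambda>h'. p (finv \<beta> h') * c * d)" if "p \<in> Hd" for p c d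
    by (intro lin_kmult_left lin_dual[OF that] L2)
  assume t: "t \<in> A"
  show "linear_on A fscale (*) (\<lambda>u. tcqt CTH (\<gamma>', \<delta>') (\<alpha>, \<beta>) t u)"
    unfolding tcqt_eq
    by (rule lin_swb_body[OF vector_space_mult vector_space_fscale A_subspace t])
      (intro MN_lins lin_swb lin_swb_body[OF vector_space_mult] dual_subspace subspace_UNIV_of E | assumption)+
qed

text \<open>Of the two dual-basis sums, the one from N is evaluated at \<alpha>^-1(m1) and gives the
  action in the braiding of modules; the one from M is evaluated at 1 and gives the action of
  1.\<close>

lemma GO_braid: "cbr (GO M) (GO N) = ybr M N"
proof -
  let ?V = "ycar M" and ?W = "ycar N" and ?\<theta> = "finv \<beta> \<circ> \<delta> \<circ> \<alpha> \<circ> finv \<delta>"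
  let ?c = "(\<alpha>, \<beta>) \<otimes>\<^bsub>G\<^esub> (\<gamma>, \<delta>) \<otimes>\<^bsub>G\<^esub> inv\<^bsub>G\<^esub> (\<alpha>, \<beta>)"
  obtain \<gamma>' \<delta>' where c: "?c = (\<gamma>', \<delta>')" by (cases ?c) auto
  let ?K = "\<lambda>m0 m1 n0 n1. s (tcqt CTH (\<gamma>', \<delta>') (\<alpha>, \<beta>) (tcross CTH (\<alpha>, \<beta>) (\<gamma>, \<delta>) n1) m1) (n0 * m0)"
  let ?L = "\<lambda>x. swt ?V ?W x (\<lambda>m n. SWC (GO M) m (\<lambda>m0 m1. SWC (GO N) n (\<lambda>n0 n1. ?K m0 m1 n0 n1)))"
  note LT = lin lin_comp[OF tcqt_linear(1)] lin_comp[OF tcqt_linear(2) lin_id] lin_comp[OF tcross(2) lin_id] tcross(2,3)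
    lin_SWC[OF MN_PM, unfolded GO_sel(2)] lin_SWC[OF MN_PN, unfolded GO_sel(2)]
    lin_SWC_body[OF MN_PN vs_s, unfolded GO_sel(2)] lin_SWC_body[OF MN_PM vs_s, unfolded GO_sel(2)]
    vss subU[OF MN_U(1)] subU[OF MN_U(2)] A_subspace bow_in ds_dual
  have "?L x = ybr M N x" if x: "x \<in> ten ?V ?W" for x
  proof (rule ten_ext[OF MN_U vs_s _ br_linear[OF M N dM dN] x, where f = ?L])
    show "linear_on (ten ?V ?W) s s ?L"
      by (rule swt_linear[OF MN_U vs_s]) (intro LT | assumption)+
    fix m n assume m: "m \<in> ?V" and n: "n \<in> ?W"
    have "?L (m * n) = SWC (GO M) m (\<lambda>m0 m1. SWC (GO N) n (\<lambda>n0 n1. ?K m0 m1 n0 n1))"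
      by (rule swt_mult[OF MN_U vs_s]) (intro LT m n | assumption)+
    also have "\<dots> = (\<Sum>i\<in>B. SWY M m (\<lambda>m0 m1. SWC (GO N) n (\<lambda>n0 n1. ?K (yact M i m0) (bow (ds i) m1) n0 n1)))"
      by (rule SWC_GO[OF M dM vs_s _ _ m]) (intro LT n | assumption)+
    also have "\<dots> = (\<Sum>i\<in>B. SWY M m (\<lambda>m0 m1. \<Sum>j\<in>B. SWY N n (\<lambda>n0 n1. ?K (yact M i m0) (bow (ds i) m1) (yact N j n0) (bow (ds j) n1))))"
      by (rule sum.cong[OF refl], rule yd_SWY_cong[OF M m], rule SWC_GO[OF N dN vs_s _ _ n]) (intro LT | assumption)+
    \<comment> \<open>The \<beta> from the crossing cancels against the \<beta>^-1 in the
      coquasitriangular structure, leaving h^j(\<alpha>^-1(m1)); the automorphisms on n1 disappear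
      under \<epsilon>.\<close>
    also have "\<dots> = (\<Sum>i\<in>B. SWY M m (\<lambda>m0 m1. \<Sum>j\<in>B. SWY N n (\<lambda>n0 n1.
        s (eps n1) (s (ds j (finv \<alpha> m1) * ds i 1) (yact N j n0 * yact M i m0)))))"
      using MN_auts by (simp add: tcross(1,4) tcqt_bow aut_eps mult_ac)
    also have "\<dots> = (\<Sum>i\<in>B. SWY M m (\<lambda>m0 m1. \<Sum>j\<in>B. s (ds j (finv \<alpha> m1) * ds i 1) (yact N j n * yact M i m0)))"
      by (rule sum.cong[OF refl], rule yd_SWY_cong[OF M m], rule sum.cong[OF refl], rule SWY_counit[OF N vs_s _ n]) (intro MN_lins | assumption)+
    also have "\<dots> = SWY M m (\<lambda>m0 m1. \<Sum>i\<in>B. \<Sum>j\<in>B. s (ds j (finv \<alpha> m1) * ds i 1) (yact N j n * yact M i m0))"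
      by (rule SWY_sum_swap[symmetric])
    also have "\<dots> = SWY M m (\<lambda>m0 m1. \<Sum>i\<in>B. s (ds i 1) (\<Sum>j\<in>B. s (ds j (finv \<alpha> m1)) (yact N j n * yact M i m0)))"
      by (simp add: uni.scale_sum_right mult.commute)
    also have "\<dots> = SWY M m (\<lambda>m0 m1. \<Sum>i\<in>B. s (ds i 1) (yact N (finv \<alpha> m1) n * yact M i m0))"
      by (rule yd_SWY_cong[OF M m], rule sum.cong[OF refl], rule arg_cong[where f = "s _"], rule sum_ds_linear[OF vs_s]) (intro MN_lins n)
    also have "\<dots> = SWY M m (\<lambda>m0 m1. yact N (finv \<alpha> m1) n * yact M 1 m0)"
      by (rule yd_SWY_cong[OF M m], rule sum_ds_linear[OF vs_s]) (intro MN_lins)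
    also have "\<dots> = SWY M m (\<lambda>m0 m1. yact N (finv \<alpha> m1) n * m0)"
      by (rule yd_SWY_cong[OF M m]) (simp add: act_one[OF M])
    finally show "?L (m * n) = ybr M N (m * n)" by (simp add: br_mult[OF M N dM dN m n])
  qed
  then have "(\<lambda>x\<in>ten ?V ?W. ?L x) = (\<lambda>x\<in>ten ?V ?W. ybr M N x)" by (rule restrict_ext)
  also have "\<dots> = ybr M N" using br_PiE[OF M N dM dN] by (intro extensional_restrict) (simp add: PiE_def)
  finally show ?thesis unfolding corep_braiding_def Let_def swC_eq by (simp add: GO_sel(1,2) dM dN c)
qed

text \<open>The coaction of CT(H) is built from the action and the coaction of H, and pairing it
  with \<open>ev\<close> and \<open>pr\<close> recovers both. A linear map thus respects it exactly
  when it respects the other two.\<close>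

lemma GO_mor: "corep_morphism s CTH (GO M) (GO N) f \<longleftrightarrow> ymor M N f"
proof (cases "ydeg M = ydeg N \<and> f \<in> ycar M \<rightarrow>\<^sub>E ycar N \<and> linear_on (ycar M) s s f")
  case True
  then have f: "f \<in> ycar M \<rightarrow>\<^sub>E ycar N" and fl: "linear_on (ycar M) s s f" by auto
  have fin: "m \<in> ycar M \<Longrightarrow> f m \<in> ycar N" for m using f by auto
  have c: "SWC (GO M) m (\<lambda>x t. tenC (f x) t) = (\<Sum>i\<in>B. SWY M m (\<lambda>x c. tenC (f (yact M i x)) (bow (ds i) c)))"
    if m: "m \<in> ycar M" for m
    by (rule SWC_GO[OF M dM vector_space_fscale _ _ m]) (intro lin lin_comp[OF fl] | assumption)+
  have "(\<forall>m\<in>ycar M. ccoact (GO N) (f m) = SWC (GO M) m (\<lambda>x t. tenC (f x) t)) \<longleftrightarrow>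
     (\<forall>h. \<forall>m\<in>ycar M. f (yact M h m) = yact N h (f m)) \<and> (\<forall>m\<in>ycar M. ycoact N (f m) = SWY M m (\<lambda>x c. tenY (f x) c))"
    (is "?C \<longleftrightarrow> ?Y")
  proof
    assume Y: ?Y
    then have fm: "ymor M N f" using True by (simp add: ymor_iff[OF M N])
    show ?C
    proof
      fix m assume m: "m \<in> ycar M"
      have "ccoact (GO N) (f m) = (\<Sum>i\<in>B. SWY N (f m) (\<lambda>x c. tenC (yact N i x) (bow (ds i) c)))"
        by (rule GO_sel(3)[OF fin[OF m]])
      also have "\<dots> = (\<Sum>i\<in>B. SWY M m (\<lambda>x c. tenC (yact N i (f x)) (bow (ds i) c)))"
        by (rule sum.cong[OF refl], rule SWY_mor[OF M N fm m vector_space_fscale]) (intro MN_lins | assumption)+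
      also have "\<dots> = (\<Sum>i\<in>B. SWY M m (\<lambda>x c. tenC (f (yact M i x)) (bow (ds i) c)))"
        by (rule sum.cong[OF refl], rule yd_SWY_cong[OF M m]) (use Y in simp)
      finally show "ccoact (GO N) (f m) = SWC (GO M) m (\<lambda>x t. tenC (f x) t)" by (simp add: c[OF m])
    qed
  next
    assume C: ?C
    \<comment> \<open>Colinearity over CT(H) in the form of Sweedler sums, for use with the summands
      that involve \<open>ev h\<close> and \<open>pr\<close>.\<close>
    have push: "SWC (GO N) (f m) F = SWC (GO M) m (\<lambda>x t. F (f x) t)"
      if m: "m \<in> ycar M" and s3: "vector_space s3" and F: "\<And>t. t \<in> A \<Longrightarrow> linear_on (ycar N) s s3 (\<lambda>x. F x t)"
        "\<And>x. x \<in> ycar N \<Longrightarrow> linear_on A fscale s3 (\<lambda>t. F x t)" for m and F :: "'v \<Rightarrow> ('k, 'h) ct \<Rightarrow> 'z::ab_group_add" and s3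
    proof -
      interpret tp: tensor_product tenC s fscale fscale "ycar N" A by (rule tpC[OF MN_U(2)])
      have bil: "bilinear_on (ycar N) A s fscale s3 F" by (intro bilinear_onI F)
      have "SWC (GO N) (f m) F = tp.sw (SWC (GO M) m (\<lambda>x t. tenC (f x) t)) F"
        unfolding SWC_def[of "GO N"] GO_sel(2) using C m by simp
      also have "\<dots> = SWC (GO M) m (\<lambda>x t. tp.sw (tenC (f x) t) F)"
        by (rule SWC_comp[OF MN_PM vector_space_fscale _ _ s3 tp.TS_subspace _ _ tp.sw_linear[OF s3 bil]], unfold GO_sel)
          (intro lin lin_comp[OF fl] tp.tensor_in fin m | assumption)+
      also have "\<dots> = SWC (GO M) m (\<lambda>x t. F (f x) t)"
        by (rule SWC_cong[OF MN_PM]) (simp add: GO_sel tp.sw_tau[OF s3 bil] fin)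
      finally show ?thesis .
    qed
    show ?Y
    proof (intro conjI allI ballI)
      fix h m assume m: "m \<in> ycar M"
      have "yact N h (f m) = SWC (GO N) (f m) (\<lambda>x t. s (ev h t) x)" by (rule GO_ev[OF N dN fin[OF m], symmetric])
      also have "\<dots> = SWC (GO M) m (\<lambda>x t. s (ev h t) (f x))"
        by (rule push[OF m vs_s]) (intro lin lin_ev vs_s | assumption)+
      also have "\<dots> = SWC (GO M) m (\<lambda>x t. f (s (ev h t) x))"
        by (rule SWC_cong[OF MN_PM]) (simp add: GO_sel linear_on_scale[OF fl])
      also have "\<dots> = f (SWC (GO M) m (\<lambda>x t. s (ev h t) x))"
        by (rule SWC_comp[OF MN_PM vs_s _ _ vs_s subU[OF MN_U(1)] _ _ fl, symmetric], unfold GO_sel)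
          (intro lin lin_ev vs_s m scale_in[OF MN_U(1)] | assumption)+
      finally show "f (yact M h m) = yact N h (f m)" by (simp add: GO_ev[OF M dM m])
    next
      fix m assume m: "m \<in> ycar M"
      have "ycoact N (f m) = SWC (GO N) (f m) (\<lambda>x t. tenY x (pr t))" by (rule GO_pr[OF N dN fin[OF m], symmetric])
      also have "\<dots> = SWC (GO M) m (\<lambda>x t. tenY (f x) (pr t))"
        by (rule push[OF m vector_space_fscale]) (intro lin lin_pr | assumption)+
      also have "\<dots> = (\<Sum>i\<in>B. SWY M m (\<lambda>x c. tenY (f (yact M i x)) (pr (bow (ds i) c))))"
        by (rule SWC_GO[OF M dM vector_space_fscale _ _ m]) (intro lin lin_pr lin_comp[OF fl] | assumption)+
      also have "\<dots> = SWY M m (\<lambda>x c. \<Sum>i\<in>B. fscale (ds i 1) (tenY (f (yact M i x)) c))"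
        by (simp add: SWY_sum_swap pure_tensor_scale_right)
      also have "\<dots> = SWY M m (\<lambda>x c. tenY (f (yact M 1 x)) c)"
        by (rule yd_SWY_cong[OF M m], rule sum_ds_linear[OF vector_space_fscale]) (intro MN_lins lin_comp[OF fl] | assumption)+
      also have "\<dots> = SWY M m (\<lambda>x c. tenY (f x) c)"
        by (rule yd_SWY_cong[OF M m]) (simp add: act_one[OF M])
      finally show "ycoact N (f m) = SWY M m (\<lambda>x c. tenY (f x) c)" .
    qed
  qed
  then show ?thesis
    using True by (simp add: corep_morphism_def colinear_def GO_sel(1,2) CT_sel(1,2) ymor_iff[OF M N] SWC_def)
qed (auto simp: corep_morphism_def GO_sel ymor_iff[OF M N])

end

text \<open>On the unit module every basis element acts by \<epsilon>, and \<Sum> \<epsilon>(h_i)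
  h^i = \<epsilon> makes the coaction x \<mapsto> x \<otimes> (\<epsilon> \<bowtie> 1).\<close>

lemma GO_unit: "corep_unit s G CTH = GO yunit"
proof -
  have "tenC x (bow eps 1) = (\<Sum>i\<in>B. SWY yunit x (\<lambda>x c. tenC (yact yunit i x) (bow (ds i) c)))" if x: "x \<in> uni.span {1}" for x
  proof -
    have "(\<Sum>i\<in>B. SWY yunit x (\<lambda>x c. tenC (yact yunit i x) (bow (ds i) c))) = (\<Sum>i\<in>B. tenC (yact yunit i x) (bow (ds i) 1))"
      by (rule sum.cong[OF refl], rule SWY_unit[OF x vector_space_fscale])
        (intro lin yd_lin[OF yd_unit_yd] | simp add: unit_sel)+
    also have "\<dots> = (\<Sum>i\<in>B. fscale (eps i) (tenC x (bow (ds i) 1)))"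
      by (simp add: unit_sel x pure_tensor_scale_left)
    also have "\<dots> = tenC x (bow eps 1)"
      by (rule sum_dual_linear[OF vector_space_fscale _ eps_dual]) (intro lin)
    finally show ?thesis ..
  qed
  then have "(\<lambda>x\<in>uni.span {1}. tenC x (bow eps 1)) =
      (\<lambda>x\<in>uni.span {1}. \<Sum>i\<in>B. SWY yunit x (\<lambda>x c. tenC (yact yunit i x) (bow (ds i) c)))"
    by (rule restrict_ext)
  then show ?thesis by (simp add: corep_unit_def GO_def unit_sel(1,2) one_G CT_sel(2,3))
qed

lemma Corep_YDhat_transport:
  "tcat_transport G (YDhat s \<U> H) (Corep s \<U> G CTH) GO (\<lambda>(M, N, f). (GO M, GO N, f))"
proof -
  note sel = YDhat_def Corep_def concrete_tcat_def
  have ten: "cten (GO M) (GO N) = GO (yten M N)" if "yd M" "yd N" for M N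
    using that GO_ten by (cases "ydeg M"; cases "ydeg N") blast
  have conj: "cconj a (GO N) = GO (yconj a N)" if "a \<in> carrier G" "yd N" for a N
    using that GO_conj by (cases a; cases "ydeg N") (auto simp: carrier_G)
  have braid: "cbr (GO M) (GO N) = ybr M N" if "yd M" "yd N" for M N
    using that GO_braid by (cases "ydeg M"; cases "ydeg N") blast
  have mor: "corep_morphism s CTH (GO M) (GO N) f \<longleftrightarrow> ymor M N f" if "yd M" "yd N" for M N f
    using that GO_mor by (cases "ydeg M"; cases "ydeg N") blast
  have into: "GO ` yd_modules s \<U> H = coreps s \<U> G CTH" and inj: "inj_on GO (yd_modules s \<U> H)"
    using GO_bij by (simp_all add: bij_betw_def)
  show ?thesis
  proof (rule tcat_transport.intro)
    show "bij_betw (\<lambda>(M, N, f). (GO M, GO N, f)) (Arr (YDhat s \<U> H)) (Arr (Corep s \<U> G CTH))"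
      using inj by (auto simp: sel into[symmetric] mor bij_betw_def inj_on_def image_iff) blast
  qed (use YDhat_braided GO_bij in \<open>auto simp: sel GO_sel(1,2) GO_unit ten conj braid yd_deg yconj_yd\<close>)
qed

end

theorem theorem3p13:
  fixes H :: "('k::field, 'h::ring_1) hopf_data" and B :: "'h set"
    and s :: "'k \<Rightarrow> 'v::ring_1 \<Rightarrow> 'v" and \<U> :: "'v set set"
  assumes "hopf_algebra H"
    and "finite_dimensional_vector_space (hscale H) B"
    and "strict_tensor_universe s \<U>"
  shows "isomorphic_braided_T_categories (GAut H) (Corep s \<U> (GAut H) (CT H B)) (YDhat s \<U> H)"
proof -
  interpret yd_setting H B s \<U> by (intro yd_setting.intro fd_hopf.intro assms)
  show ?thesis by (rule tcat_transport.isomorphic_C[OF Corep_YDhat_transport])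
qed

end
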